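(* Let $U\subset\mathbb{R}^2$ be a domain with a smooth Riemannian metric $g$. Suppose that $u\in C^1\cap H^{3/2}_{loc}(U;\mathbb{R}^3)$ is an isometric embedding of $(U,g)$ and that $u(U)$ is parametrised as a graph of $f:U'\to\mathbb{R}$, where $u=(\Psi,v)$, $\Psi:U\to U'\subset\mathbb{R}^2$ is a ($C^1$) diffeomorphism with inverse $\Phi$, and $f:=v\circ\Phi$. Then $f$ belongs to $C^1\cap H^{3/2}_{loc}(U')$ and satisfies $$\operatorname{Det}Dw=K_g(\Phi)\,(1+|Df|^2)^{1/2}\quad\text{in }\mathcal{D}'(U'),$$ where $$w:=F(Df),\qquad F:\mathbb{R}^2\to\mathbb{R}^2,\qquad F(z):=\big((1+|z|^2)^{-1/2}(1+z_2^2)^{-1}z_1,\;z_2\big).$$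
   Context: $K_g$ is the Gaussian curvature of $g$. $u$ isometric means $\partial_iu\cdot\partial_ju=g_{ij}$. $H^{s}=W^{s,2}$ are the usual (fractional) Sobolev spaces, and $h\in H^{3/2}_{loc}$ means $h\in H^1_{loc}$ and $Dh\in H^{1/2}_{loc}$. Distributional Jacobian: for $w\in H^{1/2}_{loc}(U';\mathbb{R}^2)$, $\operatorname{Det}Dw\in\mathcal{D}'(U')$ is the distribution given by $\operatorname{Det}Dw[\psi]=\lim_{k\to\infty}\int_{U'}\psi\,\det Dw_k\,dx$ for any smooth $w_k\to w$ in $H^{1/2}_{loc}$ (the limit exists and is independent of the sequence, by a theorem of Brezis and Nguyen). *)

theory Defs
  imports "HOL-Analysis.Analysis"
begin

section \<open>Differentiability classes and test functions\<close>

definition pderiv_at :: "'n \<Rightarrow> (real^'n \<Rightarrow> 'b::real_normed_vector) \<Rightarrow> real^'n \<Rightarrow> 'b"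
  where "pderiv_at i h x = frechet_derivative h (at x) (axis i 1)"

text \<open>\<open>Ck_on k U h\<close>: \<open>h\<close> is of class \<open>C^k\<close> on \<open>U\<close>; intended for open \<open>U\<close> only.
  Values of \<open>h\<close> outside \<open>U\<close> are then irrelevant.\<close>

primrec Ck_on :: "nat \<Rightarrow> (real^'n) set \<Rightarrow> (real^'n \<Rightarrow> 'b::real_normed_vector) \<Rightarrow> bool" where
  "Ck_on 0 U h \<longleftrightarrow> continuous_on U h"
| "Ck_on (Suc k) U h \<longleftrightarrow>
     (\<forall>x\<in>U. h differentiable (at x)) \<and> (\<forall>i. Ck_on k U (pderiv_at i h))"

definition smooth_on :: "(real^'n) set \<Rightarrow> (real^'n \<Rightarrow> 'b::real_normed_vector) \<Rightarrow> bool"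
  where "smooth_on U h \<longleftrightarrow> (\<forall>k. Ck_on k U h)"

definition test_functions :: "(real^'n) set \<Rightarrow> (real^'n \<Rightarrow> real) set" where
  "test_functions U =
     {\<psi>. smooth_on UNIV \<psi> \<and> compact (closure {x. \<psi> x \<noteq> 0}) \<and> closure {x. \<psi> x \<noteq> 0} \<subseteq> U}"

definition grad :: "(real^'n \<Rightarrow> real) \<Rightarrow> real^'n \<Rightarrow> real^'n"
  where "grad h x = (\<chi> i. pderiv_at i h x)"

definition C1_diffeomorphism ::
  "(real^'n) set \<Rightarrow> (real^'n) set \<Rightarrow> (real^'n \<Rightarrow> real^'n) \<Rightarrow> (real^'n \<Rightarrow> real^'n) \<Rightarrow> bool" where
  "C1_diffeomorphism U U' \<Psi> \<Phi> \<longleftrightarrow>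
     open U \<and> open U' \<and> Ck_on 1 U \<Psi> \<and> Ck_on 1 U' \<Phi> \<and> \<Psi> ` U = U' \<and> \<Phi> ` U' = U \<and>
     (\<forall>x\<in>U. \<Phi> (\<Psi> x) = x) \<and> (\<forall>y\<in>U'. \<Psi> (\<Phi> y) = y)"


section \<open>Sobolev spaces\<close>

definition compactly_inside :: "'a::topological_space set \<Rightarrow> 'a set \<Rightarrow> bool"
  where "compactly_inside V U \<longleftrightarrow> open V \<and> compact (closure V) \<and> closure V \<subseteq> U"

text \<open>Elements of \<open>L\<^sup>2\<close> are represented by Borel functions; every class has such a representative.\<close>

definition L2_norm_sq :: "(real^'n) set \<Rightarrow> (real^'n \<Rightarrow> 'b::euclidean_space) \<Rightarrow> ennreal"
  where "L2_norm_sq V h = (\<integral>\<^sup>+x\<in>V. ennreal ((norm (h x))\<^sup>2) \<partial>lborel)"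

definition L2_on :: "(real^'n) set \<Rightarrow> (real^'n \<Rightarrow> 'b::euclidean_space) \<Rightarrow> bool"
  where "L2_on V h \<longleftrightarrow> set_borel_measurable borel V h \<and> L2_norm_sq V h < \<infinity>"

definition L2_loc :: "(real^'n) set \<Rightarrow> (real^'n \<Rightarrow> 'b::euclidean_space) \<Rightarrow> bool"
  where "L2_loc U h \<longleftrightarrow> (\<forall>V. compactly_inside V U \<longrightarrow> L2_on V h)"

text \<open>The squared Gagliardo--Slobodeckij seminorm of \<open>W^{s,2}(V)\<close>, \<open>0 < s < 1\<close>. On the diagonal
  the integrand is \<open>0 / 0 = 0\<close>, which does not matter since the diagonal is a null set.\<close>

definition slobodeckij_sq ::
  "real \<Rightarrow> (real^'n) set \<Rightarrow> (real^'n \<Rightarrow> 'b::euclidean_space) \<Rightarrow> ennreal" where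
  "slobodeckij_sq s V h =
     (\<integral>\<^sup>+x\<in>V. (\<integral>\<^sup>+y\<in>V.
        ennreal ((norm (h x - h y))\<^sup>2 / norm (x - y) powr (real CARD('n) + 2 * s)) \<partial>lborel) \<partial>lborel)"

definition Hs_on :: "real \<Rightarrow> (real^'n) set \<Rightarrow> (real^'n \<Rightarrow> 'b::euclidean_space) \<Rightarrow> bool"
  where "Hs_on s V h \<longleftrightarrow> L2_on V h \<and> slobodeckij_sq s V h < \<infinity>"

definition H12_loc :: "(real^'n) set \<Rightarrow> (real^'n \<Rightarrow> 'b::euclidean_space) \<Rightarrow> bool"
  where "H12_loc U h \<longleftrightarrow> (\<forall>V. compactly_inside V U \<longrightarrow> Hs_on (1/2) V h)"

definition tends_H12_loc ::
  "(real^'n) set \<Rightarrow> (nat \<Rightarrow> real^'n \<Rightarrow> 'b::euclidean_space) \<Rightarrow> (real^'n \<Rightarrow> 'b) \<Rightarrow> bool" where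
  "tends_H12_loc U W w \<longleftrightarrow>
     (\<forall>V. compactly_inside V U \<longrightarrow>
        (\<lambda>k. L2_norm_sq V (\<lambda>x. W k x - w x)) \<longlonglongrightarrow> 0 \<and>
        (\<lambda>k. slobodeckij_sq (1/2) V (\<lambda>x. W k x - w x)) \<longlonglongrightarrow> 0)"

text \<open>\<open>d\<close> is the weak \<open>i\<close>-th partial derivative of \<open>h\<close>. Both are required to be in \<open>L\<^sup>2_loc\<close>,
  so that the integrals below converge.\<close>

definition weak_pderiv ::
  "(real^'n) set \<Rightarrow> 'n \<Rightarrow> (real^'n \<Rightarrow> 'b::euclidean_space) \<Rightarrow> (real^'n \<Rightarrow> 'b) \<Rightarrow> bool" where
  "weak_pderiv U i h d \<longleftrightarrow> L2_loc U h \<and> L2_loc U d \<and>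
     (\<forall>\<psi>\<in>test_functions U.
        (LINT x:U|lborel. pderiv_at i \<psi> x *\<^sub>R h x) = - (LINT x:U|lborel. \<psi> x *\<^sub>R d x))"

definition H1_loc :: "(real^'n) set \<Rightarrow> (real^'n \<Rightarrow> 'b::euclidean_space) \<Rightarrow> bool"
  where "H1_loc U h \<longleftrightarrow> (\<forall>i. \<exists>d. weak_pderiv U i h d)"

definition H32_loc :: "(real^'n) set \<Rightarrow> (real^'n \<Rightarrow> 'b::euclidean_space) \<Rightarrow> bool"
  where "H32_loc U h \<longleftrightarrow> H1_loc U h \<and> (\<forall>i. \<exists>d. weak_pderiv U i h d \<and> H12_loc U d)"


section \<open>The distributional Jacobian\<close>

definition jacobian_det :: "(real^2 \<Rightarrow> real^2) \<Rightarrow> real^2 \<Rightarrow> real"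
  where "jacobian_det w x = det (matrix (frechet_derivative w (at x)))"

text \<open>For \<open>w\<close> in \<open>H^{1/2}_loc\<close> the description is well defined: smooth approximating sequences
  exist, and along each of them the integrals converge to the same limit (Brezis--Nguyen).\<close>

definition Det_D :: "(real^2) set \<Rightarrow> (real^2 \<Rightarrow> real^2) \<Rightarrow> (real^2 \<Rightarrow> real) \<Rightarrow> real" where
  "Det_D U w \<psi> = (THE L. \<forall>W. (\<forall>k. smooth_on U (W k)) \<and> tends_H12_loc U W w \<longrightarrow>
     (\<lambda>k. LINT x:U|lborel. \<psi> x * jacobian_det (W k) x) \<longlonglongrightarrow> L)"


section \<open>Riemannian metrics on planar domains\<close>

definition smooth_riemannian_metric :: "(real^'n) set \<Rightarrow> (real^'n \<Rightarrow> real^'n^'n) \<Rightarrow> bool" where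
  "smooth_riemannian_metric U g \<longleftrightarrow>
     (\<forall>i j. smooth_on U (\<lambda>x. g x $ i $ j)) \<and>
     (\<forall>x\<in>U. transpose (g x) = g x \<and> (\<forall>\<xi>. \<xi> \<noteq> 0 \<longrightarrow> \<xi> \<bullet> (g x *v \<xi>) > 0))"

definition christoffel :: "(real^'n \<Rightarrow> real^'n^'n) \<Rightarrow> 'n \<Rightarrow> 'n \<Rightarrow> 'n \<Rightarrow> real^'n \<Rightarrow> real" where
  "christoffel g l i j x =
     (1/2) * (\<Sum>m\<in>UNIV. matrix_inv (g x) $ l $ m *
        (pderiv_at i (\<lambda>y. g y $ j $ m) x + pderiv_at j (\<lambda>y. g y $ i $ m) x
         - pderiv_at m (\<lambda>y. g y $ i $ j) x))"

text \<open>The \<open>l\<close>-th component of \<open>R(e_i, e_j) e_k\<close>, where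
  \<open>R(X,Y)Z = \<nabla>_X \<nabla>_Y Z - \<nabla>_Y \<nabla>_X Z - \<nabla>_[X,Y] Z\<close>.\<close>

definition riemann :: "(real^'n \<Rightarrow> real^'n^'n) \<Rightarrow> 'n \<Rightarrow> 'n \<Rightarrow> 'n \<Rightarrow> 'n \<Rightarrow> real^'n \<Rightarrow> real" where
  "riemann g l i j k x =
     pderiv_at i (christoffel g l j k) x - pderiv_at j (christoffel g l i k) x
     + (\<Sum>m\<in>UNIV. christoffel g l i m x * christoffel g m j k x
                - christoffel g l j m x * christoffel g m i k x)"

text \<open>\<open>K_g = \<langle>R(e_1, e_2) e_2, e_1\<rangle> / det g\<close>, which is positive for the round sphere.\<close>

definition gauss_curvature :: "(real^2 \<Rightarrow> real^2^2) \<Rightarrow> real^2 \<Rightarrow> real" where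
  "gauss_curvature g x = (\<Sum>l\<in>UNIV. g x $ 1 $ l * riemann g l 1 2 2 x) / det (g x)"

definition isometric_embedding ::
  "(real^'n) set \<Rightarrow> (real^'n \<Rightarrow> real^'n^'n) \<Rightarrow> (real^'n \<Rightarrow> real^'m) \<Rightarrow> bool" where
  "isometric_embedding U g u \<longleftrightarrow>
     embedding_map (top_of_set U) euclidean u \<and>
     (\<forall>x\<in>U. \<forall>i j. pderiv_at i u x \<bullet> pderiv_at j u x = g x $ i $ j)"

definition F_map :: "real^2 \<Rightarrow> real^2" where
  "F_map z = vector [z $ 1 / (sqrt (1 + (norm z)\<^sup>2) * (1 + (z $ 2)\<^sup>2)), z $ 2]"

end

theory Submission
  imports Defs
begin

text \<open>Mollify the embedding \<open>u\<close> to \<open>u\<^sub>k\<close>. The metrics induced by \<open>u\<^sub>k\<close> differ from the mollified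
  metric by Constantin--E--Titi commutators of \<open>Du\<close>; since \<open>Du\<close> is in \<open>H\<^bsup>1/2\<^esup>\<close>, the first derivatives
  of these commutators tend to zero in \<open>L\<^sup>1\<close>, so the induced metrics converge uniformly and in
  \<open>W\<^bsup>1,1\<^esup>\<close>. The Gauss curvature times the area density is the curl of a connection form that is linear in
  the first derivatives of the metric, and therefore it converges as a distribution. For smooth
  \<open>u\<^sub>k\<close> the map \<open>F\<close> is chosen such that the Jacobian of \<open>F\<close> applied to the slopes is the pullback of the
  spherical area by the Gauss map, that is, the curvature times the area density. On the other side, the
  slopes of \<open>u\<^sub>k\<close>, transported to \<open>U'\<close> by \<open>\<Phi>\<close>, converge to those of \<open>f\<close> in \<open>L\<^sup>2\<close> without concentration of
  near-diagonal \<open>H\<^bsup>1/2\<^esup>\<close> energy, and this is enough for the Jacobians to have the same limit as along any smooth sequence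
  converging to \<open>w\<close> in \<open>H\<^bsup>1/2\<^esup>\<close>.\<close>

text \<open>Two losses of smoothness shape the argument. The second derivatives of \<open>u\<close>
  need not be functions, so the Gauss equation is available for the mollified surfaces only and must
  survive the limit in a form with first derivatives of the metric; the differentiated commutator is
  bounded by squared oscillations on \<epsilon>-balls over \<epsilon>^3, exactly what the H^(1/2)
  energy of \<open>Du\<close> controls. Moreover \<open>\<Phi>\<close> is merely C^1, so the
  transported slopes are C^1, in general not smooth, and not admissible in \<open>Det_D\<close>;
  hence \<open>jacobian_form_compare\<close> treats arbitrary C^1 sequences. Its condition
  \<open>L2_tame\<close> follows from \<open>tends_tame\<close>, which products, reciprocals, roots
  and composition with a C^1 diffeomorphism preserve. As for \<open>F\<close>: its first component
  is the primitive in z_1, zero at z_1 = 0, of (1 + |z|^2)^(-3/2), the density of spherical area in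
  slope coordinates; as the second component is z_2, this density is det DF.\<close>

section \<open>Calculus of functions of class C^k\<close>

lemma frechet_derivative_cong_open:
  assumes "open S" "x \<in> S" "\<And>y. y \<in> S \<Longrightarrow> f y = g y"
  shows "frechet_derivative f (at x) = frechet_derivative g (at x)"
proof -
  have "(f has_derivative D) (at x) \<longleftrightarrow> (g has_derivative D) (at x)" for D
    using has_derivative_transform_within_open[of f D x UNIV S g]
      has_derivative_transform_within_open[of g D x UNIV S f] assms by auto
  then show ?thesis unfolding frechet_derivative_def by simp
qed

lemma pderiv_at_cong:
  assumes "open S" "x \<in> S" "\<And>y. y \<in> S \<Longrightarrow> f y = g y"
  shows "pderiv_at i f x = pderiv_at i g x"
  unfolding pderiv_at_def by (simp add: frechet_derivative_cong_open[OF assms])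

lemma pderiv_at_eqI: "(h has_derivative D) (at x) \<Longrightarrow> pderiv_at i h x = D (axis i 1)"
  unfolding pderiv_at_def by (metis frechet_derivative_at)

lemma Ck_on_cong:
  assumes "open S" "\<And>y. y \<in> S \<Longrightarrow> f y = g y"
  shows "Ck_on k S f \<longleftrightarrow> Ck_on k S g"
  using assms(2)
proof (induction k arbitrary: f g)
  case 0
  then show ?case by (auto cong: continuous_on_cong)
next
  case (Suc k)
  have "f differentiable (at x) \<longleftrightarrow> g differentiable (at x)" if "x \<in> S" for x
    unfolding differentiable_def
    using has_derivative_transform_within_open[of f _ x UNIV S g]
      has_derivative_transform_within_open[of g _ x UNIV S f] assms(1) that Suc.prems by auto
  moreover have "Ck_on k S (pderiv_at i f) \<longleftrightarrow> Ck_on k S (pderiv_at i g)" for i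
    by (rule Suc.IH) (metis pderiv_at_cong[OF assms(1)] Suc.prems)
  ultimately show ?case by simp
qed

text \<open>With an explicit derivative \<open>D\<close> the inductions below deal with the formula
  for \<open>D x (axis i 1)\<close> instead of the choice operator inside \<open>pderiv_at\<close>.
  Since \<open>S\<close> is open, the two agree near every point of \<open>S\<close>.\<close>

lemma Ck_on_Suc_I:
  assumes "open S" "\<And>x. x \<in> S \<Longrightarrow> (f has_derivative D x) (at x)"
    and "\<And>i. Ck_on k S (\<lambda>x. D x (axis i 1))"
  shows "Ck_on (Suc k) S f"
proof -
  have "Ck_on k S (pderiv_at i f)" for i
    using Ck_on_cong[OF assms(1), of "pderiv_at i f" "\<lambda>x. D x (axis i 1)" k]
    using assms pderiv_at_eqI by fastforce
  then show ?thesis using assms(2) by (auto simp: differentiable_def)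
qed

lemma Ck_on_SucD: "Ck_on (Suc k) S f \<Longrightarrow> Ck_on k S f"
proof (induction k arbitrary: f)
  case 0
  then have "f differentiable_on S"
    by (auto simp: differentiable_on_def intro: differentiable_at_withinI)
  then show ?case by (simp add: differentiable_imp_continuous_on)
next
  case (Suc k)
  then show ?case by (metis Ck_on.simps(2))
qed

lemma Ck_on_mono: "Ck_on k S f \<Longrightarrow> j \<le> k \<Longrightarrow> Ck_on j S f"
  by (induction k) (metis le_zero_eq, metis Ck_on_SucD le_Suc_eq)

lemma Ck_on_subset: "Ck_on k S f \<Longrightarrow> T \<subseteq> S \<Longrightarrow> Ck_on k T f"
  by (induction k arbitrary: f) (auto intro: continuous_on_subset)

lemma sum_axis: "(\<Sum>i\<in>UNIV. v $ i *\<^sub>R axis i 1) = (v::real^'n)"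
  by (simp add: vec_eq_iff axis_def if_distrib cong: if_cong)

lemma has_derivative_pderiv:
  assumes "h differentiable (at x)"
  shows "(h has_derivative (\<lambda>v. \<Sum>i\<in>UNIV. v $ i *\<^sub>R pderiv_at i h x)) (at x)"
proof -
  have d: "(h has_derivative frechet_derivative h (at x)) (at x)"
    using assms frechet_derivative_works by blast
  interpret bounded_linear "frechet_derivative h (at x)" by (rule has_derivative_bounded_linear[OF d])
  have "frechet_derivative h (at x) v = (\<Sum>i\<in>UNIV. v $ i *\<^sub>R pderiv_at i h x)" for v
    unfolding pderiv_at_def
    by (subst (1) sum_axis[symmetric]) (simp add: sum scale)
  then have "frechet_derivative h (at x) = (\<lambda>v. \<Sum>i\<in>UNIV. v $ i *\<^sub>R pderiv_at i h x)"
    by blast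
  then show ?thesis using d by simp
qed

lemma Ck_on_const: "open S \<Longrightarrow> Ck_on k S (\<lambda>_. c)"
proof (induction k arbitrary: c)
  case (Suc k)
  then show ?case by (intro Ck_on_Suc_I[where D="\<lambda>_ _. 0"]) auto
qed simp

lemma Ck_on_add:
  "open S \<Longrightarrow> Ck_on k S f \<Longrightarrow> Ck_on k S g \<Longrightarrow> Ck_on k S (\<lambda>x. f x + g x)"
proof (induction k arbitrary: f g)
  case (Suc k)
  show ?case
  proof (rule Ck_on_Suc_I)
    fix x assume "x \<in> S"
    then show "((\<lambda>x. f x + g x) has_derivative
       (\<lambda>v. frechet_derivative f (at x) v + frechet_derivative g (at x) v)) (at x)"
      using Suc.prems by (intro has_derivative_add) (auto simp: frechet_derivative_works[symmetric])
  qed (use Suc in \<open>auto simp flip: pderiv_at_def\<close>)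
qed (simp add: continuous_on_add)

lemma (in bounded_linear) Ck_on_compose:
  "open S \<Longrightarrow> Ck_on k S h \<Longrightarrow> Ck_on k S (\<lambda>x. f (h x))"
proof (induction k arbitrary: h)
  case (Suc k)
  show ?case
  proof (rule Ck_on_Suc_I)
    fix x assume "x \<in> S"
    then show "((\<lambda>x. f (h x)) has_derivative
       (\<lambda>v. f (frechet_derivative h (at x) v))) (at x)"
      using Suc.prems by (intro has_derivative) (auto simp: frechet_derivative_works[symmetric])
  qed (use Suc in \<open>auto simp flip: pderiv_at_def\<close>)
qed (simp add: continuous_on)

lemma Ck_on_mult:
  fixes f g :: "real^'n \<Rightarrow> real"
  shows "open S \<Longrightarrow> Ck_on k S f \<Longrightarrow> Ck_on k S g \<Longrightarrow> Ck_on k S (\<lambda>x. f x * g x)"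
proof (induction k arbitrary: f g)
  case (Suc k)
  show ?case
  proof (rule Ck_on_Suc_I)
    fix x assume "x \<in> S"
    then show "((\<lambda>x. f x * g x) has_derivative
       (\<lambda>v. f x * frechet_derivative g (at x) v + frechet_derivative f (at x) v * g x)) (at x)"
      using Suc.prems by (intro has_derivative_mult) (auto simp: frechet_derivative_works[symmetric])
  next
    fix i
    have "Ck_on k S f" "Ck_on k S g" using Suc.prems Ck_on_SucD by blast+
    then show "Ck_on k S (\<lambda>x. f x * frechet_derivative g (at x) (axis i 1)
       + frechet_derivative f (at x) (axis i 1) * g x)"
      using Suc.prems by (intro Ck_on_add Suc.IH) (auto simp flip: pderiv_at_def)
  qed (use Suc.prems in auto)
qed (simp add: continuous_on_mult)

lemma Ck_on_linear:
  assumes "bounded_linear (f :: real^'n \<Rightarrow> 'b::real_normed_vector)" shows "Ck_on k S f"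
proof -
  have "Ck_on k UNIV f"
  proof (cases k)
    case 0
    then show ?thesis using assms by (simp add: linear_continuous_on)
  next
    case (Suc k')
    then show ?thesis using assms
      by (auto simp del: Ck_on.simps intro!: Ck_on_Suc_I[where D="\<lambda>_. f"] Ck_on_const bounded_linear_imp_has_derivative)
  qed
  then show ?thesis using Ck_on_subset by blast
qed

lemma pderiv_at_mult:
  fixes f g :: "real^'n \<Rightarrow> real"
  assumes "f differentiable (at x)" "g differentiable (at x)"
  shows "pderiv_at i (\<lambda>x. f x * g x) x = f x * pderiv_at i g x + pderiv_at i f x * g x"
  unfolding pderiv_at_def
  by (subst frechet_derivative_at[symmetric, OF has_derivative_mult])
     (use assms in \<open>auto simp: frechet_derivative_works[symmetric]\<close>)

lemma pderiv_at_add: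
  assumes "f differentiable (at x)" "g differentiable (at x)"
  shows "pderiv_at i (\<lambda>x. f x + g x) x = pderiv_at i f x + pderiv_at i g x"
  unfolding pderiv_at_def
  by (subst frechet_derivative_at[symmetric, OF has_derivative_add])
     (use assms in \<open>auto simp: frechet_derivative_works[symmetric]\<close>)

lemma pderiv_at_bounded_linear:
  assumes "bounded_linear L" "f differentiable (at x)"
  shows "pderiv_at i (\<lambda>x. L (f x)) x = L (pderiv_at i f x)"
  unfolding pderiv_at_def
  by (subst frechet_derivative_at[symmetric, OF bounded_linear.has_derivative[OF assms(1)]])
     (use assms in \<open>auto simp: frechet_derivative_works[symmetric]\<close>)

section \<open>A smooth mollifier\<close>

text \<open>The power of \<open>t\<close> in the denominator makes the family closed under
  differentiation, so smoothness of every order follows by an induction in which \<open>m\<close>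
  varies.\<close>

definition exp_bump :: "nat \<Rightarrow> real \<Rightarrow> real" where
  "exp_bump m t = (if t > 0 then exp (- 1 / t) / t ^ m else 0)"

lemma exp_bump_nonneg: "0 \<le> exp_bump m t"
  by (simp add: exp_bump_def)

text \<open>The exponential series at 1/t dominates its single term of order m + 2. The quadratic
  decay gives derivative 0 at the origin, and for t at most 1 the same bound limits the size of the
  mollifier.\<close>

lemma exp_bump_le: "exp_bump m t \<le> fact (m + 2) * t\<^sup>2"
proof (cases "t > 0")
  case True
  have "(1/t) ^ (m+2) /\<^sub>R fact (m+2) \<le> exp (1/t)"
    unfolding exp_def using True
    by (intro order_trans[OF _ sum_le_suminf[OF summable_exp_generic, of "{m+2}"]]) auto
  then have "(1/t) ^ (m+2) \<le> fact (m+2) * exp (1/t)"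
    using mult_left_mono[of "(1/t) ^ (m+2) /\<^sub>R fact (m+2)" "exp (1/t)" "fact (m+2)"]
    by (simp add: mult.assoc[symmetric] del: fact_Suc power_Suc)
  then have "(1/t) ^ (m+2) * (exp (-1/t) * t\<^sup>2) \<le> (fact (m+2) * exp (1/t)) * (exp (-1/t) * t\<^sup>2)"
    by (rule mult_right_mono) auto
  moreover have "(1/t) ^ (m+2) * (exp (-1/t) * t\<^sup>2) = exp (-1/t) / t^m"
    using True by (simp add: power_add power_divide field_simps power2_eq_square)
  moreover have "exp (1/t) * exp (-1/t) = 1"
    by (simp flip: exp_add)
  then have "(fact (m+2) * exp (1/t)) * (exp (-1/t) * t\<^sup>2) = fact (m+2) * t\<^sup>2"
    by (metis (no_types, lifting) mult.assoc mult.left_neutral)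
  ultimately have "exp (-1/t) / t^m \<le> fact (m+2) * t\<^sup>2"
    by linarith
  then show ?thesis using True by (simp add: exp_bump_def del: fact_Suc)
qed (simp add: exp_bump_def)

lemma has_derivative_exp_bump:
  "(exp_bump m has_real_derivative exp_bump (m + 2) t - m * exp_bump (m + 1) t) (at t)"
proof -
  consider "t > 0" | "t < 0" | "t = 0" by linarith
  then show ?thesis
  proof cases
    case 1
    have "((\<lambda>t. exp (- inverse t) * inverse t ^ m) has_real_derivative
       exp (- inverse t) * inverse t ^ (m+2) - m * (exp (- inverse t) * inverse t ^ (m+1))) (at t)"
    proof (rule DERIV_cong)
      show "((\<lambda>t. exp (- inverse t) * inverse t ^ m) has_real_derivative
        exp (- inverse t) * (real m * (inverse t ^ (m - 1) * - (inverse t ^ 2)))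
        + exp (- inverse t) * inverse t ^ 2 * inverse t ^ m) (at t)"
        using 1 by (auto intro!: derivative_eq_intros simp: power2_eq_square)
      show "exp (- inverse t) * (real m * (inverse t ^ (m - 1) * - (inverse t ^ 2)))
        + exp (- inverse t) * inverse t ^ 2 * inverse t ^ m =
        exp (- inverse t) * inverse t ^ (m+2) - m * (exp (- inverse t) * inverse t ^ (m+1))"
        by (cases m) (auto simp: power2_eq_square algebra_simps)
    qed
    then have "((\<lambda>t. exp (- 1 / t) / t ^ m) has_real_derivative
       exp_bump (m + 2) t - m * exp_bump (m + 1) t) (at t)"
      using 1 by (simp add: exp_bump_def divide_inverse power_inverse)
    then show ?thesis
      by (rule has_field_derivative_transform_within_open[of _ _ _ "{0<..}"])
         (use 1 in \<open>auto simp: exp_bump_def\<close>)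
  next
    case 2
    have "((\<lambda>t. 0) has_real_derivative exp_bump (m + 2) t - m * exp_bump (m + 1) t) (at t)"
      using 2 by (simp add: exp_bump_def)
    then show ?thesis
      by (rule has_field_derivative_transform_within_open[of _ _ _ "{..<0}"])
         (use 2 in \<open>auto simp: exp_bump_def\<close>)
  next
    case 3
    \<comment> \<open>The quadratic bound squeezes the difference quotient at the only point where
      the two branches meet.\<close>
    have "(\<lambda>h. exp_bump m h / h) \<midarrow>0\<rightarrow> 0"
    proof (rule Lim_null_comparison[of _ "\<lambda>h. fact (m+2) * \<bar>h\<bar>"])
      show "\<forall>\<^sub>F h in at 0. norm (exp_bump m h / h) \<le> fact (m + 2) * \<bar>h\<bar>"
        using exp_bump_le[of m] exp_bump_nonneg[of m]
        by (intro always_eventually allI)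
           (auto simp: divide_simps power2_eq_square mult.assoc simp del: fact_Suc)
      show "((\<lambda>h. fact (m+2) * \<bar>h\<bar>) \<longlongrightarrow> 0) (at (0::real))"
        by (auto intro!: tendsto_eq_intros simp del: fact_Suc)
    qed
    moreover have "exp_bump k 0 = 0" for k by (simp add: exp_bump_def)
    ultimately show ?thesis unfolding 3 DERIV_def by simp
  qed
qed

text \<open>The centre \<open>a\<close> is a parameter because the profile is radial: the reflected
  kernel, as a function of the integration variable, is again a profile with another centre.\<close>

definition mollifier_profile :: "real \<Rightarrow> nat \<Rightarrow> real^2 \<Rightarrow> real^2 \<Rightarrow> real" where
  "mollifier_profile \<epsilon> m a x = exp_bump m (1 - (norm (x - a))\<^sup>2 / \<epsilon>\<^sup>2)"

lemma has_derivative_mollifier_profile: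
  "(mollifier_profile \<epsilon> m a has_derivative
    (\<lambda>v. (mollifier_profile \<epsilon> (m+2) a x - m * mollifier_profile \<epsilon> (m+1) a x)
       * (- 2 / \<epsilon>\<^sup>2 * ((x - a) \<bullet> v)))) (at x)"
proof -
  have "((\<lambda>x. 1 - (norm (x - a))\<^sup>2 / \<epsilon>\<^sup>2) has_derivative (\<lambda>v. - 2 / \<epsilon>\<^sup>2 * ((x - a) \<bullet> v))) (at x)"
    unfolding power2_norm_eq_inner divide_inverse
    by (auto intro!: derivative_eq_intros simp: inner_commute algebra_simps inner_diff)
  from has_derivative_compose[OF this has_derivative_exp_bump[unfolded has_field_derivative_def]]
  show ?thesis unfolding mollifier_profile_def[abs_def] by (simp add: mult.commute)
qed

lemma Ck_on_mollifier_profile: "Ck_on k UNIV (mollifier_profile \<epsilon> m a)"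
proof (induction k arbitrary: m)
  case 0
  have "mollifier_profile \<epsilon> m a differentiable_on UNIV"
unfolding differentiable_on_def differentiable_def
    using has_derivative_mollifier_profile has_derivative_at_withinI by blast
  then show ?case by (simp add: differentiable_imp_continuous_on)
next
  case (Suc k)
  show ?case
  proof (rule Ck_on_Suc_I)
    fix i
    have "Ck_on k UNIV (\<lambda>x. (mollifier_profile \<epsilon> (m+2) a x + - real m * mollifier_profile \<epsilon> (m+1) a x)
       * (- 2 / \<epsilon>\<^sup>2 * (x \<bullet> axis i 1 + - (a \<bullet> axis i 1))))"
      by (intro Ck_on_mult Ck_on_add Suc.IH Ck_on_const Ck_on_linear bounded_linear_inner_left) auto
    then show "Ck_on k UNIV (\<lambda>x. (mollifier_profile \<epsilon> (m+2) a x - m * mollifier_profile \<epsilon> (m+1) a x)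
       * (- 2 / \<epsilon>\<^sup>2 * ((x - a) \<bullet> axis i 1)))"
      by (simp add: inner_diff_left)
  qed (use has_derivative_mollifier_profile in \<open>blast+\<close>)
qed

text \<open>The recurring choice of a tolerance when an error is multiplied by \<open>L\<close>; the
  added 1 admits L = 0.\<close>

lemma div_succ_mult_less:
  fixes e L :: real
  assumes "e > 0" "L \<ge> 0"
  shows "e / (L + 1) > 0" "e / (L + 1) * L < e"
  using assms by (auto simp: field_simps intro: add_nonneg_pos)

section \<open>Convolution\<close>

lemma pderiv_at_eq_0_outside:
  assumes "\<And>x. norm x > R \<Longrightarrow> h x = 0" "norm x > R"
  shows "pderiv_at i h x = 0"
proof -
  have o: "open {x::real^'a. norm x > R}" by (intro open_Collect_less continuous_intros)
  have "pderiv_at i h x = pderiv_at i (\<lambda>_. 0) x"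
    by (rule pderiv_at_cong[OF o]) (use assms in auto)
  then show ?thesis by (simp add: pderiv_at_def)
qed

lemma uniformly_continuous_compact_support:
  fixes g :: "real^'n \<Rightarrow> real"
  assumes c: "continuous_on UNIV g" and z: "\<And>x. norm x > R \<Longrightarrow> g x = 0" and e: "e > 0"
  obtains d where "d > 0" "\<And>x y. norm (x - y) < d \<Longrightarrow> \<bar>g x - g y\<bar> < e"
proof -
  have "uniformly_continuous_on (cball 0 (R+1)) g"
    by (intro compact_uniformly_continuous continuous_on_subset[OF c]) auto
  then obtain d where d: "d > 0" "\<And>x y. x \<in> cball 0 (R+1) \<Longrightarrow> y \<in> cball 0 (R+1) \<Longrightarrow> dist x y < d \<Longrightarrow> dist (g x) (g y) < e"
    unfolding uniformly_continuous_on_def using e by metis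
  show thesis
  proof (rule that[of "min d 1"])
    fix x y :: "real^'n" assume xy: "norm (x - y) < min d 1"
    show "\<bar>g x - g y\<bar> < e"
    proof (cases "norm x \<le> R \<or> norm y \<le> R")
      case True
      moreover have "\<bar>norm x - norm y\<bar> < 1" using xy norm_triangle_ineq3[of x y] by linarith
      ultimately have "norm x \<le> R+1" "norm y \<le> R+1" by auto
      then show ?thesis using d(2)[of x y] xy by (auto simp: dist_norm)
    next
      case False
      then show ?thesis using z e by auto
    qed
  qed (use d in auto)
qed

lemma bounded_compact_support:
  fixes g :: "real^'n \<Rightarrow> real"
  assumes c: "continuous_on UNIV g" and z: "\<And>x. norm x > R \<Longrightarrow> g x = 0"
  obtains B where "B \<ge> 0" "\<And>x. \<bar>g x\<bar> \<le> B"
proof -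
  have "bounded (g ` cball 0 R)"
    by (intro compact_imp_bounded compact_continuous_image continuous_on_subset[OF c]) auto
  then obtain B where B: "\<And>x. x \<in> cball 0 R \<Longrightarrow> norm (g x) \<le> B" unfolding bounded_iff by blast
  have "\<bar>g x\<bar> \<le> max B 0" for x using B[of x] z[of x] by (cases "norm x \<le> R") auto
  then show ?thesis using that[of "max B 0"] by auto
qed

lemma integrable_compact_support:
  fixes g :: "real^'n \<Rightarrow> real"
  assumes c: "continuous_on UNIV g" and z: "\<And>x. norm x > R \<Longrightarrow> g x = 0"
  shows "integrable lborel g"
proof -
  have "set_integrable lborel (cball 0 R) g"
    unfolding set_integrable_def
    by (rule borel_integrable_compact) (auto intro: continuous_on_subset[OF c])
  moreover have "(\<lambda>x. indicator (cball 0 R) x *\<^sub>R g x) = g"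
    using z by (force simp: indicator_def)
  ultimately show ?thesis by (simp add: set_integrable_def)
qed

text \<open>The partial derivatives are continuous with bounded support, hence uniformly continuous,
  and the mean value inequality turns this into a first-order remainder uniform in \<open>x\<close>.
  Such a remainder can be integrated directly, which is how convolutions are differentiated
  below.\<close>

lemma uniform_differentiable_compact_support:
  fixes \<eta> :: "real^'n \<Rightarrow> real"
  assumes C: "Ck_on 1 UNIV \<eta>" and z: "\<And>x. norm x > R \<Longrightarrow> \<eta> x = 0" and e: "e > 0"
  obtains d where "d > 0"
    "\<And>x v. norm v < d \<Longrightarrow> \<bar>\<eta> (x + v) - \<eta> x - (\<Sum>i\<in>UNIV. v $ i * pderiv_at i \<eta> x)\<bar> \<le> e * norm v"
proof -
  let ?n = "real CARD('n)"
  have "\<exists>d>0. \<forall>x y. norm (x - y) < d \<longrightarrow> \<bar>pderiv_at i \<eta> x - pderiv_at i \<eta> y\<bar> < e / ?n" for i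
  proof -
    have "continuous_on UNIV (pderiv_at i \<eta>)" using C by simp
    moreover have "e / ?n > 0" using e by simp
    ultimately obtain d where "d > 0" "\<And>x y. norm (x - y) < d \<Longrightarrow> \<bar>pderiv_at i \<eta> x - pderiv_at i \<eta> y\<bar> < e / ?n"
      using uniformly_continuous_compact_support[of "pderiv_at i \<eta>" R "e / ?n"]
        pderiv_at_eq_0_outside[where h=\<eta> and R=R, OF z] by blast
    then show ?thesis by blast
  qed
  then obtain D where D: "\<And>i. D i > 0" "\<And>i x y. norm (x - y) < D i \<Longrightarrow>
      \<bar>pderiv_at i \<eta> x - pderiv_at i \<eta> y\<bar> < e / ?n" by metis
  define d where "d = Min (range D)"
  have d: "d > 0" "\<And>i. d \<le> D i" unfolding d_def using D(1) by auto
  show thesis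
  proof (rule that[OF d(1)])
    fix x v :: "real^'n" assume v: "norm v < d"
    \<comment> \<open>Without its linear part at \<open>x\<close>, the function has a derivative of
      norm at most \<open>e\<close> on the whole ball.\<close>
    define f where "f z = \<eta> z - (\<Sum>i\<in>UNIV. (z - x) $ i * pderiv_at i \<eta> x)" for z
    have der: "(f has_derivative (\<lambda>v. \<Sum>i\<in>UNIV. v $ i * (pderiv_at i \<eta> z - pderiv_at i \<eta> x)))
        (at z within ball x d)" for z
    proof -
      have e: "(\<lambda>v. \<Sum>i\<in>UNIV. v $ i * (pderiv_at i \<eta> z - pderiv_at i \<eta> x)) =
        (\<lambda>v. (\<Sum>i\<in>UNIV. v $ i *\<^sub>R pderiv_at i \<eta> z) - (\<Sum>i\<in>UNIV. v $ i * pderiv_at i \<eta> x))"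
        by (simp add: sum_subtractf right_diff_distrib)
      have "(\<eta> has_derivative (\<lambda>v. \<Sum>i\<in>UNIV. v $ i *\<^sub>R pderiv_at i \<eta> z)) (at z within ball x d)"
        using C by (intro has_derivative_at_withinI[OF has_derivative_pderiv]) simp
      moreover have "((\<lambda>z. \<Sum>i\<in>UNIV. (z - x) $ i * pderiv_at i \<eta> x) has_derivative
          (\<lambda>v. \<Sum>i\<in>UNIV. v $ i * pderiv_at i \<eta> x)) (at z within ball x d)"
      proof (rule has_derivative_sum)
        fix i
        have "((\<lambda>z. z $ i - x $ i) has_derivative (\<lambda>v. v $ i - 0)) (at z within ball x d)"
          by (intro has_derivative_diff bounded_linear_imp_has_derivative bounded_linear_vec_nth has_derivative_const)
        then show "((\<lambda>z. (z - x) $ i * pderiv_at i \<eta> x) has_derivative (\<lambda>v. v $ i * pderiv_at i \<eta> x)) (at z within ball x d)"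
          using has_derivative_mult_left by fastforce
      qed
      ultimately show ?thesis unfolding f_def e
        by (rule has_derivative_diff)
    qed
    have "norm (f (x + v) - f x) \<le> e * norm ((x + v) - x)"
    proof (rule differentiable_bound[of "ball x d" f])
      show "onorm (\<lambda>v. \<Sum>i\<in>UNIV. v $ i * (pderiv_at i \<eta> z - pderiv_at i \<eta> x)) \<le> e"
        if "z \<in> ball x d" for z
      proof (rule onorm_le)
        fix v :: "real^'n"
        have "norm (\<Sum>i\<in>UNIV. v $ i * (pderiv_at i \<eta> z - pderiv_at i \<eta> x)) \<le> (\<Sum>i\<in>(UNIV::'n set). norm v * (e / ?n))"
        proof (rule sum_norm_le)
          fix i
          have "\<bar>pderiv_at i \<eta> z - pderiv_at i \<eta> x\<bar> \<le> e / ?n"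
            using that D(2)[of z x i] d(2)[of i] by (auto simp: dist_norm norm_minus_commute)
          then show "norm (v $ i * (pderiv_at i \<eta> z - pderiv_at i \<eta> x)) \<le> norm v * (e / ?n)"
            unfolding norm_mult by (intro mult_mono component_le_norm_cart) (auto simp: component_le_norm_cart)
        qed
        then show "norm (\<Sum>i\<in>UNIV. v $ i * (pderiv_at i \<eta> z - pderiv_at i \<eta> x)) \<le> e * norm v"
          by (simp add: mult.commute)
      qed
    qed (use der v d in \<open>auto simp: dist_norm\<close>)
    then show "\<bar>\<eta> (x + v) - \<eta> x - (\<Sum>i\<in>UNIV. v $ i * pderiv_at i \<eta> x)\<bar> \<le> e * norm v"
      unfolding f_def by (simp add: algebra_simps)
  qed
qed

lemma lborel_integral_translate:
  fixes f :: "'a::euclidean_space \<Rightarrow> real"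
  shows "(LINT x|lborel. f (x + v)) = (LINT x|lborel. f x)"
proof -
  have "(LINT x|lborel. f x) = (LINT x|distr lborel borel ((+) v). f x)"
    by (simp add: lborel_distr_plus)
  also have "\<dots> = (LINT x|lborel. f (v + x))" if "f \<in> borel_measurable borel"
    using that by (intro integral_distr) auto
  finally have *: ?thesis if "f \<in> borel_measurable borel" using that by (simp add: add.commute)
  have "f \<in> borel_measurable borel" if "(\<lambda>x. f (x + v)) \<in> borel_measurable borel"
  proof -
    have "(\<lambda>x. f ((x - v) + v)) \<in> borel_measurable borel"
      by (rule measurable_compose[OF _ that]) auto
    then show ?thesis by simp
  qed
  \<comment> \<open>If \<open>f\<close> is not Borel, neither is its translate, since translating
    back recovers \<open>f\<close>; then both integrals have the default value 0.\<close>
  then have "\<not> integrable lborel (\<lambda>x. f (x + v))" "\<not> integrable lborel f" if "f \<notin> borel_measurable borel"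
    using that borel_measurable_integrable[of lborel f]
      borel_measurable_integrable[of lborel "\<lambda>x. f (x + v)"] by auto
  then show ?thesis
    using * by (cases "f \<in> borel_measurable borel") (simp_all only: not_integrable_integral_eq not_False_eq_True)
qed

lemma lborel_integral_reflect:
  fixes f :: "'a::euclidean_space \<Rightarrow> real"
  shows "(LINT y|lborel. f (x - y)) = (LINT y|lborel. f y)"
proof -
  have d: "distr lborel borel (\<lambda>y. x - y) = (lborel :: 'a measure)"
    using lborel_affine[of "-1" x] by (simp add: density_1)
  have *: ?thesis if "f \<in> borel_measurable borel"
    using integral_distr[of "\<lambda>y. x - y" lborel borel f] that by (simp add: d)
  have "f \<in> borel_measurable borel" if "(\<lambda>y. f (x - y)) \<in> borel_measurable borel"
  proof -
    have "(\<lambda>y. f (x - (x - y))) \<in> borel_measurable borel"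
      by (rule measurable_compose[OF _ that]) auto
    then show ?thesis by simp
  qed
  then have "\<not> integrable lborel (\<lambda>y. f (x - y))" "\<not> integrable lborel f" if "f \<notin> borel_measurable borel"
    using that borel_measurable_integrable[of lborel f]
      borel_measurable_integrable[of lborel "\<lambda>y. f (x - y)"] by auto
  then show ?thesis
    using * by (cases "f \<in> borel_measurable borel") (simp_all only: not_integrable_integral_eq not_False_eq_True)
qed

lemma lborel_integrable_reflect:
  fixes f :: "'a::euclidean_space \<Rightarrow> real"
  assumes "integrable lborel f" shows "integrable lborel (\<lambda>y. f (x - y))"
proof -
  have "distr lborel borel (\<lambda>y. x - y) = (lborel :: 'a measure)"
    using lborel_affine[of "-1" x] by (simp add: density_1)
  then show ?thesis
    using integrable_distr[of "\<lambda>y. x - y" lborel borel f] assms by simp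
qed

text \<open>A difference quotient has integral zero by translation invariance, and it is uniformly
  close to the partial derivative on a ball that contains both supports.\<close>

lemma integral_pderiv_eq_0:
  fixes \<eta> :: "real^'n \<Rightarrow> real"
  assumes C: "Ck_on 1 UNIV \<eta>" and z: "\<And>x. norm x > R \<Longrightarrow> \<eta> x = 0"
  shows "(LINT x|lborel. pderiv_at i \<eta> x) = 0"
proof -
  let ?I = "LINT x|lborel. pderiv_at i \<eta> x"
  \<comment> \<open>The shift used below has length at most 1, so a margin of 1 around the support
    contains everything.\<close>
  define m where "m = measure lborel (cball (0::real^'n) (R + 1))"
  have ci: "continuous_on UNIV (pderiv_at i \<eta>)" "continuous_on UNIV \<eta>"
    using C Ck_on_SucD[of 0 UNIV \<eta>] by auto
  have int: "integrable lborel (pderiv_at i \<eta>)" "integrable lborel \<eta>"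
    using integrable_compact_support[OF ci(1) pderiv_at_eq_0_outside[where h=\<eta> and R=R, OF z]]
      integrable_compact_support[OF ci(2) z] by auto
  have "\<bar>?I\<bar> \<le> e * m" if e: "e > 0" for e
  proof -
    obtain d where d: "d > 0"
    "\<And>x v. norm v < d \<Longrightarrow> \<bar>\<eta> (x + v) - \<eta> x - (\<Sum>i\<in>UNIV. v $ i * pderiv_at i \<eta> x)\<bar> \<le> e * norm v"
      using uniform_differentiable_compact_support[OF C z e] by blast
    define t where "t = min (d/2) 1"
    have t: "0 < t" "t < d" "t \<le> 1" using d by (auto simp: t_def)
    define v :: "real^'n" where "v = t *\<^sub>R axis i 1"
    have nv: "norm v = t" using t by (simp add: v_def)
    have vs: "(\<Sum>i\<in>UNIV. v $ i * pderiv_at i \<eta> x) = t * pderiv_at i \<eta> x" for x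
      by (simp add: v_def axis_def if_distrib[of "\<lambda>x. x * _"] if_distrib[of "\<lambda>x. t * x"] cong: if_cong)
    have i2: "integrable lborel (\<lambda>x. \<eta> (x + v))"
    proof (rule integrable_compact_support[of _ "R+t"])
      show "continuous_on UNIV (\<lambda>x. \<eta> (x + v))"
        by (intro continuous_on_compose2[OF ci(2)] continuous_intros) auto
      fix x :: "real^'n" assume "norm x > R + t"
      then show "\<eta> (x + v) = 0" using norm_triangle_ineq4[of "x + v" v] nv by (intro z) simp
    qed
    have "t * ?I = (LINT x|lborel. t * pderiv_at i \<eta> x - (\<eta> (x + v) - \<eta> x))"
      using int i2 by (simp add: lborel_integral_translate)
    also have "\<bar>\<dots>\<bar> \<le> (LINT x|lborel. indicator (cball (0::real^'n) (R+1)) x * (e * t))"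
    proof (rule integral_abs_bound_integral)
      fix x :: "real^'n"
      show "\<bar>t * pderiv_at i \<eta> x - (\<eta> (x + v) - \<eta> x)\<bar> \<le> indicator (cball 0 (R+1)) x * (e * t)"
      proof (cases "norm x \<le> R + 1")
        case True
        then show ?thesis using d(2)[of v x] t nv vs by (simp add: abs_minus_commute algebra_simps)
      next
        case False
        moreover have "norm (x + v) > R" using False norm_triangle_ineq4[of "x + v" v] nv t by simp
        ultimately show ?thesis using z[of x] z[of "x+v"] pderiv_at_eq_0_outside[where h=\<eta> and R=R and x=x and i=i, OF z] t by auto
      qed
    next
      show "integrable lborel (\<lambda>x. t * pderiv_at i \<eta> x - (\<eta> (x + v) - \<eta> x))"
        using int i2 by simp
      show "integrable lborel (\<lambda>x. indicator (cball (0::real^'n) (R+1)) x * (e * t))"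
        by (intro integrable_mult_left integrable_real_indicator) (auto simp: emeasure_lborel_cball_finite[unfolded infinity_ennreal_def])
    qed
    also have "\<dots> = e * t * m" by (simp add: m_def)
    finally show ?thesis using t by (simp add: abs_mult)
  qed
  moreover have "m \<ge> 0" by (simp add: m_def)
  ultimately have "\<bar>?I\<bar> \<le> 0 + e" if "e > 0" for e
    using div_succ_mult_less[OF that, of m] by fastforce
  then show ?thesis using field_le_epsilon[of "\<bar>?I\<bar>" 0] by auto
qed

definition conv :: "(real^'n \<Rightarrow> real) \<Rightarrow> (real^'n \<Rightarrow> real) \<Rightarrow> real^'n \<Rightarrow> real" where
  "conv \<eta> h x = (LINT y|lborel. \<eta> (x - y) * h y)"

lemma integrable_conv:
  fixes \<eta> h :: "real^'n \<Rightarrow> real"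
  assumes "continuous_on UNIV \<eta>" "\<And>x. norm x > R \<Longrightarrow> \<eta> x = 0" "integrable lborel h"
  shows "integrable lborel (\<lambda>y. \<eta> (x - y) * h y)"
proof -
  obtain B where B: "B \<ge> 0" "\<And>x. \<bar>\<eta> x\<bar> \<le> B" using bounded_compact_support[OF assms(1,2)] by blast
  have [measurable]: "\<eta> \<in> borel_measurable borel" "h \<in> borel_measurable borel"
    using assms(1,3) borel_measurable_continuous_onI by auto
  show ?thesis
    by (rule Bochner_Integration.integrable_bound[of _ "\<lambda>y. B * h y"])
       (use assms(3) B in \<open>auto simp: abs_mult intro!: mult_right_mono\<close>)
qed

lemma abs_conv_diff_le:
  fixes h :: "real^'n \<Rightarrow> real"
  assumes "integrable lborel h" "integrable lborel (\<lambda>y. k y * h y)" "\<And>y. \<bar>k y\<bar> \<le> e"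
  shows "\<bar>LINT y|lborel. k y * h y\<bar> \<le> e * (LINT y|lborel. \<bar>h y\<bar>)"
proof -
  have "\<bar>LINT y|lborel. k y * h y\<bar> \<le> (LINT y|lborel. e * \<bar>h y\<bar>)"
    using assms by (intro integral_abs_bound_integral) (auto simp: abs_mult intro!: mult_right_mono)
  then show ?thesis by simp
qed

lemma continuous_on_conv:
  assumes c: "continuous_on UNIV \<eta>" and z: "\<And>x. norm x > R \<Longrightarrow> \<eta> x = 0" and h: "integrable lborel h"
  shows "continuous_on UNIV (conv \<eta> h)"
  unfolding continuous_on_iff
proof (intro ballI allI impI)
  fix x and e :: real assume e: "e > 0"
  let ?L = "LINT y|lborel. \<bar>h y\<bar>"
  have L: "?L \<ge> 0" by simp
  define e' where "e' = e / (?L + 1)"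
  have e': "e' > 0" unfolding e'_def by (rule div_succ_mult_less[OF e L])
  then obtain d where d: "d > 0" "\<And>x y. norm (x - y) < d \<Longrightarrow> \<bar>\<eta> x - \<eta> y\<bar> < e'"
    using uniformly_continuous_compact_support[OF c z e'] by blast
  show "\<exists>d>0. \<forall>x'\<in>UNIV. dist x' x < d \<longrightarrow> dist (conv \<eta> h x') (conv \<eta> h x) < e"
  proof (intro exI conjI ballI impI)
    fix x' assume "dist x' x < d"
    then have "\<bar>\<eta> (x' - y) - \<eta> (x - y)\<bar> \<le> e'" for y
      using d(2)[of "x' - y" "x - y"] by (simp add: dist_norm)
    then have "\<bar>LINT y|lborel. (\<eta> (x' - y) - \<eta> (x - y)) * h y\<bar> \<le> e' * ?L"
      by (intro abs_conv_diff_le h) (auto simp: left_diff_distrib intro!: integrable_conv[OF c z h])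
    also have "\<dots> < e" unfolding e'_def by (rule div_succ_mult_less[OF e L])
    finally show "dist (conv \<eta> h x') (conv \<eta> h x) < e"
      by (simp add: dist_real_def conv_def left_diff_distrib integrable_conv[OF c z h])
  qed (rule d)
qed

text \<open>The uniform expansion of the kernel is integrated against \<open>h\<close>: all
  regularity comes from the kernel, and \<open>h\<close> contributes only its L^1 norm.\<close>

lemma has_derivative_conv:
  assumes C: "Ck_on 1 UNIV \<eta>" and z: "\<And>x. norm x > R \<Longrightarrow> \<eta> x = 0" and h: "integrable lborel h"
  shows "(conv \<eta> h has_derivative (\<lambda>v. \<Sum>i\<in>UNIV. v $ i * conv (pderiv_at i \<eta>) h x)) (at x)"
proof -
  have ci: "\<And>i. continuous_on UNIV (pderiv_at i \<eta>)" "continuous_on UNIV \<eta>"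
    using C Ck_on_SucD[of 0 UNIV \<eta>] by auto
  note int = integrable_conv[OF ci(1) pderiv_at_eq_0_outside[where h=\<eta> and R=R, OF z] h] integrable_conv[OF ci(2) z h]
  let ?L = "LINT y|lborel. \<bar>h y\<bar>"
  have L: "?L \<ge> 0" by simp
  show ?thesis
    unfolding has_derivative_at_alt
  proof (intro conjI allI impI)
    show "bounded_linear (\<lambda>v. \<Sum>i\<in>UNIV. v $ i * conv (pderiv_at i \<eta>) h x)"
      by (intro bounded_linear_sum bounded_linear_mult_left[THEN bounded_linear_compose] bounded_linear_vec_nth)
    fix e :: real assume e: "e > 0"
    define e' where "e' = e / (?L + 1)"
    have e': "e' > 0" unfolding e'_def by (rule div_succ_mult_less[OF e L])
    then obtain d where d: "d > 0"
      "\<And>x v. norm v < d \<Longrightarrow> \<bar>\<eta> (x + v) - \<eta> x - (\<Sum>i\<in>UNIV. v $ i * pderiv_at i \<eta> x)\<bar> \<le> e' * norm v"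
      using uniform_differentiable_compact_support[OF C z e'] by blast
    show "\<exists>d>0. \<forall>y. norm (y - x) < d \<longrightarrow>
       norm (conv \<eta> h y - conv \<eta> h x - (\<Sum>i\<in>UNIV. (y - x) $ i * conv (pderiv_at i \<eta>) h x)) \<le> e * norm (y - x)"
    proof (intro exI conjI allI impI)
      fix y assume y: "norm (y - x) < d"
      let ?v = "y - x"
      let ?k = "\<lambda>w. \<eta> (y - w) - \<eta> (x - w) - (\<Sum>i\<in>UNIV. ?v $ i * pderiv_at i \<eta> (x - w))"
      have "\<bar>?k w\<bar> \<le> e' * norm ?v" for w
        using d(2)[OF y, of "x - w"] by simp
      then have "\<bar>LINT w|lborel. ?k w * h w\<bar> \<le> e' * norm ?v * ?L"
        by (intro abs_conv_diff_le h)
           (simp_all only: left_diff_distrib[of _ _ "h _"] sum_distrib_right mult.assoc,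
             intro Bochner_Integration.integrable_diff Bochner_Integration.integrable_sum integrable_mult_right int)
      also have "\<dots> \<le> e * norm ?v"
      proof -
        have "e' * ?L \<le> e" unfolding e'_def using div_succ_mult_less[OF e L] by simp
        then have "e' * ?L * norm ?v \<le> e * norm ?v" by (rule mult_right_mono) simp
        then show ?thesis by (simp add: ac_simps)
      qed
      also have "(LINT w|lborel. ?k w * h w) =
         conv \<eta> h y - conv \<eta> h x - (\<Sum>i\<in>UNIV. ?v $ i * conv (pderiv_at i \<eta>) h x)"
        unfolding conv_def left_diff_distrib sum_distrib_right
        using int by (simp add: mult.assoc)
      finally show "norm (conv \<eta> h y - conv \<eta> h x - (\<Sum>i\<in>UNIV. (y - x) $ i * conv (pderiv_at i \<eta>) h x)) \<le> e * norm (y - x)"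
        by simp
    qed (rule d)
  qed
qed

lemma pderiv_at_conv:
  assumes "Ck_on 1 UNIV \<eta>" "\<And>x. norm x > R \<Longrightarrow> \<eta> x = 0" "integrable lborel h"
  shows "pderiv_at i (conv \<eta> h) x = conv (pderiv_at i \<eta>) h x"
  using pderiv_at_eqI[OF has_derivative_conv[where x=x, OF assms], where i=i]
  by (simp add: axis_def if_distrib[of "\<lambda>x. x * _"] cong: if_cong)

lemma Ck_on_conv:
  assumes "Ck_on k UNIV \<eta>" "\<And>x. norm x > R \<Longrightarrow> \<eta> x = 0" "integrable lborel h"
  shows "Ck_on k UNIV (conv \<eta> h)"
  using assms(1,2)
proof (induction k arbitrary: \<eta>)
  case 0
  then show ?case using continuous_on_conv[of \<eta> R h] assms(3) by simp
next
  case (Suc k)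
  have C: "Ck_on 1 UNIV \<eta>" using Ck_on_mono[OF Suc.prems(1), of 1] by simp
  show ?case
  proof (rule Ck_on_Suc_I)
    fix i :: 'a
    have "Ck_on k UNIV (conv (pderiv_at i \<eta>) h)"
      by (rule Suc.IH) (use Suc.prems pderiv_at_eq_0_outside[OF Suc.prems(2)] in auto)
    then show "Ck_on k UNIV (\<lambda>x. \<Sum>j\<in>UNIV. axis i 1 $ j * conv (pderiv_at j \<eta>) h x)"
      by (simp add: axis_def if_distrib[of "\<lambda>x. x * _"] cong: if_cong)
  qed (use has_derivative_conv[OF C Suc.prems(2) assms(3)] in auto)
qed

definition mollifier :: "real \<Rightarrow> real^2 \<Rightarrow> real" where
  "mollifier \<epsilon> x = inverse (LINT y|lborel. mollifier_profile \<epsilon> 0 0 y) * mollifier_profile \<epsilon> 0 0 x"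

text \<open>192 = 48 * 4. The normalising factor is at most 4 exp(4/3) / (pi \<epsilon>^2) by
  \<open>integral_mollifier_profile_ge\<close>; in the bound for the derivative the profile of order
  2 contributes 4! = 24 and the inner derivative 2 / \<epsilon>.\<close>

definition mollifier_const :: real where "mollifier_const = 192 * exp (4/3) / pi"

lemma mollifier_const_pos: "mollifier_const > 0"
  by (simp add: mollifier_const_def)

lemma mollifier_profile_outside:
  assumes "norm (x - a) \<ge> \<epsilon>" "\<epsilon> > 0" shows "mollifier_profile \<epsilon> m a x = 0"
proof -
  have "\<epsilon>\<^sup>2 \<le> (norm (x - a))\<^sup>2" using assms by (intro power_mono) auto
  then have "1 - (norm (x - a))\<^sup>2 / \<epsilon>\<^sup>2 \<le> 0" using assms by simp
  then show ?thesis by (simp add: mollifier_profile_def exp_bump_def)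
qed

lemma mollifier_profile_le:
  assumes "\<epsilon> > 0" shows "0 \<le> mollifier_profile \<epsilon> m a x" "mollifier_profile \<epsilon> m a x \<le> fact (m+2)"
proof -
  let ?s = "1 - (norm (x - a))\<^sup>2 / \<epsilon>\<^sup>2"
  show "0 \<le> mollifier_profile \<epsilon> m a x" by (simp add: mollifier_profile_def exp_bump_nonneg)
  show "mollifier_profile \<epsilon> m a x \<le> fact (m+2)"
  proof (cases "?s > 0")
    case True
    have "?s\<^sup>2 \<le> 1" using True by (auto simp: power_le_one)
    then have "fact (m+2) * ?s\<^sup>2 \<le> fact (m+2) * 1" by (intro mult_left_mono) auto
    then show ?thesis unfolding mollifier_profile_def using exp_bump_le[of m ?s] by linarith
  qed (auto simp: mollifier_profile_def exp_bump_def)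
qed

lemma integrable_mollifier_profile: "\<epsilon> > 0 \<Longrightarrow> integrable lborel (mollifier_profile \<epsilon> m 0)"
  using integrable_compact_support[of "mollifier_profile \<epsilon> m 0" \<epsilon>] Ck_on_mollifier_profile[of 0 \<epsilon> m 0]
  by (simp add: mollifier_profile_outside)

text \<open>On the ball of half the radius the argument of the bump is at least 3/4, so the profile
  is at least exp(-4/3) on an area of pi \<epsilon>^2 / 4.\<close>

lemma integral_mollifier_profile_ge:
  assumes e: "\<epsilon> > 0"
  shows "(LINT y|lborel. mollifier_profile \<epsilon> 0 0 y) \<ge> exp (-4/3) * pi * \<epsilon>\<^sup>2 / 4"
proof -
  have "measure lborel (ball (0::real^2) (\<epsilon>/2)) = pi * (\<epsilon>/2)\<^sup>2"
    using content_ball[of "\<epsilon>/2" "0::real^2"] e by (simp add: unit_ball_vol_2)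
  then have "exp (-4/3) * pi * \<epsilon>\<^sup>2 / 4 = (LINT y|lborel. indicator (ball (0::real^2) (\<epsilon>/2)) y * exp (-4/3))"
    by (simp add: power2_eq_square)
  also have "\<dots> \<le> (LINT y|lborel. mollifier_profile \<epsilon> 0 0 y)"
  proof (rule integral_mono)
    fix y :: "real^2"
    show "indicator (ball (0::real^2) (\<epsilon>/2)) y * exp (-4/3) \<le> mollifier_profile \<epsilon> 0 0 y"
    proof (cases "norm y < \<epsilon>/2")
      case True
      then have "(norm y)\<^sup>2 \<le> (\<epsilon>/2)\<^sup>2" by (intro power_mono) auto
      then have s: "1 - (norm y)\<^sup>2 / \<epsilon>\<^sup>2 \<ge> 3/4" using e by (simp add: field_simps power2_eq_square)
      define q where "q = 1 - (norm y)\<^sup>2 / \<epsilon>\<^sup>2"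
      have q: "q \<ge> 3/4" using s unfolding q_def .
      then have "-4/3 \<le> - 1 / q" by (simp add: pos_divide_le_eq)
      then have "exp (-4/3) \<le> exp_bump 0 q" using q by (simp add: exp_bump_def)
      then show ?thesis using True by (simp add: mollifier_profile_def q_def)
    qed (simp add: mollifier_profile_le[OF e])
  qed (use e in \<open>auto intro!: integrable_mult_left integrable_mollifier_profile simp: emeasure_lborel_ball_finite[unfolded infinity_ennreal_def]\<close>)
  finally show ?thesis .
qed

lemma Ck_on_mollifier: "Ck_on k UNIV (mollifier \<epsilon>)"
  unfolding mollifier_def[abs_def] by (intro Ck_on_mult Ck_on_const Ck_on_mollifier_profile) auto

lemma mollifier_nonneg: "\<epsilon> > 0 \<Longrightarrow> 0 \<le> mollifier \<epsilon> x"
  unfolding mollifier_def by (intro mult_nonneg_nonneg) (simp_all add: mollifier_profile_le)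

lemma mollifier_outside: "\<epsilon> > 0 \<Longrightarrow> norm x \<ge> \<epsilon> \<Longrightarrow> mollifier \<epsilon> x = 0"
  unfolding mollifier_def by (simp add: mollifier_profile_outside)

lemma pderiv_mollifier_outside: "\<epsilon> > 0 \<Longrightarrow> norm x > \<epsilon> \<Longrightarrow> pderiv_at i (mollifier \<epsilon>) x = 0"
  using pderiv_at_eq_0_outside[of \<epsilon> "mollifier \<epsilon>"] mollifier_outside by simp

lemma Ck_on_mollifier_reflect: "Ck_on k UNIV (\<lambda>y. mollifier \<epsilon> (x - y))"
proof -
  have "(\<lambda>y. mollifier \<epsilon> (x - y)) =
    (\<lambda>y. inverse (LINT y|lborel. mollifier_profile \<epsilon> 0 0 y) * mollifier_profile \<epsilon> 0 x y)"
    unfolding mollifier_def mollifier_profile_def by (simp add: norm_minus_commute)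
  then show ?thesis by (simp add: Ck_on_mult Ck_on_const Ck_on_mollifier_profile)
qed

lemma integral_mollifier: "\<epsilon> > 0 \<Longrightarrow> (LINT y|lborel. mollifier \<epsilon> y) = 1"
proof -
  assume e: "\<epsilon> > 0"
  have "exp (-4/3) * pi * \<epsilon>\<^sup>2 / 4 > 0" using e by simp
  then show ?thesis using integral_mollifier_profile_ge[OF e] unfolding mollifier_def by simp
qed

text \<open>For m = 0 the second term of the derivative of \<open>exp_bump\<close> carries the
  factor 0, so only the profile of order 2 remains.\<close>

lemma pderiv_mollifier:
  "pderiv_at i (mollifier \<epsilon>) x = inverse (LINT y|lborel. mollifier_profile \<epsilon> 0 0 y) *
     (mollifier_profile \<epsilon> 2 0 x * (- 2 / \<epsilon>\<^sup>2 * (x $ i)))"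
proof -
  let ?c = "inverse (LINT y|lborel. mollifier_profile \<epsilon> 0 0 y)"
  have "(mollifier \<epsilon> has_derivative (\<lambda>v. ?c * (mollifier_profile \<epsilon> 2 0 x * (- 2 / \<epsilon>\<^sup>2 * (x \<bullet> v))))) (at x)"
    unfolding mollifier_def[abs_def]
    using has_derivative_mult_right[OF has_derivative_mollifier_profile[of \<epsilon> 0 0 x], of ?c]
    by (simp add: numeral_2_eq_2)
  from pderiv_at_eqI[OF this, of i] show ?thesis by (simp add: inner_axis)
qed

lemma mollifier_bounds:
  assumes e: "\<epsilon> > 0"
  shows "\<bar>mollifier \<epsilon> x\<bar> \<le> mollifier_const / \<epsilon>\<^sup>2"
    and "\<bar>pderiv_at i (mollifier \<epsilon>) x\<bar> \<le> mollifier_const / \<epsilon> ^ 3"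
proof -
  let ?c = "inverse (LINT y|lborel. mollifier_profile \<epsilon> 0 0 y)"
  have p: "exp (-4/3) * pi * \<epsilon>\<^sup>2 / 4 > 0" using e by simp
  have c0: "?c \<ge> 0" using integral_mollifier_profile_ge[OF e] p by simp
  have "?c \<le> inverse (exp (-4/3) * pi * \<epsilon>\<^sup>2 / 4)"
    by (rule le_imp_inverse_le[OF integral_mollifier_profile_ge[OF e] p])
  also have "\<dots> = mollifier_const / 48 / \<epsilon>\<^sup>2"
    unfolding mollifier_const_def by (simp add: exp_minus field_simps)
  finally have c: "?c \<le> mollifier_const / 48 / \<epsilon>\<^sup>2" .
  have "\<bar>mollifier \<epsilon> x\<bar> = ?c * mollifier_profile \<epsilon> 0 0 x"
    unfolding mollifier_def using c0 mollifier_profile_le(1)[OF e] by simp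
  also have "\<dots> \<le> (mollifier_const / 48 / \<epsilon>\<^sup>2) * 2"
    using mollifier_profile_le[OF e, of 0 0 x] c c0 mollifier_const_pos by (intro mult_mono) auto
  also have "\<dots> \<le> mollifier_const / \<epsilon>\<^sup>2" using mollifier_const_pos e by (simp add: field_simps)
  finally show "\<bar>mollifier \<epsilon> x\<bar> \<le> mollifier_const / \<epsilon>\<^sup>2" .
  have "\<bar>pderiv_at i (mollifier \<epsilon>) x\<bar> = ?c * (mollifier_profile \<epsilon> 2 0 x * (2 / \<epsilon>\<^sup>2 * \<bar>x $ i\<bar>))"
    unfolding pderiv_mollifier using c0 mollifier_profile_le(1)[OF e] by (simp add: abs_mult)
  also have "\<dots> \<le> (mollifier_const / 48 / \<epsilon>\<^sup>2) * (24 * (2 / \<epsilon>))"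
  proof (cases "norm x < \<epsilon>")
    case True
    then have "2 / \<epsilon>\<^sup>2 * \<bar>x $ i\<bar> \<le> 2 / \<epsilon>\<^sup>2 * \<epsilon>"
      using component_le_norm_cart[of x i] by (intro mult_left_mono) auto
    also have "\<dots> = 2 / \<epsilon>" using e by (simp add: power2_eq_square)
    finally have "2 / \<epsilon>\<^sup>2 * \<bar>x $ i\<bar> \<le> 2 / \<epsilon>" .
    moreover have "mollifier_profile \<epsilon> 2 0 x \<le> 24"
      using mollifier_profile_le(2)[OF e, of 2 0 x] by (simp add: fact_numeral)
    ultimately show ?thesis
      using c c0 mollifier_const_pos e mollifier_profile_le(1)[OF e] by (intro mult_mono) auto
  next
    case False
    then show ?thesis using e mollifier_const_pos by (simp add: mollifier_profile_outside)
  qed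
  also have "\<dots> = mollifier_const / \<epsilon> ^ 3" using e by (simp add: power2_eq_square power3_eq_cube)
  finally show "\<bar>pderiv_at i (mollifier \<epsilon>) x\<bar> \<le> mollifier_const / \<epsilon> ^ 3" .
qed

section \<open>Mean square oscillation estimates\<close>

text \<open>The integral is not divided by the area of the ball; the powers of \<epsilon> in the
  estimates below account for this.\<close>

definition sq_dev :: "real \<Rightarrow> (real^2 \<Rightarrow> real) \<Rightarrow> real^2 \<Rightarrow> real \<Rightarrow> real" where
  "sq_dev \<epsilon> h x c = (LINT y:ball x \<epsilon>|lborel. (h y - c)\<^sup>2)"

definition osc :: "real \<Rightarrow> (real^2 \<Rightarrow> real) \<Rightarrow> real^2 \<Rightarrow> real" where
  "osc \<epsilon> h x = sq_dev \<epsilon> h x (h x)"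

text \<open>Integrability lets \<open>h\<close> be convolved with bounded kernels, square
  integrability makes the oscillations finite.\<close>

definition L12 :: "(real^2 \<Rightarrow> real) \<Rightarrow> bool" where
  "L12 h \<longleftrightarrow> integrable lborel h \<and> integrable lborel (\<lambda>x. (h x)\<^sup>2)"

lemma measure_ball_vec2: "\<epsilon> \<ge> 0 \<Longrightarrow> measure lborel (ball (x::real^2) \<epsilon>) = pi * \<epsilon>\<^sup>2"
  using content_ball[of \<epsilon> x] by (simp add: unit_ball_vol_2)

lemma L12_mult: "L12 f \<Longrightarrow> L12 g \<Longrightarrow> integrable lborel (\<lambda>x. f x * g x)"
proof -
  assume a: "L12 f" "L12 g"
  show ?thesis
  proof (rule Bochner_Integration.integrable_bound[of _ "\<lambda>x. (f x)\<^sup>2 + (g x)\<^sup>2"])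
    show "AE x in lborel. norm (f x * g x) \<le> norm ((f x)\<^sup>2 + (g x)\<^sup>2)"
    proof (rule AE_I2)
      fix x
      have "2 * (\<bar>f x\<bar> * \<bar>g x\<bar>) \<le> (f x)\<^sup>2 + (g x)\<^sup>2"
        using sum_squares_bound[of "\<bar>f x\<bar>" "\<bar>g x\<bar>"] by simp
      moreover have "0 \<le> \<bar>f x\<bar> * \<bar>g x\<bar>" by simp
      ultimately show "norm (f x * g x) \<le> norm ((f x)\<^sup>2 + (g x)\<^sup>2)" unfolding real_norm_def abs_mult by linarith
    qed
  qed (use a in \<open>auto simp: L12_def\<close>)
qed

lemma L12_set_integrable:
  assumes "L12 h" shows "set_integrable lborel (ball x \<epsilon>) (\<lambda>y. h y - c)"
    "set_integrable lborel (ball x \<epsilon>) (\<lambda>y. (h y - c)\<^sup>2)"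
proof -
  have c: "set_integrable lborel (ball x \<epsilon>) (\<lambda>y. c)" for c :: real
    unfolding set_integrable_def by (simp add: emeasure_lborel_ball_finite[unfolded infinity_ennreal_def])
  have h: "set_integrable lborel (ball x \<epsilon>) h" "set_integrable lborel (ball x \<epsilon>) (\<lambda>y. (h y)\<^sup>2)"
    using assms integrable_mult_indicator[of "ball x \<epsilon>" lborel h]
      integrable_mult_indicator[of "ball x \<epsilon>" lborel "\<lambda>x. (h x)\<^sup>2"]
    unfolding L12_def set_integrable_def by auto
  show "set_integrable lborel (ball x \<epsilon>) (\<lambda>y. h y - c)"
    by (rule set_integral_diff(1)[OF h(1) c])
  have "set_integrable lborel (ball x \<epsilon>) (\<lambda>y. (h y)\<^sup>2 - (2 * c) * h y + c\<^sup>2)"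
    by (intro set_integral_add(1) set_integral_diff(1) set_integrable_mult_right h c)
  then show "set_integrable lborel (ball x \<epsilon>) (\<lambda>y. (h y - c)\<^sup>2)"
    by (simp add: power2_diff algebra_simps)
qed

text \<open>Expanding the nonnegative integral of (|F| - c)^2 with \<open>c\<close> the mean of |F|
  over \<open>A\<close> is the claim, up to division by the measure; a null set is treated
  apart.\<close>

lemma set_integral_Cauchy_Schwarz:
  fixes F :: "'a \<Rightarrow> real"
  assumes A: "A \<in> sets M" "emeasure M A < \<infinity>"
    and F: "set_integrable M A F" "set_integrable M A (\<lambda>x. (F x)\<^sup>2)"
  shows "(LINT x:A|M. \<bar>F x\<bar>)\<^sup>2 \<le> measure M A * (LINT x:A|M. (F x)\<^sup>2)"
proof (cases "measure M A = 0")
  case True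
  then have "AE x in M. x \<notin> A" using A by (intro AE_not_in) (auto simp: null_sets_def emeasure_eq_ennreal_measure)
  then have "(LINT x:A|M. \<bar>F x\<bar>) = 0"
    unfolding set_lebesgue_integral_def by (intro integral_eq_zero_AE) auto
  then show ?thesis using True by simp
next
  case False
  let ?m = "measure M A" and ?I = "LINT x:A|M. \<bar>F x\<bar>" and ?J = "LINT x:A|M. (F x)\<^sup>2"
  have m: "?m > 0" using False measure_nonneg[of M A] by linarith
  define c where "c = ?I / ?m"
  have c: "set_integrable M A (\<lambda>x. d)" for d :: real
    unfolding set_integrable_def using A by simp
  have a: "set_integrable M A (\<lambda>x. \<bar>F x\<bar>)" using set_integrable_abs[OF F(1)] .
  have "0 \<le> (LINT x:A|M. (\<bar>F x\<bar> - c)\<^sup>2)"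
    unfolding set_lebesgue_integral_def by (intro integral_nonneg_AE) auto
  also have "\<dots> = (LINT x:A|M. ((F x)\<^sup>2 - (2 * c) * \<bar>F x\<bar>) + c\<^sup>2)"
    by (simp add: power2_diff algebra_simps)
  also have "\<dots> = ?J - 2 * c * ?I + c\<^sup>2 * ?m"
    using A by (subst set_integral_add(2)[OF set_integral_diff(1)[OF F(2) set_integrable_mult_right[OF a]] c],
        subst set_integral_diff(2)[OF F(2) set_integrable_mult_right[OF a]])
      (simp add: set_lebesgue_integral_def mult.commute)
  also have "\<dots> = ?J - ?I\<^sup>2 / ?m" using m by (simp add: c_def field_simps power2_eq_square)
  finally show ?thesis using m by (simp add: field_simps)
qed

lemma sq_dev_nonneg: "0 \<le> sq_dev \<epsilon> h x c"
  unfolding sq_dev_def set_lebesgue_integral_def by (intro integral_nonneg_AE) auto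

lemma osc_nonneg: "0 \<le> osc \<epsilon> h x"
  unfolding osc_def by (rule sq_dev_nonneg)

text \<open>The constant \<open>c\<close> can be subtracted under the convolution at the price of
  \<open>c\<close> times the integral of the kernel, and Cauchy-Schwarz on the ball does the rest.
  It is applied with kernels of integral 1 (the mollifier) and 0 (its derivatives).\<close>

lemma conv_dev_bound:
  fixes h :: "real^2 \<Rightarrow> real"
  assumes h: "L12 h" and e: "\<epsilon> > 0" and eta: "continuous_on UNIV \<eta>"
    and b: "\<And>x. \<bar>\<eta> x\<bar> \<le> B" and z: "\<And>x. norm x \<ge> \<epsilon> \<Longrightarrow> \<eta> x = 0"
  shows "(conv \<eta> h x - c * (LINT y|lborel. \<eta> y))\<^sup>2 \<le> B\<^sup>2 * (pi * \<epsilon>\<^sup>2) * sq_dev \<epsilon> h x c"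
proof -
  have z': "\<And>x. norm x > \<epsilon> \<Longrightarrow> \<eta> x = 0" using z by simp
  have B: "B \<ge> 0" using b[of 0] by linarith
  have "integrable lborel \<eta>" by (rule integrable_compact_support[OF eta z'])
  then have i1: "integrable lborel (\<lambda>y. \<eta> (x - y))"
    using lborel_integrable_reflect by blast
  have i2: "integrable lborel (\<lambda>y. \<eta> (x - y) * h y)"
    by (rule integrable_conv[OF eta z']) (use h in \<open>auto simp: L12_def\<close>)
  have "conv \<eta> h x - c * (LINT y|lborel. \<eta> y) = (LINT y|lborel. \<eta> (x - y) * h y - c * \<eta> (x - y))"
    unfolding conv_def using i1 i2 by (simp add: lborel_integral_reflect)
  also have "\<bar>\<dots>\<bar> \<le> (LINT y|lborel. B * (indicator (ball x \<epsilon>) y * \<bar>h y - c\<bar>))"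
  proof (rule integral_abs_bound_integral)
    show "integrable lborel (\<lambda>y. B * (indicator (ball x \<epsilon>) y * \<bar>h y - c\<bar>))"
      using set_integrable_abs[OF L12_set_integrable(1)[OF h, of x \<epsilon> c]]
      unfolding set_integrable_def by simp
    fix y
    have "\<bar>\<eta> (x - y) * h y - c * \<eta> (x - y)\<bar> = \<bar>\<eta> (x - y)\<bar> * \<bar>h y - c\<bar>"
      by (simp add: abs_mult[symmetric] algebra_simps)
    also have "\<dots> \<le> B * (indicator (ball x \<epsilon>) y * \<bar>h y - c\<bar>)"
      using b[of "x - y"] z[of "x - y"] by (cases "y \<in> ball x \<epsilon>") (auto simp: dist_norm intro: mult_right_mono)
    finally show "\<bar>\<eta> (x - y) * h y - c * \<eta> (x - y)\<bar> \<le> B * (indicator (ball x \<epsilon>) y * \<bar>h y - c\<bar>)" .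
  qed (use i1 i2 in auto)
  also have "\<dots> = B * (LINT y:ball x \<epsilon>|lborel. \<bar>h y - c\<bar>)"
    by (simp add: set_lebesgue_integral_def)
  finally have "(conv \<eta> h x - c * (LINT y|lborel. \<eta> y))\<^sup>2 \<le> (B * (LINT y:ball x \<epsilon>|lborel. \<bar>h y - c\<bar>))\<^sup>2"
    by (metis abs_ge_zero power2_abs power_mono)
  also have "\<dots> = B\<^sup>2 * (LINT y:ball x \<epsilon>|lborel. \<bar>h y - c\<bar>)\<^sup>2" by (simp add: power_mult_distrib)
  also have "\<dots> \<le> B\<^sup>2 * (measure lborel (ball x \<epsilon>) * (LINT y:ball x \<epsilon>|lborel. (h y - c)\<^sup>2))"
    by (intro mult_left_mono set_integral_Cauchy_Schwarz L12_set_integrable[OF h])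
       (auto simp: emeasure_lborel_ball_finite[unfolded infinity_ennreal_def])
  also have "\<dots> = B\<^sup>2 * (pi * \<epsilon>\<^sup>2) * sq_dev \<epsilon> h x c"
    using e by (simp add: measure_ball_vec2 sq_dev_def)
  finally show ?thesis .
qed

abbreviation moll :: "real \<Rightarrow> (real^2 \<Rightarrow> real) \<Rightarrow> real^2 \<Rightarrow> real" where
  "moll \<epsilon> \<equiv> conv (mollifier \<epsilon>)"

lemma mollifier_continuous:
  "continuous_on UNIV (mollifier \<epsilon>)" "continuous_on UNIV (pderiv_at i (mollifier \<epsilon>))"
  using Ck_on_mollifier[of 0 \<epsilon>] Ck_on_mollifier[of 1 \<epsilon>] by auto

lemma pderiv_mollifier_outside':
  "\<epsilon> > 0 \<Longrightarrow> norm x \<ge> \<epsilon> \<Longrightarrow> pderiv_at i (mollifier \<epsilon>) x = 0"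
  unfolding pderiv_mollifier by (simp add: mollifier_profile_outside)

lemma integral_pderiv_mollifier: "\<epsilon> > 0 \<Longrightarrow> (LINT y|lborel. pderiv_at i (mollifier \<epsilon>) y) = 0"
  by (rule integral_pderiv_eq_0[where R=\<epsilon>, OF Ck_on_mollifier]) (simp add: mollifier_outside)

lemma moll_differentiable: "\<epsilon> > 0 \<Longrightarrow> L12 h \<Longrightarrow> moll \<epsilon> h differentiable (at x)"
  using has_derivative_conv[OF Ck_on_mollifier[of 1 \<epsilon>], of \<epsilon> h x] mollifier_outside
  by (auto simp: L12_def differentiable_def)

lemma pderiv_moll: "\<epsilon> > 0 \<Longrightarrow> integrable lborel h \<Longrightarrow> pderiv_at i (moll \<epsilon> h) x = conv (pderiv_at i (mollifier \<epsilon>)) h x"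
  by (rule pderiv_at_conv[OF Ck_on_mollifier, where R=\<epsilon>]) (auto simp: L12_def mollifier_outside)

lemma Ck_on_moll: "\<epsilon> > 0 \<Longrightarrow> integrable lborel h \<Longrightarrow> Ck_on k UNIV (moll \<epsilon> h)"
  by (rule Ck_on_conv[OF Ck_on_mollifier, where R=\<epsilon>]) (auto simp: L12_def mollifier_outside)

lemma moll_diff_bound:
  assumes "L12 h" "\<epsilon> > 0"
  shows "(moll \<epsilon> h x - h x)\<^sup>2 \<le> mollifier_const\<^sup>2 * pi / \<epsilon>\<^sup>2 * osc \<epsilon> h x"
proof -
  have "(moll \<epsilon> h x - h x)\<^sup>2 \<le> (mollifier_const / \<epsilon>\<^sup>2)\<^sup>2 * (pi * \<epsilon>\<^sup>2) * osc \<epsilon> h x"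
    using conv_dev_bound[OF assms mollifier_continuous(1) mollifier_bounds(1)[OF assms(2)], where x=x and c="h x"] assms
    by (simp add: mollifier_outside integral_mollifier osc_def)
  also have "(mollifier_const / \<epsilon>\<^sup>2)\<^sup>2 * (pi * \<epsilon>\<^sup>2) = mollifier_const\<^sup>2 * pi / \<epsilon>\<^sup>2"
    using assms(2) by (simp add: power_divide power2_eq_square)
  finally show ?thesis .
qed

text \<open>The differentiated kernel has mean zero, so the value \<open>h x\<close> is subtracted
  for free; \<epsilon>^(-6) from the squared kernel and \<epsilon>^2 from the area of the ball make
  \<epsilon>^(-4).\<close>

lemma pderiv_moll_bound:
  assumes "L12 h" "\<epsilon> > 0"
  shows "(pderiv_at i (moll \<epsilon> h) x)\<^sup>2 \<le> mollifier_const\<^sup>2 * pi / \<epsilon> ^ 4 * osc \<epsilon> h x"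
proof -
  have "(pderiv_at i (moll \<epsilon> h) x)\<^sup>2 \<le> (mollifier_const / \<epsilon> ^ 3)\<^sup>2 * (pi * \<epsilon>\<^sup>2) * osc \<epsilon> h x"
    using conv_dev_bound[OF assms mollifier_continuous(2) mollifier_bounds(2)[OF assms(2)] pderiv_mollifier_outside'[OF assms(2)], where x=x and c="h x"] assms
    by (simp add: integral_pderiv_mollifier osc_def pderiv_moll L12_def)
  also have "(mollifier_const / \<epsilon> ^ 3)\<^sup>2 * (pi * \<epsilon>\<^sup>2) = mollifier_const\<^sup>2 * pi / \<epsilon> ^ 4"
    using assms(2) by (simp add: power_divide power2_eq_square eval_nat_numeral)
  finally show ?thesis .
qed

text \<open>Replacing the centre \<open>h x\<close> by the mollified value costs a constant factor:
  their difference is itself bounded by the oscillation, with \<epsilon>^(-2), which the area of the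
  ball cancels.\<close>

lemma sq_dev_moll:
  assumes "L12 h" "\<epsilon> > 0"
  shows "sq_dev \<epsilon> h x (moll \<epsilon> h x) \<le> (2 + 2 * mollifier_const\<^sup>2 * pi\<^sup>2) * osc \<epsilon> h x"
proof -
  let ?c = "moll \<epsilon> h x"
  have c: "set_integrable lborel (ball x \<epsilon>) (\<lambda>y. c)" for c :: real
    unfolding set_integrable_def by (simp add: emeasure_lborel_ball_finite[unfolded infinity_ennreal_def])
  have i: "set_integrable lborel (ball x \<epsilon>) (\<lambda>y. 2 * (h y - h x)\<^sup>2)"
    by (intro set_integrable_mult_right L12_set_integrable assms)
  have "sq_dev \<epsilon> h x ?c \<le> (LINT y:ball x \<epsilon>|lborel. 2 * (h y - h x)\<^sup>2 + 2 * (?c - h x)\<^sup>2)"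
    unfolding sq_dev_def
  proof (rule set_integral_mono)
    fix y
    have "(h y - ?c)\<^sup>2 = ((h y - h x) - (?c - h x))\<^sup>2" by simp
    also have "\<dots> \<le> 2 * (h y - h x)\<^sup>2 + 2 * (?c - h x)\<^sup>2"
      using zero_le_power2[of "(h y - h x) + (?c - h x)"] unfolding power2_diff power2_sum
      by (simp add: algebra_simps)
    finally show "(h y - ?c)\<^sup>2 \<le> 2 * (h y - h x)\<^sup>2 + 2 * (?c - h x)\<^sup>2" .
  qed (intro L12_set_integrable assms set_integral_add(1) i c)+
  also have "\<dots> = 2 * osc \<epsilon> h x + 2 * (?c - h x)\<^sup>2 * (pi * \<epsilon>\<^sup>2)"
    using assms(2) by (subst set_integral_add(2)[OF i c])
      (simp add: osc_def sq_dev_def, simp add: set_lebesgue_integral_def measure_ball_vec2)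
  also have "\<dots> \<le> 2 * osc \<epsilon> h x + 2 * (mollifier_const\<^sup>2 * pi / \<epsilon>\<^sup>2 * osc \<epsilon> h x) * (pi * \<epsilon>\<^sup>2)"
    using assms(2) by (intro add_left_mono mult_right_mono mult_left_mono moll_diff_bound assms) auto
  also have "\<dots> = (2 + 2 * mollifier_const\<^sup>2 * pi\<^sup>2) * osc \<epsilon> h x"
    using assms(2) by (simp add: field_simps power2_eq_square)
  finally show ?thesis .
qed

text \<open>Half of \<open>mollifier_const\<close>, because a product is at most half the sum of
  squares, times the factor 2 + 2 \<open>mollifier_const\<close>^2 pi^2 from
  \<open>sq_dev_moll\<close>.\<close>

definition commutator_const :: real where
  "commutator_const = mollifier_const * (1 + mollifier_const\<^sup>2 * pi\<^sup>2)"

text \<open>The differentiated Constantin--E--Titi commutator: since the derivative of the mollifier has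
  mean zero, both factors under the convolution can be replaced by their deviations from their
  mollifications.\<close>

lemma pderiv_commutator_bound:
  assumes f: "L12 f" and g: "L12 g" and e: "\<epsilon> > 0"
  shows "\<bar>pderiv_at i (moll \<epsilon> (\<lambda>x. f x * g x)) x -
      (pderiv_at i (moll \<epsilon> f) x * moll \<epsilon> g x + moll \<epsilon> f x * pderiv_at i (moll \<epsilon> g) x)\<bar>
    \<le> commutator_const / \<epsilon> ^ 3 * (osc \<epsilon> f x + osc \<epsilon> g x)"
proof -
  let ?\<eta> = "pderiv_at i (mollifier \<epsilon>)" and ?a = "moll \<epsilon> f x" and ?b = "moll \<epsilon> g x"
  have fg: "integrable lborel (\<lambda>x. f x * g x)" by (rule L12_mult[OF f g])
  have fi: "integrable lborel f" and gi: "integrable lborel g" using f g by (auto simp: L12_def)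
  have ic: "integrable lborel (\<lambda>y. ?\<eta> (x - y) * h y)" if "integrable lborel h" for h
    by (rule integrable_conv[where R=\<epsilon>, OF mollifier_continuous(2) pderiv_mollifier_outside[OF e] that]) auto
  have i1: "integrable lborel (\<lambda>y. ?\<eta> (x - y))"
    using lborel_integrable_reflect integrable_compact_support[OF mollifier_continuous(2) pderiv_mollifier_outside[OF e]] by blast
  have i0: "(LINT y|lborel. ?\<eta> (x - y)) = 0"
    by (simp add: lborel_integral_reflect integral_pderiv_mollifier e)
  let ?I = "LINT y|lborel. ?\<eta> (x - y) * (f y * g y) - (?\<eta> (x - y) * f y * ?b + ?a * (?\<eta> (x - y) * g y)) + ?a * ?b * ?\<eta> (x - y)"
  have I: "pderiv_at i (moll \<epsilon> (\<lambda>x. f x * g x)) x -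
      (pderiv_at i (moll \<epsilon> f) x * ?b + ?a * pderiv_at i (moll \<epsilon> g) x) = ?I"
    using ic[OF fg] ic[OF fi] ic[OF gi] i1 fg fi gi e i0
    by (simp add: pderiv_moll conv_def)
  have "\<bar>?I\<bar> \<le> (LINT y|lborel. mollifier_const / \<epsilon> ^ 3 / 2 *
      (indicator (ball x \<epsilon>) y * (f y - ?a)\<^sup>2 + indicator (ball x \<epsilon>) y * (g y - ?b)\<^sup>2))"
  proof (rule integral_abs_bound_integral)
    fix y
    let ?F = "f y - ?a" and ?G = "g y - ?b"
    have "\<bar>?\<eta> (x - y) * (f y * g y) - (?\<eta> (x - y) * f y * ?b + ?a * (?\<eta> (x - y) * g y)) + ?a * ?b * ?\<eta> (x - y)\<bar>
      = \<bar>?\<eta> (x - y)\<bar> * \<bar>?F * ?G\<bar>"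
      by (simp add: abs_mult[symmetric] algebra_simps)
    also have "\<dots> \<le> \<bar>?\<eta> (x - y)\<bar> * ((?F\<^sup>2 + ?G\<^sup>2) / 2)"
      using sum_squares_bound[of "\<bar>?F\<bar>" "\<bar>?G\<bar>"] by (intro mult_left_mono) (auto simp: abs_mult)
    also have "\<dots> \<le> mollifier_const / \<epsilon> ^ 3 * (indicator (ball x \<epsilon>) y * ((?F\<^sup>2 + ?G\<^sup>2) / 2))"
      using mult_right_mono[OF mollifier_bounds(2)[OF e, of i "x - y"], of "(?F\<^sup>2 + ?G\<^sup>2) / 2"]
        pderiv_mollifier_outside'[OF e, of "x - y" i]
      by (cases "y \<in> ball x \<epsilon>") (auto simp: dist_norm)
    finally show "\<bar>?\<eta> (x - y) * (f y * g y) - (?\<eta> (x - y) * f y * ?b + ?a * (?\<eta> (x - y) * g y)) + ?a * ?b * ?\<eta> (x - y)\<bar>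
       \<le> mollifier_const / \<epsilon> ^ 3 / 2 * (indicator (ball x \<epsilon>) y * ?F\<^sup>2 + indicator (ball x \<epsilon>) y * ?G\<^sup>2)"
      by (simp add: algebra_simps)
  next
    show "integrable lborel (\<lambda>y. mollifier_const / \<epsilon> ^ 3 / 2 *
      (indicator (ball x \<epsilon>) y * (f y - ?a)\<^sup>2 + indicator (ball x \<epsilon>) y * (g y - ?b)\<^sup>2))"
      using L12_set_integrable(2)[OF f, of x \<epsilon> ?a] L12_set_integrable(2)[OF g, of x \<epsilon> ?b]
      unfolding set_integrable_def by simp
  next
    show "integrable lborel (\<lambda>y. ?\<eta> (x - y) * (f y * g y) - (?\<eta> (x - y) * f y * ?b + ?a * (?\<eta> (x - y) * g y)) + ?a * ?b * ?\<eta> (x - y))"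
      using ic[OF fg] ic[OF fi] ic[OF gi] i1 by simp
  qed
  also have "\<dots> = mollifier_const / \<epsilon> ^ 3 / 2 * (sq_dev \<epsilon> f x ?a + sq_dev \<epsilon> g x ?b)"
    using L12_set_integrable(2)[OF f, of x \<epsilon> ?a] L12_set_integrable(2)[OF g, of x \<epsilon> ?b]
    unfolding set_integrable_def sq_dev_def set_lebesgue_integral_def by simp
  also have "\<dots> \<le> mollifier_const / \<epsilon> ^ 3 / 2 * ((2 + 2 * mollifier_const\<^sup>2 * pi\<^sup>2) * osc \<epsilon> f x +
       (2 + 2 * mollifier_const\<^sup>2 * pi\<^sup>2) * osc \<epsilon> g x)"
    using mollifier_const_pos e by (intro mult_left_mono add_mono sq_dev_moll f g) auto
  also have "\<dots> = commutator_const / \<epsilon> ^ 3 * (osc \<epsilon> f x + osc \<epsilon> g x)"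
  proof -
    have "m / E / 2 * ((2 + 2 * k) * F + (2 + 2 * k) * G) = m * (1 + k) / E * (F + G)"
      for m E k F G :: real
      by (cases "E = 0") (auto simp: field_simps)
    then show ?thesis unfolding commutator_const_def by (simp only: mult.assoc)
  qed
  finally show ?thesis unfolding I .
qed

section \<open>Near-diagonal energy\<close>

text \<open>The Gagliardo kernel of H^(1/2) in the plane, exponent 2 + 2 * (1/2) = 3, truncated to
  pairs in \<open>V\<close> at distance below \<delta>. On the diagonal the division by zero yields
  0.\<close>

definition near_kernel :: "(real^2) set \<Rightarrow> real \<Rightarrow> real^2 \<Rightarrow> real^2 \<Rightarrow> real" where
  "near_kernel V \<delta> x y =
     indicator V x * indicator V y * indicator {..<\<delta>} (norm (x - y)) / norm (x - y) ^ 3"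

definition near_energy :: "(real^2) set \<Rightarrow> real \<Rightarrow> (real^2 \<Rightarrow> real) \<Rightarrow> ennreal" where
  "near_energy V \<delta> h =
     (\<integral>\<^sup>+x. \<integral>\<^sup>+y. ennreal (near_kernel V \<delta> x y * (h x - h y)\<^sup>2) \<partial>lborel \<partial>lborel)"

lemma near_kernel_nonneg: "0 \<le> near_kernel V \<delta> x y"
  by (simp add: near_kernel_def)

lemma near_kernel_measurable [measurable]:
  assumes [measurable]: "V \<in> sets borel"
  shows "(\<lambda>p. near_kernel V \<delta> (fst p) (snd p)) \<in> borel_measurable (lborel \<Otimes>\<^sub>M lborel)"
  unfolding near_kernel_def by measurable

lemma near_energy_cong: "(\<And>x. x \<in> V \<Longrightarrow> h x = h' x) \<Longrightarrow> near_energy V \<delta> h = near_energy V \<delta> h'"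
  unfolding near_energy_def
  by (intro nn_integral_cong) (auto simp: near_kernel_def indicator_def)

text \<open>A function that is measurable only on \<open>V\<close> may be replaced by its extension
  by zero, which is Borel on the whole plane, as Tonelli's theorem requires.\<close>

lemma near_energy_restrict: "near_energy V \<delta> h = near_energy V \<delta> (\<lambda>x. indicator V x * h x)"
  by (rule near_energy_cong) simp

lemma near_integrand_measurable:
  assumes [measurable]: "V \<in> sets borel" "h \<in> borel_measurable borel"
  shows "(\<lambda>p. ennreal (near_kernel V \<delta> (fst p) (snd p) * (h (fst p) - h (snd p))\<^sup>2))
    \<in> borel_measurable (lborel \<Otimes>\<^sub>M lborel)"
  by measurable

lemma near_energy_pair:
  assumes [measurable]: "V \<in> sets borel" "h \<in> borel_measurable borel"
  shows "near_energy V \<delta> h = (\<integral>\<^sup>+p. ennreal (near_kernel V \<delta> (fst p) (snd p) * (h (fst p) - h (snd p))\<^sup>2) \<partial>(lborel \<Otimes>\<^sub>M lborel))"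
  unfolding near_energy_def
  using lborel.nn_integral_fst[OF near_integrand_measurable[OF assms]] by simp

lemma near_kernel_mono: "V \<subseteq> V' \<Longrightarrow> \<delta> \<le> \<delta>' \<Longrightarrow> near_kernel V \<delta> x y \<le> near_kernel V' \<delta>' x y"
  by (auto simp: near_kernel_def indicator_def)

lemma near_energy_mono: "V \<subseteq> V' \<Longrightarrow> \<delta> \<le> \<delta>' \<Longrightarrow> near_energy V \<delta> h \<le> near_energy V' \<delta>' h"
  unfolding near_energy_def
  by (intro nn_integral_mono ennreal_leI mult_right_mono near_kernel_mono) auto

lemma iterated_nn_integral_cmult:
  fixes f :: "'a::euclidean_space \<Rightarrow> 'a \<Rightarrow> ennreal"
  assumes [measurable]: "(\<lambda>p. f (fst p) (snd p)) \<in> borel_measurable (lborel \<Otimes>\<^sub>M lborel)"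
  shows "(\<integral>\<^sup>+x. \<integral>\<^sup>+y. c * f x y \<partial>lborel \<partial>lborel) = c * (\<integral>\<^sup>+x. \<integral>\<^sup>+y. f x y \<partial>lborel \<partial>lborel)"
proof -
  have [measurable]: "(\<lambda>(x,y). f x y) \<in> borel_measurable (lborel \<Otimes>\<^sub>M lborel)"
    using assms by (simp add: case_prod_beta)
  have 1: "f x \<in> borel_measurable lborel" for x by measurable
  have 2: "(\<lambda>x. \<integral>\<^sup>+y. f x y \<partial>lborel) \<in> borel_measurable lborel" by measurable
  show ?thesis by (simp only: nn_integral_cmult[OF 1] nn_integral_cmult[OF 2])
qed

lemma iterated_nn_integral_add:
  fixes f g :: "'a::euclidean_space \<Rightarrow> 'a \<Rightarrow> ennreal"
  assumes "(\<lambda>p. f (fst p) (snd p)) \<in> borel_measurable (lborel \<Otimes>\<^sub>M lborel)"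
    and "(\<lambda>p. g (fst p) (snd p)) \<in> borel_measurable (lborel \<Otimes>\<^sub>M lborel)"
  shows "(\<integral>\<^sup>+x. \<integral>\<^sup>+y. f x y + g x y \<partial>lborel \<partial>lborel) =
     (\<integral>\<^sup>+x. \<integral>\<^sup>+y. f x y \<partial>lborel \<partial>lborel) + (\<integral>\<^sup>+x. \<integral>\<^sup>+y. g x y \<partial>lborel \<partial>lborel)"
proof -
  have [measurable]: "(\<lambda>(x,y). f x y) \<in> borel_measurable (lborel \<Otimes>\<^sub>M lborel)"
    "(\<lambda>(x,y). g x y) \<in> borel_measurable (lborel \<Otimes>\<^sub>M lborel)"
    using assms by (simp_all add: case_prod_beta)
  have 1: "f x \<in> borel_measurable lborel" "g x \<in> borel_measurable lborel" for x by measurable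
  have 2: "(\<lambda>x. \<integral>\<^sup>+y. f x y \<partial>lborel) \<in> borel_measurable lborel"
    "(\<lambda>x. \<integral>\<^sup>+y. g x y \<partial>lborel) \<in> borel_measurable lborel" by measurable
  show ?thesis by (simp only: nn_integral_add[OF 1] nn_integral_add[OF 2])
qed

text \<open>A comparison of increments pair by pair passes to the energies. Sums, products,
  reciprocals and roots are all reduced to it.\<close>

lemma near_energy_le:
  assumes V[measurable]: "V \<in> sets borel" and m: "set_borel_measurable borel V a" "set_borel_measurable borel V b"
    and c: "c \<ge> 0"
    and le: "\<And>x y. x \<in> V \<Longrightarrow> y \<in> V \<Longrightarrow> (h x - h y)\<^sup>2 \<le> c * ((a x - a y)\<^sup>2 + (b x - b y)\<^sup>2)"
  shows "near_energy V \<delta> h \<le> ennreal c * (near_energy V \<delta> a + near_energy V \<delta> b)"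
proof -
  let ?a = "\<lambda>x. indicator V x * a x" and ?b = "\<lambda>x. indicator V x * b x"
  have [measurable]: "?a \<in> borel_measurable borel" "?b \<in> borel_measurable borel"
    using m by (auto simp: set_borel_measurable_def)
  let ?K = "\<lambda>x y. ennreal (near_kernel V \<delta> x y * (?a x - ?a y)\<^sup>2)"
  let ?L = "\<lambda>x y. ennreal (near_kernel V \<delta> x y * (?b x - ?b y)\<^sup>2)"
  have K: "(\<lambda>p. ?K (fst p) (snd p)) \<in> borel_measurable (lborel \<Otimes>\<^sub>M lborel)"
    and L: "(\<lambda>p. ?L (fst p) (snd p)) \<in> borel_measurable (lborel \<Otimes>\<^sub>M lborel)"
    by measurable
  have "near_energy V \<delta> h \<le> (\<integral>\<^sup>+x. \<integral>\<^sup>+y. ennreal c * (?K x y + ?L x y) \<partial>lborel \<partial>lborel)"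
    unfolding near_energy_def
  proof (intro nn_integral_mono)
    fix x y
    show "ennreal (near_kernel V \<delta> x y * (h x - h y)\<^sup>2) \<le> ennreal c * (?K x y + ?L x y)"
    proof (cases "x \<in> V \<and> y \<in> V")
      case True
      have "near_kernel V \<delta> x y * (h x - h y)\<^sup>2 \<le> near_kernel V \<delta> x y * (c * ((a x - a y)\<^sup>2 + (b x - b y)\<^sup>2))"
        using le True by (intro mult_left_mono near_kernel_nonneg) auto
      also have "\<dots> = c * (near_kernel V \<delta> x y * (?a x - ?a y)\<^sup>2 + near_kernel V \<delta> x y * (?b x - ?b y)\<^sup>2)"
        using True by (simp add: algebra_simps)
      finally show ?thesis
        using c by (simp add: ennreal_plus[symmetric] ennreal_mult[symmetric] near_kernel_nonneg del: ennreal_plus)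
    qed (auto simp: near_kernel_def)
  qed
  also have "\<dots> = ennreal c * ((\<integral>\<^sup>+x. \<integral>\<^sup>+y. ?K x y \<partial>lborel \<partial>lborel) + (\<integral>\<^sup>+x. \<integral>\<^sup>+y. ?L x y \<partial>lborel \<partial>lborel))"
    by (subst iterated_nn_integral_cmult[OF borel_measurable_add[OF K L]],
        subst iterated_nn_integral_add[OF K L], rule refl)
  also have "\<dots> = ennreal c * (near_energy V \<delta> a + near_energy V \<delta> b)"
    unfolding near_energy_restrict[of V \<delta> a] near_energy_restrict[of V \<delta> b] by (simp add: near_energy_def)
  finally show ?thesis .
qed

lemma slobodeckij_integrand:
  "norm (x - y :: real^2) powr (real CARD(2) + 2 * (1/2)) = norm (x - y) ^ 3"
  by (cases "x = y") (auto simp: powr_numeral)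

lemma slobodeckij_eq:
  "slobodeckij_sq (1/2) V (h :: real^2 \<Rightarrow> real) =
     (\<integral>\<^sup>+x. \<integral>\<^sup>+y. ennreal (indicator V x * indicator V y * ((h x - h y)\<^sup>2 / norm (x - y) ^ 3)) \<partial>lborel \<partial>lborel)"
proof -
  have "(\<integral>\<^sup>+y. ennreal ((norm (h x - h y))\<^sup>2 / norm (x - y) powr (real CARD(2) + 2 * (1/2))) * indicator V y \<partial>lborel) * indicator V x
      = (\<integral>\<^sup>+y. ennreal (indicator V x * indicator V y * ((h x - h y)\<^sup>2 / norm (x - y) ^ 3)) \<partial>lborel)" for x
    unfolding slobodeckij_integrand
    by (cases "x \<in> V") (auto intro!: nn_integral_cong simp: indicator_def)
  then show ?thesis unfolding slobodeckij_sq_def by simp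
qed

lemma near_energy_le_slobodeckij: "near_energy V \<delta> h \<le> slobodeckij_sq (1/2) V h"
  unfolding near_energy_def slobodeckij_eq
  by (intro nn_integral_mono ennreal_leI) (auto simp: near_kernel_def indicator_def)

text \<open>A pair at distance at least \<delta> contributes at most (2B)^2 / \<delta>^3, so on a
  set of finite measure only the neighbourhood of the diagonal is singular.\<close>

lemma slobodeckij_le_near_energy:
  assumes V[measurable]: "V \<in> sets borel" and m: "set_borel_measurable borel V h"
    and B: "\<And>x. x \<in> V \<Longrightarrow> \<bar>h x\<bar> \<le> B" and d: "\<delta> > 0"
  shows "slobodeckij_sq (1/2) V h \<le> near_energy V \<delta> h + ennreal ((2 * B)\<^sup>2 / \<delta> ^ 3) * emeasure lborel V * emeasure lborel V"
proof -
  let ?a = "\<lambda>x. indicator V x * h x"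
  have [measurable]: "?a \<in> borel_measurable borel"
    using m by (auto simp: set_borel_measurable_def)
  let ?K = "\<lambda>x y. ennreal (near_kernel V \<delta> x y * (?a x - ?a y)\<^sup>2)"
  have K: "(\<lambda>p. ?K (fst p) (snd p)) \<in> borel_measurable (lborel \<Otimes>\<^sub>M lborel)"
    by measurable
  let ?c = "ennreal ((2 * B)\<^sup>2 / \<delta> ^ 3)"
  have "slobodeckij_sq (1/2) V h \<le> (\<integral>\<^sup>+x. \<integral>\<^sup>+y. ?K x y + ?c * (indicator V x * indicator V y) \<partial>lborel \<partial>lborel)"
    unfolding slobodeckij_eq
  proof (intro nn_integral_mono)
    fix x y :: "real^2"
    show "ennreal (indicator V x * indicator V y * ((h x - h y)\<^sup>2 / norm (x - y) ^ 3)) \<le> ?K x y + ?c * (indicator V x * indicator V y)"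
    proof (cases "x \<in> V \<and> y \<in> V")
      case True
      show ?thesis
      proof (cases "norm (x - y) < \<delta>")
        case True
        then show ?thesis using \<open>x \<in> V \<and> y \<in> V\<close> by (simp add: near_kernel_def)
      next
        case False
        have "\<bar>h x - h y\<bar> \<le> 2 * B" using B[of x] B[of y] True by linarith
        then have "(h x - h y)\<^sup>2 \<le> (2 * B)\<^sup>2" using power_mono[of "\<bar>h x - h y\<bar>" "2*B" 2] by simp
        then have "(h x - h y)\<^sup>2 / norm (x - y) ^ 3 \<le> (2 * B)\<^sup>2 / \<delta> ^ 3"
          using False d by (intro frac_le) (auto intro: power_mono)
        then have "ennreal ((h x - h y)\<^sup>2 / norm (x - y) ^ 3) \<le> ?c" by (rule ennreal_leI)
        then have "ennreal ((h x - h y)\<^sup>2 / norm (x - y) ^ 3) \<le> ?K x y + ?c"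
          by (intro add_increasing) simp_all
        then show ?thesis using True by simp
      qed
    qed auto
  qed
  also have "\<dots> = (\<integral>\<^sup>+x. \<integral>\<^sup>+y. ?K x y \<partial>lborel \<partial>lborel) + ?c * emeasure lborel V * emeasure lborel V"
  proof -
    have L: "(\<lambda>p. ?c * (indicator V (fst p) * indicator V (snd p))) \<in> borel_measurable (lborel \<Otimes>\<^sub>M lborel)"
      by measurable
    have L': "(\<lambda>p. indicator V (fst p) * indicator V (snd p) :: ennreal) \<in> borel_measurable (lborel \<Otimes>\<^sub>M lborel)"
      by measurable
    show ?thesis
      by (subst iterated_nn_integral_add[OF K L], subst iterated_nn_integral_cmult[OF L'])
         (simp add: nn_integral_cmult nn_integral_multc mult.assoc)
  qed
  also have "(\<integral>\<^sup>+x. \<integral>\<^sup>+y. ?K x y \<partial>lborel \<partial>lborel) = near_energy V \<delta> h"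
    unfolding near_energy_restrict[of V \<delta> h] by (simp add: near_energy_def)
  finally show ?thesis .
qed

text \<open>Monotone convergence from above, started from a finite integral: off the diagonal the
  truncated kernels eventually vanish, and on it the increments do.\<close>

lemma near_energy_small:
  assumes V[measurable]: "V \<in> sets borel" and m: "set_borel_measurable borel V h"
    and fin: "slobodeckij_sq (1/2) V h < \<infinity>" and e: "e > (0::real)"
  obtains \<delta> where "\<delta> > 0" "near_energy V \<delta> h \<le> ennreal e"
proof -
  let ?a = "\<lambda>x. indicator V x * h x"
  have am[measurable]: "?a \<in> borel_measurable borel"
    using m by (auto simp: set_borel_measurable_def)
  define f where "f n p = ennreal (near_kernel V (1 / real (Suc n)) (fst p) (snd p) * (?a (fst p) - ?a (snd p))\<^sup>2)" for n p
  have fm[measurable]: "f n \<in> borel_measurable (lborel \<Otimes>\<^sub>M lborel)" for n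
    unfolding f_def by measurable
  have fe: "(\<integral>\<^sup>+p. f n p \<partial>(lborel \<Otimes>\<^sub>M lborel)) = near_energy V (1 / real (Suc n)) h" for n
    unfolding near_energy_restrict[of V _ h] f_def near_energy_pair[OF V am] ..
  have "(\<integral>\<^sup>+p. (INF n. f n p) \<partial>(lborel \<Otimes>\<^sub>M lborel)) = (INF n. \<integral>\<^sup>+p. f n p \<partial>(lborel \<Otimes>\<^sub>M lborel))"
  proof (rule nn_integral_monotone_convergence_INF_decseq)
    show "decseq f"
    proof (intro antimonoI le_funI)
      fix m n :: nat and p :: "(real^2) \<times> (real^2)" assume "m \<le> n"
      then have "1 / real (Suc n) \<le> 1 / real (Suc m)" by (intro divide_left_mono) auto
      then show "f n p \<le> f m p" unfolding f_def
        by (intro ennreal_leI mult_right_mono near_kernel_mono) auto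
    qed
    show "(\<integral>\<^sup>+p. f 0 p \<partial>(lborel \<Otimes>\<^sub>M lborel)) < \<infinity>"
      unfolding fe using near_energy_le_slobodeckij fin le_less_trans by blast
  qed simp
  moreover have "(INF n. f n p) = 0" for p
  proof (cases "fst p = snd p")
    case True
    then show ?thesis by (simp add: f_def)
  next
    case False
    then have "norm (fst p - snd p) > 0" by simp
    then obtain n where n: "1 / real (Suc n) < norm (fst p - snd p)" by (metis nat_approx_posE)
    then have "f n p = 0" by (simp add: f_def near_kernel_def)
    then show ?thesis by (metis INF_lower UNIV_I le_zero_eq)
  qed
  ultimately have "(INF n. near_energy V (1 / real (Suc n)) h) < ennreal e" using e by (simp add: fe)
  then obtain n where "near_energy V (1 / real (Suc n)) h < ennreal e" unfolding INF_less_iff by blast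
  then show thesis by (intro that[of "1 / real (Suc n)"]) auto
qed

lemma osc_nn_integral:
  assumes "L12 h"
  shows "ennreal (osc \<epsilon> h x) = (\<integral>\<^sup>+y. ennreal (indicator {..<\<epsilon>} (norm (x - y)) * (h x - h y)\<^sup>2) \<partial>lborel)"
proof -
  have "ennreal (osc \<epsilon> h x) = (\<integral>\<^sup>+y. ennreal (indicator (ball x \<epsilon>) y *\<^sub>R (h y - h x)\<^sup>2) \<partial>lborel)"
    unfolding osc_def sq_dev_def set_lebesgue_integral_def
    using L12_set_integrable(2)[OF assms, of x \<epsilon> "h x"] unfolding set_integrable_def
    by (intro nn_integral_eq_integral[symmetric]) auto
  also have "\<dots> = (\<integral>\<^sup>+y. ennreal (indicator {..<\<epsilon>} (norm (x - y)) * (h x - h y)\<^sup>2) \<partial>lborel)"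
    by (intro nn_integral_cong) (auto simp: indicator_def dist_norm power2_commute)
  finally show ?thesis .
qed

lemma osc_measurable [measurable]:
  assumes [measurable]: "h \<in> borel_measurable borel"
  shows "osc \<epsilon> h \<in> borel_measurable borel"
proof -
  have "(\<lambda>p. indicator {..<\<epsilon>} (norm (fst p - snd p)) * (h (snd p) - h (fst p))\<^sup>2) \<in> borel_measurable (lborel \<Otimes>\<^sub>M lborel)"
    by measurable
  then have [measurable]: "(\<lambda>(x,y). indicator {..<\<epsilon>} (norm (x - y)) * (h y - h x)\<^sup>2) \<in> borel_measurable (lborel \<Otimes>\<^sub>M lborel)"
    by (simp add: case_prod_beta)
  have "(\<lambda>x. LINT y|lborel. indicator {..<\<epsilon>} (norm (x - y)) * (h y - h x)\<^sup>2) \<in> borel_measurable lborel"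
    by measurable
  moreover have "osc \<epsilon> h = (\<lambda>x. LINT y|lborel. indicator {..<\<epsilon>} (norm (x - y)) * (h y - h x)\<^sup>2)"
    unfolding osc_def[abs_def] sq_dev_def set_lebesgue_integral_def
    by (intro ext Bochner_Integration.integral_cong) (auto simp: indicator_def dist_norm)
  ultimately show ?thesis by simp
qed

text \<open>If r < t / 2^n, a geometric sum bounds everything by 2 * 8^n, and 8^n = (2^n)^3 is at
  most (t/r)^3. The induction hypothesis serves only when the new term is 0.\<close>

lemma sum_dyadic_le:
  assumes r: "r > 0" and t: "t > 0"
  shows "(\<Sum>j<n. indicator {..<t / 2 ^ j} r * (8::real) ^ j) \<le> 2 * (t / r) ^ 3 * indicator {..<t} r"
proof (induction n)
  case (Suc n)
  show ?case
  proof (cases "r < t / 2 ^ n")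
    case True
    have "(\<Sum>j<Suc n. indicator {..<t / 2 ^ j} r * (8::real) ^ j) \<le> (\<Sum>j<Suc n. 8 ^ j)"
      by (intro sum_mono) (auto simp: indicator_def)
    also have "\<dots> \<le> 2 * 8 ^ n"
    proof -
      have "(\<Sum>j<m. 8 ^ j) \<le> (8::real) ^ m" for m
      proof (induction m)
        case (Suc m)
        have "0 \<le> (8::real) ^ m" by simp
        then show ?case using Suc unfolding sum.lessThan_Suc power_Suc by linarith
      qed simp
      from this[of n] show ?thesis by simp
    qed
    also have "(8::real) ^ n = (2 ^ n) ^ 3" 
    proof -
      have "((2::real) ^ n) ^ 3 = (2 ^ 3) ^ n" by (simp only: power_mult[symmetric] mult.commute)
      then show ?thesis by simp
    qed
    also have "2 ^ n \<le> t / r" using True r by (simp add: field_simps)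
    then have "2 * ((2::real) ^ n) ^ 3 \<le> 2 * (t / r) ^ 3" by (intro mult_left_mono power_mono) auto
    also have "t / 2 ^ n \<le> t" using t by (simp add: divide_le_eq)
    then have "2 * (t / r) ^ 3 = 2 * (t / r) ^ 3 * indicator {..<t} r" using True by simp
    finally show ?thesis .
  qed (use Suc in simp)
qed (use r t in simp)

text \<open>The dyadic scales sum up to the singular kernel: this is where the exponent
  \<open>3 = 2 + 2 * (1/2)\<close> enters.\<close>

lemma sum_osc_le_near_energy:
  assumes h: "L12 h" and A: "A \<in> sets borel" "A \<subseteq> V" and V: "V \<in> sets borel"
    and sub: "\<And>x. x \<in> A \<Longrightarrow> ball x t \<subseteq> V" and t: "t > 0"
  shows "(\<Sum>j<n. \<integral>\<^sup>+x\<in>A. ennreal (osc (t / 2 ^ j) h x / (t / 2 ^ j) ^ 3) \<partial>lborel) \<le> 2 * near_energy V t h"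
proof -
  have hm[measurable]: "h \<in> borel_measurable borel" using h by (auto simp: L12_def)
  note A(1)[measurable]
  let ?s = "\<lambda>j. t / 2 ^ j :: real"
  have s: "?s j > 0" for j using t by simp
  have m: "(\<lambda>y. indicator {..<c} (norm (x - y)) * (h x - h y)\<^sup>2 * d) \<in> borel_measurable lborel" for c d x
    by measurable
  have 1: "(\<Sum>j<n. ennreal (osc (?s j) h x / (?s j) ^ 3) * indicator A x) \<le>
     (\<integral>\<^sup>+y. 2 * ennreal (near_kernel V t x y * (h x - h y)\<^sup>2) \<partial>lborel)" for x
  proof (cases "x \<in> A")
    case True
    have "(\<Sum>j<n. ennreal (osc (?s j) h x / (?s j) ^ 3) * indicator A x) =
      (\<Sum>j<n. ennreal (1 / (?s j) ^ 3) * (\<integral>\<^sup>+y. ennreal (indicator {..<?s j} (norm (x - y)) * (h x - h y)\<^sup>2) \<partial>lborel))"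
    proof (rule sum.cong)
      fix j
      have "ennreal (osc (?s j) h x / (?s j) ^ 3) = ennreal (1 / (?s j) ^ 3 * osc (?s j) h x)" by simp
      also have "\<dots> = ennreal (1 / (?s j) ^ 3) * ennreal (osc (?s j) h x)"
        using s[of j] by (intro ennreal_mult osc_nonneg) auto
      finally show "ennreal (osc (?s j) h x / (?s j) ^ 3) * indicator A x = ennreal (1 / (?s j) ^ 3) *
         (\<integral>\<^sup>+y. ennreal (indicator {..<?s j} (norm (x - y)) * (h x - h y)\<^sup>2) \<partial>lborel)"
        using True by (simp only: osc_nn_integral[OF h]) simp
    qed simp
    also have "\<dots> = (\<Sum>j<n. \<integral>\<^sup>+y. ennreal (indicator {..<?s j} (norm (x - y)) * (h x - h y)\<^sup>2 * (1 / (?s j) ^ 3)) \<partial>lborel)"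
    proof (intro sum.cong refl)
      fix j
      have "(\<lambda>y. ennreal (indicator {..<?s j} (norm (x - y)) * (h x - h y)\<^sup>2)) \<in> borel_measurable lborel"
        by measurable
      moreover have "ennreal (F * (1 / (?s j) ^ 3)) = ennreal (1 / (?s j) ^ 3) * ennreal F" if "F \<ge> 0" for F
        using ennreal_mult[of "1 / (?s j) ^ 3" F] that s[of j] by (simp add: mult.commute)
      ultimately show "ennreal (1 / (?s j) ^ 3) * (\<integral>\<^sup>+y. ennreal (indicator {..<?s j} (norm (x - y)) * (h x - h y)\<^sup>2) \<partial>lborel)
        = (\<integral>\<^sup>+y. ennreal (indicator {..<?s j} (norm (x - y)) * (h x - h y)\<^sup>2 * (1 / (?s j) ^ 3)) \<partial>lborel)"
        by (simp only: nn_integral_cmult indicator_pos_le zero_le_power2 mult_nonneg_nonneg)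
    qed
    also have "\<dots> = (\<integral>\<^sup>+y. (\<Sum>j<n. ennreal (indicator {..<?s j} (norm (x - y)) * (h x - h y)\<^sup>2 * (1 / (?s j) ^ 3))) \<partial>lborel)"
      using m by (subst nn_integral_sum) auto
    also have "\<dots> \<le> (\<integral>\<^sup>+y. 2 * ennreal (near_kernel V t x y * (h x - h y)\<^sup>2) \<partial>lborel)"
    proof (intro nn_integral_mono)
      fix y
      have k: "(1 / (?s j) ^ 3) = 8 ^ j / t ^ 3" for j
      proof -
        have "((2::real) ^ j) ^ 3 = (2 ^ 3) ^ j" by (simp only: power_mult[symmetric] mult.commute)
        then show ?thesis by (simp add: power_divide)
      qed
      have "(\<Sum>j<n. indicator {..<?s j} (norm (x - y)) * (h x - h y)\<^sup>2 * (1 / (?s j) ^ 3))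
        = (\<Sum>j<n. indicator {..<?s j} (norm (x - y)) * 8 ^ j) * ((h x - h y)\<^sup>2 / t ^ 3)"
        unfolding k sum_distrib_right by (intro sum.cong refl) simp
      also have "\<dots> \<le> 2 * (near_kernel V t x y * (h x - h y)\<^sup>2)"
      proof (cases "x = y")
        case False
        then have "norm (x - y) > 0" by simp
        from mult_right_mono[OF sum_dyadic_le[OF this t], of "(h x - h y)\<^sup>2 / t ^ 3" n]
        have "(\<Sum>j<n. indicator {..<?s j} (norm (x - y)) * 8 ^ j) * ((h x - h y)\<^sup>2 / t ^ 3)
          \<le> 2 * (t / norm (x - y)) ^ 3 * indicator {..<t} (norm (x - y)) * ((h x - h y)\<^sup>2 / t ^ 3)"
          using t by simp
        also have "\<dots> = 2 * (indicator {..<t} (norm (x - y)) / norm (x - y) ^ 3 * (h x - h y)\<^sup>2)"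
          using t by (simp add: power_divide field_simps)
        also have "indicator {..<t} (norm (x - y)) / norm (x - y) ^ 3 = near_kernel V t x y"
          using True A sub[OF True] by (auto simp: near_kernel_def indicator_def dist_norm)
        finally show ?thesis .
      qed simp
      finally have *: "(\<Sum>j<n. indicator {..<?s j} (norm (x - y)) * (h x - h y)\<^sup>2 * (1 / (?s j) ^ 3)) \<le> 2 * (near_kernel V t x y * (h x - h y)\<^sup>2)" .
      have "(\<Sum>j<n. ennreal (indicator {..<?s j} (norm (x - y)) * (h x - h y)\<^sup>2 * (1 / (?s j) ^ 3)))
        = ennreal (\<Sum>j<n. indicator {..<?s j} (norm (x - y)) * (h x - h y)\<^sup>2 * (1 / (?s j) ^ 3))"
        using s by (subst sum_ennreal) (auto simp: less_imp_le)
      also have "\<dots> \<le> ennreal (2 * (near_kernel V t x y * (h x - h y)\<^sup>2))" by (rule ennreal_leI[OF *])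
      also have "\<dots> = 2 * ennreal (near_kernel V t x y * (h x - h y)\<^sup>2)" by (simp add: ennreal_mult' near_kernel_nonneg)
      finally show "(\<Sum>j<n. ennreal (indicator {..<?s j} (norm (x - y)) * (h x - h y)\<^sup>2 * (1 / (?s j) ^ 3)))
         \<le> 2 * ennreal (near_kernel V t x y * (h x - h y)\<^sup>2)" .
    qed
    finally show ?thesis .
  qed simp
  have [measurable]: "osc (?s j) h \<in> borel_measurable lborel" for j by simp
  have "(\<Sum>j<n. \<integral>\<^sup>+x\<in>A. ennreal (osc (?s j) h x / (?s j) ^ 3) \<partial>lborel)
     = (\<integral>\<^sup>+x. (\<Sum>j<n. ennreal (osc (?s j) h x / (?s j) ^ 3) * indicator A x) \<partial>lborel)"
    by (subst nn_integral_sum) auto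
  also have "\<dots> \<le> (\<integral>\<^sup>+x. \<integral>\<^sup>+y. 2 * ennreal (near_kernel V t x y * (h x - h y)\<^sup>2) \<partial>lborel \<partial>lborel)"
    by (intro nn_integral_mono 1)
  also have "\<dots> = 2 * near_energy V t h"
  proof -
    show ?thesis unfolding near_energy_def
      by (rule iterated_nn_integral_cmult[OF near_integrand_measurable[OF V hm]])
  qed
  finally show ?thesis .
qed

lemma osc_le_near_energy:
  assumes "L12 h" "A \<in> sets borel" "A \<subseteq> V" "V \<in> sets borel" "\<And>x. x \<in> A \<Longrightarrow> ball x t \<subseteq> V" "t > 0"
  shows "(\<integral>\<^sup>+x\<in>A. ennreal (osc t h x / t ^ 3) \<partial>lborel) \<le> 2 * near_energy V t h"
  using sum_osc_le_near_energy[OF assms, of 1] by simp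

lemma sum_squares_le: "(p + q)\<^sup>2 \<le> 2 * p\<^sup>2 + 2 * (q::real)\<^sup>2"
  using zero_le_power2[of "p - q"] by (simp add: power2_diff power2_sum)


section \<open>Near-diagonal energy under mollification and change of variables\<close>

lemma nn_integral_lborel_translate:
  fixes f :: "'a::euclidean_space \<Rightarrow> ennreal"
  assumes [measurable]: "f \<in> borel_measurable borel"
  shows "(\<integral>\<^sup>+x. f (x - z) \<partial>lborel) = (\<integral>\<^sup>+x. f x \<partial>lborel)"
proof -
  have "(\<integral>\<^sup>+x. f x \<partial>lborel) = (\<integral>\<^sup>+x. f x \<partial>distr lborel borel ((+) (- z)))"
    by (simp add: lborel_distr_plus)
  also have "\<dots> = (\<integral>\<^sup>+x. f (x - z) \<partial>lborel)"
    by (subst nn_integral_distr) auto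
  finally show ?thesis by simp
qed

text \<open>The variance of \<open>F\<close> under the probability density \<open>\<rho>\<close> is
  nonnegative.\<close>

lemma integral_Jensen_square:
  fixes \<rho> F :: "'a \<Rightarrow> real"
  assumes "integrable M \<rho>" "(LINT z|M. \<rho> z) = 1" "\<And>z. \<rho> z \<ge> 0"
    and "integrable M (\<lambda>z. \<rho> z * F z)" "integrable M (\<lambda>z. \<rho> z * (F z)\<^sup>2)"
  shows "(LINT z|M. \<rho> z * F z)\<^sup>2 \<le> (LINT z|M. \<rho> z * (F z)\<^sup>2)"
proof -
  define c where "c = (LINT z|M. \<rho> z * F z)"
  have "0 \<le> (LINT z|M. \<rho> z * (F z - c)\<^sup>2)"
    using assms(3) by (intro integral_nonneg_AE) auto
  also have "\<dots> = (LINT z|M. \<rho> z * (F z)\<^sup>2 - 2 * c * (\<rho> z * F z) + c\<^sup>2 * \<rho> z)"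
    by (simp add: power2_diff algebra_simps)
  also have "\<dots> = (LINT z|M. \<rho> z * (F z)\<^sup>2) - 2 * c * c + c\<^sup>2"
    using assms by (simp add: c_def)
  finally show ?thesis unfolding c_def[symmetric] by (simp add: power2_eq_square)
qed

lemma moll_eq_translate: "moll \<epsilon> h x = (LINT z|lborel. mollifier \<epsilon> z * h (x - z))"
  unfolding conv_def using lborel_integral_reflect[of "\<lambda>z. mollifier \<epsilon> z * h (x - z)" x] by simp

lemma moll_diff_Jensen:
  assumes h: "L12 h" and e: "\<epsilon> > 0"
  shows "ennreal ((moll \<epsilon> h x - moll \<epsilon> h y)\<^sup>2) \<le> (\<integral>\<^sup>+z. ennreal (mollifier \<epsilon> z * (h (x - z) - h (y - z))\<^sup>2) \<partial>lborel)"
proof -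
  have [measurable]: "mollifier \<epsilon> \<in> borel_measurable borel" "h \<in> borel_measurable borel"
    using mollifier_continuous(1) borel_measurable_continuous_onI h by (auto simp: L12_def)
  have hi: "integrable lborel (\<lambda>z. h (x - z))" "integrable lborel (\<lambda>z. (h (x - z))\<^sup>2)" for x
    using h lborel_integrable_reflect[of h x] lborel_integrable_reflect[of "\<lambda>z. (h z)\<^sup>2" x] by (auto simp: L12_def)
  have mb: "\<bar>mollifier \<epsilon> z * F\<bar> \<le> \<bar>mollifier_const / \<epsilon>\<^sup>2 * F\<bar>" for z F
  proof -
    have "\<bar>mollifier \<epsilon> z\<bar> \<le> \<bar>mollifier_const / \<epsilon>\<^sup>2\<bar>" using mollifier_bounds(1)[OF e, of z] by linarith
    then show ?thesis unfolding abs_mult by (intro mult_right_mono) auto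
  qed
  have b: "integrable lborel (\<lambda>z. mollifier \<epsilon> z * F z)" if "integrable lborel F" for F
  proof (rule Bochner_Integration.integrable_bound[of _ "\<lambda>z. mollifier_const / \<epsilon>\<^sup>2 * F z"])
    show "integrable lborel (\<lambda>z. mollifier_const / \<epsilon>\<^sup>2 * F z)" using that by (rule integrable_mult_right)
    show "(\<lambda>z. mollifier \<epsilon> z * F z) \<in> borel_measurable lborel" using that by measurable
    show "AE z in lborel. norm (mollifier \<epsilon> z * F z) \<le> norm (mollifier_const / \<epsilon>\<^sup>2 * F z)" using mb by simp
  qed
  let ?F = "\<lambda>z. h (x - z) - h (y - z)"
  have F1: "integrable lborel ?F" using hi by simp
  have F2: "integrable lborel (\<lambda>z. (?F z)\<^sup>2)"
  proof (rule Bochner_Integration.integrable_bound[of _ "\<lambda>z. 2 * (h (x - z))\<^sup>2 + 2 * (h (y - z))\<^sup>2"])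
    show "AE z in lborel. norm ((?F z)\<^sup>2) \<le> norm (2 * (h (x - z))\<^sup>2 + 2 * (h (y - z))\<^sup>2)"
    proof (rule AE_I2)
      fix z
      show "norm ((?F z)\<^sup>2) \<le> norm (2 * (h (x - z))\<^sup>2 + 2 * (h (y - z))\<^sup>2)"
        using sum_squares_le[of "h (x - z)" "- h (y - z)"] by simp
    qed
  qed (use hi in auto)
  have mi: "integrable lborel (mollifier \<epsilon>)"
    using integrable_compact_support[OF mollifier_continuous(1), of \<epsilon> \<epsilon>] mollifier_outside[OF e] by simp
  have "moll \<epsilon> h x - moll \<epsilon> h y = (LINT z|lborel. mollifier \<epsilon> z * ?F z)"
    unfolding moll_eq_translate using b[OF hi(1)[of x]] b[OF hi(1)[of y]] by (simp add: right_diff_distrib)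
  then have "(moll \<epsilon> h x - moll \<epsilon> h y)\<^sup>2 \<le> (LINT z|lborel. mollifier \<epsilon> z * (?F z)\<^sup>2)"
    using integral_Jensen_square[OF mi integral_mollifier[OF e] mollifier_nonneg[OF e] b[OF F1] b[OF F2]] by simp
  also have "ennreal \<dots> = (\<integral>\<^sup>+z. ennreal (mollifier \<epsilon> z * (?F z)\<^sup>2) \<partial>lborel)"
    by (rule nn_integral_eq_integral[symmetric, OF b[OF F2]]) (simp add: mollifier_nonneg[OF e])
  finally show ?thesis by (simp add: ennreal_leI)
qed

text \<open>By Jensen the increment of the mollification is an average of increments of translates.
  The singular kernel depends on x - y alone, so translating both points by the same vector only
  moves the set; since the mollifier has total mass 1, no constant is lost.\<close>

lemma near_energy_moll:
  assumes h: "L12 h" and e: "\<epsilon> > 0" and V[measurable]: "V \<in> sets borel" and V'[measurable]: "V' \<in> sets borel"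
    and sub: "\<And>x. x \<in> V \<Longrightarrow> ball x \<epsilon> \<subseteq> V'"
  shows "near_energy V \<delta> (moll \<epsilon> h) \<le> near_energy V' \<delta> h"
proof -
  have [measurable]: "mollifier \<epsilon> \<in> borel_measurable borel" and hm[measurable]: "h \<in> borel_measurable borel"
    using mollifier_continuous(1) borel_measurable_continuous_onI h by (auto simp: L12_def)
  let ?\<rho> = "mollifier \<epsilon>"
  let ?N = "\<lambda>x y. ennreal (near_kernel V' \<delta> x y * (h x - h y)\<^sup>2)"
  let ?G = "\<lambda>x y z. ennreal (near_kernel V \<delta> x y) * ennreal (?\<rho> z * (h (x - z) - h (y - z))\<^sup>2)"
  have Np: "(\<lambda>p. ?N (fst p) (snd p)) \<in> borel_measurable (lborel \<Otimes>\<^sub>M lborel)"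
    by (rule near_integrand_measurable[OF V' hm])
  then have Nm[measurable]: "(\<lambda>(x,y). ?N x y) \<in> borel_measurable (lborel \<Otimes>\<^sub>M lborel)"
    by (simp add: case_prod_beta)
  have k3: "(\<lambda>q. near_kernel V \<delta> (fst (fst q)) (snd q)) \<in> borel_measurable ((lborel \<Otimes>\<^sub>M lborel) \<Otimes>\<^sub>M lborel)"
    "(\<lambda>q. near_kernel V \<delta> (fst (fst q)) (snd (fst q))) \<in> borel_measurable ((lborel \<Otimes>\<^sub>M lborel) \<Otimes>\<^sub>M lborel)"
    unfolding near_kernel_def by measurable
  have Gxz: "(\<lambda>q. ?G (fst (fst q)) (snd q) (snd (fst q))) \<in> borel_measurable ((lborel \<Otimes>\<^sub>M lborel) \<Otimes>\<^sub>M lborel)"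
    using k3 by measurable
  have "near_energy V \<delta> (moll \<epsilon> h) \<le> (\<integral>\<^sup>+x. \<integral>\<^sup>+y. \<integral>\<^sup>+z. ?G x y z \<partial>lborel \<partial>lborel \<partial>lborel)"
    unfolding near_energy_def
  proof (intro nn_integral_mono)
    fix x y
    have "ennreal (near_kernel V \<delta> x y * (moll \<epsilon> h x - moll \<epsilon> h y)\<^sup>2)
      \<le> ennreal (near_kernel V \<delta> x y) * (\<integral>\<^sup>+z. ennreal (?\<rho> z * (h (x - z) - h (y - z))\<^sup>2) \<partial>lborel)"
      using moll_diff_Jensen[OF h e, of x y] by (simp add: ennreal_mult near_kernel_nonneg mult_left_mono)
    then show "ennreal (near_kernel V \<delta> x y * (moll \<epsilon> h x - moll \<epsilon> h y)\<^sup>2) \<le> (\<integral>\<^sup>+z. ?G x y z \<partial>lborel)"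
      by (subst nn_integral_cmult) auto
  qed
  \<comment> \<open>Tonelli, in two exchanges, moves the translation vector \<open>z\<close>
    outermost, so that for fixed \<open>z\<close> both points can be shifted.\<close>
  also have "\<dots> = (\<integral>\<^sup>+x. \<integral>\<^sup>+z. \<integral>\<^sup>+y. ?G x y z \<partial>lborel \<partial>lborel \<partial>lborel)"
  proof (rule nn_integral_cong)
    fix x :: "real^2"
    have "(\<lambda>q. ?G x (fst q) (snd q)) \<in> borel_measurable (lborel \<Otimes>\<^sub>M lborel)"
    proof -
      have "(\<lambda>q. near_kernel V \<delta> x (fst q)) \<in> borel_measurable (lborel \<Otimes>\<^sub>M lborel)"
        unfolding near_kernel_def by measurable
      then show ?thesis by measurable
    qed
    then have "(\<lambda>(y,z). ?G x y z) \<in> borel_measurable (lborel \<Otimes>\<^sub>M lborel)" by (simp add: case_prod_beta)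
    from lborel_pair.Fubini'[OF this]
    show "(\<integral>\<^sup>+y. \<integral>\<^sup>+z. ?G x y z \<partial>lborel \<partial>lborel) = (\<integral>\<^sup>+z. \<integral>\<^sup>+y. ?G x y z \<partial>lborel \<partial>lborel)" by simp
  qed
  also have "\<dots> = (\<integral>\<^sup>+z. \<integral>\<^sup>+x. \<integral>\<^sup>+y. ?G x y z \<partial>lborel \<partial>lborel \<partial>lborel)"
  proof -
    have "(\<lambda>p. \<integral>\<^sup>+y. ?G (fst p) y (snd p) \<partial>lborel) \<in> borel_measurable (lborel \<Otimes>\<^sub>M lborel)"
      by (rule lborel.borel_measurable_nn_integral) (use Gxz in \<open>simp add: case_prod_beta\<close>)
    then have "(\<lambda>(x,z). \<integral>\<^sup>+y. ?G x y z \<partial>lborel) \<in> borel_measurable (lborel \<Otimes>\<^sub>M lborel)"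
      by (simp add: case_prod_beta)
    from lborel_pair.Fubini'[OF this] show ?thesis by simp
  qed
  also have "\<dots> \<le> (\<integral>\<^sup>+z. ennreal (?\<rho> z) * near_energy V' \<delta> h \<partial>lborel)"
  proof (intro nn_integral_mono)
    fix z :: "real^2"
    show "(\<integral>\<^sup>+x. \<integral>\<^sup>+y. ?G x y z \<partial>lborel \<partial>lborel) \<le> ennreal (?\<rho> z) * near_energy V' \<delta> h"
    proof (cases "norm z < \<epsilon>")
      case True
      have "(\<integral>\<^sup>+x. \<integral>\<^sup>+y. ?G x y z \<partial>lborel \<partial>lborel) \<le> (\<integral>\<^sup>+x. \<integral>\<^sup>+y. ennreal (?\<rho> z) * ?N (x - z) (y - z) \<partial>lborel \<partial>lborel)"
      proof (intro nn_integral_mono)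
        fix x y
        have "near_kernel V \<delta> x y \<le> near_kernel V' \<delta> (x - z) (y - z)"
        proof (cases "x \<in> V \<and> y \<in> V")
          case t: True
          have "x - z \<in> ball x \<epsilon>" "y - z \<in> ball y \<epsilon>" using True by (auto simp: dist_norm)
          then have "x - z \<in> V'" "y - z \<in> V'" using sub t by blast+
          then show ?thesis using t by (simp add: near_kernel_def)
        qed (auto simp: near_kernel_def)
        then have "near_kernel V \<delta> x y * (?\<rho> z * (h (x - z) - h (y - z))\<^sup>2) \<le> near_kernel V' \<delta> (x - z) (y - z) * (?\<rho> z * (h (x - z) - h (y - z))\<^sup>2)"
          using mollifier_nonneg[OF e] by (intro mult_right_mono) auto
        then show "?G x y z \<le> ennreal (?\<rho> z) * ?N (x - z) (y - z)"
          using mollifier_nonneg[OF e] by (simp flip: ennreal_mult add: near_kernel_nonneg ac_simps)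
      qed
      also have "\<dots> = ennreal (?\<rho> z) * (\<integral>\<^sup>+x. \<integral>\<^sup>+y. ?N (x - z) (y - z) \<partial>lborel \<partial>lborel)"
      proof (rule iterated_nn_integral_cmult)
        show "(\<lambda>p. ?N (fst p - z) (snd p - z)) \<in> borel_measurable (lborel \<Otimes>\<^sub>M lborel)"
          by (rule measurable_compose[OF _ Np, of "\<lambda>p. (fst p - z, snd p - z)", simplified]) measurable
      qed
      also have "(\<integral>\<^sup>+x. \<integral>\<^sup>+y. ?N (x - z) (y - z) \<partial>lborel \<partial>lborel) = (\<integral>\<^sup>+x. \<integral>\<^sup>+y. ?N (x - z) y \<partial>lborel \<partial>lborel)"
      proof (rule nn_integral_cong, rule nn_integral_lborel_translate)
        fix x :: "real^2"
        show "?N (x - z) \<in> borel_measurable borel"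
          using measurable_compose[OF measurable_Pair1'[of "x - z" lborel lborel] Nm] by simp
      qed
      also have "\<dots> = near_energy V' \<delta> h"
        unfolding near_energy_def
      proof (rule nn_integral_lborel_translate)
        show "(\<lambda>x. \<integral>\<^sup>+y. ?N x y \<partial>lborel) \<in> borel_measurable borel"
          using lborel.borel_measurable_nn_integral[OF Nm] by simp
      qed
      finally show ?thesis .
    qed (use e in \<open>simp add: mollifier_outside\<close>)
  qed
  also have "\<dots> = (\<integral>\<^sup>+z. ennreal (?\<rho> z) \<partial>lborel) * near_energy V' \<delta> h"
    by (rule nn_integral_multc) measurable
  also have "(\<integral>\<^sup>+z. ennreal (?\<rho> z) \<partial>lborel) = ennreal (LINT z|lborel. ?\<rho> z)"
  proof (rule nn_integral_eq_integral)
    show "integrable lborel ?\<rho>"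
      using integrable_compact_support[OF mollifier_continuous(1), of \<epsilon> \<epsilon>] mollifier_outside[OF e] by simp
  qed (simp add: mollifier_nonneg[OF e])
  finally show ?thesis by (simp add: integral_mollifier[OF e])
qed

text \<open>The hypothesis on sets says that the image under \<open>\<Phi>\<close> of Lebesgue
  measure on \<open>V'\<close> is at most \<open>C\<close> times Lebesgue measure on
  \<open>V\<close>; an inequality of measures passes to integrals.\<close>

lemma nn_integral_comp_le:
  fixes \<Phi> :: "real^2 \<Rightarrow> real^2" and G :: "real^2 \<Rightarrow> ennreal"
  assumes V'[measurable]: "V' \<in> sets borel" and V[measurable]: "V \<in> sets borel"
    and \<Phi>: "continuous_on V' \<Phi>" "\<Phi> ` V' \<subseteq> V" and G[measurable]: "G \<in> borel_measurable borel"
    and le: "\<And>A. A \<in> sets borel \<Longrightarrow> A \<subseteq> V \<Longrightarrow> emeasure lborel (V' \<inter> \<Phi> -` A) \<le> C * emeasure lborel A"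
  shows "(\<integral>\<^sup>+y\<in>V'. G (\<Phi> y) \<partial>lborel) \<le> C * (\<integral>\<^sup>+x\<in>V. G x \<partial>lborel)"
proof -
  let ?R = "restrict_space lborel V'"
  have Pm[measurable]: "\<Phi> \<in> borel_measurable (restrict_space borel V')"
    by (rule borel_measurable_continuous_on_restrict[OF \<Phi>(1)])
  then have Pm'[measurable]: "\<Phi> \<in> ?R \<rightarrow>\<^sub>M borel"
    by (simp cong: measurable_cong_sets)
  let ?M = "distr ?R borel \<Phi>" and ?D = "density lborel (\<lambda>x. C * indicator V x)"
  have "?M \<le> ?D"
  proof (subst le_measure)
    show "\<forall>A\<in>sets ?M. emeasure ?M A \<le> emeasure ?D A"
    proof
      fix A assume "A \<in> sets ?M"
      then have A[measurable]: "A \<in> sets borel" by simp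
      have "emeasure ?M A = emeasure ?R (\<Phi> -` A \<inter> V')"
        by (subst emeasure_distr) (auto simp: space_restrict_space)
      also have "\<dots> = emeasure lborel (V' \<inter> \<Phi> -` (A \<inter> V))"
        using \<Phi>(2) by (subst emeasure_restrict_space) (auto intro!: arg_cong[where f="emeasure lborel"])
      also have "\<dots> \<le> C * emeasure lborel (A \<inter> V)" by (rule le) auto
      also have "\<dots> = emeasure ?D A"
        by (subst emeasure_density) (auto simp: nn_integral_cmult mult.assoc indicator_inter_arith[symmetric] Int_commute)
      finally show "emeasure ?M A \<le> emeasure ?D A" .
    qed
  qed simp
  then have "nn_integral ?M G \<le> nn_integral ?D G" by (intro nn_integral_mono_measure) simp_all
  also have "nn_integral ?M G = (\<integral>\<^sup>+y\<in>V'. G (\<Phi> y) \<partial>lborel)"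
    by (subst nn_integral_distr) (auto simp: nn_integral_restrict_space)
  also have "nn_integral ?D G = C * (\<integral>\<^sup>+x\<in>V. G x \<partial>lborel)"
    by (subst nn_integral_density) (auto simp: nn_integral_cmult[symmetric] mult.assoc mult.commute[of "G _"])
  finally show ?thesis .
qed

text \<open>The Lipschitz bound turns the kernel into L^3 times the kernel at the image points, with
  range L \<delta>, and each of the two integrations costs a factor \<open>C\<close>.\<close>

lemma near_energy_comp:
  assumes V'[measurable]: "V' \<in> sets borel" and V[measurable]: "V \<in> sets borel"
    and \<Phi>: "continuous_on V' \<Phi>" "\<Phi> ` V' \<subseteq> V" and inj: "inj_on \<Phi> V'"
    and h: "set_borel_measurable borel V h"
    and le: "\<And>A. A \<in> sets borel \<Longrightarrow> A \<subseteq> V \<Longrightarrow> emeasure lborel (V' \<inter> \<Phi> -` A) \<le> C * emeasure lborel A"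
    and L: "L > 0" "\<And>x y. x \<in> V' \<Longrightarrow> y \<in> V' \<Longrightarrow> norm (x - y) < \<delta> \<Longrightarrow> norm (\<Phi> x - \<Phi> y) \<le> L * norm (x - y)"
  shows "near_energy V' \<delta> (\<lambda>y. h (\<Phi> y)) \<le> ennreal (L ^ 3) * C * C * near_energy V (L * \<delta>) h"
proof -
  let ?h = "\<lambda>x. indicator V x * h x"
  have hm[measurable]: "?h \<in> borel_measurable borel" using h by (simp add: set_borel_measurable_def)
  let ?N = "\<lambda>x y. ennreal (near_kernel V (L * \<delta>) x y * (?h x - ?h y)\<^sup>2)"
  have Np: "(\<lambda>p. ?N (fst p) (snd p)) \<in> borel_measurable (lborel \<Otimes>\<^sub>M lborel)"
    by (rule near_integrand_measurable[OF V hm])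
  then have Nm[measurable]: "(\<lambda>(x,y). ?N x y) \<in> borel_measurable (lborel \<Otimes>\<^sub>M lborel)"
    by (simp add: case_prod_beta)
  have N1: "?N x \<in> borel_measurable borel" for x
    using measurable_compose[OF measurable_Pair1'[of x lborel lborel] Nm] by simp
  have N2: "(\<lambda>x. \<integral>\<^sup>+y\<in>V. ?N x y \<partial>lborel) \<in> borel_measurable borel"
  proof -
    have "(\<lambda>(x,y). ?N x y * indicator V y) \<in> borel_measurable (lborel \<Otimes>\<^sub>M lborel)"
      unfolding case_prod_beta using Np by measurable
    then show ?thesis using lborel.borel_measurable_nn_integral by fastforce
  qed
  have "near_energy V' \<delta> (\<lambda>y. h (\<Phi> y)) \<le> (\<integral>\<^sup>+x\<in>V'. (\<integral>\<^sup>+y\<in>V'. ennreal (L ^ 3) * ?N (\<Phi> x) (\<Phi> y) \<partial>lborel) \<partial>lborel)"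
    unfolding near_energy_def
  proof (rule nn_integral_mono)
    fix x
    show "(\<integral>\<^sup>+y. ennreal (near_kernel V' \<delta> x y * (h (\<Phi> x) - h (\<Phi> y))\<^sup>2) \<partial>lborel) \<le>
      (\<integral>\<^sup>+y\<in>V'. ennreal (L ^ 3) * ?N (\<Phi> x) (\<Phi> y) \<partial>lborel) * indicator V' x"
    proof (cases "x \<in> V'")
      case x: True
      have "(\<integral>\<^sup>+y. ennreal (near_kernel V' \<delta> x y * (h (\<Phi> x) - h (\<Phi> y))\<^sup>2) \<partial>lborel) \<le>
        (\<integral>\<^sup>+y\<in>V'. ennreal (L ^ 3) * ?N (\<Phi> x) (\<Phi> y) \<partial>lborel)"
      proof (rule nn_integral_mono)
        fix y
        show "ennreal (near_kernel V' \<delta> x y * (h (\<Phi> x) - h (\<Phi> y))\<^sup>2) \<le> ennreal (L ^ 3) * ?N (\<Phi> x) (\<Phi> y) * indicator V' y"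
        proof (cases "y \<in> V' \<and> norm (x - y) < \<delta> \<and> x \<noteq> y")
          case True
          \<comment> \<open>Injectivity keeps the image points apart; otherwise the kernel there
            would be the value 0 of a division by zero and could not dominate.\<close>
          then have P: "\<Phi> x \<in> V" "\<Phi> y \<in> V" "\<Phi> x \<noteq> \<Phi> y" using \<Phi>(2) x inj by (auto dest: inj_onD)
          have n: "norm (\<Phi> x - \<Phi> y) \<le> L * norm (x - y)" using L(2) x True by blast
          have pos: "norm (\<Phi> x - \<Phi> y) > 0" "norm (x - y) > 0" using P True by auto
          have "norm (\<Phi> x - \<Phi> y) ^ 3 \<le> (L * norm (x - y)) ^ 3" by (intro power_mono n) auto
          then have "1 / norm (x - y) ^ 3 \<le> L ^ 3 / norm (\<Phi> x - \<Phi> y) ^ 3"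
            using pos L(1) by (simp add: field_simps power_mult_distrib)
          moreover have "norm (\<Phi> x - \<Phi> y) < L * \<delta>"
            using n True L(1) by (smt (verit) mult_less_cancel_left_pos)
          ultimately have "near_kernel V' \<delta> x y \<le> L ^ 3 * near_kernel V (L * \<delta>) (\<Phi> x) (\<Phi> y)"
            using x True P by (simp add: near_kernel_def)
          then have "near_kernel V' \<delta> x y * (h (\<Phi> x) - h (\<Phi> y))\<^sup>2 \<le> L ^ 3 * near_kernel V (L * \<delta>) (\<Phi> x) (\<Phi> y) * (h (\<Phi> x) - h (\<Phi> y))\<^sup>2"
            by (rule mult_right_mono) simp
          then show ?thesis using True P L(1)
            by (simp flip: ennreal_mult add: near_kernel_nonneg mult.assoc ennreal_leI)
        next
          case False
          then have "near_kernel V' \<delta> x y * (h (\<Phi> x) - h (\<Phi> y))\<^sup>2 = 0" by (auto simp: near_kernel_def)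
          then show ?thesis by (metis ennreal_0 zero_le)
        qed
      qed
      then show ?thesis using x by simp
    qed (simp add: near_kernel_def)
  qed
  also have "\<dots> \<le> (\<integral>\<^sup>+x\<in>V'. (ennreal (L ^ 3) * (C * (\<integral>\<^sup>+y\<in>V. ?N (\<Phi> x) y \<partial>lborel))) \<partial>lborel)"
  proof (intro nn_integral_mono mult_right_mono)
    fix x
    have "(\<integral>\<^sup>+y\<in>V'. ennreal (L ^ 3) * ?N (\<Phi> x) (\<Phi> y) \<partial>lborel) \<le> C * (\<integral>\<^sup>+y\<in>V. ennreal (L ^ 3) * ?N (\<Phi> x) y \<partial>lborel)"
      using N1 by (intro nn_integral_comp_le[OF V' V \<Phi> _ le]) auto
    also have "(\<integral>\<^sup>+y\<in>V. ennreal (L ^ 3) * ?N (\<Phi> x) y \<partial>lborel) = ennreal (L ^ 3) * (\<integral>\<^sup>+y\<in>V. ?N (\<Phi> x) y \<partial>lborel)"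
      using N1[of "\<Phi> x"] by (subst nn_integral_cmult[symmetric]) (auto simp: mult.assoc)
    finally show "(\<integral>\<^sup>+y\<in>V'. ennreal (L ^ 3) * ?N (\<Phi> x) (\<Phi> y) \<partial>lborel) \<le> ennreal (L ^ 3) * (C * (\<integral>\<^sup>+y\<in>V. ?N (\<Phi> x) y \<partial>lborel))"
      by (simp add: ac_simps)
  qed simp
  also have "\<dots> \<le> C * (\<integral>\<^sup>+x\<in>V. (ennreal (L ^ 3) * (C * (\<integral>\<^sup>+y\<in>V. ?N x y \<partial>lborel))) \<partial>lborel)"
    using N2 by (intro nn_integral_comp_le[OF V' V \<Phi> _ le]) auto
  also have "(\<integral>\<^sup>+x\<in>V. (ennreal (L ^ 3) * (C * (\<integral>\<^sup>+y\<in>V. ?N x y \<partial>lborel))) \<partial>lborel)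
     = ennreal (L ^ 3) * C * (\<integral>\<^sup>+x\<in>V. (\<integral>\<^sup>+y\<in>V. ?N x y \<partial>lborel) \<partial>lborel)"
    using N2 by (subst nn_integral_cmult[symmetric]) (auto simp: mult.assoc)
  also have "(\<integral>\<^sup>+x\<in>V. (\<integral>\<^sup>+y\<in>V. ?N x y \<partial>lborel) \<partial>lborel) = near_energy V (L * \<delta>) h"
    unfolding near_energy_restrict[of V _ h] near_energy_def
    by (intro nn_integral_cong) (auto simp: near_kernel_def indicator_def intro!: nn_integral_cong)
  finally show ?thesis by (simp add: ac_simps)
qed

section \<open>Uniformly convergent sequences without energy concentration\<close>

text \<open>The energies do not concentrate on the diagonal: one \<delta> serves all large
  \<open>k\<close>. For a constant sequence this follows from finiteness of the seminorm
  (\<open>tame_const\<close>).\<close>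

definition tame :: "(real^2) set \<Rightarrow> (nat \<Rightarrow> real^2 \<Rightarrow> real) \<Rightarrow> bool" where
  "tame V H \<longleftrightarrow> (\<forall>e>0. \<exists>\<delta>>0. \<forall>\<^sub>F k in sequentially. near_energy V \<delta> (H k) \<le> ennreal e)"

text \<open>Uniform convergence to a bounded limit supplies eventual uniform bounds, without which
  energies do not control products. If the constant sequence of the limit is tame as well,
  convergence in H^(1/2) follows through \<open>tends_tame_diff\<close> and
  \<open>tends_tame_null\<close>.\<close>

definition tends_tame :: "(real^2) set \<Rightarrow> (nat \<Rightarrow> real^2 \<Rightarrow> real) \<Rightarrow> (real^2 \<Rightarrow> real) \<Rightarrow> bool" where
  "tends_tame V H h \<longleftrightarrow> (\<forall>\<^sub>F k in sequentially. set_borel_measurable borel V (H k)) \<and>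
     uniform_limit V H h sequentially \<and> bounded (h ` V) \<and> tame V H"

lemma tame_comparison:
  assumes V: "V \<in> sets borel" and A: "tame V A" and B: "tame V B"
    and m: "\<forall>\<^sub>F k in sequentially. set_borel_measurable borel V (A k)"
      "\<forall>\<^sub>F k in sequentially. set_borel_measurable borel V (B k)"
    and le: "\<forall>\<^sub>F k in sequentially. \<forall>x\<in>V. \<forall>y\<in>V. (H k x - H k y)\<^sup>2 \<le> c * ((A k x - A k y)\<^sup>2 + (B k x - B k y)\<^sup>2)"
  shows "tame V H"
  unfolding tame_def
proof (intro allI impI)
  fix e :: real assume e: "e > 0"
  \<comment> \<open>The given \<open>c\<close> may be nonpositive; the maximum with 1 allows the
    division below.\<close>
  define c' where "c' = max c 1"
  have c': "c' > 0" "c \<le> c'" by (auto simp: c'_def)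
  define e' where "e' = e / (2 * c')"
  have e': "e' > 0" using e c' by (simp add: e'_def)
  obtain a where a: "a > 0" "\<forall>\<^sub>F k in sequentially. near_energy V a (A k) \<le> ennreal e'"
    using A e' unfolding tame_def by blast
  obtain b where b: "b > 0" "\<forall>\<^sub>F k in sequentially. near_energy V b (B k) \<le> ennreal e'"
    using B e' unfolding tame_def by blast
  show "\<exists>\<delta>>0. \<forall>\<^sub>F k in sequentially. near_energy V \<delta> (H k) \<le> ennreal e"
  proof (intro exI conjI)
    show "min a b > 0" using a b by simp
    show "\<forall>\<^sub>F k in sequentially. near_energy V (min a b) (H k) \<le> ennreal e"
      using a(2) b(2) m le
    proof eventually_elim
      case (elim k)
      have "near_energy V (min a b) (H k) \<le> ennreal c' * (near_energy V (min a b) (A k) + near_energy V (min a b) (B k))"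
      proof (rule near_energy_le[OF V elim(3,4)])
        fix x y assume "x \<in> V" "y \<in> V"
        then have "(H k x - H k y)\<^sup>2 \<le> c * ((A k x - A k y)\<^sup>2 + (B k x - B k y)\<^sup>2)" using elim(5) by blast
        also have "\<dots> \<le> c' * ((A k x - A k y)\<^sup>2 + (B k x - B k y)\<^sup>2)" using c' by (intro mult_right_mono) auto
        finally show "(H k x - H k y)\<^sup>2 \<le> c' * ((A k x - A k y)\<^sup>2 + (B k x - B k y)\<^sup>2)" .
      qed (use c' in simp)
      also have "\<dots> \<le> ennreal c' * (ennreal e' + ennreal e')"
        using near_energy_mono[of V V "min a b" a "A k"] near_energy_mono[of V V "min a b" b "B k"] elim(1,2)
        by (intro mult_left_mono add_mono) (auto intro: order_trans)
      also have "\<dots> = ennreal e"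
        using e' c' by (simp flip: ennreal_plus ennreal_mult add: e'_def)
      finally show ?case .
    qed
  qed
qed

lemma tends_tame_bounded:
  assumes "tends_tame V H h"
  obtains B where "B > 0" "\<And>x. x \<in> V \<Longrightarrow> \<bar>h x\<bar> \<le> B" "\<forall>\<^sub>F k in sequentially. \<forall>x\<in>V. \<bar>H k x\<bar> \<le> B"
proof -
  obtain b where b: "\<And>x. x \<in> V \<Longrightarrow> \<bar>h x\<bar> \<le> b"
    using assms unfolding tends_tame_def bounded_iff by auto
  have "\<forall>\<^sub>F k in sequentially. \<forall>x\<in>V. dist (H k x) (h x) < 1"
    using assms unfolding tends_tame_def by (intro uniform_limitD) auto
  then have "\<forall>\<^sub>F k in sequentially. \<forall>x\<in>V. \<bar>H k x\<bar> \<le> max b 0 + 1"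
  proof eventually_elim
    case (elim k)
    show ?case
    proof
      fix x assume x: "x \<in> V"
      then have "\<bar>H k x - h x\<bar> < 1" using elim by (simp add: dist_real_def)
      then show "\<bar>H k x\<bar> \<le> max b 0 + 1" using b[OF x] by linarith
    qed
  qed
  then show thesis using b by (intro that[of "max b 0 + 1"]) fastforce+
qed

lemma tends_tame_cong:
  assumes "\<forall>\<^sub>F k in sequentially. \<forall>x\<in>V. H k x = H' k x" "\<And>x. x \<in> V \<Longrightarrow> h x = h' x" "tends_tame V H h"
  shows "tends_tame V H' h'"
  unfolding tends_tame_def
proof (intro conjI)
  have s: "set_borel_measurable borel V f \<longleftrightarrow> set_borel_measurable borel V g" if "\<forall>x\<in>V. f x = g x" for f g :: "real^2 \<Rightarrow> real"
    unfolding set_borel_measurable_def using that by (intro arg_cong[where f="\<lambda>f. f \<in> _"]) (auto simp: indicator_def)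
  have "\<forall>\<^sub>F k in sequentially. set_borel_measurable borel V (H k)" using assms(3) by (simp add: tends_tame_def)
  then show "\<forall>\<^sub>F k in sequentially. set_borel_measurable borel V (H' k)"
    using assms(1) by eventually_elim (use s in blast)
  show "uniform_limit V H' h' sequentially"
    using uniform_limit_cong[OF assms(1,2)] assms(3) by (simp add: tends_tame_def)
  show "bounded (h' ` V)" using assms by (simp add: tends_tame_def cong: image_cong_simp)
  show "tame V H'"
    unfolding tame_def
  proof (intro allI impI)
    fix e :: real assume "e > 0"
    then obtain \<delta> where d: "\<delta> > 0" "\<forall>\<^sub>F k in sequentially. near_energy V \<delta> (H k) \<le> ennreal e"
      using assms(3) unfolding tends_tame_def tame_def by blast
    from d(2) assms(1) have "\<forall>\<^sub>F k in sequentially. near_energy V \<delta> (H' k) \<le> ennreal e"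
      by eventually_elim (metis near_energy_cong)
    with d(1) show "\<exists>\<delta>>0. \<forall>\<^sub>F k in sequentially. near_energy V \<delta> (H' k) \<le> ennreal e" by blast
  qed
qed

lemma tends_tame_const: "V \<in> sets borel \<Longrightarrow> tends_tame V (\<lambda>_ _. c) (\<lambda>_. c)"
  unfolding tends_tame_def tame_def set_borel_measurable_def
  by (auto simp: near_energy_def image_constant_conv intro!: exI[of _ 1] uniform_limit_const)

lemma tends_tame_add:
  assumes V: "V \<in> sets borel" and A: "tends_tame V A a" and B: "tends_tame V B b"
  shows "tends_tame V (\<lambda>k x. A k x + B k x) (\<lambda>x. a x + b x)"
  unfolding tends_tame_def
proof (intro conjI)
  have m: "\<forall>\<^sub>F k in sequentially. set_borel_measurable borel V (A k)"
    "\<forall>\<^sub>F k in sequentially. set_borel_measurable borel V (B k)" using A B by (auto simp: tends_tame_def)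
  then show "\<forall>\<^sub>F k in sequentially. set_borel_measurable borel V (\<lambda>x. A k x + B k x)"
    by eventually_elim (auto simp: set_borel_measurable_def distrib_left)
  show "uniform_limit V (\<lambda>k x. A k x + B k x) (\<lambda>x. a x + b x) sequentially"
    using A B by (intro uniform_limit_add) (auto simp: tends_tame_def)
  show "bounded ((\<lambda>x. a x + b x) ` V)"
    using A B by (intro bounded_plus_comp) (auto simp: tends_tame_def)
  show "tame V (\<lambda>k x. A k x + B k x)"
  proof (rule tame_comparison[OF V _ _ m, where c=2])
    show "\<forall>\<^sub>F k in sequentially. \<forall>x\<in>V. \<forall>y\<in>V. (A k x + B k x - (A k y + B k y))\<^sup>2 \<le> 2 * ((A k x - A k y)\<^sup>2 + (B k x - B k y)\<^sup>2)"
    proof (intro always_eventually allI ballI)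
      fix k x y
      show "(A k x + B k x - (A k y + B k y))\<^sup>2 \<le> 2 * ((A k x - A k y)\<^sup>2 + (B k x - B k y)\<^sup>2)"
        using zero_le_power2[of "(A k x - A k y) - (B k x - B k y)"]
        by (simp add: power2_eq_square algebra_simps)
    qed
  qed (use A B in \<open>auto simp: tends_tame_def\<close>)
qed

lemma tends_tame_mult:
  assumes V: "V \<in> sets borel" and A: "tends_tame V A a" and B: "tends_tame V B b"
  shows "tends_tame V (\<lambda>k x. A k x * B k x) (\<lambda>x. a x * b x)"
proof -
  obtain M where M: "M > 0" "\<And>x. x \<in> V \<Longrightarrow> \<bar>a x\<bar> \<le> M" "\<forall>\<^sub>F k in sequentially. \<forall>x\<in>V. \<bar>A k x\<bar> \<le> M"
    using tends_tame_bounded[OF A] by blast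
  obtain N where N: "N > 0" "\<And>x. x \<in> V \<Longrightarrow> \<bar>b x\<bar> \<le> N" "\<forall>\<^sub>F k in sequentially. \<forall>x\<in>V. \<bar>B k x\<bar> \<le> N"
    using tends_tame_bounded[OF B] by blast
  have m: "\<forall>\<^sub>F k in sequentially. set_borel_measurable borel V (A k)"
    "\<forall>\<^sub>F k in sequentially. set_borel_measurable borel V (B k)" using A B by (auto simp: tends_tame_def)
  show ?thesis
    unfolding tends_tame_def
  proof (intro conjI)
    from m show "\<forall>\<^sub>F k in sequentially. set_borel_measurable borel V (\<lambda>x. A k x * B k x)"
    proof eventually_elim
      case (elim k)
      then have "(\<lambda>x. (indicator V x *\<^sub>R A k x) * (indicator V x *\<^sub>R B k x)) \<in> borel_measurable borel"
        unfolding set_borel_measurable_def by (rule borel_measurable_times)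
      moreover have "(\<lambda>x. (indicator V x *\<^sub>R A k x) * (indicator V x *\<^sub>R B k x)) = (\<lambda>x. indicator V x *\<^sub>R (A k x * B k x))"
        by (auto simp: indicator_def)
      ultimately show ?case by (simp add: set_borel_measurable_def)
    qed
    show "uniform_limit V (\<lambda>k x. A k x * B k x) (\<lambda>x. a x * b x) sequentially"
      using A B by (intro uniform_lim_mult) (auto simp: tends_tame_def)
    show "bounded ((\<lambda>x. a x * b x) ` V)"
      using M N by (intro boundedI[where B="M*N"]) (auto simp: abs_mult intro!: mult_mono)
    show "tame V (\<lambda>k x. A k x * B k x)"
    proof (rule tame_comparison[OF V _ _ m, where c="2 * (M\<^sup>2 + N\<^sup>2)"])
      show "\<forall>\<^sub>F k in sequentially. \<forall>x\<in>V. \<forall>y\<in>V. (A k x * B k x - A k y * B k y)\<^sup>2 \<le> 2 * (M\<^sup>2 + N\<^sup>2) * ((A k x - A k y)\<^sup>2 + (B k x - B k y)\<^sup>2)"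
        using M(3) N(3)
      proof eventually_elim
        case (elim k)
        show ?case
        proof (intro ballI)
          fix x y assume "x \<in> V" "y \<in> V"
          then have "(A k y)\<^sup>2 \<le> M\<^sup>2" "(B k x)\<^sup>2 \<le> N\<^sup>2"
            using elim power_mono[of "\<bar>A k y\<bar>" M 2] power_mono[of "\<bar>B k x\<bar>" N 2] by auto
          then have *: "(A k x - A k y)\<^sup>2 * (B k x)\<^sup>2 \<le> (A k x - A k y)\<^sup>2 * N\<^sup>2"
            "(A k y)\<^sup>2 * (B k x - B k y)\<^sup>2 \<le> M\<^sup>2 * (B k x - B k y)\<^sup>2"
            by (auto intro: mult_mono)
          have "A k x * B k x - A k y * B k y = (A k x - A k y) * B k x + A k y * (B k x - B k y)"
            by (simp add: algebra_simps)
          then have "(A k x * B k x - A k y * B k y)\<^sup>2 \<le> 2 * ((A k x - A k y) * B k x)\<^sup>2 + 2 * (A k y * (B k x - B k y))\<^sup>2"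
            by (simp only: sum_squares_le)
          also have "\<dots> \<le> 2 * ((A k x - A k y)\<^sup>2 * N\<^sup>2) + 2 * (M\<^sup>2 * (B k x - B k y)\<^sup>2)"
            using * by (simp add: power_mult_distrib)
          also have "\<dots> \<le> 2 * (M\<^sup>2 + N\<^sup>2) * ((A k x - A k y)\<^sup>2 + (B k x - B k y)\<^sup>2)"
            by (simp add: algebra_simps)
          finally show "(A k x * B k x - A k y * B k y)\<^sup>2 \<le> 2 * (M\<^sup>2 + N\<^sup>2) * ((A k x - A k y)\<^sup>2 + (B k x - B k y)\<^sup>2)" .
        qed
      qed
    qed (use A B in \<open>auto simp: tends_tame_def\<close>)
  qed
qed

lemma uniform_limit_lower_bound:
  assumes "uniform_limit V A a sequentially" "c > 0" "\<And>x. x \<in> V \<Longrightarrow> c \<le> \<bar>a x :: real\<bar>"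
  shows "\<forall>\<^sub>F k in sequentially. \<forall>x\<in>V. c / 2 \<le> \<bar>A k x\<bar>"
proof -
  have "\<forall>\<^sub>F k in sequentially. \<forall>x\<in>V. dist (A k x) (a x) < c / 2"
    using assms by (intro uniform_limitD) auto
  then show ?thesis
  proof eventually_elim
    case (elim k)
    show ?case
    proof
      fix x assume x: "x \<in> V"
      then have "\<bar>A k x - a x\<bar> < c / 2" using elim by (simp add: dist_real_def)
      then show "c / 2 \<le> \<bar>A k x\<bar>" using assms(3)[OF x] by linarith
    qed
  qed
qed

lemma tends_tame_inverse:
  assumes V: "V \<in> sets borel" and A: "tends_tame V A a" and c: "c > 0" "\<And>x. x \<in> V \<Longrightarrow> c \<le> \<bar>a x\<bar>"
  shows "tends_tame V (\<lambda>k x. inverse (A k x)) (\<lambda>x. inverse (a x))"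
proof -
  have low: "\<forall>\<^sub>F k in sequentially. \<forall>x\<in>V. c / 2 \<le> \<bar>A k x\<bar>"
    using A c by (intro uniform_limit_lower_bound[where a=a]) (auto simp: tends_tame_def)
  have m: "\<forall>\<^sub>F k in sequentially. set_borel_measurable borel V (A k)" using A by (auto simp: tends_tame_def)
  show ?thesis
    unfolding tends_tame_def
  proof (intro conjI)
    from m show "\<forall>\<^sub>F k in sequentially. set_borel_measurable borel V (\<lambda>x. inverse (A k x))"
    proof eventually_elim
      case (elim k)
      then have "(\<lambda>x. inverse (indicator V x *\<^sub>R A k x)) \<in> borel_measurable borel"
        unfolding set_borel_measurable_def by (rule borel_measurable_inverse)
      moreover have "(\<lambda>x. inverse (indicator V x *\<^sub>R A k x)) = (\<lambda>x. indicator V x *\<^sub>R inverse (A k x))"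
        by (auto simp: indicator_def)
      ultimately show ?case by (simp add: set_borel_measurable_def)
    qed
    show "uniform_limit V (\<lambda>k x. inverse (A k x)) (\<lambda>x. inverse (a x)) sequentially"
      using uniform_lim_inverse[where S=V and f=A and l=a and F=sequentially and b=c] A c by (simp add: tends_tame_def o_def)
    show "bounded ((\<lambda>x. inverse (a x)) ` V)"
      using c by (intro boundedI[where B="inverse c"]) (auto simp: abs_inverse intro!: le_imp_inverse_le)
    show "tame V (\<lambda>k x. inverse (A k x))"
    \<comment> \<open>Eventually both values have modulus at least c/2, so the squared product in
      the denominator of the difference of reciprocals is at least c^4 / 16.\<close>
    proof (rule tame_comparison[OF V _ _ m m, where c="16 / c ^ 4"])
      show "\<forall>\<^sub>F k in sequentially. \<forall>x\<in>V. \<forall>y\<in>V. (inverse (A k x) - inverse (A k y))\<^sup>2 \<le> 16 / c ^ 4 * ((A k x - A k y)\<^sup>2 + (A k x - A k y)\<^sup>2)"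
        using low
      proof eventually_elim
        case (elim k)
        show ?case
        proof (intro ballI)
          fix x y assume xy: "x \<in> V" "y \<in> V"
          then have b: "c / 2 \<le> \<bar>A k x\<bar>" "c / 2 \<le> \<bar>A k y\<bar>" using elim by auto
          then have nz: "A k x \<noteq> 0" "A k y \<noteq> 0" using c(1) by auto
          have "(c/2) * (c/2) \<le> \<bar>A k x\<bar> * \<bar>A k y\<bar>" using b c(1) by (intro mult_mono) auto
          then have "((c/2) * (c/2))\<^sup>2 \<le> (\<bar>A k x\<bar> * \<bar>A k y\<bar>)\<^sup>2" using c(1) by (intro power_mono) auto
          then have "c ^ 4 / 16 \<le> (A k x * A k y)\<^sup>2" by (simp add: power_mult_distrib power_divide flip: power_add)
          then have "(A k x - A k y)\<^sup>2 / (A k x * A k y)\<^sup>2 \<le> (A k x - A k y)\<^sup>2 / (c ^ 4 / 16)"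
            using c(1) by (intro divide_left_mono) (auto intro!: mult_pos_pos simp: nz)
          moreover have "(inverse (A k x) - inverse (A k y))\<^sup>2 = (A k x - A k y)\<^sup>2 / (A k x * A k y)\<^sup>2"
          proof -
            have "inverse (A k x) - inverse (A k y) = (A k y - A k x) / (A k x * A k y)"
              using nz by (simp add: field_simps)
            then show ?thesis by (simp only: power_divide power2_commute[of "A k y"])
          qed
          ultimately have "(inverse (A k x) - inverse (A k y))\<^sup>2 \<le> 16 / c ^ 4 * (A k x - A k y)\<^sup>2"
            by (simp add: mult.commute)
          also have "\<dots> \<le> 16 / c ^ 4 * ((A k x - A k y)\<^sup>2 + (A k x - A k y)\<^sup>2)"
            using c(1) by (intro mult_left_mono) auto
          finally show "(inverse (A k x) - inverse (A k y))\<^sup>2 \<le> 16 / c ^ 4 * ((A k x - A k y)\<^sup>2 + (A k x - A k y)\<^sup>2)" .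
        qed
      qed
    qed (use A in \<open>auto simp: tends_tame_def\<close>)
  qed
qed

lemma sqrt_Lipschitz:
  assumes "1 \<le> a" "1 \<le> (b::real)" shows "\<bar>sqrt a - sqrt b\<bar> \<le> \<bar>a - b\<bar>"
proof -
  have "1 \<le> sqrt a + sqrt b" using assms real_sqrt_ge_zero[of b] real_sqrt_ge_1_iff[of a] by (simp add: add_increasing2)
  then have "\<bar>sqrt a - sqrt b\<bar> * 1 \<le> \<bar>sqrt a - sqrt b\<bar> * \<bar>sqrt a + sqrt b\<bar>" by (intro mult_left_mono) auto
  also have "\<dots> = \<bar>(sqrt a - sqrt b) * (sqrt a + sqrt b)\<bar>" by (rule abs_mult[symmetric])
  also have "(sqrt a - sqrt b) * (sqrt a + sqrt b) = a - b" using assms by (simp add: algebra_simps)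
  finally show ?thesis by simp
qed

text \<open>Above 1 the square root is Lipschitz with constant 1. The arguments met later have the
  form 1 plus squares.\<close>

lemma tends_tame_sqrt:
  assumes V: "V \<in> sets borel" and A: "tends_tame V A a" and c: "\<And>x. x \<in> V \<Longrightarrow> 1 \<le> a x"
    "\<And>k x. x \<in> V \<Longrightarrow> 1 \<le> A k x"
  shows "tends_tame V (\<lambda>k x. sqrt (A k x)) (\<lambda>x. sqrt (a x))"
proof -
  obtain M where M: "M > 0" "\<And>x. x \<in> V \<Longrightarrow> \<bar>a x\<bar> \<le> M" "\<forall>\<^sub>F k in sequentially. \<forall>x\<in>V. \<bar>A k x\<bar> \<le> M"
    using tends_tame_bounded[OF A] by blast
  have m: "\<forall>\<^sub>F k in sequentially. set_borel_measurable borel V (A k)" using A by (auto simp: tends_tame_def)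
  show ?thesis
    unfolding tends_tame_def
  proof (intro conjI)
    from m show "\<forall>\<^sub>F k in sequentially. set_borel_measurable borel V (\<lambda>x. sqrt (A k x))"
    proof eventually_elim
      case (elim k)
      then have "(\<lambda>x. sqrt (indicator V x *\<^sub>R A k x)) \<in> borel_measurable borel"
        unfolding set_borel_measurable_def by measurable
      moreover have "(\<lambda>x. sqrt (indicator V x *\<^sub>R A k x)) = (\<lambda>x. indicator V x *\<^sub>R sqrt (A k x))"
        by (auto simp: indicator_def)
      ultimately show ?case by (simp add: set_borel_measurable_def)
    qed
    show "uniform_limit V (\<lambda>k x. sqrt (A k x)) (\<lambda>x. sqrt (a x)) sequentially"
    proof (rule uniform_limitI)
      fix e :: real assume "e > 0"
      then have "\<forall>\<^sub>F k in sequentially. \<forall>x\<in>V. dist (A k x) (a x) < e"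
        using A by (intro uniform_limitD) (auto simp: tends_tame_def)
      then show "\<forall>\<^sub>F k in sequentially. \<forall>x\<in>V. dist (sqrt (A k x)) (sqrt (a x)) < e"
      proof eventually_elim
        case (elim k)
        show ?case
        proof
          fix x assume x: "x \<in> V"
          then have "\<bar>sqrt (A k x) - sqrt (a x)\<bar> \<le> \<bar>A k x - a x\<bar>" by (intro sqrt_Lipschitz c)
          also have "\<dots> < e" using elim x by (simp add: dist_real_def)
          finally show "dist (sqrt (A k x)) (sqrt (a x)) < e" by (simp add: dist_real_def)
        qed
      qed
    qed
    show "bounded ((\<lambda>x. sqrt (a x)) ` V)"
    proof (rule boundedI[where B="sqrt M"])
      fix z assume "z \<in> (\<lambda>x. sqrt (a x)) ` V"
      then obtain x where x: "x \<in> V" "z = sqrt (a x)" by blast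
      then show "norm z \<le> sqrt M" using M(2)[of x] c(1)[of x] by simp
    qed
    show "tame V (\<lambda>k x. sqrt (A k x))"
    proof (rule tame_comparison[OF V _ _ m m, where c=1])
      show "\<forall>\<^sub>F k in sequentially. \<forall>x\<in>V. \<forall>y\<in>V. (sqrt (A k x) - sqrt (A k y))\<^sup>2 \<le> 1 * ((A k x - A k y)\<^sup>2 + (A k x - A k y)\<^sup>2)"
      proof (intro always_eventually allI ballI)
        fix k x y assume "x \<in> V" "y \<in> V"
        then have "(sqrt (A k x) - sqrt (A k y))\<^sup>2 \<le> (A k x - A k y)\<^sup>2"
          using sqrt_Lipschitz[of "A k x" "A k y"] c(2) by (simp add: abs_le_square_iff[symmetric])
        also have "\<dots> \<le> 1 * ((A k x - A k y)\<^sup>2 + (A k x - A k y)\<^sup>2)" by simp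
        finally show "(sqrt (A k x) - sqrt (A k y))\<^sup>2 \<le> 1 * ((A k x - A k y)\<^sup>2 + (A k x - A k y)\<^sup>2)" .
      qed
    qed (use A in \<open>auto simp: tends_tame_def\<close>)
  qed
qed

lemma ennreal_tendsto_0I:
  fixes f :: "'a \<Rightarrow> ennreal"
  assumes "\<And>e. e > 0 \<Longrightarrow> \<forall>\<^sub>F k in F. f k \<le> ennreal e"
  shows "(f \<longlongrightarrow> 0) F"
proof (rule order_tendstoI)
  fix a :: ennreal assume "a > 0"
  then obtain e :: real where "e > 0" "ennreal e < a"
    by (metis ennreal_0 ennreal_less_iff order_refl ennreal_less_zero_iff dense ennreal_cases ennreal_less_top not_less_iff_gr_or_eq top.not_eq_extremum)
  with assms[of e] show "\<forall>\<^sub>F k in F. f k < a"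
    by (auto elim!: eventually_mono intro: le_less_trans)
qed simp

lemma ennreal_tendsto_0D:
  fixes f :: "'a \<Rightarrow> ennreal"
  assumes "(f \<longlongrightarrow> 0) F" "e > 0"
  shows "\<forall>\<^sub>F k in F. f k \<le> ennreal e"
  using order_tendstoD(2)[OF assms(1), of "ennreal e"] assms(2) by (auto elim!: eventually_mono)

lemma tame_const:
  assumes V: "V \<in> sets borel" "set_borel_measurable borel V h" "slobodeckij_sq (1/2) V h < \<infinity>"
  shows "tame V (\<lambda>_. h)"
  unfolding tame_def using near_energy_small[OF V] by auto

text \<open>For a constant sequence tameness gives finite energy near the diagonal, and boundedness
  on a set of finite measure takes care of the distant pairs. Regularity of a single function is
  thus obtained from the calculus of sequences.\<close>

lemma slobodeckij_finite:
  assumes V: "V \<in> sets borel" "emeasure lborel V < \<infinity>" and t: "tends_tame V (\<lambda>_. h) h"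
  shows "slobodeckij_sq (1/2) V h < \<infinity>"
proof -
  obtain B where B: "\<And>x. x \<in> V \<Longrightarrow> \<bar>h x\<bar> \<le> B" using tends_tame_bounded[OF t] by blast
  obtain \<delta> where d: "\<delta> > 0" "near_energy V \<delta> h \<le> ennreal 1"
    using t unfolding tends_tame_def tame_def by (auto dest!: spec[of _ "1::real"])
  have m: "set_borel_measurable borel V h" using t by (simp add: tends_tame_def)
  have "slobodeckij_sq (1/2) V h \<le> near_energy V \<delta> h + ennreal ((2 * B)\<^sup>2 / \<delta> ^ 3) * emeasure lborel V * emeasure lborel V"
    by (rule slobodeckij_le_near_energy[OF V(1) m B d(1)])
  also have "\<dots> < \<infinity>"
    using d V(2) by (auto simp: ennreal_mult_less_top intro: le_less_trans)
  finally show ?thesis .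
qed

lemma tends_tame_diff:
  assumes "V \<in> sets borel" "tends_tame V A a" "tends_tame V B b"
  shows "tends_tame V (\<lambda>k x. A k x - B k x) (\<lambda>x. a x - b x)"
  using tends_tame_add[OF assms(1,2) tends_tame_mult[OF assms(1) tends_tame_const[OF assms(1), of "-1"] assms(3)]] by simp

text \<open>Tameness fixes a \<delta> below which the energy is small for all large
  \<open>k\<close>; with \<delta> fixed, uniform convergence makes the remaining, bounded part of
  the kernel harmless.\<close>

lemma tends_tame_null:
  assumes V: "V \<in> sets borel" "emeasure lborel V < \<infinity>" and t: "tends_tame V D (\<lambda>_. 0)"
  shows "(\<lambda>k. L2_norm_sq V (D k)) \<longlonglongrightarrow> 0" "(\<lambda>k. slobodeckij_sq (1/2) V (D k)) \<longlonglongrightarrow> 0"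
proof -
  obtain m where m: "emeasure lborel V = ennreal m" "m \<ge> 0" using V(2) by (cases "emeasure lborel V") auto
  have small: "\<forall>\<^sub>F k in sequentially. \<forall>x\<in>V. \<bar>D k x\<bar> \<le> e" if "e > 0" for e
  proof -
    have "\<forall>\<^sub>F k in sequentially. \<forall>x\<in>V. dist (D k x) 0 < e"
      using t that unfolding tends_tame_def by (intro uniform_limitD) auto
    then show ?thesis by eventually_elim force
  qed
  show "(\<lambda>k. L2_norm_sq V (D k)) \<longlonglongrightarrow> 0"
  proof (rule ennreal_tendsto_0I)
    fix e :: real assume e: "e > 0"
    define e' where "e' = sqrt (e / (m + 1))"
    have e': "e' > 0" using e m by (simp add: e'_def)
    show "\<forall>\<^sub>F k in sequentially. L2_norm_sq V (D k) \<le> ennreal e"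
      using small[OF e']
    proof eventually_elim
      case (elim k)
      have "L2_norm_sq V (D k) \<le> (\<integral>\<^sup>+x. ennreal (e / (m + 1)) * indicator V x \<partial>lborel)"
        unfolding L2_norm_sq_def
      proof (intro nn_integral_mono)
        fix x
        show "ennreal ((norm (D k x))\<^sup>2) * indicator V x \<le> ennreal (e / (m + 1)) * indicator V x"
        proof (cases "x \<in> V")
          case True
          then have "\<bar>D k x\<bar>\<^sup>2 \<le> e'\<^sup>2" using elim by (intro power_mono) auto
          also have "e'\<^sup>2 = e / (m + 1)" using e m by (simp add: e'_def)
          finally show ?thesis using True by (simp add: ennreal_leI)
        qed simp
      qed
      also have "\<dots> = ennreal (e / (m + 1) * m)"
        using V(1) m e by (subst nn_integral_cmult_indicator, simp, simp only: m ennreal_mult[symmetric] divide_nonneg_nonneg add_nonneg_nonneg less_imp_le zero_le_one)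
      also have "\<dots> \<le> ennreal e" using div_succ_mult_less[OF e m(2)] by (intro ennreal_leI) simp
      finally show ?case .
    qed
  qed
  show "(\<lambda>k. slobodeckij_sq (1/2) V (D k)) \<longlonglongrightarrow> 0"
  proof (rule ennreal_tendsto_0I)
    fix e :: real assume e: "e > 0"
    then obtain \<delta> where d: "\<delta> > 0" "\<forall>\<^sub>F k in sequentially. near_energy V \<delta> (D k) \<le> ennreal (e/2)"
      using t unfolding tends_tame_def tame_def by (auto dest!: spec[of _ "e/2"])
    \<comment> \<open>Values below sqrt q give the distant pairs an energy of at most (2 sqrt q)^2
      m^2 / \<delta>^3, which is less than e/2.\<close>
    define q where "q = e / 2 / (4 * m * m / \<delta> ^ 3 + 1)"
    have p: "4 * m * m / \<delta> ^ 3 \<ge> 0" using m d by simp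
    have q: "q > 0" "q * (4 * m * m / \<delta> ^ 3) < e / 2"
      using div_succ_mult_less[of "e/2", OF _ p] e unfolding q_def by auto
    have ms: "\<forall>\<^sub>F k in sequentially. set_borel_measurable borel V (D k)" using t by (simp add: tends_tame_def)
    have "sqrt q > 0" using q by simp
    from d(2) small[OF this] ms show "\<forall>\<^sub>F k in sequentially. slobodeckij_sq (1/2) V (D k) \<le> ennreal e"
    proof eventually_elim
      case (elim k)
      have "slobodeckij_sq (1/2) V (D k) \<le> near_energy V \<delta> (D k) + ennreal ((2 * sqrt q)\<^sup>2 / \<delta> ^ 3) * emeasure lborel V * emeasure lborel V"
        by (rule slobodeckij_le_near_energy[OF V(1) elim(3) _ d(1)]) (use elim(2) in blast)
      also have "ennreal ((2 * sqrt q)\<^sup>2 / \<delta> ^ 3) * emeasure lborel V * emeasure lborel V = ennreal (q * (4 * m * m / \<delta> ^ 3))"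
        using q(1) m d(1) by (simp flip: ennreal_mult add: power_mult_distrib ac_simps)
      also have "near_energy V \<delta> (D k) + ennreal (q * (4 * m * m / \<delta> ^ 3)) \<le> ennreal (e/2) + ennreal (e/2)"
        using elim(1) q(2) by (intro add_mono ennreal_leI) auto
      also have "\<dots> = ennreal e" using e by (simp flip: ennreal_plus)
      finally show ?case .
    qed
  qed
qed

section \<open>Localisation\<close>

lemma Ck_on_Un:
  "open S \<Longrightarrow> open T \<Longrightarrow> Ck_on k S f \<Longrightarrow> Ck_on k T f \<Longrightarrow> Ck_on k (S \<union> T) f"
  by (induction k arbitrary: f) (auto intro: continuous_on_open_Un)

lemma Ck_on_cutoff_mult:
  fixes \<psi> f :: "real^'n \<Rightarrow> real"
  assumes "Ck_on k UNIV \<psi>" "closed C" "\<And>x. x \<notin> C \<Longrightarrow> \<psi> x = 0" "open U" "C \<subseteq> U" "Ck_on k U f"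
  shows "Ck_on k UNIV (\<lambda>x. \<psi> x * f x)"
proof -
  have "Ck_on k U (\<lambda>x. \<psi> x * f x)"
    using assms by (intro Ck_on_mult) (auto intro: Ck_on_subset)
  moreover have "Ck_on k (- C) (\<lambda>x. \<psi> x * f x)"
    using Ck_on_cong[of "- C" "\<lambda>x. \<psi> x * f x" "\<lambda>_. 0" k] Ck_on_const[of "- C" k 0] assms by auto
  moreover have "UNIV = U \<union> - C" using assms by auto
  ultimately show ?thesis using Ck_on_Un[of U "- C" k] assms by auto
qed

lemma pderiv_at_zero_outside:
  assumes "closed C" "\<And>x. x \<notin> C \<Longrightarrow> \<psi> x = 0" "x \<notin> C"
  shows "pderiv_at i \<psi> x = 0"
proof -
  have "pderiv_at i \<psi> x = pderiv_at i (\<lambda>_. 0) x"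
    by (rule pderiv_at_cong[of "- C"]) (use assms in auto)
  then show ?thesis by (simp add: pderiv_at_def)
qed

lemma integrable_cutoff:
  fixes \<psi> f :: "real^'n \<Rightarrow> real"
  assumes "continuous_on UNIV \<psi>" "compact C" "\<And>x. x \<notin> C \<Longrightarrow> \<psi> x = 0" "open U" "C \<subseteq> U" "continuous_on U f"
  shows "integrable lborel (\<lambda>x. \<psi> x * f x)"
proof -
  obtain R where R: "\<And>x. x \<in> C \<Longrightarrow> norm x \<le> R"
    using compact_imp_bounded[OF assms(2)] unfolding bounded_iff by blast
  have "continuous_on UNIV (\<lambda>x. \<psi> x * f x)"
    using Ck_on_cutoff_mult[of 0 \<psi> C U f] assms compact_imp_closed by auto
  then show ?thesis
    by (rule integrable_compact_support[where R=R]) (use R assms(3) in force)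
qed

text \<open>Multiplication by the cutoff extends \<open>f\<close> to a C^1 function with compact
  support on the whole space, whose partial derivatives have integral zero.\<close>

lemma integration_by_parts:
  fixes \<psi> f :: "real^'n \<Rightarrow> real"
  assumes p: "Ck_on 1 UNIV \<psi>" "compact C" "\<And>x. x \<notin> C \<Longrightarrow> \<psi> x = 0" and U: "open U" "C \<subseteq> U" and f: "Ck_on 1 U f"
  shows "integrable lborel (\<lambda>x. pderiv_at i \<psi> x * f x)" "integrable lborel (\<lambda>x. \<psi> x * pderiv_at i f x)"
    "(LINT x|lborel. pderiv_at i \<psi> x * f x) = - (LINT x|lborel. \<psi> x * pderiv_at i f x)"
proof -
  have cl: "closed C" using p(2) compact_imp_closed by blast
  obtain R where R: "\<And>x. x \<in> C \<Longrightarrow> norm x \<le> R"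
    using compact_imp_bounded[OF p(2)] unfolding bounded_iff by blast
  let ?\<phi> = "\<lambda>x. \<psi> x * f x"
  have C1: "Ck_on 1 UNIV ?\<phi>" by (rule Ck_on_cutoff_mult[OF p(1) cl p(3) U f])
  have z: "?\<phi> x = 0" if "norm x > R" for x using R[of x] p(3)[of x] that by force
  have pd: "pderiv_at i ?\<phi> x = \<psi> x * pderiv_at i f x + pderiv_at i \<psi> x * f x" for x
  proof (cases "x \<in> U")
    case True
    then show ?thesis using p(1) f by (intro pderiv_at_mult) auto
  next
    case False
    then have "x \<notin> C" using U by auto
    then show ?thesis using pderiv_at_zero_outside[OF cl, of ?\<phi> x i] pderiv_at_zero_outside[OF cl, of \<psi> x i] p(3) by simp
  qed
  have c: "continuous_on UNIV \<psi>" "continuous_on UNIV (pderiv_at i \<psi>)" "continuous_on U f" "continuous_on U (pderiv_at i f)"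
    using p(1) f Ck_on_SucD[of 0] by auto
  show i1: "integrable lborel (\<lambda>x. pderiv_at i \<psi> x * f x)"
    by (rule integrable_cutoff[OF c(2) p(2) _ U c(3)]) (rule pderiv_at_zero_outside[OF cl p(3)])
  show i2: "integrable lborel (\<lambda>x. \<psi> x * pderiv_at i f x)"
    by (rule integrable_cutoff[OF c(1) p(2) p(3) U c(4)])
  have "(LINT x|lborel. pderiv_at i ?\<phi> x) = 0" by (rule integral_pderiv_eq_0[OF C1 z])
  then show "(LINT x|lborel. pderiv_at i \<psi> x * f x) = - (LINT x|lborel. \<psi> x * pderiv_at i f x)"
    unfolding pd using i1 i2 by simp
qed

lemma compact_neighbourhood:
  fixes C :: "'a::euclidean_space set"
  assumes "compact C" "open U" "C \<subseteq> U"
  obtains V r where "r > 0" "compactly_inside V U" "C \<subseteq> V" "\<And>x. x \<in> C \<Longrightarrow> ball x r \<subseteq> V"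
proof -
  obtain d where d: "d > 0" "(\<Union>x\<in>C. ball x d) \<subseteq> U"
    using compact_subset_open_imp_ball_epsilon_subset[OF assms] by blast
  define V where "V = (\<Union>x\<in>C. ball x (d/2))"
  define W where "W = {x + y |x y. x \<in> C \<and> y \<in> cball 0 (d/2)}"
  have W: "compact W" unfolding W_def by (intro compact_sums assms) auto
  have VW: "V \<subseteq> W"
  proof
    fix z assume "z \<in> V"
    then obtain x where "x \<in> C" "dist x z < d/2" by (auto simp: V_def)
    then have "z = x + (z - x)" "z - x \<in> cball 0 (d/2)" by (auto simp: dist_norm norm_minus_commute)
    then show "z \<in> W" unfolding W_def using \<open>x \<in> C\<close> by blast
  qed
  have WU: "W \<subseteq> U"
  proof
    fix z assume "z \<in> W"
    then obtain x y where xy: "z = x + y" "x \<in> C" "norm y \<le> d/2" by (auto simp: W_def)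
    then have "z \<in> ball x d" using d(1) by (simp add: dist_norm)
    then show "z \<in> U" using d(2) xy by blast
  qed
  have cV: "closure V \<subseteq> W" using VW W compact_imp_closed closure_minimal by blast
  have "compact (closure V)"
    using bounded_subset[OF compact_imp_bounded[OF W] VW] by (simp add: compact_closure)
  moreover have "open V" by (auto simp: V_def)
  ultimately have "compactly_inside V U" using cV WU by (auto simp: compactly_inside_def)
  moreover have "C \<subseteq> V" using d(1) by (force simp: V_def)
  ultimately show thesis using d(1) by (intro that[of "d/2" V]) (auto simp: V_def)
qed

text \<open>Extension by zero from \<open>K\<close>: convolution integrates over the whole plane,
  while the functions in question are controlled on an open set only.\<close>

definition restr :: "(real^2) set \<Rightarrow> (real^2 \<Rightarrow> real) \<Rightarrow> real^2 \<Rightarrow> real" where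
  "restr K h x = indicator K x * h x"

lemma L12_restr:
  assumes "compact K" "continuous_on K h"
  shows "L12 (restr K h)"
proof -
  have "integrable lborel (\<lambda>x. indicator K x *\<^sub>R h x)" "integrable lborel (\<lambda>x. indicator K x *\<^sub>R (h x)\<^sup>2)"
    by (rule borel_integrable_compact; use assms in \<open>auto intro!: continuous_intros\<close>)+
  moreover have "(\<lambda>x. indicator K x *\<^sub>R (h x)\<^sup>2) = (\<lambda>x. (restr K h x)\<^sup>2)" "(\<lambda>x. indicator K x *\<^sub>R h x) = restr K h"
    by (auto simp: restr_def indicator_def)
  ultimately show ?thesis by (simp add: L12_def)
qed

lemma moll_cong:
  assumes "\<epsilon> > 0" "\<And>y. y \<in> ball x \<epsilon> \<Longrightarrow> h y = h' y"
  shows "moll \<epsilon> h x = moll \<epsilon> h' x"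
  unfolding conv_def
proof (rule Bochner_Integration.integral_cong)
  fix y
  show "mollifier \<epsilon> (x - y) * h y = mollifier \<epsilon> (x - y) * h' y"
    using assms mollifier_outside[OF assms(1), of "x - y"] by (cases "norm (x - y) < \<epsilon>") (auto simp: dist_norm)
qed simp

lemma moll_near:
  assumes e: "\<epsilon> > 0" and h: "integrable lborel h" and b: "\<And>y. y \<in> ball x \<epsilon> \<Longrightarrow> \<bar>h y - c\<bar> \<le> d"
  shows "\<bar>moll \<epsilon> h x - c\<bar> \<le> d"
proof -
  have i1: "integrable lborel (\<lambda>y. mollifier \<epsilon> (x - y))"
    using lborel_integrable_reflect[OF integrable_compact_support[OF mollifier_continuous(1), of \<epsilon> \<epsilon>]] mollifier_outside[OF e] by simp
  have i2: "integrable lborel (\<lambda>y. mollifier \<epsilon> (x - y) * h y)"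
    by (rule integrable_conv[OF mollifier_continuous(1), where R=\<epsilon>]) (use mollifier_outside[OF e] h in auto)
  have 1: "(LINT y|lborel. mollifier \<epsilon> (x - y)) = 1"
    using lborel_integral_reflect[of "mollifier \<epsilon>" x] integral_mollifier[OF e] by simp
  have "moll \<epsilon> h x - c = (LINT y|lborel. mollifier \<epsilon> (x - y) * h y - mollifier \<epsilon> (x - y) * c)"
    using i1 i2 1 by (simp add: conv_def)
  also have "\<dots> = (LINT y|lborel. mollifier \<epsilon> (x - y) * (h y - c))" by (simp add: right_diff_distrib)
  finally have eq: "moll \<epsilon> h x - c = (LINT y|lborel. mollifier \<epsilon> (x - y) * (h y - c))" .
  have "\<bar>LINT y|lborel. mollifier \<epsilon> (x - y) * (h y - c)\<bar> \<le> (LINT y|lborel. mollifier \<epsilon> (x - y) * d)"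
  proof (rule integral_abs_bound_integral)
    fix y
    show "\<bar>mollifier \<epsilon> (x - y) * (h y - c)\<bar> \<le> mollifier \<epsilon> (x - y) * d"
      using b[of y] mollifier_nonneg[OF e, of "x - y"] mollifier_outside[OF e, of "x - y"]
      by (cases "norm (x - y) < \<epsilon>") (auto simp: dist_norm abs_mult intro: mult_left_mono)
  qed (use i1 i2 in \<open>auto simp: right_diff_distrib\<close>)
  also have "\<dots> = d" using i1 1 by simp
  finally show ?thesis using eq by simp
qed

lemma moll_uniform_limit:
  assumes K: "compact K" "continuous_on K h" and r: "r > 0" "\<And>x. x \<in> A \<Longrightarrow> ball x r \<subseteq> K"
    and s: "s \<longlonglongrightarrow> 0" "\<And>k. s k > (0::real)"
  shows "uniform_limit A (\<lambda>k. moll (s k) (restr K h)) h sequentially"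
proof (rule uniform_limitI)
  fix e :: real assume e: "e > 0"
  have "uniformly_continuous_on K h" using K by (intro compact_uniformly_continuous)
  then obtain d where d: "d > 0" "\<And>x y. x \<in> K \<Longrightarrow> y \<in> K \<Longrightarrow> dist y x < d \<Longrightarrow> dist (h y) (h x) < e/2"
    unfolding uniformly_continuous_on_def using e by (metis half_gt_zero)
  have "\<forall>\<^sub>F k in sequentially. s k < min d r" using order_tendstoD(2)[OF s(1), of "min d r"] d r by auto
  then show "\<forall>\<^sub>F k in sequentially. \<forall>x\<in>A. dist (moll (s k) (restr K h) x) (h x) < e"
  proof eventually_elim
    case (elim k)
    show ?case
    proof
      fix x assume x: "x \<in> A"
      have "\<bar>moll (s k) (restr K h) x - h x\<bar> \<le> e/2"
      proof (rule moll_near[OF s(2)])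
        show "integrable lborel (restr K h)" using L12_restr[OF K] by (simp add: L12_def)
        fix y assume y: "y \<in> ball x (s k)"
        then have "y \<in> ball x r" using elim by auto
        then have "y \<in> K" using r(2)[OF x] by blast
        moreover have "x \<in> K" using r(1) r(2)[OF x] by (auto simp: subset_iff)
        ultimately show "\<bar>restr K h y - h x\<bar> \<le> e/2"
          using d(2)[of x y] y elim by (auto simp: restr_def dist_real_def dist_commute)
      qed
      then show "dist (moll (s k) (restr K h) x) (h x) < e" using e by (simp add: dist_real_def)
    qed
  qed
qed

text \<open>The extension by zero may jump at the boundary of \<open>K\<close>, so differentiation
  commutes with mollification only where the support of the kernel stays in \<open>K\<close>. There
  the reflected kernel is a cutoff for an integration by parts.\<close>

lemma pderiv_moll_restr:
  assumes U: "open U" "K \<subseteq> U" "compact K" and h: "Ck_on 1 U h" and e: "\<epsilon> > 0" "cball x \<epsilon> \<subseteq> K"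
  shows "pderiv_at i (moll \<epsilon> (restr K h)) x = moll \<epsilon> (restr K (pderiv_at i h)) x"
proof -
  have hc: "continuous_on K h" "continuous_on K (pderiv_at i h)"
    using h Ck_on_SucD[of 0 U h] U(2) by (auto intro: continuous_on_subset)
  let ?\<psi> = "\<lambda>y. mollifier \<epsilon> (x - y)"
  have z: "y \<notin> cball x \<epsilon> \<Longrightarrow> ?\<psi> y = 0" for y using e(1) by (intro mollifier_outside) (auto simp: dist_norm)
  have pd: "pderiv_at i ?\<psi> y = - pderiv_at i (mollifier \<epsilon>) (x - y)" for y
  proof -
    have "(mollifier \<epsilon> has_derivative (\<lambda>v. \<Sum>i\<in>UNIV. v $ i *\<^sub>R pderiv_at i (mollifier \<epsilon>) (x - y))) (at (x - y))"
      using Ck_on_mollifier[of 1 \<epsilon>] by (intro has_derivative_pderiv) auto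
    moreover have "((\<lambda>y. x - y) has_derivative (\<lambda>v. - v)) (at y)" by (auto intro!: derivative_eq_intros)
    ultimately have "(?\<psi> has_derivative (\<lambda>v. \<Sum>i\<in>UNIV. (- v) $ i *\<^sub>R pderiv_at i (mollifier \<epsilon>) (x - y))) (at y)"
      using has_derivative_compose by blast
    from pderiv_at_eqI[OF this, of i] show ?thesis
      by (simp add: axis_def if_distrib[of "\<lambda>x. x * _"] if_distrib[of uminus] sum_negf cong: if_cong)
  qed
  have "pderiv_at i (moll \<epsilon> (restr K h)) x = (LINT y|lborel. pderiv_at i (mollifier \<epsilon>) (x - y) * restr K h y)"
    using L12_restr[OF U(3) hc(1)] e(1) by (simp add: pderiv_moll L12_def conv_def)
  also have "\<dots> = - (LINT y|lborel. pderiv_at i ?\<psi> y * h y)"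
  proof -
    have "norm (x - y) > \<epsilon>" if "y \<notin> K" for y using e(2) that by (force simp: dist_norm)
    then have "pderiv_at i (mollifier \<epsilon>) (x - y) * restr K h y = - (pderiv_at i ?\<psi> y * h y)" for y
      using pderiv_mollifier_outside[OF e(1), of "x - y" i] unfolding pd
      by (cases "y \<in> K") (auto simp: restr_def)
    then show ?thesis by simp
  qed
  also have "\<dots> = (LINT y|lborel. ?\<psi> y * pderiv_at i h y)"
    using integration_by_parts(3)[OF Ck_on_mollifier_reflect compact_cball z U(1) _ h, of x \<epsilon> i] e(2) U(2)
    by (simp add: subset_trans[of _ K])
  also have "\<dots> = moll \<epsilon> (restr K (pderiv_at i h)) x"
    unfolding conv_def
  proof (rule Bochner_Integration.integral_cong)
    fix y
    show "?\<psi> y * pderiv_at i h y = ?\<psi> y * restr K (pderiv_at i h) y"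
      using z[of y] e(2) by (cases "y \<in> K") (simp_all add: restr_def subset_iff, blast)
  qed simp
  finally show ?thesis .
qed

text \<open>Mollification leaves \<delta> and the energy bound unchanged and only needs a slightly
  larger set, so one \<delta> serves all small scales.\<close>

lemma tame_moll:
  assumes V: "V \<in> sets borel" "V' \<in> sets borel" and h: "L12 h" and r: "r > 0" "\<And>x. x \<in> V \<Longrightarrow> ball x r \<subseteq> V'"
    and s: "s \<longlonglongrightarrow> 0" "\<And>k. s k > (0::real)" and t: "tame V' (\<lambda>_. h)"
  shows "tame V (\<lambda>k. moll (s k) h)"
  unfolding tame_def
proof (intro allI impI)
  fix e :: real assume "e > 0"
  then obtain \<delta> where d: "\<delta> > 0" "near_energy V' \<delta> h \<le> ennreal e"
    using t unfolding tame_def by auto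
  have "\<forall>\<^sub>F k in sequentially. s k < r" using order_tendstoD(2)[OF s(1) r(1)] .
  then have "\<forall>\<^sub>F k in sequentially. near_energy V \<delta> (moll (s k) h) \<le> ennreal e"
  proof eventually_elim
    case (elim k)
    have "near_energy V \<delta> (moll (s k) h) \<le> near_energy V' \<delta> h"
    proof (rule near_energy_moll[OF h s(2) V])
      fix x assume "x \<in> V"
      then show "ball x (s k) \<subseteq> V'" using r(2)[of x] elim by (meson less_imp_le order_trans subset_ball)
    qed
    then show ?case using d(2) by simp
  qed
  with d(1) show "\<exists>\<delta>>0. \<forall>\<^sub>F k in sequentially. near_energy V \<delta> (moll (s k) h) \<le> ennreal e" by blast
qed

lemma set_borel_measurable_continuous:
  fixes h :: "real^2 \<Rightarrow> real"
  assumes "V \<in> sets borel" "continuous_on V h" shows "set_borel_measurable borel V h"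
  unfolding set_borel_measurable_def using borel_measurable_continuous_on_indicator[OF assms] .

lemma tends_tame_moll:
  assumes V: "V \<in> sets borel" "open V'" and K: "compact (closure V')" "continuous_on (closure V') h"
    and r: "r > 0" "\<And>x. x \<in> V \<Longrightarrow> ball x r \<subseteq> V'"
    and s: "s \<longlonglongrightarrow> 0" "\<And>k. s k > (0::real)" and f: "slobodeckij_sq (1/2) V' h < \<infinity>"
  shows "tends_tame V (\<lambda>k. moll (s k) (restr (closure V') h)) h"
  unfolding tends_tame_def
proof (intro conjI always_eventually allI)
  let ?K = "closure V'"
  have L: "L12 (restr ?K h)" by (rule L12_restr[OF K])
  have V'K: "V' \<subseteq> ?K" by (rule closure_subset)
  fix k
  have "continuous_on UNIV (moll (s k) (restr ?K h))"
    using Ck_on_moll[OF s(2)[of k], of "restr ?K h" 0] L by (simp add: L12_def)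
  then show "set_borel_measurable borel V (moll (s k) (restr ?K h))"
    using V by (intro set_borel_measurable_continuous) (auto intro: continuous_on_subset)
next
  let ?K = "closure V'"
  have V'K: "V' \<subseteq> ?K" by (rule closure_subset)
  show "uniform_limit V (\<lambda>k. moll (s k) (restr ?K h)) h sequentially"
    using r V'K by (intro moll_uniform_limit[OF K r(1) _ s]) blast
  have "V \<subseteq> ?K" using r V'K by (meson centre_in_ball subset_iff)
  then show "bounded (h ` V)"
    using compact_imp_bounded[OF compact_continuous_image[OF K(2,1)]] by (meson bounded_subset image_mono)
  have m: "set_borel_measurable borel V' h"
    using V K V'K by (intro set_borel_measurable_continuous) (auto intro: continuous_on_subset)
  have "tame V' (\<lambda>_. h)" using V f m by (intro tame_const) auto
  then have "tame V' (\<lambda>_. restr ?K h)"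
    unfolding tame_def using near_energy_cong[of V' h "restr ?K h"] V'K
    by (auto simp: restr_def subset_iff)
  then show "tame V (\<lambda>k. moll (s k) (restr ?K h))"
    using V by (intro tame_moll[OF _ _ L12_restr[OF K] r s]) auto
qed

section \<open>The Jacobian as a bilinear form\<close>

text \<open>The explicit formula for the second derivatives is symmetric in \<open>i\<close> and
  \<open>j\<close>.\<close>

lemma pderiv_mollifier_commute:
  "pderiv_at i (pderiv_at j (mollifier \<epsilon>)) x = pderiv_at j (pderiv_at i (mollifier \<epsilon>)) x"
proof -
  let ?c = "inverse (LINT y|lborel. mollifier_profile \<epsilon> 0 0 y)"
  let ?p = "\<lambda>m. mollifier_profile \<epsilon> m 0 x"
  have "pderiv_at i (pderiv_at j (mollifier \<epsilon>)) x =
    ?c * ((?p 4 - 2 * ?p 3) * (- 2 / \<epsilon>\<^sup>2 * (x $ i)) * (- 2 / \<epsilon>\<^sup>2 * (x $ j)) + ?p 2 * (- 2 / \<epsilon>\<^sup>2 * (if i = j then 1 else 0)))"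
    for i j :: 2
  proof -
    have "pderiv_at j (mollifier \<epsilon>) = (\<lambda>x. ?c * (mollifier_profile \<epsilon> 2 0 x * (- 2 / \<epsilon>\<^sup>2 * (x $ j))))"
      by (rule ext) (rule pderiv_mollifier)
    moreover have "(mollifier_profile \<epsilon> 2 0 has_derivative (\<lambda>v. (?p 4 - 2 * ?p 3) * (- 2 / \<epsilon>\<^sup>2 * (x \<bullet> v)))) (at x)"
      using has_derivative_mollifier_profile[of \<epsilon> 2 0 x] by (simp add: eval_nat_numeral)
    then have "((\<lambda>x. ?c * (mollifier_profile \<epsilon> 2 0 x * (- 2 / \<epsilon>\<^sup>2 * (x $ j)))) has_derivative
      (\<lambda>v. ?c * (?p 2 * (- 2 / \<epsilon>\<^sup>2 * (v $ j)) +
        (?p 4 - 2 * ?p 3) * (- 2 / \<epsilon>\<^sup>2 * (x \<bullet> v)) * (- 2 / \<epsilon>\<^sup>2 * (x $ j))))) (at x)"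
      by (intro has_derivative_mult_right has_derivative_mult bounded_linear_imp_has_derivative bounded_linear_vec_nth)
    moreover have "axis i (1::real) $ j = (if i = j then 1 else 0)" by (simp add: axis_def)
    ultimately show ?thesis
      by (simp only: pderiv_at_eqI inner_axis inner_real_def mult_1_right add.commute)
  qed
  then show ?thesis by (simp add: ac_simps)
qed

text \<open>Symmetry is inherited from the kernel: the second derivatives of a mollification are
  mollifications of the second derivatives, they can be exchanged because they may as well fall on
  the kernel, and mollifications of continuous functions converge.\<close>

lemma pderiv_at_commute:
  fixes h :: "real^2 \<Rightarrow> real"
  assumes U: "open U" "x \<in> U" and h: "Ck_on 2 U h"
  shows "pderiv_at i (pderiv_at j h) x = pderiv_at j (pderiv_at i h) x"
proof -
  obtain r where r: "r > 0" "cball x r \<subseteq> U" using U open_contains_cball by blast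
  let ?K = "cball x r"
  have h1: "Ck_on 1 U h" "\<And>j. Ck_on 1 U (pderiv_at j h)"
    using h Ck_on_mono[of 2 U h 1] by (auto simp: numeral_2_eq_2)
  have hc: "continuous_on ?K h" "\<And>i j. continuous_on ?K (pderiv_at i (pderiv_at j h))"
  proof -
    have "continuous_on U h" using h1(1) Ck_on_SucD[of 0 U h] by simp
    then show "continuous_on ?K h" using r(2) continuous_on_subset by blast
    fix i j
    have "continuous_on U (pderiv_at i (pderiv_at j h))" using h1(2)[of j] by simp
    then show "continuous_on ?K (pderiv_at i (pderiv_at j h))" using r(2) continuous_on_subset by blast
  qed
  define s where "s k = r / (2 * real (Suc k))" for k
  have s: "s \<longlonglongrightarrow> 0" "\<And>k. s k > 0"
  proof -
    have "(\<lambda>k. r / 2 * (1 / real (Suc k))) \<longlonglongrightarrow> r / 2 * 0"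
      by (intro tendsto_intros lim_1_over_n[THEN LIMSEQ_Suc])
    then show "s \<longlonglongrightarrow> 0" unfolding s_def by simp
  qed (use r in \<open>simp add: s_def\<close>)
  have sr: "s k \<le> r / 2" for k using r unfolding s_def by (simp add: field_simps)
  have H: "integrable lborel (restr ?K h)" using L12_restr[of ?K h] hc by (simp add: L12_def)
  have 1: "pderiv_at i (pderiv_at j (moll (s k) (restr ?K h))) x = moll (s k) (restr ?K (pderiv_at i (pderiv_at j h))) x" for i j k
  proof -
    have "pderiv_at i (pderiv_at j (moll (s k) (restr ?K h))) x = pderiv_at i (moll (s k) (restr ?K (pderiv_at j h))) x"
    proof (rule pderiv_at_cong[of "ball x (r/2)"])
      fix y assume "y \<in> ball x (r/2)"
      then have "cball y (s k) \<subseteq> ?K"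
        using sr[of k] by (intro subsetI) (smt (verit) dist_triangle mem_ball mem_cball field_sum_of_halves)
      then show "pderiv_at j (moll (s k) (restr ?K h)) y = moll (s k) (restr ?K (pderiv_at j h)) y"
        by (intro pderiv_moll_restr[OF U(1) r(2) _ h1(1) s(2)]) auto
    qed (use r in auto)
    also have "\<dots> = moll (s k) (restr ?K (pderiv_at i (pderiv_at j h))) x"
      using sr[of k] r(1) by (intro pderiv_moll_restr[OF U(1) r(2) _ h1(2) s(2)]) auto
    finally show ?thesis .
  qed
  \<comment> \<open>Here both derivatives fall on the kernel, whereas the preceding identity puts
    them on \<open>h\<close>.\<close>
  have 2: "pderiv_at i (pderiv_at j (moll (s k) (restr ?K h))) x = conv (pderiv_at i (pderiv_at j (mollifier (s k)))) (restr ?K h) x" for i j k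
  proof -
    have "pderiv_at j (moll (s k) (restr ?K h)) = conv (pderiv_at j (mollifier (s k))) (restr ?K h)"
      by (rule ext) (rule pderiv_moll[OF s(2) H])
    moreover have "pderiv_at i (conv (pderiv_at j (mollifier (s k))) (restr ?K h)) x = conv (pderiv_at i (pderiv_at j (mollifier (s k)))) (restr ?K h) x"
      using Ck_on_mollifier[of 2 "s k"]
      by (intro pderiv_at_conv[where R="s k", OF _ _ H] pderiv_mollifier_outside[OF s(2)]) (auto simp: numeral_2_eq_2)
    ultimately show ?thesis by simp
  qed
  have "pderiv_at i (pderiv_at j (mollifier \<epsilon>)) = pderiv_at j (pderiv_at i (mollifier \<epsilon>))" for \<epsilon>
    by (rule ext) (rule pderiv_mollifier_commute)
  then have eq: "moll (s k) (restr ?K (pderiv_at i (pderiv_at j h))) x = moll (s k) (restr ?K (pderiv_at j (pderiv_at i h))) x" for k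
    unfolding 1[symmetric] 2 by simp
  have lim: "(\<lambda>k. moll (s k) (restr ?K (pderiv_at i (pderiv_at j h))) x) \<longlonglongrightarrow> pderiv_at i (pderiv_at j h) x" for i j
  proof -
    have "uniform_limit {x} (\<lambda>k. moll (s k) (restr ?K (pderiv_at i (pderiv_at j h)))) (pderiv_at i (pderiv_at j h)) sequentially"
      by (rule moll_uniform_limit[OF _ hc(2) r(1) _ s]) auto
    then show ?thesis by simp
  qed
  show ?thesis by (rule LIMSEQ_unique[OF lim[of i j, unfolded eq] lim[of j i]])
qed

definition jac :: "(real^2 \<Rightarrow> real) \<Rightarrow> (real^2 \<Rightarrow> real) \<Rightarrow> real^2 \<Rightarrow> real" where
  "jac a b x = pderiv_at 1 a x * pderiv_at 2 b x - pderiv_at 2 a x * pderiv_at 1 b x"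

definition jacobian_form :: "(real^2 \<Rightarrow> real) \<Rightarrow> (real^2 \<Rightarrow> real) \<Rightarrow> (real^2 \<Rightarrow> real) \<Rightarrow> real" where
  "jacobian_form \<psi> a b = (LINT x|lborel. \<psi> x * jac a b x)"

text \<open>Only C^1 is asked for, because a test function on \<open>U'\<close> composed with the
  C^1 map \<open>\<Psi>\<close> retains no more. \<open>C\<close> may be any compact set outside
  which the function vanishes.\<close>

definition cutoff_on :: "(real^2) set \<Rightarrow> (real^2 \<Rightarrow> real) \<Rightarrow> bool" where
  "cutoff_on C \<psi> \<longleftrightarrow> compact C \<and> Ck_on 1 UNIV \<psi> \<and> (\<forall>x. x \<notin> C \<longrightarrow> \<psi> x = 0)"

lemma continuous_on_jac:
  "Ck_on 1 U a \<Longrightarrow> Ck_on 1 U b \<Longrightarrow> continuous_on U (jac a b)"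
  unfolding jac_def[abs_def] by (intro continuous_intros) auto

lemma integrable_jac:
  assumes "cutoff_on C \<psi>" "open U" "C \<subseteq> U" "Ck_on 1 U a" "Ck_on 1 U b"
  shows "integrable lborel (\<lambda>x. \<psi> x * jac a b x)"
  using assms Ck_on_SucD[of 0 UNIV \<psi>]
  by (intro integrable_cutoff[of \<psi> C U] continuous_on_jac) (auto simp: cutoff_on_def)

lemma pderiv_at_diff:
  fixes f g :: "real^'n \<Rightarrow> real"
  assumes "f differentiable (at x)" "g differentiable (at x)"
  shows "pderiv_at i (\<lambda>x. f x - g x) x = pderiv_at i f x - pderiv_at i g x"
  unfolding pderiv_at_def
  by (subst frechet_derivative_at[symmetric, OF has_derivative_diff])
     (use assms in \<open>auto simp: frechet_derivative_works[symmetric]\<close>)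

lemma Ck_on_diff:
  fixes f g :: "real^'n \<Rightarrow> real"
  assumes "open S" "Ck_on k S f" "Ck_on k S g" shows "Ck_on k S (\<lambda>x. f x - g x)"
  using Ck_on_add[OF assms(1,2) Ck_on_mult[OF assms(1) Ck_on_const[OF assms(1), of k "-1"] assms(3)]] by simp

text \<open>The derivative of \<open>a\<close> moves to the cutoff, and the mixed second derivatives
  of \<open>b\<close> that arise cancel. As \<open>a\<close> is then undifferentiated, the smallness
  of a difference in this slot can pay for large derivatives of \<open>b\<close>.\<close>

lemma jacobian_form_by_parts:
  assumes \<psi>: "cutoff_on C \<psi>" and a: "Ck_on 1 UNIV a" and b: "Ck_on 2 UNIV b"
  shows "integrable lborel (\<lambda>x. a x * (pderiv_at 1 \<psi> x * pderiv_at 2 b x - pderiv_at 2 \<psi> x * pderiv_at 1 b x))"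
    "jacobian_form \<psi> a b = - (LINT x|lborel. a x * (pderiv_at 1 \<psi> x * pderiv_at 2 b x - pderiv_at 2 \<psi> x * pderiv_at 1 b x))"
proof -
  have b1: "Ck_on 1 UNIV (pderiv_at j b)" for j using b by (simp add: numeral_2_eq_2)
  have p: "Ck_on 1 UNIV \<psi>" "compact C" "\<And>x. x \<notin> C \<Longrightarrow> \<psi> x = 0" using \<psi> by (auto simp: cutoff_on_def)
  have ab: "Ck_on 1 UNIV (\<lambda>x. a x * pderiv_at j b x)" for j by (intro Ck_on_mult a b1) auto
  note ibp = integration_by_parts[OF p open_UNIV subset_UNIV ab]
  have pd: "pderiv_at i (\<lambda>x. a x * pderiv_at j b x) x = a x * pderiv_at i (pderiv_at j b) x + pderiv_at i a x * pderiv_at j b x" for i j x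
    using a b1 by (intro pderiv_at_mult) auto
  show i: "integrable lborel (\<lambda>x. a x * (pderiv_at 1 \<psi> x * pderiv_at 2 b x - pderiv_at 2 \<psi> x * pderiv_at 1 b x))"
    using Bochner_Integration.integrable_diff[OF ibp(1)[of 1 2] ibp(1)[of 2 1]]
    by (rule back_subst[of "integrable lborel"]) (auto simp: algebra_simps)
  have "(LINT x|lborel. a x * (pderiv_at 1 \<psi> x * pderiv_at 2 b x - pderiv_at 2 \<psi> x * pderiv_at 1 b x))
    = (LINT x|lborel. pderiv_at 1 \<psi> x * (a x * pderiv_at 2 b x) - pderiv_at 2 \<psi> x * (a x * pderiv_at 1 b x))"
    by (intro Bochner_Integration.integral_cong) (auto simp: algebra_simps)
  also have "\<dots> = (LINT x|lborel. pderiv_at 1 \<psi> x * (a x * pderiv_at 2 b x)) - (LINT x|lborel. pderiv_at 2 \<psi> x * (a x * pderiv_at 1 b x))"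
    by (rule Bochner_Integration.integral_diff[OF ibp(1) ibp(1)])
  also have "\<dots> = - (LINT x|lborel. \<psi> x * pderiv_at 1 (\<lambda>x. a x * pderiv_at 2 b x) x - \<psi> x * pderiv_at 2 (\<lambda>x. a x * pderiv_at 1 b x) x)"
    using ibp(3)[of 1 2] ibp(3)[of 2 1] ibp(2)[of 1 2] ibp(2)[of 2 1] by simp
  also have "(LINT x|lborel. \<psi> x * pderiv_at 1 (\<lambda>x. a x * pderiv_at 2 b x) x - \<psi> x * pderiv_at 2 (\<lambda>x. a x * pderiv_at 1 b x) x) = jacobian_form \<psi> a b"
    unfolding jacobian_form_def
  proof (rule Bochner_Integration.integral_cong)
    fix x
    have "pderiv_at 1 (pderiv_at 2 b) x = pderiv_at 2 (pderiv_at 1 b) x"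
      by (rule pderiv_at_commute[OF open_UNIV _ b]) simp
    then show "\<psi> x * pderiv_at 1 (\<lambda>x. a x * pderiv_at 2 b x) x - \<psi> x * pderiv_at 2 (\<lambda>x. a x * pderiv_at 1 b x) x = \<psi> x * jac a b x"
      unfolding pd jac_def by (simp add: algebra_simps)
  qed simp
  finally show "jacobian_form \<psi> a b = - (LINT x|lborel. a x * (pderiv_at 1 \<psi> x * pderiv_at 2 b x - pderiv_at 2 \<psi> x * pderiv_at 1 b x))"
    by simp
qed

lemma jacobian_form_bound:
  assumes \<psi>: "cutoff_on C \<psi>" and D: "\<And>i x. \<bar>pderiv_at i \<psi> x\<bar> \<le> D"
    and a: "Ck_on 1 UNIV a" and b: "Ck_on 2 UNIV b"
    and G: "integrable lborel (\<lambda>x. indicator C x * G x)"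
    and le: "\<And>x i. x \<in> C \<Longrightarrow> \<bar>a x\<bar> * \<bar>pderiv_at i b x\<bar> \<le> G x"
  shows "\<bar>jacobian_form \<psi> a b\<bar> \<le> 2 * D * (LINT x|lborel. indicator C x * G x)"
proof -
  have cl: "closed C" "\<And>x. x \<notin> C \<Longrightarrow> \<psi> x = 0" using \<psi> compact_imp_closed by (auto simp: cutoff_on_def)
  have "\<bar>jacobian_form \<psi> a b\<bar> = \<bar>LINT x|lborel. a x * (pderiv_at 1 \<psi> x * pderiv_at 2 b x - pderiv_at 2 \<psi> x * pderiv_at 1 b x)\<bar>"
    unfolding jacobian_form_by_parts(2)[OF \<psi> a b] by simp
  also have "\<dots> \<le> (LINT x|lborel. 2 * D * (indicator C x * G x))"
  proof (rule integral_abs_bound_integral)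
    fix x
    show "\<bar>a x * (pderiv_at 1 \<psi> x * pderiv_at 2 b x - pderiv_at 2 \<psi> x * pderiv_at 1 b x)\<bar> \<le> 2 * D * (indicator C x * G x)"
    proof (cases "x \<in> C")
      case True
      have 1: "\<bar>a x * (pderiv_at i \<psi> x * pderiv_at j b x)\<bar> \<le> D * G x" for i j
      proof -
        have "\<bar>a x * (pderiv_at i \<psi> x * pderiv_at j b x)\<bar> = \<bar>pderiv_at i \<psi> x\<bar> * (\<bar>a x\<bar> * \<bar>pderiv_at j b x\<bar>)"
          by (simp add: abs_mult)
        also have "\<dots> \<le> D * G x" using D[of i x] le[OF True, of j] by (intro mult_mono) (auto intro: order_trans[OF abs_ge_zero])
        finally show ?thesis .
      qed
      show ?thesis using 1[of 1 2] 1[of 2 1] True by (simp add: right_diff_distrib)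
    next
      case False
      then show ?thesis using pderiv_at_zero_outside[OF cl] by simp
    qed
  qed (use G jacobian_form_by_parts(1)[OF \<psi> a b] in auto)
  also have "\<dots> = 2 * D * (LINT x|lborel. indicator C x * G x)" by simp
  finally show ?thesis .
qed

lemma osc_mono:
  assumes "L12 h" "r \<le> s" shows "osc r h x \<le> osc s h x"
proof -
  have "ennreal (osc r h x) \<le> ennreal (osc s h x)"
    unfolding osc_nn_integral[OF assms(1)]
    using assms(2) by (intro nn_integral_mono ennreal_leI mult_right_mono) (auto simp: indicator_def)
  then show ?thesis using osc_nonneg by simp
qed

lemma osc_integrable:
  assumes h: "L12 h" and K: "compact C" and s: "s > 0"
  shows "integrable lborel (\<lambda>x. indicator C x * osc s h x)"
proof -
  have hm[measurable]: "h \<in> borel_measurable borel" and C[measurable]: "C \<in> sets borel"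
    using h borel_closed[OF compact_imp_closed[OF K]] by (auto simp: L12_def)
  have cf: "emeasure lborel C < \<infinity>" using K emeasure_compact_finite by blast
  let ?J = "LINT y|lborel. (h y)\<^sup>2"
  have J: "?J \<ge> 0" by simp
  have b: "osc s h x \<le> 2 * ?J + 2 * (h x)\<^sup>2 * (pi * s\<^sup>2)" for x
  proof -
    have i: "integrable lborel (\<lambda>y. indicator (ball x s) y * (h x)\<^sup>2)" "integrable lborel (\<lambda>y. (h y)\<^sup>2)"
      using h by (auto simp: L12_def emeasure_lborel_ball_finite[unfolded infinity_ennreal_def])
    have "osc s h x \<le> (LINT y|lborel. 2 * (h y)\<^sup>2 + 2 * (indicator (ball x s) y * (h x)\<^sup>2))"
      unfolding osc_def sq_dev_def set_lebesgue_integral_def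
    proof (rule integral_mono)
      show "integrable lborel (\<lambda>y. indicat_real (ball x s) y *\<^sub>R (h y - h x)\<^sup>2)"
        using L12_set_integrable(2)[OF h] by (simp add: set_integrable_def)
      fix y
      show "indicat_real (ball x s) y *\<^sub>R (h y - h x)\<^sup>2 \<le> 2 * (h y)\<^sup>2 + 2 * (indicator (ball x s) y * (h x)\<^sup>2)"
        using sum_squares_le[of "h y" "- h x"] by (auto simp: indicator_def)
    qed (use i in auto)
    also have "\<dots> = 2 * ?J + 2 * (h x)\<^sup>2 * (pi * s\<^sup>2)"
      using i s by (simp add: measure_ball_vec2)
    finally show ?thesis .
  qed
  show ?thesis
  proof (rule Bochner_Integration.integrable_bound[of _ "\<lambda>x. indicator C x * (2 * ?J) + 2 * (pi * s\<^sup>2) * (h x)\<^sup>2"])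
    show "integrable lborel (\<lambda>x. indicator C x * (2 * ?J) + 2 * (pi * s\<^sup>2) * (h x)\<^sup>2)"
      using h cf by (intro Bochner_Integration.integrable_add integrable_mult_left integrable_mult_right integrable_real_indicator) (auto simp: L12_def)
    show "AE x in lborel. norm (indicator C x * osc s h x) \<le> norm (indicator C x * (2 * ?J) + 2 * (pi * s\<^sup>2) * (h x)\<^sup>2)"
    proof (rule AE_I2)
      fix x
      show "norm (indicator C x * osc s h x) \<le> norm (indicator C x * (2 * ?J) + 2 * (pi * s\<^sup>2) * (h x)\<^sup>2)"
        using b[of x] osc_nonneg[of s h x] J by (cases "x \<in> C") (auto simp: ac_simps)
    qed
  qed measurable
qed

text \<open>The pointwise estimate has the constant 10 \<open>mollifier_const\<close>^2 pi. The
  factor 4 collects the two terms of a Jacobian and the two forms into which a dyadic step is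
  split.\<close>

definition telescope_const :: real where "telescope_const = 40 * (mollifier_const\<^sup>2 * pi)"

text \<open>Inequality of arithmetic and geometric means. The weight \<open>s\<close> balances a
  difference of mollifications at scale \<open>s\<close> against a derivative, which is larger by a
  factor of order 1/s.\<close>

lemma abs_mult_le_weighted: "s > 0 \<Longrightarrow> \<bar>p\<bar> * \<bar>q\<bar> \<le> (p\<^sup>2 / s + s * q\<^sup>2) / (2::real)"
proof -
  assume s: "s > 0"
  have "0 \<le> (\<bar>p\<bar> - s * \<bar>q\<bar>)\<^sup>2 / s" using s by simp
  also have "\<dots> = p\<^sup>2 / s + s * q\<^sup>2 - 2 * (\<bar>p\<bar> * \<bar>q\<bar>)"
    using s by (simp add: power2_diff power_mult_distrib field_simps power2_eq_square)
  finally show ?thesis by simp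
qed

lemma telescope_pointwise:
  assumes h: "L12 f" "L12 g" and s: "s > 0"
  shows "\<bar>moll s f x - moll (s/2) f x\<bar> * \<bar>pderiv_at i (moll s g) x\<bar> \<le> telescope_const / 4 * ((osc s f x + osc s g x) / s ^ 3)"
    "\<bar>moll s f x - moll (s/2) f x\<bar> * \<bar>pderiv_at i (moll (s/2) g) x\<bar> \<le> telescope_const / 4 * ((osc s f x + osc s g x) / s ^ 3)"
proof -
  let ?c = "mollifier_const\<^sup>2 * pi"
  have c: "?c \<ge> 0" by simp
  have s2: "s/2 > 0" using s by simp
  have o: "osc (s/2) f x \<le> osc s f x" "osc (s/2) g x \<le> osc s g x" using osc_mono h s by auto
  note on = osc_nonneg[of s f x] osc_nonneg[of s g x]
  have "(moll s f x - moll (s/2) f x)\<^sup>2 \<le> 2 * (moll s f x - f x)\<^sup>2 + 2 * (moll (s/2) f x - f x)\<^sup>2"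
    using sum_squares_le[of "moll s f x - f x" "f x - moll (s/2) f x"]
    by (simp add: power2_commute[of "f x"])
  also have "\<dots> \<le> 2 * (?c / s\<^sup>2 * osc s f x) + 2 * (?c / (s/2)\<^sup>2 * osc (s/2) f x)"
    using moll_diff_bound[OF h(1) s, of x] moll_diff_bound[OF h(1) s2, of x] by simp
  also have "\<dots> \<le> 2 * (?c / s\<^sup>2 * osc s f x) + 2 * (?c / (s/2)\<^sup>2 * osc s f x)"
    using o c by (intro add_left_mono mult_left_mono) auto
  \<comment> \<open>10 = 2 * 1 + 2 * 4, as halving the scale multiplies s^(-2) by 4.\<close>
  also have "\<dots> = 10 * ?c / s\<^sup>2 * osc s f x" using s by (simp add: power_divide field_simps)
  finally have d: "(moll s f x - moll (s/2) f x)\<^sup>2 \<le> 10 * ?c / s\<^sup>2 * osc s f x" .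
  have g1: "(pderiv_at i (moll s g) x)\<^sup>2 \<le> 10 * ?c / s ^ 4 * osc s g x"
  proof -
    have "(pderiv_at i (moll s g) x)\<^sup>2 \<le> ?c / s ^ 4 * osc s g x" by (rule pderiv_moll_bound[OF h(2) s])
    also have "\<dots> \<le> 10 * ?c / s ^ 4 * osc s g x"
      using on s c by (intro mult_right_mono divide_right_mono) auto
    finally show ?thesis .
  qed
  have g2: "(pderiv_at i (moll (s/2) g) x)\<^sup>2 \<le> 16 * ?c / s ^ 4 * osc s g x"
  proof -
    have "(pderiv_at i (moll (s/2) g) x)\<^sup>2 \<le> ?c / (s/2) ^ 4 * osc (s/2) g x" by (rule pderiv_moll_bound[OF h(2) s2])
    also have "\<dots> \<le> ?c / (s/2) ^ 4 * osc s g x" using o c s by (intro mult_left_mono) auto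
    also have "\<dots> = 16 * ?c / s ^ 4 * osc s g x" using s by (simp add: power_divide)
    finally show ?thesis .
  qed
  \<comment> \<open>The constant 20 covers both derivative bounds, 10 at scale \<open>s\<close> and
    16 = 2^4 at scale s/2.\<close>
  have main: "\<bar>moll s f x - moll (s/2) f x\<bar> * \<bar>q\<bar> \<le> telescope_const / 4 * ((osc s f x + osc s g x) / s ^ 3)"
    if q: "q\<^sup>2 \<le> 20 * ?c / s ^ 4 * osc s g x" for q
  proof -
    have "\<bar>moll s f x - moll (s/2) f x\<bar> * \<bar>q\<bar> \<le> ((moll s f x - moll (s/2) f x)\<^sup>2 / s + s * q\<^sup>2) / 2"
      by (rule abs_mult_le_weighted[OF s])
    also have "\<dots> \<le> ((10 * ?c / s\<^sup>2 * osc s f x) / s + s * (20 * ?c / s ^ 4 * osc s g x)) / 2"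
      using d q s by (intro divide_right_mono add_mono mult_left_mono) auto
    also have "\<dots> = ?c * ((5 * osc s f x + 10 * osc s g x) / s ^ 3)"
      using s by (simp add: field_simps power2_eq_square power3_eq_cube eval_nat_numeral)
    also have "\<dots> \<le> ?c * ((10 * osc s f x + 10 * osc s g x) / s ^ 3)"
      using on s c by (intro mult_left_mono divide_right_mono) auto
    also have "\<dots> = telescope_const / 4 * ((osc s f x + osc s g x) / s ^ 3)"
      by (simp add: telescope_const_def algebra_simps add_divide_distrib)
    finally show ?thesis .
  qed
  have w: "m * ?c / s ^ 4 * osc s g x \<le> 20 * ?c / s ^ 4 * osc s g x" if "m \<le> 20" for m
    using on s c that by (intro mult_right_mono divide_right_mono) auto
  show "\<bar>moll s f x - moll (s/2) f x\<bar> * \<bar>pderiv_at i (moll s g) x\<bar> \<le> telescope_const / 4 * ((osc s f x + osc s g x) / s ^ 3)"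
    using main g1 w[of 10] by force
  show "\<bar>moll s f x - moll (s/2) f x\<bar> * \<bar>pderiv_at i (moll (s/2) g) x\<bar> \<le> telescope_const / 4 * ((osc s f x + osc s g x) / s ^ 3)"
    using main g2 w[of 16] by force
qed

text \<open>By bilinearity and antisymmetry the difference of the two forms equals J(f_s - f_(s/2),
  g_s) - J(g_s - g_(s/2), f_(s/2)). Both differences stand in the first slot, the one that loses its
  derivative in the integration by parts.\<close>

lemma jacobian_form_step:
  assumes \<psi>: "cutoff_on C \<psi>" and D: "\<And>i x. \<bar>pderiv_at i \<psi> x\<bar> \<le> D"
    and f: "L12 f" and g: "L12 g" and s: "s > 0"
  shows "\<bar>jacobian_form \<psi> (moll s f) (moll s g) - jacobian_form \<psi> (moll (s/2) f) (moll (s/2) g)\<bar>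
    \<le> telescope_const * D * (LINT x|lborel. indicator C x * ((osc s f x + osc s g x) / s ^ 3))"
proof -
  have C: "compact C" using \<psi> by (simp add: cutoff_on_def)
  have sm: "Ck_on k UNIV (moll s f)" "Ck_on k UNIV (moll s g)" "Ck_on k UNIV (moll (s/2) f)" "Ck_on k UNIV (moll (s/2) g)" for k
    using f g s by (auto simp: L12_def intro!: Ck_on_moll)
  define F where "F x = moll s f x - moll (s/2) f x" for x
  define G where "G x = moll s g x - moll (s/2) g x" for x
  have FG: "Ck_on k UNIV F" "Ck_on k UNIV G" for k
    unfolding F_def[abs_def] G_def[abs_def] by (intro Ck_on_diff sm open_UNIV)+
  have pd: "pderiv_at i F x = pderiv_at i (moll s f) x - pderiv_at i (moll (s/2) f) x"
    "pderiv_at i G x = pderiv_at i (moll s g) x - pderiv_at i (moll (s/2) g) x" for i x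
    unfolding F_def[abs_def] G_def[abs_def] using sm[of 1] by (auto intro!: pderiv_at_diff)
  have int: "integrable lborel (\<lambda>x. \<psi> x * jac a b x)" if "Ck_on 1 UNIV a" "Ck_on 1 UNIV b" for a b
    by (rule integrable_jac[OF \<psi> open_UNIV subset_UNIV that])
  have "jacobian_form \<psi> F (moll s g) - jacobian_form \<psi> G (moll (s/2) f)
     = (LINT x|lborel. \<psi> x * jac F (moll s g) x - \<psi> x * jac G (moll (s/2) f) x)"
    unfolding jacobian_form_def using int[OF FG(1) sm(2)] int[OF FG(2) sm(3)] by simp
  also have "\<dots> = (LINT x|lborel. \<psi> x * jac (moll s f) (moll s g) x - \<psi> x * jac (moll (s/2) f) (moll (s/2) g) x)"
    by (intro Bochner_Integration.integral_cong) (auto simp: jac_def pd algebra_simps)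
  also have "\<dots> = jacobian_form \<psi> (moll s f) (moll s g) - jacobian_form \<psi> (moll (s/2) f) (moll (s/2) g)"
    unfolding jacobian_form_def using int[OF sm(1,2)] int[OF sm(3,4)] by simp
  finally have eq: "jacobian_form \<psi> (moll s f) (moll s g) - jacobian_form \<psi> (moll (s/2) f) (moll (s/2) g) =
    jacobian_form \<psi> F (moll s g) - jacobian_form \<psi> G (moll (s/2) f)" ..
  have oi: "integrable lborel (\<lambda>x. indicator C x * (telescope_const / 4 * ((osc s f x + osc s g x) / s ^ 3)))"
    using integrable_mult_right[OF Bochner_Integration.integrable_add[OF osc_integrable[OF f C s] osc_integrable[OF g C s]], of "telescope_const / 4 / s ^ 3"]
    by (rule back_subst[of "integrable lborel"]) (auto simp: field_simps)
  have 1: "\<bar>jacobian_form \<psi> F (moll s g)\<bar> \<le> 2 * D * (LINT x|lborel. indicator C x * (telescope_const / 4 * ((osc s f x + osc s g x) / s ^ 3)))"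
    using telescope_pointwise(1)[OF f g s] by (intro jacobian_form_bound[OF \<psi> D FG(1) sm(2) oi]) (simp add: F_def)
  have 2: "\<bar>jacobian_form \<psi> G (moll (s/2) f)\<bar> \<le> 2 * D * (LINT x|lborel. indicator C x * (telescope_const / 4 * ((osc s f x + osc s g x) / s ^ 3)))"
    using telescope_pointwise(2)[OF g f s] by (intro jacobian_form_bound[OF \<psi> D FG(2) sm(3) oi]) (simp add: G_def add.commute)
  have "(LINT x|lborel. indicator C x * (telescope_const / 4 * ((osc s f x + osc s g x) / s ^ 3)))
     = telescope_const / 4 * (LINT x|lborel. indicator C x * ((osc s f x + osc s g x) / s ^ 3))"
    by (simp only: integral_mult_right_zero[symmetric] mult.left_commute)
  then show ?thesis unfolding eq using 1 2 by (simp add: abs_diff_le_iff algebra_simps) linarith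
qed

lemma cutoff_on_pderiv_bound:
  assumes "cutoff_on C \<psi>"
  obtains D where "D > 0" "\<And>i x. \<bar>pderiv_at i \<psi> x\<bar> \<le> D"
proof -
  have C: "compact C" "closed C" "Ck_on 1 UNIV \<psi>" "\<And>x. x \<notin> C \<Longrightarrow> \<psi> x = 0"
    using assms compact_imp_closed by (auto simp: cutoff_on_def)
  obtain R where R: "\<And>x. x \<in> C \<Longrightarrow> norm x \<le> R"
    using compact_imp_bounded[OF C(1)] unfolding bounded_iff by blast
  have "\<exists>B. \<forall>x. \<bar>pderiv_at i \<psi> x\<bar> \<le> B" for i
  proof -
    have c: "continuous_on UNIV (pderiv_at i \<psi>)" using C(3) by simp
    have z: "pderiv_at i \<psi> x = 0" if "norm x > R" for x
      using R[of x] that by (intro pderiv_at_zero_outside[OF C(2,4)]) auto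
    show ?thesis using bounded_compact_support[OF c z] by metis
  qed
  then obtain B where B: "\<And>i x. \<bar>pderiv_at i \<psi> x\<bar> \<le> B i" by metis
  have "\<bar>pderiv_at i \<psi> x\<bar> \<le> max (B 1) (B 2) + 1" for i x
    using B[of i x] exhaust_2[of i] by auto
  moreover have "max (B 1) (B 2) + 1 > 0" using B[of 1 0] by (smt (verit))
  ultimately show thesis by (rule that[rotated])
qed

lemma integral_uniform_limit:
  fixes \<psi> g :: "real^2 \<Rightarrow> real"
  assumes \<psi>: "cutoff_on C \<psi>" and lim: "uniform_limit C G g sequentially"
    and int: "\<forall>\<^sub>F k in sequentially. integrable lborel (\<lambda>x. \<psi> x * G k x)" "integrable lborel (\<lambda>x. \<psi> x * g x)"
  shows "(\<lambda>k. LINT x|lborel. \<psi> x * G k x) \<longlonglongrightarrow> (LINT x|lborel. \<psi> x * g x)"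
proof (rule tendstoI)
  fix e :: real assume e: "e > 0"
  have C: "compact C" "Ck_on 1 UNIV \<psi>" "\<And>x. x \<notin> C \<Longrightarrow> \<psi> x = 0" using \<psi> by (auto simp: cutoff_on_def)
  obtain R where R: "\<And>x. x \<in> C \<Longrightarrow> norm x \<le> R"
    using compact_imp_bounded[OF C(1)] unfolding bounded_iff by blast
  have pi: "integrable lborel \<psi>"
    using Ck_on_SucD[of 0 UNIV \<psi>] C R by (intro integrable_compact_support[where R=R]) force+
  let ?I = "LINT x|lborel. \<bar>\<psi> x\<bar>"
  have I: "?I \<ge> 0" by simp
  have "e / (?I + 1) > 0" using div_succ_mult_less(1)[OF e I] .
  then have "\<forall>\<^sub>F k in sequentially. \<forall>x\<in>C. dist (G k x) (g x) < e / (?I + 1)"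
    by (rule uniform_limitD[OF lim])
  then show "\<forall>\<^sub>F k in sequentially. dist (LINT x|lborel. \<psi> x * G k x) (LINT x|lborel. \<psi> x * g x) < e"
    using int(1)
  proof eventually_elim
    case (elim k)
    have "\<bar>LINT x|lborel. \<psi> x * G k x - \<psi> x * g x\<bar> \<le> (LINT x|lborel. e / (?I + 1) * \<bar>\<psi> x\<bar>)"
    proof (rule integral_abs_bound_integral)
      fix x
      show "\<bar>\<psi> x * G k x - \<psi> x * g x\<bar> \<le> e / (?I + 1) * \<bar>\<psi> x\<bar>"
      proof (cases "x \<in> C")
        case True
        then have "\<bar>\<psi> x\<bar> * \<bar>G k x - g x\<bar> \<le> \<bar>\<psi> x\<bar> * (e / (?I + 1))"
          using elim(1) by (intro mult_left_mono) (auto simp: dist_real_def less_imp_le)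
        then show ?thesis by (simp add: abs_mult[symmetric] algebra_simps)
      qed (simp add: C)
    qed (use elim(2) int(2) pi in auto)
    also have "\<dots> < e" using div_succ_mult_less(2)[OF e I] by simp
    finally show ?case using elim(2) int(2) by (simp add: dist_real_def)
  qed
qed

lemma uniform_limit_jac:
  assumes C: "compact C" "C \<subseteq> U" and c: "Ck_on 1 U a" "Ck_on 1 U b"
    and A: "\<And>i. uniform_limit C (\<lambda>k. pderiv_at i (A k)) (pderiv_at i a) sequentially"
    and B: "\<And>i. uniform_limit C (\<lambda>k. pderiv_at i (B k)) (pderiv_at i b) sequentially"
  shows "uniform_limit C (\<lambda>k. jac (A k) (B k)) (jac a b) sequentially"
proof -
  have bd: "bounded (pderiv_at i h ` C)" if "Ck_on 1 U h" for h :: "real^2 \<Rightarrow> real" and i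
    using that C by (intro compact_imp_bounded compact_continuous_image) (auto intro: continuous_on_subset)
  show ?thesis unfolding jac_def[abs_def]
    by (intro uniform_limit_minus uniform_lim_mult A B bd c)
qed

lemma uniform_limit_pderiv_moll_restr:
  assumes U: "open U" "K \<subseteq> U" "compact K" and h: "Ck_on 1 U h" and t: "t > 0" "\<And>x. x \<in> C \<Longrightarrow> ball x t \<subseteq> K"
    and s: "s \<longlonglongrightarrow> 0" "\<And>k. s k > (0::real)"
  shows "uniform_limit C (\<lambda>k. pderiv_at i (moll (s k) (restr K h))) (pderiv_at i h) sequentially"
proof -
  have hc: "continuous_on K (pderiv_at i h)" using h U(2) by (auto intro: continuous_on_subset)
  have lim: "uniform_limit C (\<lambda>k. moll (s k) (restr K (pderiv_at i h))) (pderiv_at i h) sequentially"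
    by (rule moll_uniform_limit[OF U(3) hc t s])
  have "\<forall>\<^sub>F k in sequentially. s k < t" using order_tendstoD(2)[OF s(1) t(1)] .
  then have "\<forall>\<^sub>F k in sequentially. \<forall>x\<in>C. moll (s k) (restr K (pderiv_at i h)) x = pderiv_at i (moll (s k) (restr K h)) x"
  proof eventually_elim
    case (elim k)
    show ?case
    proof
      fix x assume "x \<in> C"
      then have "cball x (s k) \<subseteq> K" using t(2)[of x] elim by (force simp: subset_iff)
      then show "moll (s k) (restr K (pderiv_at i h)) x = pderiv_at i (moll (s k) (restr K h)) x"
        using pderiv_moll_restr[OF U h s(2)] by simp
    qed
  qed
  from uniform_limit_cong[OF this refl] lim show ?thesis by blast
qed

lemma jacobian_form_moll_limit:
  assumes \<psi>: "cutoff_on C \<psi>" and U: "open U" "K \<subseteq> U" "compact K" and ab: "Ck_on 1 U a" "Ck_on 1 U b"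
    and t: "t > 0" "\<And>x. x \<in> C \<Longrightarrow> ball x t \<subseteq> K" and s: "s \<longlonglongrightarrow> 0" "\<And>k. s k > (0::real)"
  shows "(\<lambda>k. jacobian_form \<psi> (moll (s k) (restr K a)) (moll (s k) (restr K b))) \<longlonglongrightarrow> jacobian_form \<psi> a b"
  unfolding jacobian_form_def
proof (rule integral_uniform_limit[OF \<psi>])
  have C: "compact C" "C \<subseteq> U" using \<psi> t U(2) centre_in_ball[of _ t] unfolding cutoff_on_def by blast+
  show "uniform_limit C (\<lambda>k. jac (moll (s k) (restr K a)) (moll (s k) (restr K b))) (jac a b) sequentially"
    by (rule uniform_limit_jac[OF C ab uniform_limit_pderiv_moll_restr[OF U ab(1) t s] uniform_limit_pderiv_moll_restr[OF U ab(2) t s]])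
  show "integrable lborel (\<lambda>x. \<psi> x * jac a b x)" by (rule integrable_jac[OF \<psi> U(1) C(2) ab])
  have "L12 (restr K a)" "L12 (restr K b)"
    using ab Ck_on_SucD[of 0 U] U by (auto intro!: L12_restr intro: continuous_on_subset)
  then show "\<forall>\<^sub>F k in sequentially. integrable lborel (\<lambda>x. \<psi> x * jac (moll (s k) (restr K a)) (moll (s k) (restr K b)) x)"
    using s(2) by (intro always_eventually allI integrable_jac[OF \<psi> open_UNIV subset_UNIV] Ck_on_moll) (auto simp: L12_def)
qed

text \<open>Telescoping over dyadic scales: consecutive differences only see mean oscillations, and
  these add up to the near-diagonal energy. This replaces the harmonic-extension proof of the
  Brezis--Nguyen estimate.\<close>

lemma jacobian_form_near_energy:
  assumes \<psi>: "cutoff_on C \<psi>" and D: "\<And>i x. \<bar>pderiv_at i \<psi> x\<bar> \<le> D" "D > 0"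
    and U: "open U" "closure V \<subseteq> U" and V: "open V" "compact (closure V)"
    and ab: "Ck_on 1 U a" "Ck_on 1 U b" and t: "t > 0" "\<And>x. x \<in> C \<Longrightarrow> ball x t \<subseteq> V"
  shows "ennreal \<bar>jacobian_form \<psi> (moll t (restr (closure V) a)) (moll t (restr (closure V) b)) - jacobian_form \<psi> a b\<bar>
    \<le> ennreal (2 * telescope_const * D) * (near_energy V t a + near_energy V t b)"
proof -
  let ?K = "closure V"
  let ?A = "restr ?K a" and ?B = "restr ?K b"
  have VK: "V \<subseteq> ?K" by (rule closure_subset)
  have C: "compact C" "C \<in> sets borel" using \<psi> borel_closed compact_imp_closed by (auto simp: cutoff_on_def)
  note C(2)[measurable]
  have L: "L12 ?A" "L12 ?B"
    using ab Ck_on_SucD[of 0 U] U V by (auto intro!: L12_restr intro: continuous_on_subset)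
  have hm[measurable]: "?A \<in> borel_measurable borel" "?B \<in> borel_measurable borel" using L by (auto simp: L12_def)
  have tc: "telescope_const * D \<ge> 0" using D by (simp add: telescope_const_def)
  define s where "s j = t / 2 ^ j" for j :: nat
  have s: "s j > 0" for j using t by (simp add: s_def)
  define J where "J j = jacobian_form \<psi> (moll (s j) ?A) (moll (s j) ?B)" for j
  have sS: "s (Suc j) = s j / 2" for j by (simp add: s_def)
  have d: "ennreal \<bar>J j - J (Suc j)\<bar> \<le> ennreal (telescope_const * D) *
     ((\<integral>\<^sup>+x\<in>C. ennreal (osc (s j) ?A x / s j ^ 3) \<partial>lborel) + (\<integral>\<^sup>+x\<in>C. ennreal (osc (s j) ?B x / s j ^ 3) \<partial>lborel))" for j
  proof -
    have i: "integrable lborel (\<lambda>x. indicator C x * ((osc (s j) ?A x + osc (s j) ?B x) / s j ^ 3))"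
      using Bochner_Integration.integrable_add[OF osc_integrable[OF L(1) C(1) s] osc_integrable[OF L(2) C(1) s], of j j]
      by (simp add: distrib_left[symmetric])
    have "\<bar>J j - J (Suc j)\<bar> \<le> telescope_const * D * (LINT x|lborel. indicator C x * ((osc (s j) ?A x + osc (s j) ?B x) / s j ^ 3))"
      unfolding J_def sS by (rule jacobian_form_step[OF \<psi> D(1) L s])
    then have "ennreal \<bar>J j - J (Suc j)\<bar> \<le> ennreal (telescope_const * D) * ennreal (LINT x|lborel. indicator C x * ((osc (s j) ?A x + osc (s j) ?B x) / s j ^ 3))"
      using tc by (simp add: ennreal_mult'[symmetric] ennreal_leI)
    also have "ennreal (LINT x|lborel. indicator C x * ((osc (s j) ?A x + osc (s j) ?B x) / s j ^ 3))
       = (\<integral>\<^sup>+x. ennreal (indicator C x * ((osc (s j) ?A x + osc (s j) ?B x) / s j ^ 3)) \<partial>lborel)"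
      using s[of j] by (intro nn_integral_eq_integral[OF i, symmetric]) (auto simp: osc_nonneg intro!: AE_I2 divide_nonneg_nonneg add_nonneg_nonneg mult_nonneg_nonneg)
    also have "\<dots> = (\<integral>\<^sup>+x. ennreal (osc (s j) ?A x / s j ^ 3) * indicator C x + ennreal (osc (s j) ?B x / s j ^ 3) * indicator C x \<partial>lborel)"
    proof (rule nn_integral_cong)
      fix x
      have "ennreal ((osc (s j) ?A x + osc (s j) ?B x) / s j ^ 3) = ennreal (osc (s j) ?A x / s j ^ 3) + ennreal (osc (s j) ?B x / s j ^ 3)"
        unfolding add_divide_distrib using s[of j] by (intro ennreal_plus divide_nonneg_nonneg osc_nonneg) auto
      then show "ennreal (indicator C x * ((osc (s j) ?A x + osc (s j) ?B x) / s j ^ 3)) =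
        ennreal (osc (s j) ?A x / s j ^ 3) * indicator C x + ennreal (osc (s j) ?B x / s j ^ 3) * indicator C x"
        by (cases "x \<in> C") auto
    qed
    also have "\<dots> = (\<integral>\<^sup>+x\<in>C. ennreal (osc (s j) ?A x / s j ^ 3) \<partial>lborel) + (\<integral>\<^sup>+x\<in>C. ennreal (osc (s j) ?B x / s j ^ 3) \<partial>lborel)"
      using C(2) by (intro nn_integral_add) measurable
    finally show ?thesis .
  qed
  have sub: "C \<subseteq> V" using t by (meson centre_in_ball subset_iff)
  have Vb: "V \<in> sets borel" using V by simp
  have nr: "near_energy V t ?A = near_energy V t a" "near_energy V t ?B = near_energy V t b"
    using VK by (auto intro!: near_energy_cong simp: restr_def subset_iff)
  have tele: "ennreal \<bar>J 0 - J n\<bar> \<le> ennreal (2 * telescope_const * D) * (near_energy V t a + near_energy V t b)" for n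
  proof -
    have "\<bar>J 0 - J n\<bar> \<le> (\<Sum>j<n. \<bar>J j - J (Suc j)\<bar>)"
      using sum_abs[of "\<lambda>j. J j - J (Suc j)" "{..<n}"] sum_lessThan_telescope'[of J n] by simp
    then have "ennreal \<bar>J 0 - J n\<bar> \<le> (\<Sum>j<n. ennreal \<bar>J j - J (Suc j)\<bar>)"
      by (subst sum_ennreal) (auto intro: ennreal_leI)
    also have "\<dots> \<le> (\<Sum>j<n. ennreal (telescope_const * D) *
     ((\<integral>\<^sup>+x\<in>C. ennreal (osc (s j) ?A x / s j ^ 3) \<partial>lborel) + (\<integral>\<^sup>+x\<in>C. ennreal (osc (s j) ?B x / s j ^ 3) \<partial>lborel)))"
      by (intro sum_mono d)
    also have "\<dots> = ennreal (telescope_const * D) * ((\<Sum>j<n. \<integral>\<^sup>+x\<in>C. ennreal (osc (s j) ?A x / s j ^ 3) \<partial>lborel)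
       + (\<Sum>j<n. \<integral>\<^sup>+x\<in>C. ennreal (osc (s j) ?B x / s j ^ 3) \<partial>lborel))"
      by (simp add: sum_distrib_left[symmetric] sum.distrib)
    also have "\<dots> \<le> ennreal (telescope_const * D) * (2 * near_energy V t ?A + 2 * near_energy V t ?B)"
      unfolding s_def by (intro mult_left_mono add_mono sum_osc_le_near_energy[OF _ C(2) sub Vb t(2,1)] L) auto
    also have "\<dots> = ennreal (2 * telescope_const * D) * (near_energy V t a + near_energy V t b)"
    proof -
      have "ennreal (2 * telescope_const * D) = 2 * ennreal (telescope_const * D)"
        using ennreal_mult[of 2 "telescope_const * D"] tc by (simp add: mult.assoc)
      then show ?thesis unfolding nr by (simp only: distrib_left mult.assoc mult.left_commute)
    qed
    finally show ?thesis .
  qed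
  \<comment> \<open>The bound on the partial sums does not depend on \<open>n\<close>, and as the
    scales tend to 0 the C^1 regularity of \<open>a\<close> and \<open>b\<close> removes the
    mollification.\<close>
  have "J \<longlonglongrightarrow> jacobian_form \<psi> a b"
    unfolding J_def
  proof (rule jacobian_form_moll_limit[OF \<psi> U(1) U(2) V(2) ab t(1) _ _ s])
    show "s \<longlonglongrightarrow> 0" unfolding s_def
      using tendsto_mult_left[OF LIMSEQ_power_zero[of "1/2::real"], of t] by (simp add: power_divide)
    show "ball x t \<subseteq> ?K" if "x \<in> C" for x using t(2)[OF that] VK by blast
  qed
  then have "(\<lambda>n. ennreal \<bar>J 0 - J n\<bar>) \<longlonglongrightarrow> ennreal \<bar>J 0 - jacobian_form \<psi> a b\<bar>"
    by (intro tendsto_intros tendsto_ennrealI)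
  then have "ennreal \<bar>J 0 - jacobian_form \<psi> a b\<bar> \<le> ennreal (2 * telescope_const * D) * (near_energy V t a + near_energy V t b)"
    by (rule Lim_bounded[where M=0]) (use tele in blast)
  then show ?thesis by (simp add: J_def s_def)
qed

text \<open>At a fixed scale the kernel is bounded, so L^2 convergence already yields uniform
  convergence of derivatives: \<open>conv_dev_bound\<close> with c = 0 is applied to the
  difference.\<close>

lemma uniform_limit_pderiv_moll_L2:
  assumes V: "open V" "compact (closure V)" and t: "t > 0" "\<And>x. x \<in> C \<Longrightarrow> ball x t \<subseteq> V"
    and A: "\<forall>\<^sub>F k in sequentially. continuous_on (closure V) (A k)" and a: "continuous_on (closure V) a"
    and lim: "(\<lambda>k. L2_norm_sq V (\<lambda>x. A k x - a x)) \<longlonglongrightarrow> 0"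
  shows "uniform_limit C (\<lambda>k. pderiv_at i (moll t (restr (closure V) (A k)))) (pderiv_at i (moll t (restr (closure V) a))) sequentially"
proof (rule uniform_limitI)
  let ?K = "closure V"
  have VK: "V \<subseteq> ?K" by (rule closure_subset)
  fix e :: real assume e: "e > 0"
  let ?c = "(mollifier_const / t ^ 3)\<^sup>2 * (pi * t\<^sup>2)"
  have c: "?c \<ge> 0" by simp
  define q where "q = e\<^sup>2 / (?c + 1)"
  have q: "q > 0" "q * ?c < e\<^sup>2" using div_succ_mult_less[OF _ c, of "e\<^sup>2"] e unfolding q_def by auto
  from A ennreal_tendsto_0D[OF lim q(1)]
  show "\<forall>\<^sub>F k in sequentially. \<forall>x\<in>C. dist (pderiv_at i (moll t (restr ?K (A k))) x) (pderiv_at i (moll t (restr ?K a)) x) < e"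
  proof eventually_elim
    case (elim k)
    let ?H = "restr ?K (\<lambda>x. A k x - a x)"
    have L: "L12 ?H" "L12 (restr ?K (A k))" "L12 (restr ?K a)"
      using elim(1) a by (auto intro!: L12_restr V continuous_intros)
    show ?case
    proof
      fix x assume x: "x \<in> C"
      have "ennreal (sq_dev t ?H x 0) = (\<integral>\<^sup>+y. ennreal (indicator (ball x t) y *\<^sub>R (?H y - 0)\<^sup>2) \<partial>lborel)"
        unfolding sq_dev_def set_lebesgue_integral_def
        using L12_set_integrable(2)[OF L(1), of x t 0] unfolding set_integrable_def
        by (intro nn_integral_eq_integral[symmetric]) auto
      also have "\<dots> \<le> L2_norm_sq V (\<lambda>x. A k x - a x)"
        unfolding L2_norm_sq_def using t(2)[OF x] VK
        by (intro nn_integral_mono) (auto simp: restr_def indicator_def subset_iff)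
      also have "\<dots> \<le> ennreal q" by (rule elim(2))
      finally have sq: "sq_dev t ?H x 0 \<le> q" using q(1) by (simp add: ennreal_le_iff)
      have ic: "integrable lborel (\<lambda>y. pderiv_at i (mollifier t) (x - y) * h y)" if "integrable lborel h" for h
        by (rule integrable_conv[where R=t, OF mollifier_continuous(2) pderiv_mollifier_outside[OF t(1)] that]) auto
      have "conv (pderiv_at i (mollifier t)) ?H x = conv (pderiv_at i (mollifier t)) (restr ?K (A k)) x - conv (pderiv_at i (mollifier t)) (restr ?K a) x"
      proof -
        have "?H y = restr ?K (A k) y - restr ?K a y" for y by (simp add: restr_def right_diff_distrib)
        then show ?thesis unfolding conv_def using ic L by (simp add: right_diff_distrib L12_def)
      qed
      then have eq: "conv (pderiv_at i (mollifier t)) ?H x = pderiv_at i (moll t (restr ?K (A k))) x - pderiv_at i (moll t (restr ?K a)) x"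
        using L t(1) by (simp add: pderiv_moll L12_def)
      have "(conv (pderiv_at i (mollifier t)) ?H x - 0 * (LINT y|lborel. pderiv_at i (mollifier t) y))\<^sup>2 \<le> ?c * sq_dev t ?H x 0"
        by (rule conv_dev_bound[OF L(1) t(1) mollifier_continuous(2) mollifier_bounds(2)[OF t(1)] pderiv_mollifier_outside'[OF t(1)]])
      also have "\<dots> \<le> ?c * q" using sq c by (intro mult_left_mono)
      also have "\<dots> < e\<^sup>2" using q(2) by (simp add: mult.commute)
      finally have "(pderiv_at i (moll t (restr ?K (A k))) x - pderiv_at i (moll t (restr ?K a)) x)\<^sup>2 < e\<^sup>2"
        unfolding eq by simp
      then have "\<bar>pderiv_at i (moll t (restr ?K (A k))) x - pderiv_at i (moll t (restr ?K a)) x\<bar> < e"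
        using e abs_square_less_1 by (metis abs_le_square_iff abs_of_pos linorder_not_less)
      then show "dist (pderiv_at i (moll t (restr ?K (A k))) x) (pderiv_at i (moll t (restr ?K a)) x) < e"
        by (simp add: dist_real_def)
    qed
  qed
qed

definition L2_tame :: "(real^2) set \<Rightarrow> (nat \<Rightarrow> real^2 \<Rightarrow> real) \<Rightarrow> (real^2 \<Rightarrow> real) \<Rightarrow> bool" where
  "L2_tame V A a \<longleftrightarrow> (\<lambda>k. L2_norm_sq V (\<lambda>x. A k x - a x)) \<longlonglongrightarrow> 0 \<and> tame V A"

lemma jacobian_form_moll_L2:
  assumes \<psi>: "cutoff_on C \<psi>" and V: "open V" "compact (closure V)" and t: "t > 0" "\<And>x. x \<in> C \<Longrightarrow> ball x t \<subseteq> V"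
    and A: "\<forall>\<^sub>F k in sequentially. continuous_on (closure V) (A k)" and B: "\<forall>\<^sub>F k in sequentially. continuous_on (closure V) (B k)"
    and a: "continuous_on (closure V) a" and b: "continuous_on (closure V) b"
    and lim: "(\<lambda>k. L2_norm_sq V (\<lambda>x. A k x - a x)) \<longlonglongrightarrow> 0" "(\<lambda>k. L2_norm_sq V (\<lambda>x. B k x - b x)) \<longlonglongrightarrow> 0"
  shows "(\<lambda>k. jacobian_form \<psi> (moll t (restr (closure V) (A k))) (moll t (restr (closure V) (B k))))
     \<longlonglongrightarrow> jacobian_form \<psi> (moll t (restr (closure V) a)) (moll t (restr (closure V) b))"
  unfolding jacobian_form_def
proof (rule integral_uniform_limit[OF \<psi>])
  let ?K = "closure V"
  have sm: "Ck_on 1 UNIV (moll t (restr ?K h))" if "continuous_on ?K h" for h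
    using L12_restr[OF V(2) that] by (intro Ck_on_moll t) (simp add: L12_def)
  have C: "compact C" using \<psi> by (simp add: cutoff_on_def)
  show "uniform_limit C (\<lambda>k. jac (moll t (restr ?K (A k))) (moll t (restr ?K (B k)))) (jac (moll t (restr ?K a)) (moll t (restr ?K b))) sequentially"
    by (rule uniform_limit_jac[OF C subset_UNIV sm[OF a] sm[OF b] uniform_limit_pderiv_moll_L2[OF V t A a lim(1)] uniform_limit_pderiv_moll_L2[OF V t B b lim(2)]])
  show "integrable lborel (\<lambda>x. \<psi> x * jac (moll t (restr ?K a)) (moll t (restr ?K b)) x)"
    by (rule integrable_jac[OF \<psi> open_UNIV subset_UNIV sm[OF a] sm[OF b]])
  from A B show "\<forall>\<^sub>F k in sequentially. integrable lborel (\<lambda>x. \<psi> x * jac (moll t (restr ?K (A k))) (moll t (restr ?K (B k))) x)"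
    by eventually_elim (rule integrable_jac[OF \<psi> open_UNIV subset_UNIV sm sm])
qed

text \<open>The tame energies determine a scale \<open>t\<close> at which mollifying changes every
  form by little, uniformly in \<open>k\<close>. At this fixed scale both sequences of forms
  converge to the same number, the form of the mollified limits. The limits \<open>a\<close>,
  \<open>b\<close> are only continuous, so no Jacobian of theirs is available to compare
  with.\<close>

lemma jacobian_form_compare:
  assumes \<psi>: "cutoff_on C \<psi>" and U: "open U" "closure V \<subseteq> U" and V: "open V" "compact (closure V)"
    and t0: "t0 > 0" "\<And>x. x \<in> C \<Longrightarrow> ball x t0 \<subseteq> V"
    and ck: "\<forall>\<^sub>F k in sequentially. Ck_on 1 U (A k) \<and> Ck_on 1 U (B k) \<and> Ck_on 1 U (A' k) \<and> Ck_on 1 U (B' k)"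
    and a: "continuous_on (closure V) a" and b: "continuous_on (closure V) b"
    and lim: "L2_tame V A a" "L2_tame V B b" "L2_tame V A' a" "L2_tame V B' b"
  shows "(\<lambda>k. jacobian_form \<psi> (A k) (B k) - jacobian_form \<psi> (A' k) (B' k)) \<longlonglongrightarrow> 0"
proof (rule tendstoI)
  fix e :: real assume e: "e > 0"
  obtain D where D: "D > 0" "\<And>i x. \<bar>pderiv_at i \<psi> x\<bar> \<le> D" using cutoff_on_pderiv_bound[OF \<psi>] by blast
  define c where "c = 2 * telescope_const * D"
  have c: "c > 0" using D mollifier_const_pos by (simp add: c_def telescope_const_def)
  \<comment> \<open>Then c (q + q) = e/8. Four errors of size at most e/8 are added below: two from
    mollifying, two from the limits at fixed scale.\<close>
  define q where "q = e / (16 * c)"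
  have q: "q > 0" using e c by (simp add: q_def)
  have "\<exists>\<delta>>0. \<forall>\<^sub>F k in sequentially. near_energy V \<delta> (h k) \<le> ennreal q" if "L2_tame V h l" for h l
    using that q unfolding L2_tame_def tame_def by blast
  then obtain d1 d2 d3 d4 where d: "d1 > 0" "d2 > 0" "d3 > 0" "d4 > 0"
    "\<forall>\<^sub>F k in sequentially. near_energy V d1 (A k) \<le> ennreal q" "\<forall>\<^sub>F k in sequentially. near_energy V d2 (B k) \<le> ennreal q"
    "\<forall>\<^sub>F k in sequentially. near_energy V d3 (A' k) \<le> ennreal q" "\<forall>\<^sub>F k in sequentially. near_energy V d4 (B' k) \<le> ennreal q"
    using lim by metis
  define t where "t = Min {t0, d1, d2, d3, d4}"
  have t: "t > 0" "t \<le> t0" "t \<le> d1" "t \<le> d2" "t \<le> d3" "t \<le> d4" using d t0 by (auto simp: t_def)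
  have tV: "ball x t \<subseteq> V" if "x \<in> C" for x using t0(2)[OF that] t(2) by (meson order_trans subset_ball)
  have cc: "continuous_on (closure V) h" if "Ck_on 1 U h" for h :: "real^2 \<Rightarrow> real"
    using that Ck_on_SucD[of 0 U h] U(2) by (auto intro: continuous_on_subset)
  have near: "\<bar>jacobian_form \<psi> (moll t (restr (closure V) f)) (moll t (restr (closure V) g)) - jacobian_form \<psi> f g\<bar> \<le> e / 8"
    if fg: "Ck_on 1 U f" "Ck_on 1 U g" "near_energy V d f \<le> ennreal q" "near_energy V d' g \<le> ennreal q" "t \<le> d" "t \<le> d'" for f g d d'
  proof -
    have "ennreal \<bar>jacobian_form \<psi> (moll t (restr (closure V) f)) (moll t (restr (closure V) g)) - jacobian_form \<psi> f g\<bar>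
      \<le> ennreal c * (near_energy V t f + near_energy V t g)"
      unfolding c_def by (rule jacobian_form_near_energy[OF \<psi> D(2,1) U V fg(1,2) t(1) tV])
    also have "\<dots> \<le> ennreal c * (ennreal q + ennreal q)"
      using near_energy_mono[of V V t d f] near_energy_mono[of V V t d' g] fg
      by (intro mult_left_mono add_mono) auto
    also have "\<dots> = ennreal (e / 8)"
      using c q e by (simp flip: ennreal_plus ennreal_mult add: q_def)
    finally show ?thesis using e by (simp add: ennreal_le_iff)
  qed
  let ?J = "\<lambda>f g. jacobian_form \<psi> (moll t (restr (closure V) f)) (moll t (restr (closure V) g))"
  have cA: "\<forall>\<^sub>F k in sequentially. continuous_on (closure V) (A k)" "\<forall>\<^sub>F k in sequentially. continuous_on (closure V) (B k)"
    "\<forall>\<^sub>F k in sequentially. continuous_on (closure V) (A' k)" "\<forall>\<^sub>F k in sequentially. continuous_on (closure V) (B' k)"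
    using ck by (auto elim!: eventually_mono intro: cc)
  have l1: "(\<lambda>k. ?J (A k) (B k)) \<longlonglongrightarrow> ?J a b"
    using lim by (intro jacobian_form_moll_L2[OF \<psi> V t(1) tV cA(1,2) a b]) (auto simp: L2_tame_def)
  have l2: "(\<lambda>k. ?J (A' k) (B' k)) \<longlonglongrightarrow> ?J a b"
    using lim by (intro jacobian_form_moll_L2[OF \<psi> V t(1) tV cA(3,4) a b]) (auto simp: L2_tame_def)
  have e8: "e / 8 > 0" using e by simp
  from tendstoD[OF l1 e8] tendstoD[OF l2 e8] ck d(5-8)
  show "\<forall>\<^sub>F k in sequentially. dist (jacobian_form \<psi> (A k) (B k) - jacobian_form \<psi> (A' k) (B' k)) 0 < e"
  proof eventually_elim
    case (elim k)
    have "\<bar>?J (A k) (B k) - jacobian_form \<psi> (A k) (B k)\<bar> \<le> e / 8"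
      using elim t by (intro near[of _ _ d1 d2]) auto
    moreover have "\<bar>?J (A' k) (B' k) - jacobian_form \<psi> (A' k) (B' k)\<bar> \<le> e / 8"
      using elim t by (intro near[of _ _ d3 d4]) auto
    ultimately show ?case using elim(1,2) e unfolding dist_real_def by linarith
  qed
qed

section \<open>Change of variables\<close>

lemma matrix_frechet_nth:
  fixes h :: "real^'n \<Rightarrow> real^'m"
  assumes "h differentiable (at x)"
  shows "matrix (frechet_derivative h (at x)) $ i $ j = pderiv_at j (\<lambda>x. h x $ i) x"
proof -
  have "pderiv_at j (\<lambda>x. h x $ i) x = pderiv_at j h x $ i"
    by (rule pderiv_at_bounded_linear[OF bounded_linear_vec_nth assms])
  then show ?thesis by (simp add: matrix_def pderiv_at_def)
qed

lemma jacobian_det_eq_jac: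
  assumes "h differentiable (at x)"
  shows "jacobian_det h x = jac (\<lambda>x. h x $ 1) (\<lambda>x. h x $ 2) x"
  unfolding jacobian_det_def det_2 jac_def by (simp add: matrix_frechet_nth[OF assms])

lemma Ck_on_vec_nth: "open U \<Longrightarrow> Ck_on k U h \<Longrightarrow> Ck_on k U (\<lambda>x. h x $ i)"
  by (rule bounded_linear.Ck_on_compose[OF bounded_linear_vec_nth])

lemma continuous_on_jacobian_det:
  assumes "open U" "Ck_on 1 U h"
  shows "continuous_on U (jacobian_det h)"
proof -
  have "continuous_on U (jac (\<lambda>x. h x $ 1) (\<lambda>x. h x $ 2))"
    by (intro continuous_on_jac Ck_on_vec_nth assms)
  then show ?thesis
    using assms(2) by (subst continuous_on_cong[OF refl, where g="jac (\<lambda>x. h x $ 1) (\<lambda>x. h x $ 2)"]) (auto intro: jacobian_det_eq_jac)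
qed

lemma compact_continuous_bound:
  assumes "compact C" "continuous_on C (g :: 'a::topological_space \<Rightarrow> 'b::real_normed_vector)"
  obtains B where "B > 0" "\<And>x. x \<in> C \<Longrightarrow> norm (g x) \<le> B"
proof -
  obtain b where "\<forall>z\<in>g ` C. norm z \<le> b"
    using compact_imp_bounded[OF compact_continuous_image[OF assms(2,1)]] unfolding bounded_iff by blast
  then show thesis by (intro that[of "max b 1"]) force+
qed

context
  fixes U U' :: "(real^2) set" and \<Psi> \<Phi> :: "real^2 \<Rightarrow> real^2"
  assumes diffeo: "C1_diffeomorphism U U' \<Psi> \<Phi>"
begin

lemma diffeo_facts:
  shows "open U" "open U'" "Ck_on 1 U \<Psi>" "Ck_on 1 U' \<Phi>" "\<Psi> ` U = U'" "\<Phi> ` U' = U"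
    "\<And>x. x \<in> U \<Longrightarrow> \<Phi> (\<Psi> x) = x" "\<And>y. y \<in> U' \<Longrightarrow> \<Psi> (\<Phi> y) = y"
    "continuous_on U \<Psi>" "continuous_on U' \<Phi>"
  using diffeo Ck_on_SucD[of 0 U \<Psi>] Ck_on_SucD[of 0 U' \<Phi>] unfolding C1_diffeomorphism_def by auto

lemma diffeo_image_open: "open V' \<Longrightarrow> V' \<subseteq> U' \<Longrightarrow> open (\<Phi> ` V')"
proof -
  assume V': "open V'" "V' \<subseteq> U'"
  have "\<Phi> ` V' = U \<inter> \<Psi> -` V'"
  proof (intro equalityI subsetI)
    fix x assume "x \<in> \<Phi> ` V'"
    then obtain y where "y \<in> V'" "x = \<Phi> y" by blast
    then show "x \<in> U \<inter> \<Psi> -` V'" using V'(2) diffeo_facts(6,8) by auto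
  next
    fix x assume "x \<in> U \<inter> \<Psi> -` V'"
    then have "\<Psi> x \<in> V'" "\<Phi> (\<Psi> x) = x" using diffeo_facts(7) by auto
    then show "x \<in> \<Phi> ` V'" by (metis imageI)
  qed
  then show ?thesis using continuous_open_preimage[OF diffeo_facts(9,1) V'(1)] by simp
qed

lemma diffeo_compactly_inside:
  assumes V': "compactly_inside V' U'"
  shows "compactly_inside (\<Phi> ` V') U" "closure (\<Phi> ` V') \<subseteq> \<Phi> ` closure V'" "compact (\<Phi> ` closure V')" "\<Phi> ` closure V' \<subseteq> U"
proof -
  have V: "open V'" "compact (closure V')" "closure V' \<subseteq> U'" using V' by (auto simp: compactly_inside_def)
  show c: "compact (\<Phi> ` closure V')"
    by (intro compact_continuous_image continuous_on_subset[OF diffeo_facts(10)] V)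
  show s: "closure (\<Phi> ` V') \<subseteq> \<Phi> ` closure V'"
    using closure_subset[of V'] by (intro closure_minimal compact_imp_closed c) blast
  show i: "\<Phi> ` closure V' \<subseteq> U" using V(3) diffeo_facts(6) by blast
  have "compact (closure (\<Phi> ` V'))"
    using bounded_subset[OF compact_imp_bounded[OF c], of "\<Phi> ` V'"] closure_subset[of V'] by (simp add: compact_closure image_mono)
  then show "compactly_inside (\<Phi> ` V') U"
    using s i diffeo_image_open[OF V(1)] V(3) closure_subset[of V'] by (auto simp: compactly_inside_def)
qed

text \<open>The preimage of \<open>A\<close> under \<open>\<Phi>\<close> in V' is its image under
  \<open>\<Psi>\<close>, and the Jacobian of \<open>\<Psi>\<close> is bounded on the compact image
  of the closure of V'.\<close>

lemma diffeo_measure_bound: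
  assumes V': "compactly_inside V' U'"
  obtains C where "C > 0" "\<And>A. A \<in> sets borel \<Longrightarrow> A \<subseteq> \<Phi> ` V' \<Longrightarrow> emeasure lborel (V' \<inter> \<Phi> -` A) \<le> ennreal C * emeasure lborel A"
proof -
  note K = diffeo_compactly_inside[OF V']
  have V: "open V'" "V' \<subseteq> U'" using V' closure_subset[of V'] by (auto simp: compactly_inside_def)
  have jc: "continuous_on U (jacobian_det \<Psi>)" by (intro continuous_on_jacobian_det diffeo_facts)
  obtain C where C: "C > 0" "\<And>x. x \<in> \<Phi> ` closure V' \<Longrightarrow> norm (jacobian_det \<Psi> x) \<le> C"
    using compact_continuous_bound[OF K(3) continuous_on_subset[OF jc K(4)]] by blast
  show thesis
  proof (rule that[OF C(1)])
    fix A assume A: "A \<in> sets borel" "A \<subseteq> \<Phi> ` V'"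
    have AU: "A \<subseteq> U" "A \<subseteq> \<Phi> ` closure V'" using A(2) K(4) closure_subset[of V'] by blast+
    have eq: "V' \<inter> \<Phi> -` A = \<Psi> ` A"
    proof (intro equalityI subsetI)
      fix y assume "y \<in> V' \<inter> \<Phi> -` A"
      then have "\<Phi> y \<in> A" "\<Psi> (\<Phi> y) = y" using V(2) diffeo_facts(8) by auto
      then show "y \<in> \<Psi> ` A" by (metis imageI)
    next
      fix y assume "y \<in> \<Psi> ` A"
      then obtain x where x: "x \<in> A" "y = \<Psi> x" by blast
      then obtain y' where y': "y' \<in> V'" "x = \<Phi> y'" using A(2) by blast
      then have "\<Psi> x = y'" using V(2) diffeo_facts(8) by auto
      then show "y \<in> V' \<inter> \<Phi> -` A" using x y' by simp
    qed
    have "bounded A" using bounded_subset[OF compact_imp_bounded[OF K(3)] AU(2)] .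
    then have fin: "emeasure lborel A < \<infinity>" using emeasure_bounded_finite by blast
    then have Am: "A \<in> lmeasurable" using A(1) by (simp add: fmeasurable_def)
    have der: "(\<Psi> has_derivative frechet_derivative \<Psi> (at x)) (at x within A)" if "x \<in> A" for x
      using diffeo_facts(3) AU(1) that by (intro has_derivative_at_withinI[OF iffD1[OF frechet_derivative_works]]) auto
    have bd: "\<bar>det (matrix (frechet_derivative \<Psi> (at x)))\<bar> \<le> C" if "x \<in> A" for x
      using C(2) AU(2) that unfolding jacobian_det_def by auto
    have "set_integrable lborel A (\<lambda>x. \<bar>jacobian_det \<Psi> x\<bar>)"
      unfolding set_integrable_def
    proof (rule Bochner_Integration.integrable_bound[of _ "\<lambda>x. indicator A x * C"])
      show "integrable lborel (\<lambda>x. indicator A x * C)"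
        using A(1) fin by (intro integrable_mult_left integrable_real_indicator) auto
      have "(\<lambda>x. indicator U x *\<^sub>R jacobian_det \<Psi> x) \<in> borel_measurable borel"
        using diffeo_facts(1) by (intro borel_measurable_continuous_on_indicator jc) auto
      then have "(\<lambda>x. indicator A x * \<bar>indicator U x *\<^sub>R jacobian_det \<Psi> x\<bar>) \<in> borel_measurable borel"
        using A(1) by (intro borel_measurable_times borel_measurable_indicator borel_measurable_abs) auto
      moreover have "(\<lambda>x. indicator A x * \<bar>indicator U x *\<^sub>R jacobian_det \<Psi> x\<bar>) = (\<lambda>x. indicator A x *\<^sub>R \<bar>jacobian_det \<Psi> x\<bar>)"
        using AU(1) by (auto simp: indicator_def fun_eq_iff)
      ultimately show "(\<lambda>x. indicator A x *\<^sub>R \<bar>jacobian_det \<Psi> x\<bar>) \<in> borel_measurable lborel" by simp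
      show "AE x in lborel. norm (indicator A x *\<^sub>R \<bar>jacobian_det \<Psi> x\<bar>) \<le> norm (indicator A x * C)"
        using C AU(2) by (intro AE_I2) (auto simp: indicator_def intro: order_trans)
    qed
    then have int: "(\<lambda>x. \<bar>det (matrix (frechet_derivative \<Psi> (at x)))\<bar>) integrable_on A"
      using set_borel_integral_eq_integral(1) unfolding jacobian_det_def by blast
    have "\<Psi> ` A \<in> lmeasurable" "measure lebesgue (\<Psi> ` A) \<le> C * measure lebesgue A"
      using measurable_bounded_differentiable_image[OF Am der int bd] measure_bounded_differentiable_image[OF Am der int bd] by auto
    \<comment> \<open>The image bound concerns the completed measure; as a preimage under
      \<open>\<Phi>\<close> the set is Borel, so that it also holds for
      \<open>lborel\<close>.\<close>
    moreover have B: "V' \<inter> \<Phi> -` A \<in> sets borel"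
    proof -
      have "\<Phi> \<in> borel_measurable (restrict_space borel V')"
        by (rule borel_measurable_continuous_on_restrict[OF continuous_on_subset[OF diffeo_facts(10) V(2)]])
      from measurable_sets[OF this A(1)] show ?thesis
        using V(1) by (simp add: space_restrict_space sets_restrict_space_iff Int_commute)
    qed
    ultimately have "measure lborel (\<Psi> ` A) \<le> C * measure lborel A" "emeasure lborel (\<Psi> ` A) < \<infinity>"
      using A(1) unfolding eq[symmetric] by (auto simp: fmeasurable_def)
    then show "emeasure lborel (V' \<inter> \<Phi> -` A) \<le> ennreal C * emeasure lborel A"
      unfolding eq using fin C(1)
      by (simp add: emeasure_eq_ennreal_measure ennreal_mult'[symmetric] ennreal_leI)
  qed
qed

text \<open>V' need not be convex, so the bound is confined to pairs closer than \<open>r\<close>: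
  the ball around the first point lies in a larger compactly contained set where the derivatives of
  \<open>\<Phi>\<close> are bounded.\<close>

lemma diffeo_Lipschitz:
  assumes V': "compactly_inside V' U'"
  obtains L r where "L > 0" "r > 0" "\<And>x y. x \<in> V' \<Longrightarrow> norm (x - y) < r \<Longrightarrow> norm (\<Phi> x - \<Phi> y) \<le> L * norm (x - y)"
proof -
  have V: "compact (closure V')" "closure V' \<subseteq> U'" using V' by (auto simp: compactly_inside_def)
  obtain W r where W: "r > 0" "compactly_inside W U'" "closure V' \<subseteq> W" "\<And>x. x \<in> closure V' \<Longrightarrow> ball x r \<subseteq> W"
    using compact_neighbourhood[OF V(1) diffeo_facts(2) V(2)] by metis
  have WU: "W \<subseteq> U'" "compact (closure W)" "closure W \<subseteq> U'" using W(2) closure_subset[of W] by (auto simp: compactly_inside_def)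
  have "\<exists>B>0. \<forall>x\<in>closure W. norm (pderiv_at i \<Phi> x) \<le> B" for i
  proof -
    have "continuous_on (closure W) (pderiv_at i \<Phi>)"
      using diffeo_facts(4) WU(3) by (auto intro: continuous_on_subset)
    then show ?thesis using compact_continuous_bound[OF WU(2)] by metis
  qed
  then obtain B where B: "\<And>i. B i > 0" "\<And>i x. x \<in> closure W \<Longrightarrow> norm (pderiv_at i \<Phi> x) \<le> B i" by metis
  define L where "L = (\<Sum>i\<in>UNIV. B i)"
  have L: "L > 0" unfolding L_def by (intro sum_pos B) auto
  show thesis
  proof (rule that[OF L W(1)])
    fix x y assume xy: "x \<in> V'" "norm (x - y) < r"
    have sub: "ball x r \<subseteq> W" using W(4) xy(1) closure_subset[of V'] by blast
    show "norm (\<Phi> x - \<Phi> y) \<le> L * norm (x - y)"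
    proof (rule differentiable_bound[of "ball x r" \<Phi>])
      fix z assume z: "z \<in> ball x r"
      then have zW: "z \<in> W" using sub by blast
      show "(\<Phi> has_derivative (\<lambda>v. \<Sum>i\<in>UNIV. v $ i *\<^sub>R pderiv_at i \<Phi> z)) (at z within ball x r)"
        using diffeo_facts(4) zW WU(1) by (intro has_derivative_at_withinI[OF has_derivative_pderiv]) auto
      show "onorm (\<lambda>v. \<Sum>i\<in>UNIV. v $ i *\<^sub>R pderiv_at i \<Phi> z) \<le> L"
      proof (rule onorm_le)
        fix v :: "real^2"
        have "norm (\<Sum>i\<in>UNIV. v $ i *\<^sub>R pderiv_at i \<Phi> z) \<le> (\<Sum>i\<in>(UNIV::2 set). norm v * B i)"
        proof (rule sum_norm_le)
          fix i
          show "norm (v $ i *\<^sub>R pderiv_at i \<Phi> z) \<le> norm v * B i"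
            using B(2)[of z i] zW closure_subset[of W] component_le_norm_cart[of v i] by (auto intro!: mult_mono)
        qed
        then show "norm (\<Sum>i\<in>UNIV. v $ i *\<^sub>R pderiv_at i \<Phi> z) \<le> L * norm v"
          by (simp add: L_def sum_distrib_left mult.commute)
      qed
    qed (use xy W(1) in \<open>auto simp: dist_norm\<close>)
  qed
qed

lemma tends_tame_comp:
  assumes V': "compactly_inside V' U'" and t: "tends_tame (\<Phi> ` V') H h"
  shows "tends_tame V' (\<lambda>k y. H k (\<Phi> y)) (\<lambda>y. h (\<Phi> y))"
  unfolding tends_tame_def
proof (intro conjI)
  have V: "open V'" "V' \<subseteq> U'" using V' closure_subset[of V'] by (auto simp: compactly_inside_def)
  have Vb: "V' \<in> sets borel" "\<Phi> ` V' \<in> sets borel" using V diffeo_image_open by auto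
  have \<Phi>c: "continuous_on V' \<Phi>" using diffeo_facts(10) V(2) continuous_on_subset by blast
  have m: "\<forall>\<^sub>F k in sequentially. set_borel_measurable borel (\<Phi> ` V') (H k)" using t by (simp add: tends_tame_def)
  then show "\<forall>\<^sub>F k in sequentially. set_borel_measurable borel V' (\<lambda>y. H k (\<Phi> y))"
  proof eventually_elim
    case (elim k)
    have "(\<lambda>y. (indicator (\<Phi> ` V') (\<Phi> y) *\<^sub>R H k (\<Phi> y))) \<in> borel_measurable (restrict_space borel V')"
      by (rule measurable_compose[OF borel_measurable_continuous_on_restrict[OF \<Phi>c] elim[unfolded set_borel_measurable_def]])
    then have "(\<lambda>y. indicator V' y *\<^sub>R (indicator (\<Phi> ` V') (\<Phi> y) *\<^sub>R H k (\<Phi> y))) \<in> borel_measurable borel"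
      using Vb by (subst (asm) borel_measurable_restrict_space_iff) auto
    moreover have "(\<lambda>y. indicator V' y *\<^sub>R (indicator (\<Phi> ` V') (\<Phi> y) *\<^sub>R H k (\<Phi> y))) = (\<lambda>y. indicator V' y *\<^sub>R H k (\<Phi> y))"
      by (auto simp: indicator_def fun_eq_iff)
    ultimately show ?case by (simp add: set_borel_measurable_def)
  qed
  show "uniform_limit V' (\<lambda>k y. H k (\<Phi> y)) (\<lambda>y. h (\<Phi> y)) sequentially"
  proof (rule uniform_limitI)
    fix e :: real assume "e > 0"
    then have "\<forall>\<^sub>F k in sequentially. \<forall>x\<in>\<Phi> ` V'. dist (H k x) (h x) < e"
      using t unfolding tends_tame_def by (intro uniform_limitD) auto
    then show "\<forall>\<^sub>F k in sequentially. \<forall>y\<in>V'. dist (H k (\<Phi> y)) (h (\<Phi> y)) < e"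
      by eventually_elim blast
  qed
  have "bounded (h ` \<Phi> ` V')" using t by (simp add: tends_tame_def)
  then show "bounded ((\<lambda>y. h (\<Phi> y)) ` V')" by (simp add: image_image)
  obtain L r where L: "L > 0" "r > 0" "\<And>x y. x \<in> V' \<Longrightarrow> norm (x - y) < r \<Longrightarrow> norm (\<Phi> x - \<Phi> y) \<le> L * norm (x - y)"
    using diffeo_Lipschitz[OF V'] by blast
  obtain C where C: "C > 0" "\<And>A. A \<in> sets borel \<Longrightarrow> A \<subseteq> \<Phi> ` V' \<Longrightarrow> emeasure lborel (V' \<inter> \<Phi> -` A) \<le> ennreal C * emeasure lborel A"
    using diffeo_measure_bound[OF V'] by blast
  have inj: "inj_on \<Phi> V'" using diffeo_facts(8) V(2) by (metis inj_on_inverseI subset_iff)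
  show "tame V' (\<lambda>k y. H k (\<Phi> y))"
    unfolding tame_def
  proof (intro allI impI)
    fix e :: real assume e: "e > 0"
    define c where "c = L ^ 3 * C * C"
    have c: "c > 0" using L C by (simp add: c_def)
    then have "e / c > 0" using e by simp
    then obtain d where d: "d > 0" "\<forall>\<^sub>F k in sequentially. near_energy (\<Phi> ` V') d (H k) \<le> ennreal (e / c)"
      using t unfolding tends_tame_def tame_def by blast
    \<comment> \<open>The first entry keeps the local Lipschitz bound valid, the second brings the
      stretched range L \<delta> below \<open>d\<close>.\<close>
    define \<delta> where "\<delta> = min r (d / L)"
    have \<delta>: "\<delta> > 0" "\<delta> \<le> r" "L * \<delta> \<le> d" using d L by (auto simp: \<delta>_def min_def field_simps)
    from d(2) m have "\<forall>\<^sub>F k in sequentially. near_energy V' \<delta> (\<lambda>y. H k (\<Phi> y)) \<le> ennreal e"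
    proof eventually_elim
      case (elim k)
      have "near_energy V' \<delta> (\<lambda>y. H k (\<Phi> y)) \<le> ennreal (L ^ 3) * ennreal C * ennreal C * near_energy (\<Phi> ` V') (L * \<delta>) (H k)"
        using L \<delta> by (intro near_energy_comp[OF Vb \<Phi>c order_refl inj elim(2) C(2)]) auto
      also have "\<dots> \<le> ennreal (L ^ 3) * ennreal C * ennreal C * ennreal (e / c)"
        using near_energy_mono[OF order_refl \<delta>(3), of "\<Phi> ` V'" "H k"] elim(1) by (intro mult_left_mono) auto
      also have "\<dots> = ennreal e"
        using L C e c by (simp flip: ennreal_mult add: c_def)
      finally show ?case .
    qed
    with \<delta>(1) show "\<exists>\<delta>>0. \<forall>\<^sub>F k in sequentially. near_energy V' \<delta> (\<lambda>y. H k (\<Phi> y)) \<le> ennreal e" by blast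
  qed
qed

end

section \<open>Weak derivatives\<close>

lemma mollifier_test_function:
  assumes "\<epsilon> > 0" "cball x \<epsilon> \<subseteq> U" shows "(\<lambda>y. mollifier \<epsilon> (x - y)) \<in> test_functions U"
proof -
  have "{y. mollifier \<epsilon> (x - y) \<noteq> 0} \<subseteq> cball x \<epsilon>"
    using mollifier_outside[OF assms(1)] by (force simp: dist_norm)
  then have c: "closure {y. mollifier \<epsilon> (x - y) \<noteq> 0} \<subseteq> cball x \<epsilon>" by (intro closure_minimal) auto
  have "bounded {y. mollifier \<epsilon> (x - y) \<noteq> 0}" using c bounded_cball bounded_subset closure_subset by metis
  then show ?thesis using assms(2) c Ck_on_mollifier_reflect
    by (auto simp: test_functions_def smooth_on_def compact_closure)
qed

lemma L2_norm_sq_component: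
  "L2_norm_sq V (\<lambda>x. (h x :: real^'m) $ i) \<le> L2_norm_sq V h"
  unfolding L2_norm_sq_def
proof (intro nn_integral_mono mult_right_mono ennreal_leI)
  fix x
  show "(norm (h x $ i))\<^sup>2 \<le> (norm (h x))\<^sup>2"
    using component_le_norm_cart[of "h x" i] by (intro power_mono) auto
qed auto

lemma slobodeckij_component:
  "slobodeckij_sq s V (\<lambda>x. (h x :: real^'m) $ i) \<le> slobodeckij_sq s V h"
  unfolding slobodeckij_sq_def
proof (intro nn_integral_mono mult_right_mono ennreal_leI divide_right_mono)
  fix x y
  show "(norm (h x $ i - h y $ i))\<^sup>2 \<le> (norm (h x - h y))\<^sup>2"
    using component_le_norm_cart[of "h x - h y" i] by (intro power_mono) auto
qed auto

lemma set_borel_measurable_component: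
  "set_borel_measurable borel V h \<Longrightarrow> set_borel_measurable borel V (\<lambda>x. (h x :: real^'m) $ i)"
  unfolding set_borel_measurable_def
  by (drule borel_measurable_continuous_onI[OF continuous_on_component[OF continuous_on_id, of UNIV i], THEN measurable_compose[rotated]]) simp

lemma L2_on_integrable:
  fixes h :: "real^2 \<Rightarrow> real"
  assumes V: "V \<in> sets borel" "emeasure lborel V < \<infinity>" and h: "L2_on V h"
  shows "L12 (restr V h)"
proof -
  have m[measurable]: "restr V h \<in> borel_measurable borel"
    using h unfolding L2_on_def set_borel_measurable_def restr_def[abs_def] by simp
  have "(\<integral>\<^sup>+x. ennreal ((restr V h x)\<^sup>2) \<partial>lborel) = L2_norm_sq V h"
    unfolding L2_norm_sq_def by (intro nn_integral_cong) (auto simp: restr_def indicator_def)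
  then have 2: "integrable lborel (\<lambda>x. (restr V h x)\<^sup>2)"
    using h by (intro integrableI_nonneg) (auto simp: L2_on_def)
  have "integrable lborel (restr V h)"
  proof (rule Bochner_Integration.integrable_bound[of _ "\<lambda>x. indicator V x + (restr V h x)\<^sup>2"])
    show "integrable lborel (\<lambda>x. indicator V x + (restr V h x)\<^sup>2)"
      using 2 V by (intro Bochner_Integration.integrable_add integrable_real_indicator) auto
    show "AE x in lborel. norm (restr V h x) \<le> norm (indicator V x + (restr V h x)\<^sup>2)"
    proof (rule AE_I2)
      fix x
      have "\<bar>h x\<bar> \<le> 1 + (h x)\<^sup>2" using zero_le_power2[of "\<bar>h x\<bar> - 1"] by (simp add: power2_diff)
      then show "norm (restr V h x) \<le> norm (indicator V x + (restr V h x)\<^sup>2)"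
        by (cases "x \<in> V") (auto simp: restr_def)
    qed
  qed simp
  then show ?thesis using 2 by (simp add: L12_def)
qed

lemma compactly_inside_finite: "compactly_inside V U \<Longrightarrow> emeasure lborel (V :: 'a::euclidean_space set) < \<infinity>"
  using emeasure_bounded_finite[of V] bounded_subset[OF compact_imp_bounded[of "closure V"] closure_subset]
  unfolding compactly_inside_def by blast

text \<open>The reflected mollifier is an admissible test function, and testing with it expresses
  the mollified weak derivative through \<open>u\<close> alone.\<close>

lemma weak_pderiv_component:
  fixes u d :: "real^2 \<Rightarrow> real^3"
  assumes U: "open U" and u: "continuous_on U u" and w: "weak_pderiv U i u d"
    and V: "compactly_inside V U" and e: "\<epsilon> > 0" and x: "cball x \<epsilon> \<subseteq> V"
  shows "(LINT y|lborel. pderiv_at i (\<lambda>y. mollifier \<epsilon> (x - y)) y * u y $ m) = - moll \<epsilon> (restr V (\<lambda>y. d y $ m)) x"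
proof -
  let ?\<psi> = "\<lambda>y. mollifier \<epsilon> (x - y)"
  have VU: "V \<subseteq> U" "V \<in> sets borel" using V closure_subset[of V] by (auto simp: compactly_inside_def)
  have \<psi>: "?\<psi> \<in> test_functions U" using VU x by (intro mollifier_test_function[OF e]) blast
  have z: "?\<psi> y = 0" if "y \<notin> cball x \<epsilon>" for y using e that by (intro mollifier_outside) (auto simp: dist_norm)
  have z': "pderiv_at i ?\<psi> y = 0" if "y \<notin> cball x \<epsilon>" for y
    by (rule pderiv_at_zero_outside[OF closed_cball z that])
  have pc: "continuous_on UNIV (pderiv_at i ?\<psi>)" using Ck_on_mollifier_reflect[of 1 \<epsilon> x] by simp
  have uc: "continuous_on U (\<lambda>y. u y $ m)" for m using u by (intro continuous_on_component)
  have i1: "integrable lborel (\<lambda>y. pderiv_at i ?\<psi> y * u y $ m)" for m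
    using VU x by (intro integrable_cutoff[OF pc compact_cball z' U _ uc]) auto
  have dL: "L2_on V d" using w V by (auto simp: weak_pderiv_def L2_loc_def)
  then have dm: "L2_on V (\<lambda>y. d y $ m)" for m
    using L2_norm_sq_component[of V d m] set_borel_measurable_component[of V d m] by (auto simp: L2_on_def intro: le_less_trans)
  have L: "L12 (restr V (\<lambda>y. d y $ m))" for m by (rule L2_on_integrable[OF VU(2) compactly_inside_finite[OF V] dm])
  have i2: "integrable lborel (\<lambda>y. ?\<psi> y * restr V (\<lambda>y. d y $ m) y)" for m
    by (rule integrable_conv[OF mollifier_continuous(1), where R=\<epsilon>]) (use mollifier_outside[OF e] L[of m] in \<open>auto simp: L12_def\<close>)
  \<comment> \<open>A component may be taken under a vector-valued integral only once this integral
    is known to converge, so integrability is assembled from the components first.\<close>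
  have vec: "(LINT y:U|lborel. c y *\<^sub>R h y) $ m = (LINT y|lborel. c y * restr V (\<lambda>y. h y $ m) y)"
    if c: "\<And>y. y \<notin> V \<Longrightarrow> c y = 0" and i: "\<And>m. integrable lborel (\<lambda>y. c y * restr V (\<lambda>y. h y $ m) y)"
    for c and h :: "real^2 \<Rightarrow> real^3"
  proof -
    have "(\<lambda>y. indicator U y *\<^sub>R (c y *\<^sub>R h y)) = (\<lambda>y. \<Sum>m\<in>UNIV. (c y * restr V (\<lambda>y. h y $ m) y) *\<^sub>R axis m 1)"
    proof
      fix y
      show "indicator U y *\<^sub>R (c y *\<^sub>R h y) = (\<Sum>m\<in>UNIV. (c y * restr V (\<lambda>y. h y $ m) y) *\<^sub>R axis m 1)"
      proof (cases "y \<in> V")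
        case True
        then show ?thesis using VU(1) sum_axis[of "c y *\<^sub>R h y"] by (auto simp: restr_def)
      qed (simp add: c)
    qed
    moreover have "integrable lborel (\<lambda>y. \<Sum>m\<in>(UNIV::3 set). (c y * restr V (\<lambda>y. h y $ m) y) *\<^sub>R (axis m 1 :: real^3))"
      by (intro Bochner_Integration.integrable_sum integrable_scaleR_left i)
    ultimately have I: "integrable lborel (\<lambda>y. indicator U y *\<^sub>R (c y *\<^sub>R h y))" by simp
    have "(LINT y:U|lborel. c y *\<^sub>R h y) $ m = (LINT y|lborel. (indicator U y *\<^sub>R (c y *\<^sub>R h y)) $ m)"
      unfolding set_lebesgue_integral_def
      by (rule integral_bounded_linear[OF bounded_linear_vec_nth I, symmetric])
    also have "\<dots> = (LINT y|lborel. c y * restr V (\<lambda>y. h y $ m) y)"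
      using c VU(1) by (intro Bochner_Integration.integral_cong) (auto simp: restr_def indicator_def)
    finally show ?thesis .
  qed
  have rV: "pderiv_at i ?\<psi> y * restr V (\<lambda>y. u y $ m) y = pderiv_at i ?\<psi> y * u y $ m" for y m
    using z'[of y] x by (cases "y \<in> V") (simp_all add: restr_def subset_iff, blast)
  have "(LINT y:U|lborel. pderiv_at i ?\<psi> y *\<^sub>R u y) = - (LINT y:U|lborel. ?\<psi> y *\<^sub>R d y)"
    using w \<psi> by (simp add: weak_pderiv_def)
  then have "(LINT y:U|lborel. pderiv_at i ?\<psi> y *\<^sub>R u y) $ m = - (LINT y:U|lborel. ?\<psi> y *\<^sub>R d y) $ m" by simp
  moreover have "(LINT y:U|lborel. pderiv_at i ?\<psi> y *\<^sub>R u y) $ m = (LINT y|lborel. pderiv_at i ?\<psi> y * u y $ m)"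
    using z' x by (subst vec) (simp_all add: rV i1 subset_iff, blast)
  moreover have "(LINT y:U|lborel. ?\<psi> y *\<^sub>R d y) $ m = (LINT y|lborel. ?\<psi> y * restr V (\<lambda>y. d y $ m) y)"
    using z x by (subst vec) (simp_all add: i2 subset_iff, blast)
  ultimately show ?thesis by (simp add: conv_def)
qed

lemma pderiv_at_component:
  fixes u :: "real^'n \<Rightarrow> real^'m"
  shows "u differentiable (at x) \<Longrightarrow> pderiv_at i (\<lambda>x. u x $ m) x = pderiv_at i u x $ m"
  by (rule pderiv_at_bounded_linear[OF bounded_linear_vec_nth])

lemma inverse_Suc_tendsto: "(\<lambda>k. 1 / real (Suc k)) \<longlonglongrightarrow> 0" "\<And>k. 1 / real (Suc k) > 0"
  using LIMSEQ_inverse_real_of_nat by (simp_all add: inverse_eq_divide)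

text \<open>The weak derivative \<open>d\<close> is some representative and must be identified with
  the classical derivative almost everywhere. Both have the same mollifications; those of the
  classical derivative converge uniformly on \<open>V\<close>, and finite energy makes those of
  \<open>d\<close> converge in L^2 there, with squared error of order \<open>s\<close>. Changing the
  integrand on a null set in either variable leaves the seminorm unchanged.\<close>

lemma weak_pderiv_slobodeckij:
  fixes u d :: "real^2 \<Rightarrow> real^3"
  assumes U: "open U" and u: "Ck_on 1 U u" and w: "weak_pderiv U i u d" and dH: "H12_loc U d"
    and V: "compactly_inside V U"
  shows "slobodeckij_sq (1/2) V (\<lambda>x. pderiv_at i u x $ m) < \<infinity>"
proof -
  let ?h = "\<lambda>x. u x $ m" and ?G = "\<lambda>x. pderiv_at i u x $ m" and ?d = "\<lambda>x. d x $ m"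
  have Vo: "open V" "compact (closure V)" "closure V \<subseteq> U" using V by (auto simp: compactly_inside_def)
  obtain V1 r where V1: "r > 0" "compactly_inside V1 U" "closure V \<subseteq> V1" "\<And>x. x \<in> closure V \<Longrightarrow> ball x r \<subseteq> V1"
    using compact_neighbourhood[OF Vo(2) U Vo(3)] by metis
  let ?K = "closure V1"
  have V1o: "open V1" "compact ?K" "?K \<subseteq> U" "V1 \<subseteq> ?K" using V1(2) closure_subset[of V1] by (auto simp: compactly_inside_def)
  have Vb[measurable]: "V \<in> sets borel" "V1 \<in> sets borel" using Vo V1o by auto
  have VV1: "V \<subseteq> V1" using closure_subset V1(3) by blast
  have rV: "ball x r \<subseteq> V1" if "x \<in> V" for x using V1(4) closure_subset that by blast
  have hC: "Ck_on 1 U ?h" by (rule Ck_on_vec_nth[OF U u])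
  have uc: "continuous_on U u" using u Ck_on_SucD[of 0 U u] by simp
  have pdh: "pderiv_at i ?h x = ?G x" if "x \<in> U" for x
    using u that by (intro pderiv_at_component) auto
  have Gc: "continuous_on U ?G" using u by (intro continuous_on_component) auto
  have GK: "continuous_on ?K ?G" using Gc V1o(3) continuous_on_subset by blast
  have dV1: "L2_on V1 d" "slobodeckij_sq (1/2) V1 d < \<infinity>" "slobodeckij_sq (1/2) V d < \<infinity>"
    using dH V1(2) V by (auto simp: H12_loc_def Hs_on_def)
  have "L2_on V1 ?d"
    using dV1(1) L2_norm_sq_component[of V1 d m] set_borel_measurable_component[of V1 d m] by (auto simp: L2_on_def intro: le_less_trans)
  then have L: "L12 (restr V1 ?d)" by (rule L2_on_integrable[OF Vb(2) compactly_inside_finite[OF V1(2)]])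
  let ?H = "restr V1 ?d"
  have hm[measurable]: "?H \<in> borel_measurable borel" using L by (auto simp: L12_def)
  obtain S where S: "slobodeckij_sq (1/2) V1 ?d = ennreal S" "S \<ge> 0"
    using le_less_trans[OF slobodeckij_component[of "1/2" V1 d m] dV1(2)] by (cases "slobodeckij_sq (1/2) V1 ?d") auto
  obtain M where M: "emeasure lborel V = ennreal M" "M \<ge> 0"
    using compactly_inside_finite[OF V] by (cases "emeasure lborel V") auto
  define s where "s k = 1 / real (Suc k)" for k
  have s: "s \<longlonglongrightarrow> 0" "\<And>k. s k > 0" using inverse_Suc_tendsto unfolding s_def by auto
  \<comment> \<open>Both mollifications equal minus the integral of \<open>u\<close> against the
    derivative of the kernel, one by the weak identity, the other by parts.\<close>
  have mollH: "moll \<epsilon> ?H x = moll \<epsilon> (restr ?K ?G) x" if \<epsilon>: "\<epsilon> > 0" "cball x \<epsilon> \<subseteq> V1" for \<epsilon> x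
  proof -
    have z: "mollifier \<epsilon> (x - y) = 0" if "y \<notin> cball x \<epsilon>" for y
      using \<epsilon> that by (intro mollifier_outside) (auto simp: dist_norm)
    have "moll \<epsilon> ?H x = - (LINT y|lborel. pderiv_at i (\<lambda>y. mollifier \<epsilon> (x - y)) y * ?h y)"
      using weak_pderiv_component[OF U uc w V1(2) \<epsilon>] by simp
    also have "\<dots> = (LINT y|lborel. mollifier \<epsilon> (x - y) * pderiv_at i ?h y)"
      using integration_by_parts(3)[OF Ck_on_mollifier_reflect compact_cball z U _ hC, of x \<epsilon> i] \<epsilon> V1o
      by (simp add: subset_trans[of _ V1])
    also have "\<dots> = moll \<epsilon> (restr ?K ?G) x"
      unfolding conv_def
    proof (rule Bochner_Integration.integral_cong)
      fix y
      show "mollifier \<epsilon> (x - y) * pderiv_at i ?h y = mollifier \<epsilon> (x - y) * restr ?K ?G y"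
      proof (cases "y \<in> cball x \<epsilon>")
        case True
        then have "y \<in> ?K" "y \<in> U" using \<epsilon>(2) V1o by blast+
        then show ?thesis by (simp add: restr_def pdh)
      qed (simp add: z)
    qed simp
    finally show ?thesis .
  qed
  let ?c = "mollifier_const\<^sup>2 * pi"
  let ?I = "\<integral>\<^sup>+x. ennreal ((?H x - restr V ?G x)\<^sup>2) * indicator V x \<partial>lborel"
  have I: "?I \<le> ennreal e" if e: "e > 0" for e
  proof -
    \<comment> \<open>Each half of \<open>e\<close> goes to one error: \<open>e1\<close> bounds the
      squared uniform error, integrated over measure \<open>M\<close> with a factor 2, and
      \<open>e2\<close> bounds the scale \<open>s\<close> in 4 c s S.\<close>
    define e1 where "e1 = e / 4 / (M + 1)"
    have e1: "e1 > 0" "e1 * M < e / 4" using div_succ_mult_less[of "e/4" M] e M unfolding e1_def by auto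
    define e2 where "e2 = e / 2 / (4 * ?c * S + 1)"
    have p: "4 * ?c * S \<ge> 0" using S by simp
    have e2: "e2 > 0" "e2 * (4 * ?c * S) < e / 2" using div_succ_mult_less[OF _ p, of "e/2"] e unfolding e2_def by auto
    have ul: "uniform_limit V (\<lambda>k. moll (s k) (restr ?K ?G)) ?G sequentially"
      using rV V1o(4) by (intro moll_uniform_limit[OF V1o(2) GK V1(1) _ s]) blast
    have "sqrt e1 > 0" using e1 by simp
    from uniform_limitD[OF ul this] order_tendstoD(2)[OF s(1) e2(1)] order_tendstoD(2)[OF s(1) V1(1)]
    have "\<forall>\<^sub>F k in sequentially. (\<forall>x\<in>V. dist (moll (s k) (restr ?K ?G) x) (?G x) < sqrt e1) \<and> s k < e2 \<and> s k < r"
      by eventually_elim simp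
    then obtain k where k: "\<And>x. x \<in> V \<Longrightarrow> dist (moll (s k) (restr ?K ?G) x) (?G x) < sqrt e1" "s k < e2" "s k < r"
      using eventually_happens'[OF sequentially_bot] by blast
    let ?s = "s k"
    have "?I \<le> (\<integral>\<^sup>+x. ennreal (2 * ?c * ?s) * (ennreal (osc ?s ?H x / ?s ^ 3) * indicator V x) + ennreal (2 * e1) * indicator V x \<partial>lborel)"
    proof (rule nn_integral_mono)
      fix x
      show "ennreal ((?H x - restr V ?G x)\<^sup>2) * indicator V x \<le> ennreal (2 * ?c * ?s) * (ennreal (osc ?s ?H x / ?s ^ 3) * indicator V x) + ennreal (2 * e1) * indicator V x"
      proof (cases "x \<in> V")
        case True
        have cb: "cball x ?s \<subseteq> V1" using rV[OF True] k(3) by (force simp: subset_iff)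
        have "(moll ?s ?H x - ?G x)\<^sup>2 \<le> e1"
        proof -
          have "\<bar>moll ?s ?H x - ?G x\<bar> \<le> sqrt e1"
            using k(1)[OF True] by (simp add: mollH[OF s(2) cb] dist_real_def less_imp_le)
          then have "\<bar>moll ?s ?H x - ?G x\<bar>\<^sup>2 \<le> (sqrt e1)\<^sup>2" by (intro power_mono) auto
          then show ?thesis using e1 by simp
        qed
        moreover have "(?H x - ?G x)\<^sup>2 \<le> 2 * (moll ?s ?H x - ?H x)\<^sup>2 + 2 * (moll ?s ?H x - ?G x)\<^sup>2"
          using sum_squares_le[of "?H x - moll ?s ?H x" "moll ?s ?H x - ?G x"] by (simp add: power2_commute[of "?H x"])
        moreover have "(moll ?s ?H x - ?H x)\<^sup>2 \<le> ?c * ?s * (osc ?s ?H x / ?s ^ 3)"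
        proof -
          have "(moll ?s ?H x - ?H x)\<^sup>2 \<le> ?c / ?s\<^sup>2 * osc ?s ?H x" by (rule moll_diff_bound[OF L s(2)])
          also have "\<dots> = ?c * ?s * (osc ?s ?H x / ?s ^ 3)"
            using s(2)[of k] by (simp add: power2_eq_square power3_eq_cube)
          finally show ?thesis .
        qed
        ultimately have "(?H x - ?G x)\<^sup>2 \<le> 2 * ?c * ?s * (osc ?s ?H x / ?s ^ 3) + 2 * e1" by linarith
        then have "ennreal ((?H x - ?G x)\<^sup>2) \<le> ennreal (2 * ?c * ?s * (osc ?s ?H x / ?s ^ 3) + 2 * e1)" by (rule ennreal_leI)
        also have "\<dots> = ennreal (2 * ?c * ?s) * ennreal (osc ?s ?H x / ?s ^ 3) + ennreal (2 * e1)"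
        proof -
          have "ennreal (a * b + c) = ennreal a * ennreal b + ennreal c" if "a \<ge> 0" "b \<ge> 0" "c \<ge> 0" for a b c :: real
            using that by (simp add: ennreal_mult)
          moreover have "osc ?s ?H x / ?s ^ 3 \<ge> 0" "2 * ?c * ?s \<ge> 0" "2 * e1 \<ge> 0"
            using s(2)[of k] e1 by (auto intro!: divide_nonneg_nonneg osc_nonneg mult_nonneg_nonneg)
          ultimately show ?thesis by blast
        qed
        finally show ?thesis using True by (simp add: restr_def)
      qed simp
    qed
    also have "\<dots> = ennreal (2 * ?c * ?s) * (\<integral>\<^sup>+x\<in>V. ennreal (osc ?s ?H x / ?s ^ 3) \<partial>lborel) + ennreal (2 * e1) * emeasure lborel V"
      by (subst nn_integral_add) (auto simp: nn_integral_cmult)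
    also have "\<dots> \<le> ennreal (2 * ?c * ?s) * (2 * ennreal S) + ennreal (2 * e1) * ennreal M"
    proof (intro add_mono mult_left_mono)
      have "(\<integral>\<^sup>+x\<in>V. ennreal (osc ?s ?H x / ?s ^ 3) \<partial>lborel) \<le> 2 * near_energy V1 ?s ?H"
      proof (rule osc_le_near_energy[OF L Vb(1) VV1 Vb(2) _ s(2)])
        fix x assume "x \<in> V"
        then show "ball x ?s \<subseteq> V1" using rV k(3) by (meson less_imp_le order_trans subset_ball)
      qed
      also have "near_energy V1 ?s ?H = near_energy V1 ?s ?d" by (rule near_energy_cong) (simp add: restr_def)
      also have "\<dots> \<le> ennreal S" using near_energy_le_slobodeckij[of V1 ?s ?d] S(1) by simp
      finally show "(\<integral>\<^sup>+x\<in>V. ennreal (osc ?s ?H x / ?s ^ 3) \<partial>lborel) \<le> 2 * ennreal S" by (simp add: mult_left_mono)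
    qed (use M in auto)
    also have "\<dots> = ennreal (2 * ?c * ?s * (2 * S) + 2 * e1 * M)"
    proof -
      have "0 \<le> 2 * ?c * ?s" "0 \<le> 2 * e1" "0 \<le> 2 * S" using s(2)[of k] e1 S(2) by auto
      moreover have "2 * ennreal S = ennreal (2 * S)" using S(2) by (simp add: ennreal_mult)
      ultimately show ?thesis using M S by (simp add: ennreal_mult[symmetric] ennreal_plus[symmetric] del: ennreal_plus)
    qed
    also have "\<dots> \<le> ennreal e"
    proof (rule ennreal_leI)
      have "?s * (4 * ?c * S) \<le> e2 * (4 * ?c * S)" using k(2) p by (intro mult_right_mono) auto
      then show "2 * ?c * ?s * (2 * S) + 2 * e1 * M \<le> e" using e1(2) e2(2) by (simp add: ac_simps)
    qed
    finally show ?thesis .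
  qed
  have "?I = 0"
  proof (rule ccontr)
    assume "?I \<noteq> 0"
    then have "?I > 0" by (simp add: zero_less_iff_neq_zero)
    moreover have "?I \<noteq> top" using I[of 1] by (auto simp: top_unique)
    ultimately obtain y where y: "?I = ennreal y" "y > 0" by (cases ?I) auto
    then show False using I[of "y/2"] by (simp add: ennreal_le_iff)
  qed
  moreover have "restr V ?G \<in> borel_measurable borel"
  proof -
    have "V \<subseteq> U" using VV1 V1o by blast
    from set_borel_measurable_continuous[OF Vb(1) continuous_on_subset[OF Gc this]]
    show ?thesis unfolding set_borel_measurable_def restr_def[abs_def] by simp
  qed
  ultimately have "AE x in lborel. ennreal ((?H x - restr V ?G x)\<^sup>2) * indicator V x = 0"
    by (subst (asm) nn_integral_0_iff_AE) auto
  then have ae: "AE x in lborel. x \<in> V \<longrightarrow> ?d x = ?G x"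
  proof eventually_elim
    case (elim x)
    then show ?case using VV1 by (auto simp: restr_def ennreal_eq_0_iff)
  qed
  have "slobodeckij_sq (1/2) V ?G = slobodeckij_sq (1/2) V ?d"
    unfolding slobodeckij_eq
  proof (rule nn_integral_cong_AE)
    show "AE x in lborel. (\<integral>\<^sup>+y. ennreal (indicator V x * indicator V y * ((?G x - ?G y)\<^sup>2 / norm (x - y) ^ 3)) \<partial>lborel) =
      (\<integral>\<^sup>+y. ennreal (indicator V x * indicator V y * ((?d x - ?d y)\<^sup>2 / norm (x - y) ^ 3)) \<partial>lborel)"
      using ae
    proof eventually_elim
      case (elim x)
      show ?case
      proof (rule nn_integral_cong_AE)
        show "AE y in lborel. ennreal (indicator V x * indicator V y * ((?G x - ?G y)\<^sup>2 / norm (x - y) ^ 3)) =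
          ennreal (indicator V x * indicator V y * ((?d x - ?d y)\<^sup>2 / norm (x - y) ^ 3))"
          using ae by eventually_elim (use elim in \<open>auto simp: indicator_def\<close>)
      qed
    qed
  qed
  also have "\<dots> < \<infinity>" using slobodeckij_component[of "1/2" V d m] dV1(3) by (rule le_less_trans)
  finally show ?thesis .
qed

section \<open>The Brioschi expression\<close>

text \<open>Brioschi's formula for \<open>K (E G - F\<^sup>2)\<^sup>2\<close>; the last argument stands for
  \<open>\<partial>\<^sub>1\<partial>\<^sub>2F - \<partial>\<^sub>2\<partial>\<^sub>2E / 2 - \<partial>\<^sub>1\<partial>\<^sub>1G / 2\<close>.\<close>

definition brioschi :: "real \<Rightarrow> real \<Rightarrow> real \<Rightarrow> real \<Rightarrow> real \<Rightarrow> real \<Rightarrow> real \<Rightarrow> real \<Rightarrow> real \<Rightarrow> real \<Rightarrow> real" where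
  "brioschi E F G E1 E2 F1 F2 G1 G2 R =
     R * (E * G - F\<^sup>2) - E1 / 2 * ((F2 - G1 / 2) * G - F * (G2 / 2))
     + (F1 - E2 / 2) * ((F2 - G1 / 2) * F - E * (G2 / 2))
     + E2 / 2 * (E2 / 2 * G - F * (G1 / 2)) - G1 / 2 * (E2 / 2 * F - E * (G1 / 2))"

definition metric_brioschi :: "(real^2 \<Rightarrow> real) \<Rightarrow> (real^2 \<Rightarrow> real) \<Rightarrow> (real^2 \<Rightarrow> real) \<Rightarrow> real^2 \<Rightarrow> real" where
  "metric_brioschi E F G x = brioschi (E x) (F x) (G x) (pderiv_at 1 E x) (pderiv_at 2 E x) (pderiv_at 1 F x) (pderiv_at 2 F x)
     (pderiv_at 1 G x) (pderiv_at 2 G x)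
     (pderiv_at 1 (pderiv_at 2 F) x - pderiv_at 2 (pderiv_at 2 E) x / 2 - pderiv_at 1 (pderiv_at 1 G) x / 2)"

definition metric_det :: "(real^2 \<Rightarrow> real) \<Rightarrow> (real^2 \<Rightarrow> real) \<Rightarrow> (real^2 \<Rightarrow> real) \<Rightarrow> real^2 \<Rightarrow> real" where
  "metric_det E F G x = E x * G x - F x * F x"

text \<open>The connection form of the orthonormal frame obtained by Gram--Schmidt from the coordinate
  frame. It is linear in the first derivatives of the metric, so it passes to the limit along
  metrics converging in \<open>W\<^bsup>1,1\<^esup>\<close> and uniformly.\<close>

definition conn1 :: "(real^2 \<Rightarrow> real) \<Rightarrow> (real^2 \<Rightarrow> real) \<Rightarrow> (real^2 \<Rightarrow> real) \<Rightarrow> real^2 \<Rightarrow> real" where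
  "conn1 E F G x = inverse (sqrt (metric_det E F G x)) *
     (pderiv_at 2 E x / 2 - pderiv_at 1 F x + F x * inverse (E x) * pderiv_at 1 E x / 2)"

definition conn2 :: "(real^2 \<Rightarrow> real) \<Rightarrow> (real^2 \<Rightarrow> real) \<Rightarrow> (real^2 \<Rightarrow> real) \<Rightarrow> real^2 \<Rightarrow> real" where
  "conn2 E F G x = inverse (sqrt (metric_det E F G x)) *
     (F x * inverse (E x) * pderiv_at 2 E x / 2 - pderiv_at 1 G x / 2)"

text \<open>\<open>s\<close> stands for sqrt D and \<open>D1\<close>, \<open>D2\<close> for the
  derivatives of \<open>D\<close>. Over the common denominator D s E^2 the mixed derivative
  \<open>E12\<close> cancels, and the numerator carries the factor E^2.\<close>

lemma curl_algebra:
  fixes E F G D E1 E2 F1 F2 G1 G2 D1 D2 E11 E12 E22 F12 F11 G11 G12 s :: real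
  assumes E: "E \<noteq> 0" and s: "s \<noteq> 0" "s * s = D" and D: "D = E * G - F\<^sup>2"
    and D1: "D1 = E1 * G + E * G1 - 2 * F * F1" and D2: "D2 = E2 * G + E * G2 - 2 * F * F2"
  shows "- D1 / (2 * D * s) * (F * inverse E * E2 / 2 - G1 / 2)
       + inverse s * ((F1 * inverse E - F * E1 / E\<^sup>2) * E2 / 2 + F * inverse E * E12 / 2 - G11 / 2)
       - (- D2 / (2 * D * s) * (E2 / 2 - F1 + F * inverse E * E1 / 2)
       + inverse s * (E22 / 2 - F12 + (F2 * inverse E - F * E2 / E\<^sup>2) * E1 / 2 + F * inverse E * E12 / 2))
     = brioschi E F G E1 E2 F1 F2 G1 G2 (F12 - E22 / 2 - G11 / 2) / (D * s)"
proof -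
  have Dn: "D \<noteq> 0" using s by auto
  have "- D1 * (F * E2 - E * G1) * E / 4 + D * ((F1 * E - F * E1) * E2 / 2 + F * E * E12 / 2 - E\<^sup>2 * G11 / 2)
     + D2 * (E * E2 - 2 * E * F1 + F * E1) * E / 4
     - D * (E\<^sup>2 * (E22 / 2 - F12) + (F2 * E - F * E2) * E1 / 2 + F * E * E12 / 2)
    = brioschi E F G E1 E2 F1 F2 G1 G2 (F12 - E22 / 2 - G11 / 2) * E\<^sup>2"
    unfolding brioschi_def D D1 D2 by (simp add: field_simps power2_eq_square)
  note main = this
  have "(- D1 / (2 * D * s) * (F * inverse E * E2 / 2 - G1 / 2)
       + inverse s * ((F1 * inverse E - F * E1 / E\<^sup>2) * E2 / 2 + F * inverse E * E12 / 2 - G11 / 2)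
       - (- D2 / (2 * D * s) * (E2 / 2 - F1 + F * inverse E * E1 / 2)
       + inverse s * (E22 / 2 - F12 + (F2 * inverse E - F * E2 / E\<^sup>2) * E1 / 2 + F * inverse E * E12 / 2)))
    = (- D1 * (F * E2 - E * G1) * E / 4 + D * ((F1 * E - F * E1) * E2 / 2 + F * E * E12 / 2 - E\<^sup>2 * G11 / 2)
     + D2 * (E * E2 - 2 * E * F1 + F * E1) * E / 4
     - D * (E\<^sup>2 * (E22 / 2 - F12) + (F2 * E - F * E2) * E1 / 2 + F * E * E12 / 2)) / (D * s * E\<^sup>2)"
    using E s(1) Dn by (simp add: divide_simps power2_eq_square) (simp add: algebra_simps)
  then show ?thesis unfolding main using E by simp
qed

text \<open>The four fractions are the Christoffel symbols \<Gamma>^1_22, \<Gamma>^2_22,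
  \<Gamma>^1_12, \<Gamma>^2_12, in this order of appearance, as Cramer's rule gives them.\<close>

lemma gauss_algebra:
  fixes E F G D E1 E2 F1 F2 G1 G2 R :: real
  assumes D: "D = E * G - F\<^sup>2" "D \<noteq> 0"
  shows "R - E1 * ((G * (F2 - G1/2) - F * (G2/2)) / D) - F1 * ((E * (G2/2) - F * (F2 - G1/2)) / D)
       + E2 * ((G * (E2/2) - F * (G1/2)) / D) + F2 * ((E * (G1/2) - F * (E2/2)) / D)
       + E1/2 * ((G * (F2 - G1/2) - F * (G2/2)) / D) + E2/2 * ((E * (G2/2) - F * (F2 - G1/2)) / D)
       - E2/2 * ((G * (E2/2) - F * (G1/2)) / D) - (F2 - G1/2) * ((E * (G1/2) - F * (E2/2)) / D)
     = brioschi E F G E1 E2 F1 F2 G1 G2 R / D"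
  using D(2) unfolding brioschi_def D(1)[symmetric] by (simp add: field_simps power2_eq_square)

text \<open>The product of two determinants is the determinant of the matrix of inner products of
  (a, p, q) with (b, p, q), expanded along its first row.\<close>

lemma gram_algebra:
  fixes a1 a2 a3 b1 b2 b3 p1 p2 p3 q1 q2 q3 :: real
  defines "det3 \<equiv> \<lambda>x1 x2 x3. x1 * (p2 * q3 - p3 * q2) + x2 * (p3 * q1 - p1 * q3) + x3 * (p1 * q2 - p2 * q1)"
  defines "E \<equiv> p1*p1 + p2*p2 + p3*p3" and "F \<equiv> p1*q1 + p2*q2 + p3*q3" and "G \<equiv> q1*q1 + q2*q2 + q3*q3"
  defines "ab \<equiv> a1*b1 + a2*b2 + a3*b3" and "ap \<equiv> a1*p1 + a2*p2 + a3*p3" and "aq \<equiv> a1*q1 + a2*q2 + a3*q3"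
    and "bp \<equiv> b1*p1 + b2*p2 + b3*p3" and "bq \<equiv> b1*q1 + b2*q2 + b3*q3"
  shows "det3 a1 a2 a3 * det3 b1 b2 b3 = ab * (E * G - F\<^sup>2) - ap * (bp * G - F * bq) + aq * (bp * F - E * bq)"
  unfolding det3_def E_def F_def G_def ab_def ap_def aq_def bp_def bq_def
  by (simp add: algebra_simps power2_eq_square)

text \<open>Here \<open>n\<close> is the cross product p x q, and \<open>m\<close>, \<open>l\<close>
  are its derivatives when p, q have the derivatives a, c in the first and c, b in the second
  direction. The triple product of n, m, l is then the determinant of the unnormalised second
  fundamental form.\<close>

lemma normal_algebra:
  fixes a1 a2 a3 b1 b2 b3 c1 c2 c3 p1 p2 p3 q1 q2 q3 :: real
  defines "n1 \<equiv> p2 * q3 - p3 * q2" and "n2 \<equiv> p3 * q1 - p1 * q3" and "n3 \<equiv> p1 * q2 - p2 * q1"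
  defines "m1 \<equiv> (a2 * q3 + p2 * c3) - (a3 * q2 + p3 * c2)" and "m2 \<equiv> (a3 * q1 + p3 * c1) - (a1 * q3 + p1 * c3)"
    and "m3 \<equiv> (a1 * q2 + p1 * c2) - (a2 * q1 + p2 * c1)"
  defines "l1 \<equiv> (c2 * q3 + p2 * b3) - (c3 * q2 + p3 * b2)" and "l2 \<equiv> (c3 * q1 + p3 * b1) - (c1 * q3 + p1 * b3)"
    and "l3 \<equiv> (c1 * q2 + p1 * b2) - (c2 * q1 + p2 * b1)"
  shows "n1 * (m2 * l3 - m3 * l2) + n2 * (m3 * l1 - m1 * l3) + n3 * (m1 * l2 - m2 * l1)
    = (a1 * n1 + a2 * n2 + a3 * n3) * (b1 * n1 + b2 * n2 + b3 * n3) - (c1 * n1 + c2 * n2 + c3 * n3)\<^sup>2"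
  unfolding n1_def n2_def n3_def m1_def m2_def m3_def l1_def l2_def l3_def
  by (simp add: algebra_simps power2_eq_square)

lemma pderiv_at_cmult:
  fixes f :: "real^'n \<Rightarrow> real"
  shows "f differentiable (at x) \<Longrightarrow> pderiv_at i (\<lambda>x. c * f x) x = c * pderiv_at i f x"
  by (rule pderiv_at_bounded_linear[OF bounded_linear_mult_right])

lemma pderiv_at_uminus:
  fixes f :: "real^'n \<Rightarrow> real"
  shows "f differentiable (at x) \<Longrightarrow> pderiv_at i (\<lambda>x. - f x) x = - pderiv_at i f x"
  by (rule pderiv_at_bounded_linear[OF bounded_linear_minus[OF bounded_linear_ident]])

lemma pderiv_at_const [simp]: "pderiv_at i (\<lambda>_. c) x = 0"
  by (simp add: pderiv_at_def)

lemma pderiv_at_real_compose: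
  fixes f :: "real^'n \<Rightarrow> real"
  assumes "(\<phi> has_real_derivative d) (at (f x))" "f differentiable (at x)"
  shows "(\<lambda>x. \<phi> (f x)) differentiable (at x)" "pderiv_at i (\<lambda>x. \<phi> (f x)) x = d * pderiv_at i f x"
proof -
  have "((\<lambda>x. \<phi> (f x)) has_derivative (\<lambda>v. d * frechet_derivative f (at x) v)) (at x)"
    using has_derivative_compose[of f "frechet_derivative f (at x)" x UNIV \<phi> "(*) d"] assms
    by (auto simp: frechet_derivative_works has_field_derivative_def)
  then show "(\<lambda>x. \<phi> (f x)) differentiable (at x)" "pderiv_at i (\<lambda>x. \<phi> (f x)) x = d * pderiv_at i f x"
    by (auto simp: differentiable_def pderiv_at_eqI) (simp add: pderiv_at_def)
qed

lemma pderiv_at_inverse: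
  fixes f :: "real^'n \<Rightarrow> real"
  assumes "f differentiable (at x)" "f x \<noteq> 0"
  shows "(\<lambda>x. inverse (f x)) differentiable (at x)"
    "pderiv_at i (\<lambda>x. inverse (f x)) x = - pderiv_at i f x / (f x)\<^sup>2"
proof -
  have d: "(inverse has_real_derivative - inverse ((f x)\<^sup>2)) (at (f x))"
    using assms(2) by (auto intro!: derivative_eq_intros simp: power2_eq_square)
  show "(\<lambda>x. inverse (f x)) differentiable (at x)" by (rule pderiv_at_real_compose(1)[OF d assms(1)])
  show "pderiv_at i (\<lambda>x. inverse (f x)) x = - pderiv_at i f x / (f x)\<^sup>2"
    using pderiv_at_real_compose(2)[OF d assms(1)] by (simp add: divide_inverse mult.commute)
qed

lemma pderiv_at_sqrt:
  fixes f :: "real^'n \<Rightarrow> real"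
  assumes "f differentiable (at x)" "f x > 0"
  shows "(\<lambda>x. sqrt (f x)) differentiable (at x)"
    "pderiv_at i (\<lambda>x. sqrt (f x)) x = pderiv_at i f x / (2 * sqrt (f x))"
  using pderiv_at_real_compose[OF DERIV_real_sqrt[OF assms(2)] assms(1)] by (auto simp: field_simps)

lemma pderiv_at_inverse_sqrt:
  fixes f :: "real^'n \<Rightarrow> real"
  assumes "f differentiable (at x)" "f x > 0"
  shows "(\<lambda>x. inverse (sqrt (f x))) differentiable (at x)"
    "pderiv_at i (\<lambda>x. inverse (sqrt (f x))) x = - pderiv_at i f x / (2 * f x * sqrt (f x))"
  using pderiv_at_inverse[OF pderiv_at_sqrt(1)[OF assms]] pderiv_at_sqrt(2)[OF assms] assms(2)
  by auto

lemma Ck_on_1_I: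
  assumes "open S" "\<And>x. x \<in> S \<Longrightarrow> f differentiable (at x)"
    "\<And>x i. x \<in> S \<Longrightarrow> pderiv_at i f x = g i x" "\<And>i. continuous_on S (g i)"
  shows "Ck_on 1 S f"
  using assms continuous_on_cong[of S S "pderiv_at _ f" "g _"] by auto

lemma Ck_on_1_D:
  assumes "Ck_on 1 S f"
  shows "continuous_on S f" "x \<in> S \<Longrightarrow> f differentiable (at x)" "continuous_on S (pderiv_at i f)"
  using assms Ck_on_SucD[of 0 S f] by auto

lemma Ck_on_1_inverse:
  fixes f :: "real^'n \<Rightarrow> real"
  assumes "open S" "Ck_on 1 S f" "\<And>x. x \<in> S \<Longrightarrow> f x \<noteq> 0"
  shows "Ck_on 1 S (\<lambda>x. inverse (f x))"
  using assms by (intro Ck_on_1_I[where g="\<lambda>i x. - pderiv_at i f x / (f x)\<^sup>2"] pderiv_at_inverse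
      continuous_intros Ck_on_1_D[OF assms(2)]) auto

lemma Ck_on_1_sqrt:
  fixes f :: "real^'n \<Rightarrow> real"
  assumes "open S" "Ck_on 1 S f" "\<And>x. x \<in> S \<Longrightarrow> f x > 0"
  shows "Ck_on 1 S (\<lambda>x. sqrt (f x))"
  using assms by (intro Ck_on_1_I[where g="\<lambda>i x. pderiv_at i f x / (2 * sqrt (f x))"] pderiv_at_sqrt
      continuous_intros Ck_on_1_D[OF assms(2)]) (auto simp: less_imp_neq[symmetric])

lemma Ck_on_2_D:
  assumes "Ck_on 2 S f"
  shows "Ck_on 1 S f" "Ck_on 1 S (pderiv_at i f)"
  using assms Ck_on_mono[of 2 S f 1] by (auto simp: numeral_2_eq_2)

lemma metric_det_pderiv:
  assumes "E differentiable (at x)" "F differentiable (at x)" "G differentiable (at x)"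
  shows "metric_det E F G differentiable (at x)"
    "pderiv_at i (metric_det E F G) x = pderiv_at i E x * G x + E x * pderiv_at i G x - 2 * F x * pderiv_at i F x"
  using assms by (auto simp: metric_det_def[abs_def] pderiv_at_diff pderiv_at_mult)

lemma Ck_on_conn:
  assumes S: "open S" and ck: "Ck_on 2 S E" "Ck_on 2 S F" "Ck_on 2 S G"
    and pos: "\<And>x. x \<in> S \<Longrightarrow> E x > 0" "\<And>x. x \<in> S \<Longrightarrow> metric_det E F G x > 0"
  shows "Ck_on 1 S (conn1 E F G)" "Ck_on 1 S (conn2 E F G)"
proof -
  note c1 = Ck_on_2_D(1)[OF ck(1)] Ck_on_2_D(1)[OF ck(2)] Ck_on_2_D(1)[OF ck(3)]
  note c2 = Ck_on_2_D(2)[OF ck(1)] Ck_on_2_D(2)[OF ck(2)] Ck_on_2_D(2)[OF ck(3)]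
  have D: "Ck_on 1 S (metric_det E F G)"
    unfolding metric_det_def[abs_def] by (intro Ck_on_diff Ck_on_mult S c1)
  have s: "Ck_on 1 S (\<lambda>x. inverse (sqrt (metric_det E F G x)))"
    using pos(2) by (intro Ck_on_1_inverse Ck_on_1_sqrt S D) (auto simp: less_imp_neq[symmetric])
  have Ei: "Ck_on 1 S (\<lambda>x. inverse (E x))"
    using pos(1) by (intro Ck_on_1_inverse S c1) (auto simp: less_imp_neq[symmetric])
  show "Ck_on 1 S (conn1 E F G)" "Ck_on 1 S (conn2 E F G)"
    unfolding conn1_def[abs_def] conn2_def[abs_def] divide_inverse
    by (intro Ck_on_mult Ck_on_add Ck_on_diff S s Ei c1 c2 Ck_on_const)+
qed

text \<open>By \<open>gauss_curvature_brioschi\<close> the right-hand side is curvature times area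
  density, so second derivatives of the metric enter only through a curl.\<close>

lemma curl_conn:
  assumes S: "open S" "x \<in> S" and ck: "Ck_on 2 S E" "Ck_on 2 S F" "Ck_on 2 S G"
    and pos: "E x > 0" "metric_det E F G x > 0"
  shows "pderiv_at 1 (conn2 E F G) x - pderiv_at 2 (conn1 E F G) x
    = metric_brioschi E F G x / (metric_det E F G x * sqrt (metric_det E F G x))"
proof -
  have d: "E differentiable (at x)" "F differentiable (at x)" "G differentiable (at x)"
    "pderiv_at i E differentiable (at x)" "pderiv_at i F differentiable (at x)" "pderiv_at i G differentiable (at x)" for i
    using Ck_on_1_D(2)[OF Ck_on_2_D(1)] Ck_on_1_D(2)[OF Ck_on_2_D(2)] ck S(2) by blast+
  let ?D = "metric_det E F G"
  have Dd: "?D differentiable (at x)" by (rule metric_det_pderiv[OF d(1-3)])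
  note isq = pderiv_at_inverse_sqrt[OF Dd pos(2)]
  have E0: "E x \<noteq> 0" using pos by simp
  note ie = pderiv_at_inverse[OF d(1) E0]
  have c12: "pderiv_at 2 (pderiv_at 1 h) x = pderiv_at 1 (pderiv_at 2 h) x" if "Ck_on 2 S h" for h :: "real^2 \<Rightarrow> real"
    by (rule pderiv_at_commute[OF S that])
  let ?p = "pderiv_at"
  have A: "?p i (\<lambda>x. F x * inverse (E x) * ?p j E x) x =
     (?p i F x * inverse (E x) - F x * ?p i E x / (E x)\<^sup>2) * ?p j E x + F x * inverse (E x) * ?p i (?p j E) x" for i j
    using d ie by (simp add: pderiv_at_mult divide_inverse algebra_simps)
  have Ad: "(\<lambda>x. F x * inverse (E x) * ?p j E x) differentiable (at x)" for j
    using d ie by (intro differentiable_mult)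
  have B2: "(\<lambda>x. F x * inverse (E x) * ?p 2 E x / 2 - ?p 1 G x / 2) differentiable (at x)"
    "?p 1 (\<lambda>x. F x * inverse (E x) * ?p 2 E x / 2 - ?p 1 G x / 2) x =
      ((?p 1 F x * inverse (E x) - F x * ?p 1 E x / (E x)\<^sup>2) * ?p 2 E x / 2 + F x * inverse (E x) * ?p 1 (?p 2 E) x / 2 - ?p 1 (?p 1 G) x / 2)"
  proof -
    have h: "pderiv_at i (\<lambda>x. f x / 2) x = pderiv_at i f x / 2" "(\<lambda>x. f x / 2) differentiable (at x)" if "f differentiable (at x)" for f :: "real^2 \<Rightarrow> real" and i
      using pderiv_at_cmult[OF that, of i "1/2"] that by auto
    show "(\<lambda>x. F x * inverse (E x) * ?p 2 E x / 2 - ?p 1 G x / 2) differentiable (at x)"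
      by (intro differentiable_diff h Ad d)
    show "?p 1 (\<lambda>x. F x * inverse (E x) * ?p 2 E x / 2 - ?p 1 G x / 2) x =
      ((?p 1 F x * inverse (E x) - F x * ?p 1 E x / (E x)\<^sup>2) * ?p 2 E x / 2 + F x * inverse (E x) * ?p 1 (?p 2 E) x / 2 - ?p 1 (?p 1 G) x / 2)"
      by (subst pderiv_at_diff[OF h(2)[OF Ad] h(2)[OF d(6)]]) (simp only: h(1)[OF Ad] h(1)[OF d(6)] A add_divide_distrib)
  qed
  have B1: "(\<lambda>x. ?p 2 E x / 2 - ?p 1 F x + F x * inverse (E x) * ?p 1 E x / 2) differentiable (at x)"
    "?p 2 (\<lambda>x. ?p 2 E x / 2 - ?p 1 F x + F x * inverse (E x) * ?p 1 E x / 2) x =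
      (?p 2 (?p 2 E) x / 2 - ?p 2 (?p 1 F) x + ((?p 2 F x * inverse (E x) - F x * ?p 2 E x / (E x)\<^sup>2) * ?p 1 E x / 2 + F x * inverse (E x) * ?p 2 (?p 1 E) x / 2))"
  proof -
    have h: "pderiv_at i (\<lambda>x. f x / 2) x = pderiv_at i f x / 2" "(\<lambda>x. f x / 2) differentiable (at x)" if "f differentiable (at x)" for f :: "real^2 \<Rightarrow> real" and i
      using pderiv_at_cmult[OF that, of i "1/2"] that by auto
    have h2: "(\<lambda>x. ?p 2 E x / 2 - ?p 1 F x) differentiable (at x)"
      by (intro differentiable_diff h d)
    show "(\<lambda>x. ?p 2 E x / 2 - ?p 1 F x + F x * inverse (E x) * ?p 1 E x / 2) differentiable (at x)"
      by (intro differentiable_add h2 h Ad)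
    show "?p 2 (\<lambda>x. ?p 2 E x / 2 - ?p 1 F x + F x * inverse (E x) * ?p 1 E x / 2) x =
      (?p 2 (?p 2 E) x / 2 - ?p 2 (?p 1 F) x + ((?p 2 F x * inverse (E x) - F x * ?p 2 E x / (E x)\<^sup>2) * ?p 1 E x / 2 + F x * inverse (E x) * ?p 2 (?p 1 E) x / 2))"
      by (subst pderiv_at_add[OF h2 h(2)[OF Ad]], subst pderiv_at_diff[OF h(2)[OF d(4)] d(5)])
         (simp only: h(1)[OF Ad] h(1)[OF d(4)] A add_divide_distrib)
  qed
  have P2: "?p 1 (conn2 E F G) x = - ?p 1 ?D x / (2 * ?D x * sqrt (?D x)) * (F x * inverse (E x) * ?p 2 E x / 2 - ?p 1 G x / 2)
       + inverse (sqrt (?D x)) * ((?p 1 F x * inverse (E x) - F x * ?p 1 E x / (E x)\<^sup>2) * ?p 2 E x / 2 + F x * inverse (E x) * ?p 1 (?p 2 E) x / 2 - ?p 1 (?p 1 G) x / 2)"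
    unfolding conn2_def[abs_def] by (subst pderiv_at_mult[OF isq(1) B2(1)]) (simp only: isq(2) B2(2) add.commute)
  have P1: "?p 2 (conn1 E F G) x = - ?p 2 ?D x / (2 * ?D x * sqrt (?D x)) * (?p 2 E x / 2 - ?p 1 F x + F x * inverse (E x) * ?p 1 E x / 2)
       + inverse (sqrt (?D x)) * (?p 2 (?p 2 E) x / 2 - ?p 2 (?p 1 F) x + (?p 2 F x * inverse (E x) - F x * ?p 2 E x / (E x)\<^sup>2) * ?p 1 E x / 2 + F x * inverse (E x) * ?p 2 (?p 1 E) x / 2)"
    unfolding conn1_def[abs_def] by (subst pderiv_at_mult[OF isq(1) B1(1)]) (simp only: isq(2) B1(2) add.commute add.left_commute add.assoc)
  have s: "sqrt (?D x) \<noteq> 0" "sqrt (?D x) * sqrt (?D x) = ?D x" using pos by auto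
  show ?thesis
    unfolding P1 P2 c12[OF ck(1)] c12[OF ck(2)] metric_brioschi_def
    by (rule curl_algebra[OF E0 s]) (simp_all add: metric_det_pderiv[OF d(1-3)], simp add: metric_det_def power2_eq_square)
qed

section \<open>Surfaces in space\<close>

text \<open>Taken cyclically over the three coordinates, these are the components of the cross
  product of the coordinate tangent vectors, an unnormalised normal.\<close>

definition nrm :: "(real^2 \<Rightarrow> real) \<Rightarrow> (real^2 \<Rightarrow> real) \<Rightarrow> real^2 \<Rightarrow> real" where
  "nrm a b x = pderiv_at 1 a x * pderiv_at 2 b x - pderiv_at 1 b x * pderiv_at 2 a x"

definition ffundamental :: "2 \<Rightarrow> 2 \<Rightarrow> (real^2 \<Rightarrow> real) \<Rightarrow> (real^2 \<Rightarrow> real) \<Rightarrow> (real^2 \<Rightarrow> real) \<Rightarrow> real^2 \<Rightarrow> real" where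
  "ffundamental i j p q r x = pderiv_at i p x * pderiv_at j p x + pderiv_at i q x * pderiv_at j q x + pderiv_at i r x * pderiv_at j r x"

text \<open>First component of \<open>F_map\<close>, written with products and inverses because the
  closure lemmas for C^1 and for tame convergence are about these operations.\<close>

definition F1 :: "real \<Rightarrow> real \<Rightarrow> real" where
  "F1 a b = a * (inverse (sqrt (1 + (a * a + b * b))) * inverse (1 + b * b))"

text \<open>The second entry stays \<open>b\<close>, so derivatives of \<open>b\<close> inside
  \<open>F1\<close> drop out and only the derivative of \<open>F1\<close> in its first argument
  counts: with q = 1 + a^2 + b^2 and r = 1 + b^2 it is (q - a^2) / (q sqrt q r), and q - a^2 =
  r.\<close>

lemma jac_F1:
  assumes d: "a differentiable (at x)" "b differentiable (at x)"
  shows "(\<lambda>x. F1 (a x) (b x)) differentiable (at x)"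
    "jac (\<lambda>x. F1 (a x) (b x)) b x = jac a b x / ((1 + (a x * a x + b x * b x)) * sqrt (1 + (a x * a x + b x * b x)))"
proof -
  let ?q = "\<lambda>x. 1 + (a x * a x + b x * b x)" and ?r = "\<lambda>x. 1 + b x * b x"
  have q: "?q differentiable (at x)" "?r differentiable (at x)" using d by auto
  have pos: "?q x > 0" "?r x > 0" by (auto intro: add_pos_nonneg)
  have pq: "pderiv_at i ?q x = 2 * a x * pderiv_at i a x + 2 * b x * pderiv_at i b x" for i
    using d by (simp add: pderiv_at_add pderiv_at_mult)
  have pr: "pderiv_at i ?r x = 2 * b x * pderiv_at i b x" for i
    using d by (simp add: pderiv_at_add pderiv_at_mult)
  note s = pderiv_at_inverse_sqrt[OF q(1) pos(1)]
  have rn: "?r x \<noteq> 0" using pos by simp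
  note v = pderiv_at_inverse[OF q(2) rn]
  show "(\<lambda>x. F1 (a x) (b x)) differentiable (at x)"
    unfolding F1_def using d s v by (intro differentiable_mult)
  have p: "pderiv_at i (\<lambda>x. F1 (a x) (b x)) x = pderiv_at i a x * (inverse (sqrt (?q x)) * inverse (?r x))
     + a x * (- pderiv_at i ?q x / (2 * ?q x * sqrt (?q x)) * inverse (?r x) + inverse (sqrt (?q x)) * (- pderiv_at i ?r x / (?r x)\<^sup>2))" for i
    unfolding F1_def using d s v by (simp add: pderiv_at_mult algebra_simps)
  have alg: "(a1 * (inverse s * inverse r) + A * (- (2 * A * a1 + 2 * B * b1) / (2 * q * s) * inverse r + inverse s * (- (2 * B * b1) / r\<^sup>2))) * b2
     - (a2 * (inverse s * inverse r) + A * (- (2 * A * a2 + 2 * B * b2) / (2 * q * s) * inverse r + inverse s * (- (2 * B * b2) / r\<^sup>2))) * b1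
     = (a1 * b2 - a2 * b1) / (q * s)" if h: "q = r + A * A" "q \<noteq> 0" "r \<noteq> 0" "s \<noteq> 0" for a1 a2 b1 b2 A B q r s :: real
  proof -
    have "(a1 * (inverse s * inverse r) + A * (- (2 * A * a1 + 2 * B * b1) / (2 * q * s) * inverse r + inverse s * (- (2 * B * b1) / r\<^sup>2))) * b2
     - (a2 * (inverse s * inverse r) + A * (- (2 * A * a2 + 2 * B * b2) / (2 * q * s) * inverse r + inverse s * (- (2 * B * b2) / r\<^sup>2))) * b1
     = (a1 * b2 - a2 * b1) * (q - A * A) / (q * s * r)"
      using h(2-4) by (simp add: divide_simps power2_eq_square) (simp add: algebra_simps)
    also have "q - A * A = r" using h(1) by simp
    finally show ?thesis using h(3) by simp
  qed
  show "jac (\<lambda>x. F1 (a x) (b x)) b x = jac a b x / (?q x * sqrt (?q x))"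
    unfolding jac_def p pq pr using pos by (intro alg) auto
qed

text \<open>A graph over the first two coordinates with normal (n_1, n_2, n_3) has gradient (-n_1 /
  n_3, -n_2 / n_3).\<close>

definition slope :: "(real^2 \<Rightarrow> real) \<Rightarrow> (real^2 \<Rightarrow> real) \<Rightarrow> real^2 \<Rightarrow> real" where
  "slope n m x = - (n x * inverse (m x))"

lemma pderiv_nrm:
  assumes S: "open S" "x \<in> S" and ck: "Ck_on 2 S a" "Ck_on 2 S b"
  shows "nrm a b differentiable (at x)"
    "pderiv_at i (nrm a b) x = pderiv_at i (pderiv_at 1 a) x * pderiv_at 2 b x + pderiv_at 1 a x * pderiv_at i (pderiv_at 2 b) x
      - (pderiv_at i (pderiv_at 1 b) x * pderiv_at 2 a x + pderiv_at 1 b x * pderiv_at i (pderiv_at 2 a) x)"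
proof -
  have d: "pderiv_at i a differentiable (at x)" "pderiv_at i b differentiable (at x)" for i
    using Ck_on_1_D(2)[OF Ck_on_2_D(2)] ck S(2) by blast+
  show "nrm a b differentiable (at x)" unfolding nrm_def[abs_def] using d by auto
  show "pderiv_at i (nrm a b) x = pderiv_at i (pderiv_at 1 a) x * pderiv_at 2 b x + pderiv_at 1 a x * pderiv_at i (pderiv_at 2 b) x
      - (pderiv_at i (pderiv_at 1 b) x * pderiv_at 2 a x + pderiv_at 1 b x * pderiv_at i (pderiv_at 2 a) x)"
    unfolding nrm_def[abs_def] using d by (simp add: pderiv_at_diff pderiv_at_mult)
qed

text \<open>The slopes are the central projection of the vector (n, l, m). The numerator is the
  triple product of this vector with its two partial derivatives.\<close>

lemma jac_slope:
  assumes "n differentiable (at x)" "l differentiable (at x)" "m differentiable (at x)" "m x \<noteq> 0"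
  shows "slope n m differentiable (at x)"
    "jac (slope n m) (slope l m) x = (n x * (pderiv_at 1 l x * pderiv_at 2 m x - pderiv_at 1 m x * pderiv_at 2 l x)
       + l x * (pderiv_at 1 m x * pderiv_at 2 n x - pderiv_at 1 n x * pderiv_at 2 m x)
       + m x * (pderiv_at 1 n x * pderiv_at 2 l x - pderiv_at 1 l x * pderiv_at 2 n x)) / (m x) ^ 3"
proof -
  note im = pderiv_at_inverse[OF assms(3,4)]
  show "slope n m differentiable (at x)" unfolding slope_def[abs_def] using assms im by (intro differentiable_minus differentiable_mult)
  have p: "pderiv_at i (slope k m) x = - (pderiv_at i k x * inverse (m x) - k x * pderiv_at i m x / (m x)\<^sup>2)"
    if "k differentiable (at x)" for k i
    unfolding slope_def[abs_def] using that im
    by (subst pderiv_at_uminus) (auto simp: pderiv_at_mult intro!: differentiable_mult)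
  have alg: "(- (n1 * inverse m - n * m1 / m\<^sup>2)) * (- (l2 * inverse m - l * m2 / m\<^sup>2)) - (- (n2 * inverse m - n * m2 / m\<^sup>2)) * (- (l1 * inverse m - l * m1 / m\<^sup>2))
    = (n * (l1 * m2 - m1 * l2) + l * (m1 * n2 - n1 * m2) + m * (n1 * l2 - l1 * n2)) / m ^ 3" if "m \<noteq> 0"
    for n n1 n2 l l1 l2 m m1 m2 :: real
    using that by (simp add: divide_simps power2_eq_square power3_eq_cube) (simp add: algebra_simps)
  show "jac (slope n m) (slope l m) x = (n x * (pderiv_at 1 l x * pderiv_at 2 m x - pderiv_at 1 m x * pderiv_at 2 l x)
       + l x * (pderiv_at 1 m x * pderiv_at 2 n x - pderiv_at 1 n x * pderiv_at 2 m x)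
       + m x * (pderiv_at 1 n x * pderiv_at 2 l x - pderiv_at 1 l x * pderiv_at 2 n x)) / (m x) ^ 3"
    unfolding jac_def p[OF assms(1)] p[OF assms(2)] by (rule alg[OF assms(4)])
qed

text \<open>The square root produces |m|, so that m^3 stands against |m|^3 and the sign of
  \<open>m\<close> survives: the orientation of the projection.\<close>

lemma sqrt_cube_algebra:
  fixes D m :: real
  assumes "D > 0" "m \<noteq> 0"
  shows "B / m ^ 3 / (D / m\<^sup>2 * sqrt (D / m\<^sup>2)) = sgn m * (B / (D * sqrt D))"
proof -
  have "sqrt (D / m\<^sup>2) = sqrt D / \<bar>m\<bar>" by (simp add: real_sqrt_divide)
  moreover have "\<bar>m\<bar> = sgn m * m" by (simp add: abs_sgn mult.commute)
  moreover have "sgn m \<noteq> 0" "sgn m * sgn m = 1" using assms by (auto simp: sgn_if)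
  ultimately show ?thesis using assms
    by (simp add: divide_simps power2_eq_square power3_eq_cube) (metis mult.assoc mult.commute mult.right_neutral)
qed

text \<open>The factor in \<open>jac_F1\<close> is the density of the spherical area in slope coordinates, so
  the left-hand side is the pullback of this area by the Gauss map.\<close>

lemma jac_graph_map:
  assumes S: "open S" "x \<in> S" and ck: "Ck_on 3 S p" "Ck_on 3 S q" "Ck_on 3 S r"
    and m: "nrm p q x \<noteq> 0"
  defines "E \<equiv> ffundamental 1 1 p q r" and "F \<equiv> ffundamental 1 2 p q r" and "G \<equiv> ffundamental 2 2 p q r"
  shows "jac (\<lambda>x. F1 (slope (nrm q r) (nrm p q) x) (slope (nrm r p) (nrm p q) x)) (slope (nrm r p) (nrm p q)) x =
     sgn (nrm p q x) * (metric_brioschi E F G x / (metric_det E F G x * sqrt (metric_det E F G x)))"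
proof -
  have c2: "Ck_on 2 S p" "Ck_on 2 S q" "Ck_on 2 S r" using ck Ck_on_mono[of 3 S _ 2] by auto
  have c2': "Ck_on 2 S (pderiv_at i p)" "Ck_on 2 S (pderiv_at i q)" "Ck_on 2 S (pderiv_at i r)" for i
    using ck by (auto simp: eval_nat_numeral)
  let ?p = "pderiv_at"
  have sw: "?p 2 (?p 1 h) x = ?p 1 (?p 2 h) x" if "Ck_on 2 S h" for h :: "real^2 \<Rightarrow> real" by (rule pderiv_at_commute[OF S that])
  have sw3: "?p 2 (?p 1 (?p i h)) x = ?p 1 (?p 2 (?p i h)) x" if "Ck_on 2 S (?p i h)" for i and h :: "real^2 \<Rightarrow> real"
    by (rule pderiv_at_commute[OF S that])
  let ?n1 = "nrm q r" and ?n2 = "nrm r p" and ?n3 = "nrm p q"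
  have nd: "?n1 differentiable (at x)" "?n2 differentiable (at x)" "?n3 differentiable (at x)"
    using pderiv_nrm(1)[OF S] c2 by blast+
  have sd: "slope ?n1 ?n3 differentiable (at x)" "slope ?n2 ?n3 differentiable (at x)"
    using jac_slope(1)[OF nd(1) nd(1) nd(3) m] jac_slope(1)[OF nd(2) nd(2) nd(3) m] by auto
  let ?D = "metric_det E F G x"
  have D: "?D = (?n1 x)\<^sup>2 + (?n2 x)\<^sup>2 + (?n3 x)\<^sup>2"
    unfolding metric_det_def E_def F_def G_def ffundamental_def nrm_def by (simp add: algebra_simps power2_eq_square)
  have Dpos: "?D > 0" unfolding D using m by (simp add: add_nonneg_pos)
  have q: "1 + (slope ?n1 ?n3 x * slope ?n1 ?n3 x + slope ?n2 ?n3 x * slope ?n2 ?n3 x) = ?D / (?n3 x)\<^sup>2"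
    unfolding D slope_def using m by (simp add: field_simps power2_eq_square)
  let ?B = "?n1 x * (?p 1 ?n2 x * ?p 2 ?n3 x - ?p 1 ?n3 x * ?p 2 ?n2 x)
       + ?n2 x * (?p 1 ?n3 x * ?p 2 ?n1 x - ?p 1 ?n1 x * ?p 2 ?n3 x)
       + ?n3 x * (?p 1 ?n1 x * ?p 2 ?n2 x - ?p 1 ?n2 x * ?p 2 ?n1 x)"
  \<comment> \<open>The triple product of the normal with its derivatives is the determinant of the
    second fundamental form; products of triple products become Gram determinants, which involve
    inner products of derivatives of the embedding only.\<close>
  have B: "?B = metric_brioschi E F G x"
  proof -
    note pn = pderiv_nrm(2)[OF S c2(2,3)] pderiv_nrm(2)[OF S c2(3,1)] pderiv_nrm(2)[OF S c2(1,2)]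
    define a1 a2 a3 where "a1 = ?p 1 (?p 1 p) x" "a2 = ?p 1 (?p 1 q) x" "a3 = ?p 1 (?p 1 r) x"
    define b1 b2 b3 where "b1 = ?p 2 (?p 2 p) x" "b2 = ?p 2 (?p 2 q) x" "b3 = ?p 2 (?p 2 r) x"
    define d1 d2 d3 where "d1 = ?p 1 (?p 2 p) x" "d2 = ?p 1 (?p 2 q) x" "d3 = ?p 1 (?p 2 r) x"
    define p1 p2 p3 where "p1 = ?p 1 p x" "p2 = ?p 1 q x" "p3 = ?p 1 r x"
    define q1 q2 q3 where "q1 = ?p 2 p x" "q2 = ?p 2 q x" "q3 = ?p 2 r x"
    note defs = a1_a2_a3_def b1_b2_b3_def d1_d2_d3_def p1_p2_p3_def q1_q2_q3_def
    have "?B = (p2 * q3 - p3 * q2) * (((a3 * q1 + p3 * d1) - (a1 * q3 + p1 * d3)) * ((d1 * q2 + p1 * b2) - (d2 * q1 + p2 * b1)) - ((a1 * q2 + p1 * d2) - (a2 * q1 + p2 * d1)) * ((d3 * q1 + p3 * b1) - (d1 * q3 + p1 * b3)))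
      + (p3 * q1 - p1 * q3) * (((a1 * q2 + p1 * d2) - (a2 * q1 + p2 * d1)) * ((d2 * q3 + p2 * b3) - (d3 * q2 + p3 * b2)) - ((a2 * q3 + p2 * d3) - (a3 * q2 + p3 * d2)) * ((d1 * q2 + p1 * b2) - (d2 * q1 + p2 * b1)))
      + (p1 * q2 - p2 * q1) * (((a2 * q3 + p2 * d3) - (a3 * q2 + p3 * d2)) * ((d3 * q1 + p3 * b1) - (d1 * q3 + p1 * b3)) - ((a3 * q1 + p3 * d1) - (a1 * q3 + p1 * d3)) * ((d2 * q3 + p2 * b3) - (d3 * q2 + p3 * b2)))"
      unfolding pn nrm_def sw[OF c2(1)] sw[OF c2(2)] sw[OF c2(3)] defs by (simp only: mult.commute[of "?p 2 _ x"])
    also have "\<dots> = (a1 * (p2 * q3 - p3 * q2) + a2 * (p3 * q1 - p1 * q3) + a3 * (p1 * q2 - p2 * q1)) * (b1 * (p2 * q3 - p3 * q2) + b2 * (p3 * q1 - p1 * q3) + b3 * (p1 * q2 - p2 * q1)) - (d1 * (p2 * q3 - p3 * q2) + d2 * (p3 * q1 - p1 * q3) + d3 * (p1 * q2 - p2 * q1)) * (d1 * (p2 * q3 - p3 * q2) + d2 * (p3 * q1 - p1 * q3) + d3 * (p1 * q2 - p2 * q1))"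
      by (simp only: normal_algebra power2_eq_square)
    also note gram_algebra[of a1 p2 q3 p3 q2 a2 q1 p1 a3 b1 b2 b3]
    also note gram_algebra[of d1 p2 q3 p3 q2 d2 q1 p1 d3 d1 d2 d3]
    finally have 1: "?B = (a1 * b1 + a2 * b2 + a3 * b3 - (d1 * d1 + d2 * d2 + d3 * d3)) * (E x * G x - (F x)\<^sup>2)
      - (a1 * p1 + a2 * p2 + a3 * p3) * ((b1 * p1 + b2 * p2 + b3 * p3) * G x - F x * (b1 * q1 + b2 * q2 + b3 * q3))
      + (a1 * q1 + a2 * q2 + a3 * q3) * ((b1 * p1 + b2 * p2 + b3 * p3) * F x - E x * (b1 * q1 + b2 * q2 + b3 * q3))
      + (d1 * p1 + d2 * p2 + d3 * p3) * ((d1 * p1 + d2 * p2 + d3 * p3) * G x - F x * (d1 * q1 + d2 * q2 + d3 * q3))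
      - (d1 * q1 + d2 * q2 + d3 * q3) * ((d1 * p1 + d2 * p2 + d3 * p3) * F x - E x * (d1 * q1 + d2 * q2 + d3 * q3))"
      unfolding E_def F_def G_def ffundamental_def p1_p2_p3_def[symmetric] q1_q2_q3_def[symmetric] by (simp add: left_diff_distrib)
    have df: "?p i h differentiable (at x)" "?p j (?p i h) differentiable (at x)" if "Ck_on 3 S h" for i j and h :: "real^2 \<Rightarrow> real"
    proof -
      have "Ck_on 2 S (?p i h)" using that by (auto simp: eval_nat_numeral)
      then show "?p i h differentiable (at x)" "?p j (?p i h) differentiable (at x)"
        using Ck_on_1_D(2)[OF Ck_on_2_D(1) S(2)] Ck_on_1_D(2)[OF Ck_on_2_D(2) S(2)] by blast+
    qed
    have dfS: "?p i h differentiable (at y)" if "Ck_on 3 S h" "y \<in> S" for i y and h :: "real^2 \<Rightarrow> real"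
    proof -
      have "Ck_on 2 S (?p i h)" using that(1) by (auto simp: eval_nat_numeral)
      then show ?thesis using Ck_on_1_D(2)[OF Ck_on_2_D(1) that(2)] by blast
    qed
    have prod: "?p k (\<lambda>x. ?p i h x * ?p j h x) y = ?p i h y * ?p k (?p j h) y + ?p k (?p i h) y * ?p j h y"
      if "Ck_on 3 S h" "y \<in> S" for i j k y and h :: "real^2 \<Rightarrow> real"
      using dfS[OF that] by (intro pderiv_at_mult)
    have ff1: "?p k (ffundamental i j p q r) y = (?p i p y * ?p k (?p j p) y + ?p k (?p i p) y * ?p j p y)
        + (?p i q y * ?p k (?p j q) y + ?p k (?p i q) y * ?p j q y) + (?p i r y * ?p k (?p j r) y + ?p k (?p i r) y * ?p j r y)"
      if "y \<in> S" for i j k y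
      unfolding ffundamental_def[abs_def] using dfS[OF ck(1) that] dfS[OF ck(2) that] dfS[OF ck(3) that]
      by (simp add: pderiv_at_add prod[OF _ that] ck)
    have prod2: "?p l (\<lambda>x. ?p i h x * ?p k (?p j h) x) x = ?p i h x * ?p l (?p k (?p j h)) x + ?p l (?p i h) x * ?p k (?p j h) x"
      "?p l (\<lambda>x. ?p k (?p j h) x * ?p i h x) x = ?p k (?p j h) x * ?p l (?p i h) x + ?p l (?p k (?p j h)) x * ?p i h x"
      if "Ck_on 3 S h" for i j k l and h :: "real^2 \<Rightarrow> real"
      using df[OF that] by (intro pderiv_at_mult; blast)+
    have ff2: "?p l (?p k (ffundamental i j p q r)) x = 
       (?p i p x * ?p l (?p k (?p j p)) x + ?p l (?p i p) x * ?p k (?p j p) x + (?p k (?p i p) x * ?p l (?p j p) x + ?p l (?p k (?p i p)) x * ?p j p x))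
       + (?p i q x * ?p l (?p k (?p j q)) x + ?p l (?p i q) x * ?p k (?p j q) x + (?p k (?p i q) x * ?p l (?p j q) x + ?p l (?p k (?p i q)) x * ?p j q x))
       + (?p i r x * ?p l (?p k (?p j r)) x + ?p l (?p i r) x * ?p k (?p j r) x + (?p k (?p i r) x * ?p l (?p j r) x + ?p l (?p k (?p i r)) x * ?p j r x))" for i j k l
    proof -
      have "?p l (?p k (ffundamental i j p q r)) x = ?p l (\<lambda>y. (?p i p y * ?p k (?p j p) y + ?p k (?p i p) y * ?p j p y)
        + (?p i q y * ?p k (?p j q) y + ?p k (?p i q) y * ?p j q y) + (?p i r y * ?p k (?p j r) y + ?p k (?p i r) y * ?p j r y)) x"
        by (rule pderiv_at_cong[OF S]) (rule ff1)
      then show ?thesis using df[OF ck(1)] df[OF ck(2)] df[OF ck(3)]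
        by (simp add: pderiv_at_add prod2 ck)
    qed
    have T1: "?p k (?p 2 (?p 1 h)) x = ?p k (?p 1 (?p 2 h)) x" if "Ck_on 2 S h" for k and h :: "real^2 \<Rightarrow> real"
      by (rule pderiv_at_cong[OF S]) (rule pderiv_at_commute[OF S(1) _ that])
    \<comment> \<open>In this combination of second derivatives of the metric all third derivatives
      of the embedding cancel, which is the Theorema Egregium in coordinates.\<close>
    have R: "?p 1 (?p 2 F) x - ?p 2 (?p 2 E) x / 2 - ?p 1 (?p 1 G) x / 2 = a1 * b1 + a2 * b2 + a3 * b3 - (d1 * d1 + d2 * d2 + d3 * d3)"
      unfolding E_def F_def G_def ff2 sw[OF c2(1)] sw[OF c2(2)] sw[OF c2(3)] defs
        T1[OF c2(1)] T1[OF c2(2)] T1[OF c2(3)] sw3[OF c2'(1)] sw3[OF c2'(2)] sw3[OF c2'(3)]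
      by (simp add: field_simps)
    show ?thesis
      unfolding metric_brioschi_def R 1 brioschi_def
      unfolding E_def F_def G_def ff1[OF S(2)] sw[OF c2(1)] sw[OF c2(2)] sw[OF c2(3)]
      unfolding ffundamental_def defs[symmetric]
      by (simp add: field_simps power2_eq_square)
  qed
  show ?thesis
    unfolding jac_F1(2)[OF sd] q jac_slope(2)[OF nd m] B by (rule sqrt_cube_algebra[OF Dpos m])
qed

section \<open>Curvature of a smooth metric\<close>

lemma metric_positive:
  fixes g :: "real^2 \<Rightarrow> real^2^2"
  assumes g: "smooth_riemannian_metric U g" and x: "x \<in> U"
  shows "g x $ 1 $ 1 > 0" "g x $ 2 $ 1 = g x $ 1 $ 2" "g x $ 1 $ 1 * g x $ 2 $ 2 - g x $ 1 $ 2 * g x $ 1 $ 2 > 0"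
proof -
  have t: "transpose (g x) = g x" and pos: "\<And>\<xi>. \<xi> \<noteq> 0 \<Longrightarrow> \<xi> \<bullet> (g x *v \<xi>) > 0"
    using g x by (auto simp: smooth_riemannian_metric_def)
  show s: "g x $ 2 $ 1 = g x $ 1 $ 2" using arg_cong[OF t, of "\<lambda>A. A $ 1 $ 2"] by (simp add: transpose_def)
  have q: "a * (g x $ 1 $ 1 * a + g x $ 1 $ 2 * b) + b * (g x $ 1 $ 2 * a + g x $ 2 $ 2 * b) > 0" if "a \<noteq> 0 \<or> b \<noteq> 0" for a b
  proof -
    have "vector [a, b] \<noteq> (0 :: real^2)" using that by (auto simp: vec_eq_iff forall_2)
    from pos[OF this] show ?thesis by (simp add: inner_vec_def sum_2 matrix_vector_mult_def s)
  qed
  show e: "g x $ 1 $ 1 > 0" using q[of 1 0] by simp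
  \<comment> \<open>The quadratic form at the vector (-F, E) equals E (E G - F^2).\<close>
  have "g x $ 1 $ 1 * (g x $ 1 $ 1 * g x $ 2 $ 2 - g x $ 1 $ 2 * g x $ 1 $ 2) > 0"
    using q[of "- g x $ 1 $ 2" "g x $ 1 $ 1"] e by (simp add: algebra_simps)
  then show "g x $ 1 $ 1 * g x $ 2 $ 2 - g x $ 1 $ 2 * g x $ 1 $ 2 > 0" using e by (simp add: zero_less_mult_iff)
qed

lemma matrix_inv_2:
  fixes A :: "real^2^2"
  assumes d: "A $ 1 $ 1 * A $ 2 $ 2 - A $ 1 $ 2 * A $ 2 $ 1 \<noteq> 0" (is "?d \<noteq> 0")
  shows "matrix_inv A $ 1 $ 1 = A $ 2 $ 2 * inverse ?d" "matrix_inv A $ 1 $ 2 = - A $ 1 $ 2 * inverse ?d"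
    "matrix_inv A $ 2 $ 1 = - A $ 2 $ 1 * inverse ?d" "matrix_inv A $ 2 $ 2 = A $ 1 $ 1 * inverse ?d"
proof -
  define q where "q = inverse ?d"
  have "?d * q = 1" using d by (simp add: q_def)
  then have q: "A $ 1 $ 1 * (A $ 2 $ 2 * q) = 1 + A $ 1 $ 2 * (A $ 2 $ 1 * q)"
    by (simp add: algebra_simps)
  define B :: "real^2^2" where "B = vector [vector [A $ 2 $ 2 * q, - A $ 1 $ 2 * q], vector [- A $ 2 $ 1 * q, A $ 1 $ 1 * q]]"
  have B: "A ** B = mat 1" "B ** A = mat 1"
    using q by (auto simp: B_def vec_eq_iff forall_2 matrix_matrix_mult_def sum_2 mat_def ac_simps)
  then have "invertible A" by (auto simp: invertible_def)
  then have "A ** matrix_inv A = mat 1" unfolding invertible_def matrix_inv_def by (rule someI2_ex) simp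
  then have "matrix_inv A = B" using B by (metis matrix_mul_assoc matrix_mul_lid matrix_mul_rid)
  then show "matrix_inv A $ 1 $ 1 = A $ 2 $ 2 * inverse ?d" "matrix_inv A $ 1 $ 2 = - A $ 1 $ 2 * inverse ?d"
    "matrix_inv A $ 2 $ 1 = - A $ 2 $ 1 * inverse ?d" "matrix_inv A $ 2 $ 2 = A $ 1 $ 1 * inverse ?d"
    by (simp_all add: B_def q_def)
qed

text \<open>The curvature is assembled from lowered Christoffel symbols: contracting with the first
  row of the metric undoes the inverse metric, so the derivatives of the symbols are found without
  differentiating the inverse.\<close>

lemma gauss_curvature_brioschi:
  assumes U: "open U" "x \<in> U" and g: "smooth_riemannian_metric U g"
  defines "E \<equiv> \<lambda>x. g x $ 1 $ 1" and "F \<equiv> \<lambda>x. g x $ 1 $ 2" and "G \<equiv> \<lambda>x. g x $ 2 $ 2"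
  shows "gauss_curvature g x * sqrt (metric_det E F G x) = metric_brioschi E F G x / (metric_det E F G x * sqrt (metric_det E F G x))"
proof -
  let ?p = "pderiv_at"
  have ck: "Ck_on 2 U (\<lambda>x. g x $ i $ j)" for i j
    using g by (auto simp: smooth_riemannian_metric_def smooth_on_def)
  have ckE: "Ck_on 2 U E" "Ck_on 2 U F" "Ck_on 2 U G" unfolding E_def F_def G_def by (rule ck)+
  have sym: "g y $ 2 $ 1 = F y" if "y \<in> U" for y using metric_positive(2)[OF g that] by (simp add: F_def)
  have symp: "?p i (\<lambda>y. g y $ 2 $ 1) y = ?p i F y" if "y \<in> U" for i y
    by (rule pderiv_at_cong[OF U(1) that]) (rule sym)
  let ?D = "metric_det E F G"
  have Dpos: "?D y > 0" if "y \<in> U" for y using metric_positive(3)[OF g that] by (simp add: metric_det_def E_def F_def G_def)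
  have Dg: "g y $ 1 $ 1 * g y $ 2 $ 2 - g y $ 1 $ 2 * g y $ 2 $ 1 = ?D y" if "y \<in> U" for y
    using sym[OF that] by (simp add: metric_det_def E_def F_def G_def)
  \<comment> \<open>\<open>C1\<close> and \<open>C2\<close> are the Christoffel symbols of the first
    kind, \<open>c1\<close> and \<open>c2\<close> below those of the second kind.\<close>
  define C1 where "C1 i j y = (1/2) * (?p i (\<lambda>y. g y $ j $ 1) y + ?p j (\<lambda>y. g y $ i $ 1) y - ?p 1 (\<lambda>y. g y $ i $ j) y)" for i j y
  define C2 where "C2 i j y = (1/2) * (?p i (\<lambda>y. g y $ j $ 2) y + ?p j (\<lambda>y. g y $ i $ 2) y - ?p 2 (\<lambda>y. g y $ i $ j) y)" for i j y
  have chr: "christoffel g 1 i j y = (G y * C1 i j y - F y * C2 i j y) * inverse (?D y)"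
    "christoffel g 2 i j y = (E y * C2 i j y - F y * C1 i j y) * inverse (?D y)" if "y \<in> U" for i j y
  proof -
    have n: "g y $ 1 $ 1 * g y $ 2 $ 2 - g y $ 1 $ 2 * g y $ 2 $ 1 \<noteq> 0" unfolding Dg[OF that] using Dpos[OF that] by simp
    note inv = matrix_inv_2[OF n, unfolded Dg[OF that] sym[OF that]]
    show "christoffel g 1 i j y = (G y * C1 i j y - F y * C2 i j y) * inverse (?D y)"
      "christoffel g 2 i j y = (E y * C2 i j y - F y * C1 i j y) * inverse (?D y)"
      unfolding christoffel_def sum_2 inv C1_def C2_def by (simp_all add: metric_det_def E_def F_def G_def algebra_simps)
  qed
  have gd: "?p i (\<lambda>y. g y $ j $ m) differentiable (at y)" if "y \<in> U" for i j m y
    by (rule Ck_on_1_D(2)[OF Ck_on_2_D(2)[OF ck] that])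
  have Cd: "C1 i j differentiable (at y)" "C2 i j differentiable (at y)" if "y \<in> U" for i j y
    unfolding C1_def[abs_def] C2_def[abs_def] using gd[OF that] by (auto intro!: differentiable_mult differentiable_diff differentiable_add)
  have d1: "E differentiable (at y)" "F differentiable (at y)" "G differentiable (at y)" if "y \<in> U" for y
    using Ck_on_1_D(2)[OF Ck_on_2_D(1) that] ckE by blast+
  have iD: "(\<lambda>y. inverse (?D y)) differentiable (at y)" if "y \<in> U" for y
    using pderiv_at_inverse(1)[OF metric_det_pderiv(1)[OF d1[OF that]]] Dpos[OF that] by simp
  define c1 where "c1 i j y = (G y * C1 i j y - F y * C2 i j y) * inverse (?D y)" for i j y
  define c2 where "c2 i j y = (E y * C2 i j y - F y * C1 i j y) * inverse (?D y)" for i j y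
  have cd: "c1 i j differentiable (at x)" "c2 i j differentiable (at x)" for i j
    unfolding c1_def[abs_def] c2_def[abs_def] using d1[OF U(2)] Cd[OF U(2)] iD[OF U(2)]
    by (auto intro!: differentiable_mult differentiable_diff)
  have pchr: "?p k (christoffel g 1 i j) x = ?p k (c1 i j) x" "?p k (christoffel g 2 i j) x = ?p k (c2 i j) x" for i j k
    by (rule pderiv_at_cong[OF U]; simp add: chr c1_def c2_def)+
  have low: "E y * c1 i j y + F y * c2 i j y = C1 i j y" if "y \<in> U" for i j y
  proof -
    have "E y * c1 i j y + F y * c2 i j y = ?D y * C1 i j y * inverse (?D y)"
      unfolding c1_def c2_def by (simp add: metric_det_def algebra_simps)
    then show ?thesis using Dpos[OF that] by simp
  qed
  \<comment> \<open>The product rule, applied to the identity that lowers the index, replaces the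
    quotient rule.\<close>
  have plow: "E x * ?p k (c1 i j) x + F x * ?p k (c2 i j) x = ?p k (C1 i j) x - ?p k E x * c1 i j x - ?p k F x * c2 i j x" for i j k
  proof -
    have "?p k (C1 i j) x = ?p k (\<lambda>y. E y * c1 i j y + F y * c2 i j y) x"
      by (rule pderiv_at_cong[OF U]) (simp add: low)
    also have "\<dots> = (E x * ?p k (c1 i j) x + ?p k E x * c1 i j x) + (F x * ?p k (c2 i j) x + ?p k F x * c2 i j x)"
      using d1[OF U(2)] cd by (simp add: pderiv_at_add pderiv_at_mult)
    finally show ?thesis by simp
  qed
  have pC: "?p 1 (C1 2 2) x - ?p 2 (C1 1 2) x = ?p 1 (?p 2 F) x - ?p 2 (?p 2 E) x / 2 - ?p 1 (?p 1 G) x / 2"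
  proof -
    have d: "?p i E differentiable (at x)" "?p i F differentiable (at x)" "?p i G differentiable (at x)" for i
      using gd[OF U(2)] unfolding E_def F_def G_def by blast+
    have "?p 1 (C1 2 2) x = ?p 1 (\<lambda>y. ?p 2 F y - 1/2 * ?p 1 G y) x"
      by (rule pderiv_at_cong[OF U]) (simp add: C1_def symp G_def)
    moreover have "?p 2 (C1 1 2) x = ?p 2 (\<lambda>y. 1/2 * ?p 2 E y) x"
      by (rule pderiv_at_cong[OF U]) (simp add: C1_def symp E_def F_def)
    ultimately show ?thesis using d by (simp add: pderiv_at_diff pderiv_at_cmult del: times_divide_eq_left)
  qed
  have Cx: "C1 1 1 x = ?p 1 E x / 2" "C2 1 1 x = ?p 1 F x - ?p 2 E x / 2" "C1 1 2 x = ?p 2 E x / 2" "C2 1 2 x = ?p 1 G x / 2"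
    "C1 2 1 x = ?p 2 E x / 2" "C2 2 1 x = ?p 1 G x / 2" "C1 2 2 x = ?p 2 F x - ?p 1 G x / 2" "C2 2 2 x = ?p 2 G x / 2"
    unfolding C1_def C2_def by (simp_all add: symp[OF U(2)] E_def F_def G_def field_simps)
  have "(\<Sum>l\<in>UNIV. g x $ 1 $ l * riemann g l 1 2 2 x)
    = (E x * ?p 1 (c1 2 2) x + F x * ?p 1 (c2 2 2) x) - (E x * ?p 2 (c1 1 2) x + F x * ?p 2 (c2 1 2) x)
     + ((E x * c1 1 1 x + F x * c2 1 1 x) * c1 2 2 x + (E x * c1 1 2 x + F x * c2 1 2 x) * c2 2 2 x
      - (E x * c1 2 1 x + F x * c2 2 1 x) * c1 1 2 x - (E x * c1 2 2 x + F x * c2 2 2 x) * c2 1 2 x)"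
    unfolding riemann_def sum_2 pchr chr[OF U(2)] c1_def[symmetric] c2_def[symmetric] E_def[symmetric] F_def[symmetric]
    by (simp add: algebra_simps E_def F_def)
  also have "\<dots> = (?p 1 (?p 2 F) x - ?p 2 (?p 2 E) x / 2 - ?p 1 (?p 1 G) x / 2) - ?p 1 E x * c1 2 2 x - ?p 1 F x * c2 2 2 x
     + ?p 2 E x * c1 1 2 x + ?p 2 F x * c2 1 2 x
     + ?p 1 E x / 2 * c1 2 2 x + ?p 2 E x / 2 * c2 2 2 x - ?p 2 E x / 2 * c1 1 2 x - (?p 2 F x - ?p 1 G x / 2) * c2 1 2 x"
    unfolding plow low[OF U(2)] Cx pC[symmetric] by simp
  also have "\<dots> = metric_brioschi E F G x / ?D x"
  proof -
    have D: "?D x = E x * G x - (F x)\<^sup>2" "?D x \<noteq> 0" using Dpos[OF U(2)] by (simp_all add: metric_det_def power2_eq_square)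
    have c: "c1 2 2 x = (G x * (?p 2 F x - ?p 1 G x/2) - F x * (?p 2 G x/2)) / ?D x"
      "c2 2 2 x = (E x * (?p 2 G x/2) - F x * (?p 2 F x - ?p 1 G x/2)) / ?D x"
      "c1 1 2 x = (G x * (?p 2 E x/2) - F x * (?p 1 G x/2)) / ?D x"
      "c2 1 2 x = (E x * (?p 1 G x/2) - F x * (?p 2 E x/2)) / ?D x"
      unfolding c1_def c2_def Cx by (simp_all only: divide_inverse)
    show ?thesis unfolding c metric_brioschi_def by (rule gauss_algebra[OF D])
  qed
  finally have "gauss_curvature g x = metric_brioschi E F G x / ?D x / ?D x"
    unfolding gauss_curvature_def det_2 Dg[OF U(2)] by simp
  moreover have "b / D / D * s = b / (D * s)" if "s \<noteq> 0" "s * s = D" for b s D :: real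
    using that(1) unfolding that(2)[symmetric] by simp
  moreover have "sqrt (?D x) \<noteq> 0" "sqrt (?D x) * sqrt (?D x) = ?D x" using Dpos[OF U(2)] by auto
  ultimately show ?thesis by simp
qed

section \<open>Convergence of the induced metrics\<close>

lemma integrable_compact_continuous:
  assumes "compact C" "continuous_on C (h :: real^2 \<Rightarrow> real)"
  shows "integrable lborel (\<lambda>x. indicator C x * h x)"
  using borel_integrable_compact[OF assms] by simp

lemma integral_product_limit:
  fixes Z H :: "nat \<Rightarrow> real^2 \<Rightarrow> real"
  assumes C: "compact C" and Z: "uniform_limit C Z z sequentially"
    and cZ: "\<forall>\<^sub>F k in sequentially. continuous_on C (Z k)" and cz: "continuous_on C z"
    and cH: "\<forall>\<^sub>F k in sequentially. continuous_on C (H k)" and ch: "continuous_on C h"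
    and L1: "(\<lambda>k. \<integral>\<^sup>+x\<in>C. ennreal \<bar>H k x - h x\<bar> \<partial>lborel) \<longlonglongrightarrow> 0"
  shows "(\<lambda>k. LINT x|lborel. indicator C x * (Z k x * H k x)) \<longlonglongrightarrow> (LINT x|lborel. indicator C x * (z x * h x))"
proof (rule tendstoI)
  fix e :: real assume e: "e > 0"
  obtain B where B: "B > 0" "\<And>x. x \<in> C \<Longrightarrow> norm (z x) \<le> B" using compact_continuous_bound[OF C cz] by blast
  let ?I = "LINT x|lborel. indicator C x * \<bar>h x\<bar>"
  have I: "?I \<ge> 0" by (intro integral_nonneg_AE) auto
  \<comment> \<open>The minimum with 1 keeps |Z k| below B + 1; the other entry absorbs the integral
    of |h|.\<close>
  define e1 where "e1 = min 1 (e / 2 / (?I + 1))"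
  have e2: "e / 2 > 0" using e by simp
  have e1: "e1 > 0" "e1 \<le> 1" "e1 * ?I < e / 2"
  proof -
    note d = div_succ_mult_less[OF e2 I]
    show "e1 > 0" "e1 \<le> 1" using d(1) by (auto simp: e1_def)
    have "e1 * ?I \<le> e / 2 / (?I + 1) * ?I" using I by (intro mult_right_mono) (auto simp: e1_def)
    then show "e1 * ?I < e / 2" using d(2) by linarith
  qed
  define e3 where "e3 = e / 2 / (B + 1)"
  have e3: "e3 > 0" "(B + 1) * e3 = e / 2"
  proof -
    have "B + 1 > 0" using B(1) by linarith
    then show "e3 > 0" "(B + 1) * e3 = e / 2"
      using e nonzero_mult_div_cancel_left[of "B + 1" "e / 2"] by (simp_all only: e3_def times_divide_eq_right) simp_all
  qed
  from uniform_limitD[OF Z e1(1)] cZ cH ennreal_tendsto_0D[OF L1 e3(1)]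
  show "\<forall>\<^sub>F k in sequentially. dist (LINT x|lborel. indicator C x * (Z k x * H k x)) (LINT x|lborel. indicator C x * (z x * h x)) < e"
  proof eventually_elim
    case (elim k)
    note i = integrable_compact_continuous[OF C]
    have iH: "integrable lborel (\<lambda>x. indicator C x * \<bar>H k x - h x\<bar>)" by (intro i continuous_intros elim ch)
    have ih: "integrable lborel (\<lambda>x. indicator C x * \<bar>h x\<bar>)" by (intro i continuous_intros ch)
    have iZ: "integrable lborel (\<lambda>x. indicator C x * (Z k x * H k x))" "integrable lborel (\<lambda>x. indicator C x * (z x * h x))"
      by (intro i continuous_intros elim ch cz)+
    have "ennreal (LINT x|lborel. indicator C x * \<bar>H k x - h x\<bar>) = (\<integral>\<^sup>+x. ennreal (indicator C x * \<bar>H k x - h x\<bar>) \<partial>lborel)"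
      by (rule nn_integral_eq_integral[OF iH, symmetric]) auto
    also have "\<dots> = (\<integral>\<^sup>+x\<in>C. ennreal \<bar>H k x - h x\<bar> \<partial>lborel)"
      by (intro nn_integral_cong) (auto simp: indicator_def)
    finally have L: "(LINT x|lborel. indicator C x * \<bar>H k x - h x\<bar>) \<le> e3"
      using elim(4) ennreal_le_iff[OF less_imp_le[OF e3(1)]] by metis
    have "\<bar>LINT x|lborel. indicator C x * (Z k x * H k x) - indicator C x * (z x * h x)\<bar> \<le>
      (LINT x|lborel. (B + 1) * (indicator C x * \<bar>H k x - h x\<bar>) + e1 * (indicator C x * \<bar>h x\<bar>))"
    proof (rule integral_abs_bound_integral)
      fix x
      show "\<bar>indicator C x * (Z k x * H k x) - indicator C x * (z x * h x)\<bar> \<le> (B + 1) * (indicator C x * \<bar>H k x - h x\<bar>) + e1 * (indicator C x * \<bar>h x\<bar>)"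
      proof (cases "x \<in> C")
        case True
        have z: "\<bar>Z k x - z x\<bar> \<le> e1" using elim(1) True by (auto simp: dist_real_def less_imp_le)
        then have Zb: "\<bar>Z k x\<bar> \<le> B + 1" using B(2)[OF True] e1(2) by (simp add: abs_le_iff)
        have "Z k x * H k x - z x * h x = Z k x * (H k x - h x) + (Z k x - z x) * h x" by (simp add: algebra_simps)
        also have "\<bar>\<dots>\<bar> \<le> \<bar>Z k x\<bar> * \<bar>H k x - h x\<bar> + \<bar>Z k x - z x\<bar> * \<bar>h x\<bar>"
          unfolding abs_mult[symmetric] by (rule abs_triangle_ineq)
        also have "\<dots> \<le> (B + 1) * \<bar>H k x - h x\<bar> + e1 * \<bar>h x\<bar>" by (intro add_mono mult_right_mono z Zb) auto
        finally show ?thesis using True by simp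
      qed simp
    qed (use iZ iH ih in auto)
    also have "\<dots> = (B + 1) * (LINT x|lborel. indicator C x * \<bar>H k x - h x\<bar>) + e1 * ?I"
      using iH ih by simp
    also have "\<dots> \<le> (B + 1) * e3 + e1 * ?I" using L B by (intro add_right_mono mult_left_mono) auto
    also have "\<dots> < e" using e3(2) e1(3) by linarith
    finally show ?case using iZ by (simp add: dist_real_def)
  qed
qed

lemma moll_add:
  assumes "\<epsilon> > 0" "integrable lborel f" "integrable lborel g"
  shows "moll \<epsilon> (\<lambda>x. f x + g x) x = moll \<epsilon> f x + moll \<epsilon> g x"
proof -
  have "integrable lborel (\<lambda>y. mollifier \<epsilon> (x - y) * h y)" if "integrable lborel h" for h
    by (rule integrable_conv[OF mollifier_continuous(1), where R=\<epsilon>]) (use mollifier_outside[OF assms(1)] that in auto)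
  then show ?thesis unfolding conv_def using assms by (simp add: distrib_left)
qed

text \<open>The weight s^(-3) of the commutator bound is exactly the one the energy at scale
  \<open>s\<close> controls, and this energy vanishes as \<open>s\<close> tends to 0. With
  boundedness alone the commutators would not be seen to vanish.\<close>

lemma nn_integral_osc_tendsto_0:
  assumes C: "compact C" "C \<subseteq> V" and V: "open V" and r: "r > 0" "\<And>x. x \<in> C \<Longrightarrow> ball x r \<subseteq> V"
    and h: "L12 h" "tame V (\<lambda>_. h)" and s: "s \<longlonglongrightarrow> 0" "\<And>k. s k > (0::real)"
  shows "(\<lambda>k. \<integral>\<^sup>+x\<in>C. ennreal (osc (s k) h x / s k ^ 3) \<partial>lborel) \<longlonglongrightarrow> 0"
proof (rule ennreal_tendsto_0I)
  fix e :: real assume e: "e > 0"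
  then obtain \<delta> where d: "\<delta> > 0" "near_energy V \<delta> h \<le> ennreal (e/2)"
    using h(2) unfolding tame_def by (auto dest!: spec[of _ "e/2"])
  have Cb: "C \<in> sets borel" "V \<in> sets borel" using borel_closed[OF compact_imp_closed[OF C(1)]] V by auto
  from order_tendstoD(2)[OF s(1) d(1)] order_tendstoD(2)[OF s(1) r(1)]
  show "\<forall>\<^sub>F k in sequentially. (\<integral>\<^sup>+x\<in>C. ennreal (osc (s k) h x / s k ^ 3) \<partial>lborel) \<le> ennreal e"
  proof eventually_elim
    case (elim k)
    have "(\<integral>\<^sup>+x\<in>C. ennreal (osc (s k) h x / s k ^ 3) \<partial>lborel) \<le> 2 * near_energy V (s k) h"
    proof (rule osc_le_near_energy[OF h(1) Cb(1) C(2) Cb(2) _ s(2)])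
      fix x assume "x \<in> C"
      then show "ball x (s k) \<subseteq> V" using r(2) elim(2) by (meson less_imp_le order_trans subset_ball)
    qed
    also have "\<dots> \<le> 2 * near_energy V \<delta> h" using elim(1) by (intro mult_left_mono near_energy_mono) auto
    also have "\<dots> \<le> 2 * ennreal (e/2)" using d(2) by (intro mult_left_mono) auto
    also have "\<dots> = ennreal e" using e ennreal_mult[of 2 "e/2"] by simp
    finally show ?case .
  qed
qed

lemma ennreal_tendsto_0_mult:
  fixes f :: "nat \<Rightarrow> ennreal"
  assumes "f \<longlonglongrightarrow> 0" "c \<ge> 0" shows "(\<lambda>k. ennreal c * f k) \<longlonglongrightarrow> 0"
proof (rule ennreal_tendsto_0I)
  fix e :: real assume e: "e > 0"
  have "e / (c + 1) > 0" using div_succ_mult_less(1)[OF e assms(2)] .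
  from ennreal_tendsto_0D[OF assms(1) this] show "\<forall>\<^sub>F k in sequentially. ennreal c * f k \<le> ennreal e"
  proof eventually_elim
    case (elim k)
    have "ennreal c * f k \<le> ennreal c * ennreal (e / (c + 1))" using elim by (intro mult_left_mono) auto
    also have "\<dots> = ennreal (e / (c + 1) * c)" using assms(2) e by (subst ennreal_mult[symmetric]) (auto simp: mult.commute)
    also have "\<dots> \<le> ennreal e" using div_succ_mult_less(2)[OF e assms(2)] by (intro ennreal_leI) simp
    finally show ?case .
  qed
qed

lemma ennreal_tendsto_0_add:
  fixes f g :: "nat \<Rightarrow> ennreal"
  assumes "f \<longlonglongrightarrow> 0" "g \<longlonglongrightarrow> 0" shows "(\<lambda>k. f k + g k) \<longlonglongrightarrow> 0"
  using tendsto_add[OF assms] by simp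

lemma ennreal_tendsto_0_mono:
  fixes f g :: "nat \<Rightarrow> ennreal"
  assumes "\<forall>\<^sub>F k in sequentially. f k \<le> g k" "g \<longlonglongrightarrow> 0" shows "f \<longlonglongrightarrow> 0"
  by (rule tendsto_sandwich[OF _ assms(1) tendsto_const assms(2)]) simp

lemma nn_integral_uniform_0:
  assumes C: "C \<in> sets borel" "emeasure lborel C < \<infinity>" and ul: "uniform_limit C G g sequentially"
  shows "(\<lambda>k. \<integral>\<^sup>+x\<in>C. ennreal \<bar>G k x - g x :: real\<bar> \<partial>lborel) \<longlonglongrightarrow> 0"
proof (rule ennreal_tendsto_0I)
  fix e :: real assume e: "e > 0"
  obtain m where m: "emeasure lborel C = ennreal m" "m \<ge> 0" using C(2) by (cases "emeasure lborel C") auto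
  have "e / (m + 1) > 0" using div_succ_mult_less(1)[OF e m(2)] .
  from uniform_limitD[OF ul this]
  show "\<forall>\<^sub>F k in sequentially. (\<integral>\<^sup>+x\<in>C. ennreal \<bar>G k x - g x\<bar> \<partial>lborel) \<le> ennreal e"
  proof eventually_elim
    case (elim k)
    have "(\<integral>\<^sup>+x\<in>C. ennreal \<bar>G k x - g x\<bar> \<partial>lborel) \<le> (\<integral>\<^sup>+x. ennreal (e / (m + 1)) * indicator C x \<partial>lborel)"
    proof (rule nn_integral_mono)
      fix x
      show "ennreal \<bar>G k x - g x\<bar> * indicator C x \<le> ennreal (e / (m + 1)) * indicator C x"
        using elim by (cases "x \<in> C") (auto simp: dist_real_def intro!: ennreal_leI dest!: bspec)
    qed
    also have "\<dots> = ennreal (e / (m + 1)) * ennreal m" using C(1) by (subst nn_integral_cmult_indicator) (auto simp: m)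
    also have "\<dots> = ennreal (e / (m + 1) * m)" using e m by (subst ennreal_mult) auto
    also have "\<dots> \<le> ennreal e" using div_succ_mult_less(2)[OF e m(2)] by (intro ennreal_leI) simp
    finally show ?case .
  qed
qed

lemma pderiv_commutator_bound':
  assumes f: "L12 f" and g: "L12 g" and e: "\<epsilon> > 0"
  shows "\<bar>pderiv_at i (\<lambda>x. moll \<epsilon> f x * moll \<epsilon> g x) x - pderiv_at i (moll \<epsilon> (\<lambda>x. f x * g x)) x\<bar>
    \<le> commutator_const * (osc \<epsilon> f x / \<epsilon> ^ 3 + osc \<epsilon> g x / \<epsilon> ^ 3)"
proof -
  have "pderiv_at i (\<lambda>x. moll \<epsilon> f x * moll \<epsilon> g x) x = moll \<epsilon> f x * pderiv_at i (moll \<epsilon> g) x + pderiv_at i (moll \<epsilon> f) x * moll \<epsilon> g x"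
    by (intro pderiv_at_mult moll_differentiable e f g)
  moreover have "c / d * (p + q) = c * (p / d + q / d)" for c d p q :: real
    by (simp add: add_divide_distrib[symmetric])
  ultimately show ?thesis using pderiv_commutator_bound[OF f g e, of i x]
    by (simp only: abs_minus_commute add.commute)
qed

lemma Ck_on_ffundamental:
  assumes "open S" "Ck_on (Suc k) S p" "Ck_on (Suc k) S q" "Ck_on (Suc k) S r"
  shows "Ck_on k S (ffundamental i j p q r)"
  unfolding ffundamental_def[abs_def] using assms by (intro Ck_on_add Ck_on_mult) auto

text \<open>The induced metric of the mollified map differs from the mollified metric by a commutator.\<close>

lemma induced_metric_L1:
  fixes p :: "3 \<Rightarrow> real^2 \<Rightarrow> real"
  assumes U: "open U" and p: "\<And>m. Ck_on 1 U (p m)" and E: "Ck_on 1 U (ffundamental i j (p 1) (p 2) (p 3))"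
    and V1: "compactly_inside V1 U" and C: "compact C" and r: "open W" "C \<subseteq> W" "r > 0" "\<And>x. x \<in> W \<Longrightarrow> ball x r \<subseteq> V1"
    and slob: "\<And>i m. slobodeckij_sq (1/2) V1 (pderiv_at i (p m)) < \<infinity>"
    and s: "s \<longlonglongrightarrow> 0" "\<And>k. s k > (0::real)"
  defines "P \<equiv> \<lambda>k m. moll (s k) (restr (closure V1) (p m))"
  shows "(\<lambda>k. \<integral>\<^sup>+x\<in>C. ennreal \<bar>pderiv_at l (ffundamental i j (P k 1) (P k 2) (P k 3)) x - pderiv_at l (ffundamental i j (p 1) (p 2) (p 3)) x\<bar> \<partial>lborel) \<longlonglongrightarrow> 0"
proof -
  let ?K = "closure V1"
  let ?E = "ffundamental i j (p 1) (p 2) (p 3)"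
  have V1o: "open V1" "compact ?K" "?K \<subseteq> U" "V1 \<subseteq> ?K" using V1 closure_subset[of V1] by (auto simp: compactly_inside_def)
  have Cb[measurable]: "C \<in> sets borel" using borel_closed[OF compact_imp_closed[OF C]] .
  have V1b: "V1 \<in> sets borel" using V1o by simp
  define a where "a i m = restr ?K (pderiv_at i (p m))" for i m
  have cK: "continuous_on ?K (pderiv_at i (p m))" for i m
    using Ck_on_1_D(3)[OF p] V1o(3) continuous_on_subset by blast
  have aL: "L12 (a i m)" for i m unfolding a_def by (rule L12_restr[OF V1o(2) cK])
  have [measurable]: "a i m \<in> borel_measurable borel" for i m
    using aL[of i m] borel_measurable_integrable[of lborel "a i m"] by (simp add: L12_def)
  have at: "tame V1 (\<lambda>_. a i m)" for i m
  proof -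
    have "set_borel_measurable borel V1 (pderiv_at i (p m))"
      by (rule set_borel_measurable_continuous[OF V1b continuous_on_subset[OF cK V1o(4)]])
    then have "tame V1 (\<lambda>_. pderiv_at i (p m))" using slob V1b by (intro tame_const)
    moreover have "near_energy V1 \<delta> (a i m) = near_energy V1 \<delta> (pderiv_at i (p m))" for \<delta>
      using V1o(4) by (intro near_energy_cong) (auto simp: a_def restr_def)
    ultimately show ?thesis by (simp add: tame_def)
  qed
  have EK: "restr ?K ?E x = a i 1 x * a j 1 x + (a i 2 x * a j 2 x + a i 3 x * a j 3 x)" for x
    by (simp add: restr_def a_def ffundamental_def indicator_def)
  have ab: "integrable lborel (\<lambda>x. a i m x * a j m x)" for m by (rule L12_mult[OF aL aL])
  have Wr: "ball x r \<subseteq> ?K" if "x \<in> W" for x using r(4)[OF that] V1o(4) by blast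
  have CV1: "C \<subseteq> V1" using r(2,3,4) by (meson centre_in_ball subset_iff)
  have rC: "\<And>x. x \<in> C \<Longrightarrow> ball x r \<subseteq> V1" "\<And>x. x \<in> C \<Longrightarrow> ball x r \<subseteq> ?K" using r(2,4) Wr by blast+
  have bound: "\<bar>pderiv_at l (ffundamental i j (P k 1) (P k 2) (P k 3)) x - pderiv_at l ?E x\<bar> \<le>
     commutator_const * (osc (s k) (a i 1) x / s k ^ 3 + osc (s k) (a j 1) x / s k ^ 3) +
     (commutator_const * (osc (s k) (a i 2) x / s k ^ 3 + osc (s k) (a j 2) x / s k ^ 3) +
     (commutator_const * (osc (s k) (a i 3) x / s k ^ 3 + osc (s k) (a j 3) x / s k ^ 3) +
     \<bar>moll (s k) (restr ?K (pderiv_at l ?E)) x - pderiv_at l ?E x\<bar>))"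
    if sk: "s k < r" and x: "x \<in> C" for k x
  proof -
    let ?M = "\<lambda>m x. moll (s k) (a i m) x * moll (s k) (a j m) x"
    let ?A = "\<lambda>m. moll (s k) (\<lambda>x. a i m x * a j m x)"
    have xW: "x \<in> W" using x r(2) by blast
    have cb: "cball y (s k) \<subseteq> ?K" if "y \<in> W" for y using Wr[OF that] sk by (force simp: subset_iff)
    \<comment> \<open>The identity is differentiated next, so it is established on the open set
      \<open>W\<close> and not merely on \<open>C\<close>.\<close>
    have pP: "pderiv_at i (P k m) y = moll (s k) (a i m) y" if "y \<in> W" for i m y
      unfolding P_def a_def by (rule pderiv_moll_restr[OF U V1o(3,2) p s(2) cb[OF that]])
    have Md: "?M m differentiable (at x)" for m by (intro differentiable_mult moll_differentiable s aL)
    have "pderiv_at l (ffundamental i j (P k 1) (P k 2) (P k 3)) x = pderiv_at l (\<lambda>x. ?M 1 x + ?M 2 x + ?M 3 x) x"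
      by (rule pderiv_at_cong[OF r(1) xW]) (simp add: ffundamental_def pP)
    also have "\<dots> = pderiv_at l (?M 1) x + pderiv_at l (?M 2) x + pderiv_at l (?M 3) x"
      using Md by (simp add: pderiv_at_add)
    finally have 1: "pderiv_at l (ffundamental i j (P k 1) (P k 2) (P k 3)) x = pderiv_at l (?M 1) x + pderiv_at l (?M 2) x + pderiv_at l (?M 3) x" .
    have Ad: "?A m differentiable (at x)" for m
      using Ck_on_1_D(2)[OF Ck_on_moll[OF s(2) ab]] by simp
    have "moll (s k) (restr ?K ?E) = (\<lambda>x. ?A 1 x + (?A 2 x + ?A 3 x))"
    proof -
      have "restr ?K ?E = (\<lambda>x. a i 1 x * a j 1 x + (a i 2 x * a j 2 x + a i 3 x * a j 3 x))"
        by (rule ext) (rule EK)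
      then show ?thesis
        by (simp only:, intro ext) (simp only: moll_add[OF s(2) ab Bochner_Integration.integrable_add[OF ab ab]] moll_add[OF s(2) ab ab])
    qed
    then have "pderiv_at l (moll (s k) (restr ?K ?E)) x = pderiv_at l (?A 1) x + (pderiv_at l (?A 2) x + pderiv_at l (?A 3) x)"
      using Ad by (simp add: pderiv_at_add)
    then have 2: "moll (s k) (restr ?K (pderiv_at l ?E)) x = pderiv_at l (?A 1) x + (pderiv_at l (?A 2) x + pderiv_at l (?A 3) x)"
      using pderiv_moll_restr[OF U V1o(3,2) E s(2) cb[OF xW], of l] by simp
    show ?thesis
      using pderiv_commutator_bound'[OF aL aL s(2), of l k i 1 j 1 x] pderiv_commutator_bound'[OF aL aL s(2), of l k i 2 j 2 x]
        pderiv_commutator_bound'[OF aL aL s(2), of l k i 3 j 3 x] unfolding 1 2 by linarith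
  qed
  let ?O = "\<lambda>k i m. \<integral>\<^sup>+x\<in>C. ennreal (osc (s k) (a i m) x / s k ^ 3) \<partial>lborel"
  let ?S = "\<lambda>k. \<integral>\<^sup>+x\<in>C. ennreal \<bar>moll (s k) (restr ?K (pderiv_at l ?E)) x - pderiv_at l ?E x\<bar> \<partial>lborel"
  have cc: "commutator_const \<ge> 0" using mollifier_const_pos by (simp add: commutator_const_def)
  have EKc: "continuous_on ?K (pderiv_at l ?E)" using Ck_on_1_D(3)[OF E] V1o(3) continuous_on_subset by blast
  \<comment> \<open>The induced metric is C^1 by hypothesis although \<open>p\<close> is only C^1;
    hence its derivatives are continuous and their mollifications converge uniformly.\<close>
  have ES: "?S \<longlonglongrightarrow> 0"
    using emeasure_compact_finite[OF C] by (intro nn_integral_uniform_0 Cb moll_uniform_limit[OF V1o(2) EKc r(3) rC(2) s]) auto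
  have O0: "(\<lambda>k. ?O k i m) \<longlonglongrightarrow> 0" for i m
    by (rule nn_integral_osc_tendsto_0[OF C CV1 V1o(1) r(3) rC(1) aL at s])
  have lim: "(\<lambda>k. ennreal commutator_const * (?O k i 1 + ?O k j 1) + (ennreal commutator_const * (?O k i 2 + ?O k j 2) +
     (ennreal commutator_const * (?O k i 3 + ?O k j 3) + ?S k))) \<longlonglongrightarrow> 0"
    by (intro ennreal_tendsto_0_add ennreal_tendsto_0_mult O0 ES cc)
  have "\<forall>\<^sub>F k in sequentially. s k < r" using order_tendstoD(2)[OF s(1) r(3)] .
  then have "\<forall>\<^sub>F k in sequentially. (\<integral>\<^sup>+x\<in>C. ennreal \<bar>pderiv_at l (ffundamental i j (P k 1) (P k 2) (P k 3)) x - pderiv_at l ?E x\<bar> \<partial>lborel)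
    \<le> ennreal commutator_const * (?O k i 1 + ?O k j 1) + (ennreal commutator_const * (?O k i 2 + ?O k j 2) +
     (ennreal commutator_const * (?O k i 3 + ?O k j 3) + ?S k))"
  proof eventually_elim
    case (elim k)
    have on: "osc (s k) (a i m) x / s k ^ 3 \<ge> 0" for i m x using s(2)[of k] by (simp add: osc_nonneg)
    define q where "q i m x = ennreal (osc (s k) (a i m) x / s k ^ 3) * indicator C x" for i m x
    have [measurable]: "q i m \<in> borel_measurable lborel" for i m unfolding q_def by measurable
    define t where "t x = ennreal \<bar>moll (s k) (restr ?K (pderiv_at l ?E)) x - pderiv_at l ?E x\<bar> * indicator C x" for x
    have tm[measurable]: "t \<in> borel_measurable lborel"
    proof -
      have "continuous_on C (pderiv_at l ?E)" using EKc CV1 V1o(4) continuous_on_subset by blast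
      moreover have "continuous_on C (moll (s k) (restr ?K (pderiv_at l ?E)))"
        using Ck_on_moll[OF s(2)[of k], of "restr ?K (pderiv_at l ?E)" 0] L12_restr[OF V1o(2) EKc] continuous_on_subset
        by (auto simp: L12_def)
      ultimately have "(\<lambda>x. indicator C x *\<^sub>R \<bar>moll (s k) (restr ?K (pderiv_at l ?E)) x - pderiv_at l ?E x\<bar>) \<in> borel_measurable borel"
        by (intro borel_measurable_continuous_on_indicator Cb continuous_intros)
      then have "(\<lambda>x. ennreal (indicator C x *\<^sub>R \<bar>moll (s k) (restr ?K (pderiv_at l ?E)) x - pderiv_at l ?E x\<bar>)) \<in> borel_measurable lborel"
        by simp
      moreover have "(\<lambda>x. ennreal (indicator C x *\<^sub>R \<bar>moll (s k) (restr ?K (pderiv_at l ?E)) x - pderiv_at l ?E x\<bar>)) = t"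
        by (auto simp: t_def indicator_def)
      ultimately show ?thesis by (simp only:)
    qed
    have "(\<integral>\<^sup>+x\<in>C. ennreal \<bar>pderiv_at l (ffundamental i j (P k 1) (P k 2) (P k 3)) x - pderiv_at l ?E x\<bar> \<partial>lborel)
      \<le> (\<integral>\<^sup>+x. ennreal commutator_const * (q i 1 x + q j 1 x) + (ennreal commutator_const * (q i 2 x + q j 2 x) +
     (ennreal commutator_const * (q i 3 x + q j 3 x) + t x)) \<partial>lborel)"
    proof (rule nn_integral_mono)
      fix x
      show "ennreal \<bar>pderiv_at l (ffundamental i j (P k 1) (P k 2) (P k 3)) x - pderiv_at l ?E x\<bar> * indicator C x \<le>
        ennreal commutator_const * (q i 1 x + q j 1 x) + (ennreal commutator_const * (q i 2 x + q j 2 x) +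
     (ennreal commutator_const * (q i 3 x + q j 3 x) + t x))"
      proof (cases "x \<in> C")
        case True
        have "ennreal (c * (x1 + y1) + (c * (x2 + y2) + (c * (x3 + y3) + z))) =
           ennreal c * (ennreal x1 + ennreal y1) + (ennreal c * (ennreal x2 + ennreal y2) + (ennreal c * (ennreal x3 + ennreal y3) + ennreal z))"
          if "c \<ge> 0" "x1 \<ge> 0" "y1 \<ge> 0" "x2 \<ge> 0" "y2 \<ge> 0" "x3 \<ge> 0" "y3 \<ge> 0" "z \<ge> 0" for c x1 y1 x2 y2 x3 y3 z :: real
          using that by (simp add: ennreal_plus ennreal_mult)
        from this[OF cc on on on on on on abs_ge_zero] show ?thesis
          using ennreal_leI[OF bound[OF elim True]] True by (simp add: q_def t_def)
      qed simp
    qed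
    also have "\<dots> = ennreal commutator_const * (?O k i 1 + ?O k j 1) + (ennreal commutator_const * (?O k i 2 + ?O k j 2) +
     (ennreal commutator_const * (?O k i 3 + ?O k j 3) + ?S k))"
      by (simp add: nn_integral_add nn_integral_cmult q_def[symmetric] t_def[symmetric])
    finally show ?case .
  qed
  then show ?thesis by (rule ennreal_tendsto_0_mono[OF _ lim])
qed

lemma sqrt_diff_le: "a \<ge> 0 \<Longrightarrow> b \<ge> 0 \<Longrightarrow> \<bar>sqrt a - sqrt b\<bar> \<le> sqrt \<bar>a - b\<bar>"
proof (rule real_le_rsqrt)
  assume ab: "a \<ge> 0" "b \<ge> 0"
  have "\<bar>sqrt a - sqrt b\<bar>\<^sup>2 \<le> \<bar>sqrt a - sqrt b\<bar> * \<bar>sqrt a + sqrt b\<bar>"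
    unfolding power2_eq_square using ab by (intro mult_left_mono) (auto simp: abs_le_iff)
  also have "\<dots> = \<bar>(sqrt a - sqrt b) * (sqrt a + sqrt b)\<bar>" by (rule abs_mult[symmetric])
  also have "(sqrt a - sqrt b) * (sqrt a + sqrt b) = a - b" using ab by (simp add: algebra_simps)
  finally show "\<bar>sqrt a - sqrt b\<bar>\<^sup>2 \<le> \<bar>a - b\<bar>" .
qed

lemma uniform_limit_sqrt:
  assumes "uniform_limit C A a sequentially" "\<forall>\<^sub>F k in sequentially. \<forall>x\<in>C. 0 \<le> A k x" "\<And>x. x \<in> C \<Longrightarrow> (0::real) \<le> a x"
  shows "uniform_limit C (\<lambda>k x. sqrt (A k x)) (\<lambda>x. sqrt (a x)) sequentially"
proof (rule uniform_limitI)
  fix e :: real assume e: "e > 0"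
  then have "e\<^sup>2 > 0" by simp
  from uniform_limitD[OF assms(1) this] assms(2)
  show "\<forall>\<^sub>F k in sequentially. \<forall>x\<in>C. dist (sqrt (A k x)) (sqrt (a x)) < e"
  proof eventually_elim
    case (elim k)
    show ?case
    proof
      fix x assume x: "x \<in> C"
      have "\<bar>sqrt (A k x) - sqrt (a x)\<bar> \<le> sqrt \<bar>A k x - a x\<bar>" using elim(2) assms(3) x by (intro sqrt_diff_le) auto
      also have "\<dots> < sqrt (e\<^sup>2)" using elim(1) x unfolding real_sqrt_less_iff by (auto simp: dist_real_def)
      finally show "dist (sqrt (A k x)) (sqrt (a x)) < e" using e by (simp add: dist_real_def)
    qed
  qed
qed

lemma uniform_limit_metric_det:
  assumes "uniform_limit C Ek E sequentially" "uniform_limit C Fk F sequentially" "uniform_limit C Gk G sequentially"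
    and "bounded (E ` C)" "bounded (F ` C)" "bounded (G ` C)"
  shows "uniform_limit C (\<lambda>k. metric_det (Ek k) (Fk k) (Gk k)) (metric_det E F G) sequentially"
  unfolding metric_det_def[abs_def] by (intro uniform_limit_minus uniform_lim_mult assms)

text \<open>Each summand of the connection form is a coefficient that converges uniformly on
  \<open>C\<close>, where the limiting denominators stay away from 0, times one first derivative of
  the metric that converges in L^1.\<close>

lemma conn_limit:
  assumes C: "compact C" and S: "open S" "C \<subseteq> S"
    and ckk: "\<And>k. Ck_on 1 S (Ek k)" "\<And>k. Ck_on 1 S (Fk k)" "\<And>k. Ck_on 1 S (Gk k)"
    and ck: "Ck_on 1 S E" "Ck_on 1 S F" "Ck_on 1 S G"
    and ul: "uniform_limit C Ek E sequentially" "uniform_limit C Fk F sequentially" "uniform_limit C Gk G sequentially"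
    and pos: "\<And>x. x \<in> S \<Longrightarrow> E x > 0" "\<And>x. x \<in> S \<Longrightarrow> metric_det E F G x > 0"
    and posk: "\<forall>\<^sub>F k in sequentially. \<forall>x\<in>C. Ek k x > 0 \<and> metric_det (Ek k) (Fk k) (Gk k) x > 0"
    and L1: "\<And>l. (\<lambda>k. \<integral>\<^sup>+x\<in>C. ennreal \<bar>pderiv_at l (Ek k) x - pderiv_at l E x\<bar> \<partial>lborel) \<longlonglongrightarrow> 0"
      "\<And>l. (\<lambda>k. \<integral>\<^sup>+x\<in>C. ennreal \<bar>pderiv_at l (Fk k) x - pderiv_at l F x\<bar> \<partial>lborel) \<longlonglongrightarrow> 0"
      "\<And>l. (\<lambda>k. \<integral>\<^sup>+x\<in>C. ennreal \<bar>pderiv_at l (Gk k) x - pderiv_at l G x\<bar> \<partial>lborel) \<longlonglongrightarrow> 0"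
    and z: "continuous_on C z"
  shows "(\<lambda>k. LINT x|lborel. indicator C x * (z x * conn1 (Ek k) (Fk k) (Gk k) x)) \<longlonglongrightarrow> (LINT x|lborel. indicator C x * (z x * conn1 E F G x))"
    "(\<lambda>k. LINT x|lborel. indicator C x * (z x * conn2 (Ek k) (Fk k) (Gk k) x)) \<longlonglongrightarrow> (LINT x|lborel. indicator C x * (z x * conn2 E F G x))"
proof -
  have con: "continuous_on C h" "continuous_on C (pderiv_at l h)" if "Ck_on 1 S h" for h :: "real^2 \<Rightarrow> real" and l
    using Ck_on_1_D(1,3)[OF that] S(2) continuous_on_subset by blast+
  have bd: "bounded (h ` C)" if "continuous_on C h" for h :: "real^2 \<Rightarrow> real"
    by (rule compact_imp_bounded[OF compact_continuous_image[OF that C]])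
  let ?D = "metric_det E F G" and ?Dk = "\<lambda>k. metric_det (Ek k) (Fk k) (Gk k)"
  have Dc: "continuous_on C ?D" "continuous_on C (?Dk k)" for k
    unfolding metric_det_def[abs_def] by (intro continuous_intros con ck ckk)+
  have uD: "uniform_limit C ?Dk ?D sequentially"
    by (intro uniform_limit_metric_det ul bd con ck)
  have low: "\<exists>c>0. \<forall>x\<in>C. c \<le> norm (h x)" if h: "continuous_on C h" "\<And>x. x \<in> C \<Longrightarrow> h x > 0" for h :: "real^2 \<Rightarrow> real"
  proof -
    have "continuous_on C (\<lambda>x. inverse (h x))" using h by (intro continuous_intros) (auto simp: less_imp_neq[symmetric])
    then obtain B where B: "B > 0" "\<And>x. x \<in> C \<Longrightarrow> norm (inverse (h x)) \<le> B" using compact_continuous_bound[OF C] by blast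
    have "inverse B \<le> norm (h x)" if "x \<in> C" for x
      using B(2)[OF that] B(1) h(2)[OF that] by (simp add: field_simps)
    then show ?thesis using B(1) by (intro exI[of _ "inverse B"]) auto
  qed
  let ?q = "\<lambda>x. inverse (sqrt (?D x))" and ?qk = "\<lambda>k x. inverse (sqrt (?Dk k x))"
  have sD: "continuous_on C (\<lambda>x. sqrt (?D x))" by (intro continuous_intros Dc)
  have sDpos: "x \<in> C \<Longrightarrow> sqrt (?D x) > 0" for x using pos(2) S(2) by auto
  obtain c1 where c1: "c1 > 0" "\<And>x. x \<in> C \<Longrightarrow> c1 \<le> norm (sqrt (?D x))" using low[OF sD sDpos] by blast
  have Epos: "x \<in> C \<Longrightarrow> E x > 0" for x using pos(1) S(2) by auto
  obtain c2 where c2: "c2 > 0" "\<And>x. x \<in> C \<Longrightarrow> c2 \<le> norm (E x)" using low[OF con(1)[OF ck(1)] Epos] by blast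
  have uq: "uniform_limit C ?qk ?q sequentially"
  proof -
    have "uniform_limit C (\<lambda>k x. sqrt (?Dk k x)) (\<lambda>x. sqrt (?D x)) sequentially"
      using posk pos(2) S(2) by (intro uniform_limit_sqrt uD) (auto elim!: eventually_mono intro: less_imp_le)
    from uniform_lim_inverse[OF this c1(2,1)] show ?thesis by (simp add: o_def)
  qed
  have ue: "uniform_limit C (\<lambda>k x. inverse (Ek k x)) (\<lambda>x. inverse (E x)) sequentially"
    using uniform_lim_inverse[OF ul(1) c2(2,1)] by (simp add: o_def)
  have qc: "continuous_on C ?q" using sDpos by (intro continuous_intros sD) (auto simp: less_imp_neq[symmetric])
  have ec: "continuous_on C (\<lambda>x. inverse (E x))" using Epos by (intro continuous_intros con ck) (auto simp: less_imp_neq[symmetric])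
  have qkc: "\<forall>\<^sub>F k in sequentially. continuous_on C (?qk k)"
    using posk
  proof eventually_elim
    case (elim k)
    have "continuous_on C (\<lambda>x. sqrt (?Dk k x))" by (intro continuous_intros Dc)
    moreover have "sqrt (?Dk k x) \<noteq> 0" if "x \<in> C" for x using elim that by fastforce
    ultimately show ?case by (intro continuous_on_inverse) auto
  qed
  have ekc: "\<forall>\<^sub>F k in sequentially. continuous_on C (\<lambda>x. inverse (Ek k x))"
    using posk
  proof eventually_elim
    case (elim k)
    have "Ek k x \<noteq> 0" if "x \<in> C" for x using elim that by fastforce
    then show ?case by (intro continuous_on_inverse con ckk) auto
  qed
  have zq: "uniform_limit C (\<lambda>k x. z x * ?qk k x) (\<lambda>x. z x * ?q x) sequentially"
    by (intro uniform_lim_mult uniform_limit_const uq bd z qc)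
  have zqc: "continuous_on C (\<lambda>x. z x * ?q x)" by (intro continuous_intros z qc)
  have zqkc: "\<forall>\<^sub>F k in sequentially. continuous_on C (\<lambda>x. z x * ?qk k x)"
    using qkc by eventually_elim (intro continuous_on_mult z)
  have Fe: "uniform_limit C (\<lambda>k x. Fk k x * inverse (Ek k x)) (\<lambda>x. F x * inverse (E x)) sequentially"
    by (intro uniform_lim_mult ul ue bd con ck ec)
  have Fec: "continuous_on C (\<lambda>x. F x * inverse (E x))" by (intro continuous_intros con ck ec)
  have zf: "uniform_limit C (\<lambda>k x. z x * ?qk k x * (Fk k x * inverse (Ek k x))) (\<lambda>x. z x * ?q x * (F x * inverse (E x))) sequentially"
    by (rule uniform_lim_mult[OF zq Fe bd[OF zqc] bd[OF Fec]])
  have zfc: "continuous_on C (\<lambda>x. z x * ?q x * (F x * inverse (E x)))" by (rule continuous_on_mult[OF zqc Fec])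
  have zfkc: "\<forall>\<^sub>F k in sequentially. continuous_on C (\<lambda>x. z x * ?qk k x * (Fk k x * inverse (Ek k x)))"
    using zqkc ekc
  proof eventually_elim
    case (elim k)
    show ?case by (rule continuous_on_mult[OF elim(1) continuous_on_mult[OF con(1)[OF ckk(2)] elim(2)]])
  qed
  have ev: "\<forall>\<^sub>F k in sequentially. continuous_on C (pderiv_at l (Ek k))" "\<forall>\<^sub>F k in sequentially. continuous_on C (pderiv_at l (Fk k))"
    "\<forall>\<^sub>F k in sequentially. continuous_on C (pderiv_at l (Gk k))" for l
    by (intro always_eventually allI con ckk)+
  note ipl = integral_product_limit[OF C]
  note iE = ipl[OF zq zqkc zqc ev(1) con(2)[OF ck(1)] L1(1)] ipl[OF zf zfkc zfc ev(1) con(2)[OF ck(1)] L1(1)]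
  note iF = ipl[OF zq zqkc zqc ev(2) con(2)[OF ck(2)] L1(2)]
  note iG = ipl[OF zq zqkc zqc ev(3) con(2)[OF ck(3)] L1(3)]
  note int = integrable_compact_continuous[OF C]
  \<comment> \<open>Stated for arbitrary coefficients, because it splits the limit as well as the
    members of the sequence.\<close>
  have split1: "(LINT x|lborel. indicator C x * (z x * conn1 E F G x)) =
     (LINT x|lborel. indicator C x * (z x * inverse (sqrt (metric_det E F G x)) * pderiv_at 2 E x)) / 2
     - (LINT x|lborel. indicator C x * (z x * inverse (sqrt (metric_det E F G x)) * pderiv_at 1 F x))
     + (LINT x|lborel. indicator C x * (z x * inverse (sqrt (metric_det E F G x)) * (F x * inverse (E x)) * pderiv_at 1 E x)) / 2"
    "(LINT x|lborel. indicator C x * (z x * conn2 E F G x)) =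
     (LINT x|lborel. indicator C x * (z x * inverse (sqrt (metric_det E F G x)) * (F x * inverse (E x)) * pderiv_at 2 E x)) / 2
     - (LINT x|lborel. indicator C x * (z x * inverse (sqrt (metric_det E F G x)) * pderiv_at 1 G x)) / 2"
    if c: "continuous_on C (\<lambda>x. z x * inverse (sqrt (metric_det E F G x)))"
      "continuous_on C (\<lambda>x. z x * inverse (sqrt (metric_det E F G x)) * (F x * inverse (E x)))"
      "Ck_on 1 S E" "Ck_on 1 S F" "Ck_on 1 S G" for E F G
  proof -
    note i = int[OF continuous_on_mult[OF c(1) con(2)[OF c(3)]]] int[OF continuous_on_mult[OF c(2) con(2)[OF c(3)]]]
      int[OF continuous_on_mult[OF c(1) con(2)[OF c(4)]]] int[OF continuous_on_mult[OF c(1) con(2)[OF c(5)]]]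
    have "(LINT x|lborel. indicator C x * (z x * conn1 E F G x)) =
      (LINT x|lborel. indicator C x * (z x * inverse (sqrt (metric_det E F G x)) * pderiv_at 2 E x) / 2
       - indicator C x * (z x * inverse (sqrt (metric_det E F G x)) * pderiv_at 1 F x)
       + indicator C x * (z x * inverse (sqrt (metric_det E F G x)) * (F x * inverse (E x)) * pderiv_at 1 E x) / 2)"
      by (intro Bochner_Integration.integral_cong) (auto simp: conn1_def algebra_simps)
    then show "(LINT x|lborel. indicator C x * (z x * conn1 E F G x)) =
     (LINT x|lborel. indicator C x * (z x * inverse (sqrt (metric_det E F G x)) * pderiv_at 2 E x)) / 2
     - (LINT x|lborel. indicator C x * (z x * inverse (sqrt (metric_det E F G x)) * pderiv_at 1 F x))
     + (LINT x|lborel. indicator C x * (z x * inverse (sqrt (metric_det E F G x)) * (F x * inverse (E x)) * pderiv_at 1 E x)) / 2"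
      using i by simp
    have "(LINT x|lborel. indicator C x * (z x * conn2 E F G x)) =
      (LINT x|lborel. indicator C x * (z x * inverse (sqrt (metric_det E F G x)) * (F x * inverse (E x)) * pderiv_at 2 E x) / 2
       - indicator C x * (z x * inverse (sqrt (metric_det E F G x)) * pderiv_at 1 G x) / 2)"
      by (intro Bochner_Integration.integral_cong) (auto simp: conn2_def algebra_simps)
    then show "(LINT x|lborel. indicator C x * (z x * conn2 E F G x)) =
     (LINT x|lborel. indicator C x * (z x * inverse (sqrt (metric_det E F G x)) * (F x * inverse (E x)) * pderiv_at 2 E x)) / 2
     - (LINT x|lborel. indicator C x * (z x * inverse (sqrt (metric_det E F G x)) * pderiv_at 1 G x)) / 2"
      using i by simp
  qed
  have both: "\<forall>\<^sub>F k in sequentially. continuous_on C (\<lambda>x. z x * ?qk k x) \<and> continuous_on C (\<lambda>x. z x * ?qk k x * (Fk k x * inverse (Ek k x)))"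
    using zqkc zfkc by eventually_elim simp
  have lim1: "(\<lambda>k. (LINT x|lborel. indicator C x * (z x * ?qk k x * pderiv_at 2 (Ek k) x)) / 2
     - (LINT x|lborel. indicator C x * (z x * ?qk k x * pderiv_at 1 (Fk k) x))
     + (LINT x|lborel. indicator C x * (z x * ?qk k x * (Fk k x * inverse (Ek k x)) * pderiv_at 1 (Ek k) x)) / 2)
     \<longlonglongrightarrow> (LINT x|lborel. indicator C x * (z x * conn1 E F G x))"
    unfolding split1(1)[OF zqc zfc ck] by (intro tendsto_intros iE iF) auto
  show "(\<lambda>k. LINT x|lborel. indicator C x * (z x * conn1 (Ek k) (Fk k) (Gk k) x)) \<longlonglongrightarrow> (LINT x|lborel. indicator C x * (z x * conn1 E F G x))"
    by (rule Lim_transform_eventually[OF lim1], rule eventually_mono[OF both]) (simp add: split1(1)[OF _ _ ckk])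
  have lim2: "(\<lambda>k. (LINT x|lborel. indicator C x * (z x * ?qk k x * (Fk k x * inverse (Ek k x)) * pderiv_at 2 (Ek k) x)) / 2
     - (LINT x|lborel. indicator C x * (z x * ?qk k x * pderiv_at 1 (Gk k) x)) / 2)
     \<longlonglongrightarrow> (LINT x|lborel. indicator C x * (z x * conn2 E F G x))"
    unfolding split1(2)[OF zqc zfc ck] by (intro tendsto_intros iE iG) auto
  show "(\<lambda>k. LINT x|lborel. indicator C x * (z x * conn2 (Ek k) (Fk k) (Gk k) x)) \<longlonglongrightarrow> (LINT x|lborel. indicator C x * (z x * conn2 E F G x))"
    by (rule Lim_transform_eventually[OF lim2], rule eventually_mono[OF both]) (simp add: split1(2)[OF _ _ ckk])
qed

section \<open>Chain rule and change of variables for integrals\<close>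

lemma pderiv_at_chain:
  fixes a :: "real^2 \<Rightarrow> real" and \<Phi> :: "real^2 \<Rightarrow> real^2"
  assumes "\<Phi> differentiable (at y)" "a differentiable (at (\<Phi> y))"
  shows "(\<lambda>y. a (\<Phi> y)) differentiable (at y)"
    "pderiv_at i (\<lambda>y. a (\<Phi> y)) y = pderiv_at i (\<lambda>y. \<Phi> y $ 1) y * pderiv_at 1 a (\<Phi> y) + pderiv_at i (\<lambda>y. \<Phi> y $ 2) y * pderiv_at 2 a (\<Phi> y)"
proof -
  have "((\<lambda>y. a (\<Phi> y)) has_derivative (\<lambda>v. \<Sum>j\<in>UNIV. (frechet_derivative \<Phi> (at y) v) $ j *\<^sub>R pderiv_at j a (\<Phi> y))) (at y)"
    using has_derivative_compose[OF iffD1[OF frechet_derivative_works assms(1)] has_derivative_pderiv[OF assms(2)]] .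
  then show "(\<lambda>y. a (\<Phi> y)) differentiable (at y)"
    "pderiv_at i (\<lambda>y. a (\<Phi> y)) y = pderiv_at i (\<lambda>y. \<Phi> y $ 1) y * pderiv_at 1 a (\<Phi> y) + pderiv_at i (\<lambda>y. \<Phi> y $ 2) y * pderiv_at 2 a (\<Phi> y)"
    by (auto simp: differentiable_def pderiv_at_eqI sum_2 pderiv_at_component[OF assms(1)])
      (simp add: pderiv_at_def)
qed

lemma Ck_on_1_chain:
  fixes a :: "real^2 \<Rightarrow> real" and \<Phi> :: "real^2 \<Rightarrow> real^2"
  assumes "open S" "Ck_on 1 S \<Phi>" "Ck_on 1 T a" "\<Phi> ` S \<subseteq> T"
  shows "Ck_on 1 S (\<lambda>y. a (\<Phi> y))"
proof -
  have d: "\<Phi> differentiable (at y)" "a differentiable (at (\<Phi> y))" if "y \<in> S" for y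
    using Ck_on_1_D(2) assms that by blast+
  have c: "continuous_on S (\<lambda>y. pderiv_at j a (\<Phi> y))" for j
    by (rule continuous_on_compose2[OF Ck_on_1_D(3)[OF assms(3)] Ck_on_1_D(1)[OF assms(2)] assms(4)])
  have c': "continuous_on S (pderiv_at i (\<lambda>y. \<Phi> y $ j))" for i j
    by (rule Ck_on_1_D(3)[OF Ck_on_vec_nth[OF assms(1,2)]])
  show ?thesis
    by (rule Ck_on_1_I[OF assms(1) pderiv_at_chain(1)[OF d] pderiv_at_chain(2)[OF d]])
       (assumption+, intro continuous_intros c c')
qed

lemma jac_chain:
  fixes a b :: "real^2 \<Rightarrow> real" and \<Phi> :: "real^2 \<Rightarrow> real^2"
  assumes "\<Phi> differentiable (at y)" "a differentiable (at (\<Phi> y))" "b differentiable (at (\<Phi> y))"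
  shows "jac (\<lambda>y. a (\<Phi> y)) (\<lambda>y. b (\<Phi> y)) y = jac a b (\<Phi> y) * jacobian_det \<Phi> y"
  unfolding jac_def jacobian_det_eq_jac[OF assms(1)] pderiv_at_chain(2)[OF assms(1,2)] pderiv_at_chain(2)[OF assms(1,3)]
  by (simp add: algebra_simps)

text \<open>The change of variables theorem used next concerns vector-valued functions and the
  Henstock-Kurzweil integral; scalars pass through \<open>real^1\<close>.\<close>

lemma absolutely_integrable_vec_1:
  fixes h :: "real^2 \<Rightarrow> real"
  assumes "h \<in> borel_measurable borel" "\<And>x. x \<notin> S \<Longrightarrow> h x = 0" "S \<in> sets borel"
  shows "(\<lambda>x. vec (h x) :: real^1) absolutely_integrable_on S \<longleftrightarrow> integrable lborel h"
    "integrable lborel h \<Longrightarrow> integral S (\<lambda>x. vec (h x) :: real^1) = vec (LINT x|lborel. h x)"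
proof -
  have ind: "(\<lambda>x. indicator S x *\<^sub>R h x) = h" using assms(2) by (auto simp: indicator_def fun_eq_iff)
  have s: "h absolutely_integrable_on S \<longleftrightarrow> integrable lborel h"
    unfolding set_integrable_def ind using assms(1) by (simp add: integrable_completion)
  then show "(\<lambda>x. vec (h x) :: real^1) absolutely_integrable_on S \<longleftrightarrow> integrable lborel h"
    by (simp add: absolutely_integrable_on_1_iff)
  assume i: "integrable lborel h"
  then have "(LINT x:S|lebesgue. h x) = integral S h" using s by (intro set_lebesgue_integral_eq_integral(2)) simp
  moreover have "(LINT x:S|lebesgue. h x) = (LINT x|lborel. h x)"
    unfolding set_lebesgue_integral_def ind using assms(1) by (simp add: integral_completion)
  ultimately show "integral S (\<lambda>x. vec (h x) :: real^1) = vec (LINT x|lborel. h x)"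
    by (simp add: integral_on_1_eq)
qed

lemma diffeo_change_of_variables:
  fixes h :: "real^2 \<Rightarrow> real"
  assumes diffeo: "C1_diffeomorphism U U' \<Psi> \<Phi>" and h: "integrable lborel h" "\<And>x. x \<notin> U \<Longrightarrow> h x = 0"
  shows "(LINT y|lborel. indicator U' y * (\<bar>jacobian_det \<Phi> y\<bar> * h (\<Phi> y))) = (LINT x|lborel. h x)"
proof -
  note D = diffeo_facts[OF diffeo]
  have hm: "h \<in> borel_measurable borel" using h(1) borel_measurable_integrable by auto
  let ?k = "\<lambda>y. indicator U' y * (\<bar>jacobian_det \<Phi> y\<bar> * h (\<Phi> y))"
  have jc: "continuous_on U' (jacobian_det \<Phi>)" by (rule continuous_on_jacobian_det[OF D(2,4)])
  have km: "?k \<in> borel_measurable borel"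
  proof -
    have "(\<lambda>y. h (\<Phi> y)) \<in> borel_measurable (restrict_space borel U')"
      by (rule measurable_compose[OF borel_measurable_continuous_on_restrict[OF D(10)] hm])
    then have "(\<lambda>y. indicator U' y *\<^sub>R h (\<Phi> y)) \<in> borel_measurable borel"
      using D(2) by (subst (asm) borel_measurable_restrict_space_iff) auto
    moreover have "(\<lambda>y. indicator U' y *\<^sub>R jacobian_det \<Phi> y) \<in> borel_measurable borel"
      using D(2) by (intro borel_measurable_continuous_on_indicator jc) auto
    ultimately have "(\<lambda>y. \<bar>indicator U' y *\<^sub>R jacobian_det \<Phi> y\<bar> * (indicator U' y *\<^sub>R h (\<Phi> y))) \<in> borel_measurable borel"
      by measurable
    moreover have "(\<lambda>y. \<bar>indicator U' y *\<^sub>R jacobian_det \<Phi> y\<bar> * (indicator U' y *\<^sub>R h (\<Phi> y))) = ?k"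
      by (auto simp: indicator_def)
    ultimately show ?thesis by simp
  qed
  have der: "(\<Phi> has_derivative frechet_derivative \<Phi> (at y)) (at y within U')" if "y \<in> U'" for y
    using Ck_on_1_D(2)[OF D(4) that] by (intro has_derivative_at_withinI[OF iffD1[OF frechet_derivative_works]])
  have "((\<lambda>y. \<bar>det (matrix (frechet_derivative \<Phi> (at y)))\<bar> *\<^sub>R (vec (h (\<Phi> y)) :: real^1)) absolutely_integrable_on U' \<and>
     integral U' (\<lambda>y. \<bar>det (matrix (frechet_derivative \<Phi> (at y)))\<bar> *\<^sub>R (vec (h (\<Phi> y)) :: real^1)) = vec (LINT x|lborel. h x))
    \<longleftrightarrow> ((\<lambda>x. vec (h x) :: real^1) absolutely_integrable_on (\<Phi> ` U') \<and> integral (\<Phi> ` U') (\<lambda>x. vec (h x) :: real^1) = vec (LINT x|lborel. h x))"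
    by (rule has_absolute_integral_change_of_variables_invertible[OF der, where h=\<Psi>])
       (use D in auto)
  moreover have "(\<lambda>x. vec (h x) :: real^1) absolutely_integrable_on (\<Phi> ` U')" "integral (\<Phi> ` U') (\<lambda>x. vec (h x) :: real^1) = vec (LINT x|lborel. h x)"
    unfolding D(6) using absolutely_integrable_vec_1[OF hm h(2)] h(1) D(1) by auto
  ultimately have 1: "(\<lambda>y. \<bar>det (matrix (frechet_derivative \<Phi> (at y)))\<bar> *\<^sub>R (vec (h (\<Phi> y)) :: real^1)) absolutely_integrable_on U'"
     "integral U' (\<lambda>y. \<bar>det (matrix (frechet_derivative \<Phi> (at y)))\<bar> *\<^sub>R (vec (h (\<Phi> y)) :: real^1)) = vec (LINT x|lborel. h x)" by auto
  have eq: "\<bar>det (matrix (frechet_derivative \<Phi> (at y)))\<bar> *\<^sub>R (vec (h (\<Phi> y)) :: real^1) = vec (?k y)" if "y \<in> U'" for y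
    using that by (simp add: vec_eq_iff jacobian_det_def)
  have 2: "(\<lambda>y. vec (?k y) :: real^1) absolutely_integrable_on U'"
    using 1(1) by (rule set_integrable_cong[THEN iffD1, rotated -1]) (auto simp: eq)
  have 3: "integral U' (\<lambda>y. vec (?k y) :: real^1) = vec (LINT x|lborel. h x)"
    using 1(2) eq by (metis (no_types, lifting) integral_cong)
  have "integrable lborel ?k" using 2 absolutely_integrable_vec_1(1)[OF km] D(2) by auto
  from absolutely_integrable_vec_1(2)[OF km _ _ this, of U'] 3 D(2)
  have "vec (LINT y|lborel. ?k y) = (vec (LINT x|lborel. h x) :: real^1)" by auto
  then show ?thesis by (simp add: vec_eq_iff)
qed

section \<open>Vector-valued norms and smooth approximation\<close>

lemma L2_on_continuous:
  fixes h :: "real^2 \<Rightarrow> 'b::euclidean_space"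
  assumes V: "compactly_inside V U" and h: "continuous_on U h"
  shows "L2_on V h"
proof -
  have Vo: "open V" "compact (closure V)" "closure V \<subseteq> U" "V \<subseteq> closure V" using V closure_subset by (auto simp: compactly_inside_def)
  obtain B where B: "B > 0" "\<And>x. x \<in> closure V \<Longrightarrow> norm (h x) \<le> B"
    using compact_continuous_bound[OF Vo(2) continuous_on_subset[OF h Vo(3)]] by blast
  have "set_borel_measurable borel V h"
    unfolding set_borel_measurable_def
    using Vo by (intro borel_measurable_continuous_on_indicator continuous_on_subset[OF h]) auto
  moreover have "L2_norm_sq V h \<le> (\<integral>\<^sup>+x. ennreal (B\<^sup>2) * indicator V x \<partial>lborel)"
    unfolding L2_norm_sq_def
  proof (rule nn_integral_mono)
    fix x
    show "ennreal ((norm (h x))\<^sup>2) * indicator V x \<le> ennreal (B\<^sup>2) * indicator V x"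
    proof (cases "x \<in> V")
      case True
      then have "norm (h x) \<le> B" using B(2) Vo(4) by blast
      then have "(norm (h x))\<^sup>2 \<le> B\<^sup>2" by (intro power_mono) auto
      then show ?thesis by (intro mult_right_mono ennreal_leI) auto
    qed simp
  qed
  moreover have "(\<integral>\<^sup>+x. ennreal (B\<^sup>2) * indicator V x \<partial>lborel) < \<infinity>"
    using compactly_inside_finite[OF V] Vo(1) by (subst nn_integral_cmult_indicator) (auto simp: ennreal_mult_less_top)
  ultimately show ?thesis unfolding L2_on_def by (auto intro: le_less_trans)
qed

lemma norm_vec2_sq: "(norm (a :: real^2))\<^sup>2 = (a $ 1)\<^sup>2 + (a $ 2)\<^sup>2"
  unfolding power2_norm_eq_inner inner_vec_def sum_2 by (simp add: power2_eq_square)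

lemma slobodeckij_vec2_le:
  fixes h :: "real^2 \<Rightarrow> real^2"
  assumes V[measurable]: "V \<in> sets borel" and m: "\<And>i. set_borel_measurable borel V (\<lambda>x. h x $ i)"
  shows "slobodeckij_sq (1/2) V h \<le> slobodeckij_sq (1/2) V (\<lambda>x. h x $ 1) + slobodeckij_sq (1/2) V (\<lambda>x. h x $ 2)"
proof -
  let ?a = "\<lambda>i x. indicator V x * h x $ i"
  have [measurable]: "?a i \<in> borel_measurable borel" for i using m[of i] by (simp add: set_borel_measurable_def)
  let ?K = "\<lambda>i x y. ennreal (indicator V x * indicator V y * ((?a i x - ?a i y)\<^sup>2 / norm (x - y) ^ 3))"
  have K: "(\<lambda>p. ?K i (fst p) (snd p)) \<in> borel_measurable (lborel \<Otimes>\<^sub>M lborel)" for i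
    by measurable
  have "slobodeckij_sq (1/2) V h \<le> (\<integral>\<^sup>+x. \<integral>\<^sup>+y. ?K 1 x y + ?K 2 x y \<partial>lborel \<partial>lborel)"
    unfolding slobodeckij_sq_def
  proof (rule nn_integral_mono)
    fix x
    show "(\<integral>\<^sup>+y\<in>V. ennreal ((norm (h x - h y))\<^sup>2 / norm (x - y) powr (real CARD(2) + 2 * (1/2))) \<partial>lborel) * indicator V x
      \<le> (\<integral>\<^sup>+y. ?K 1 x y + ?K 2 x y \<partial>lborel)"
    proof (cases "x \<in> V")
      case True
      have "(\<integral>\<^sup>+y\<in>V. ennreal ((norm (h x - h y))\<^sup>2 / norm (x - y) powr (real CARD(2) + 2 * (1/2))) \<partial>lborel) \<le> (\<integral>\<^sup>+y. ?K 1 x y + ?K 2 x y \<partial>lborel)"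
      proof (rule nn_integral_mono)
        fix y
        show "ennreal ((norm (h x - h y))\<^sup>2 / norm (x - y) powr (real CARD(2) + 2 * (1/2))) * indicator V y \<le> ?K 1 x y + ?K 2 x y"
          unfolding slobodeckij_integrand norm_vec2_sq using True
          by (cases "y \<in> V") (auto simp flip: ennreal_plus simp: add_divide_distrib)
      qed
      then show ?thesis using True by simp
    qed simp
  qed
  also have "\<dots> = (\<integral>\<^sup>+x. \<integral>\<^sup>+y. ?K 1 x y \<partial>lborel \<partial>lborel) + (\<integral>\<^sup>+x. \<integral>\<^sup>+y. ?K 2 x y \<partial>lborel \<partial>lborel)"
    by (rule iterated_nn_integral_add[OF K K])
  also have "\<dots> = slobodeckij_sq (1/2) V (\<lambda>x. h x $ 1) + slobodeckij_sq (1/2) V (\<lambda>x. h x $ 2)"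
    unfolding slobodeckij_eq by (intro arg_cong2[where f="(+)"] nn_integral_cong) (auto simp: indicator_def)
  finally show ?thesis .
qed

lemma L2_norm_sq_vec2_le:
  fixes h :: "real^2 \<Rightarrow> real^2"
  assumes V[measurable]: "V \<in> sets borel" and m: "\<And>i. set_borel_measurable borel V (\<lambda>x. h x $ i)"
  shows "L2_norm_sq V h \<le> L2_norm_sq V (\<lambda>x. h x $ 1) + L2_norm_sq V (\<lambda>x. h x $ 2)"
proof -
  let ?a = "\<lambda>i x. indicator V x * h x $ i"
  have [measurable]: "?a i \<in> borel_measurable borel" for i using m[of i] by (simp add: set_borel_measurable_def)
  have "L2_norm_sq V h = (\<integral>\<^sup>+x. ennreal ((?a 1 x)\<^sup>2) + ennreal ((?a 2 x)\<^sup>2) \<partial>lborel)"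
    unfolding L2_norm_sq_def norm_vec2_sq by (intro nn_integral_cong) (auto simp: indicator_def)
  also have "\<dots> = (\<integral>\<^sup>+x. ennreal ((?a 1 x)\<^sup>2) \<partial>lborel) + (\<integral>\<^sup>+x. ennreal ((?a 2 x)\<^sup>2) \<partial>lborel)"
    by (rule nn_integral_add) auto
  also have "\<dots> = L2_norm_sq V (\<lambda>x. h x $ 1) + L2_norm_sq V (\<lambda>x. h x $ 2)"
    unfolding L2_norm_sq_def by (intro arg_cong2[where f="(+)"] nn_integral_cong) (auto simp: indicator_def)
  finally show ?thesis by simp
qed

lemma compact_exhaustion:
  fixes U :: "(real^2) set"
  assumes "open U"
  obtains K :: "nat \<Rightarrow> (real^2) set" where "\<And>n. compact (K n)" "\<And>n. K n \<subseteq> U"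
    "\<And>C. compact C \<Longrightarrow> C \<subseteq> U \<Longrightarrow> \<forall>\<^sub>F n in sequentially. C \<subseteq> K n"
proof -
  define K where "K n = cball 0 (real n) \<inter> {x. \<forall>y. y \<notin> U \<longrightarrow> 1 / real (Suc n) \<le> dist x y}" for n
  show thesis
  proof (rule that[of K])
    fix n
    have "closed {x. \<forall>y. y \<notin> U \<longrightarrow> 1 / real (Suc n) \<le> dist x y}"
      by (intro closed_Collect_all closed_Collect_imp closed_Collect_le open_Collect_const continuous_intros)
    then show "compact (K n)" unfolding K_def by (intro compact_Int_closed) auto
    show "K n \<subseteq> U"
    proof
      fix x assume x: "x \<in> K n"
      show "x \<in> U"
      proof (rule ccontr)
        assume "x \<notin> U"
        then have "1 / real (Suc n) \<le> dist x x" using x by (auto simp: K_def)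
        then show False by simp
      qed
    qed
  next
    fix C assume C: "compact C" "C \<subseteq> U"
    obtain d where d: "d > 0" "(\<Union>x\<in>C. ball x d) \<subseteq> U"
      using compact_subset_open_imp_ball_epsilon_subset[OF C(1) assms C(2)] by blast
    obtain R where R: "\<And>x. x \<in> C \<Longrightarrow> norm x \<le> R" using compact_imp_bounded[OF C(1)] unfolding bounded_iff by blast
    have "\<forall>\<^sub>F n in sequentially. R \<le> real n"
      using filterlim_real_sequentially unfolding filterlim_at_top by blast
    moreover have "\<forall>\<^sub>F n in sequentially. 1 / real (Suc n) < d"
      using order_tendstoD(2)[OF inverse_Suc_tendsto(1) d(1)] .
    ultimately show "\<forall>\<^sub>F n in sequentially. C \<subseteq> K n"
    proof eventually_elim
      case (elim n)
      show ?case
      proof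
        fix x assume x: "x \<in> C"
        have "d \<le> dist x y" if "y \<notin> U" for y using d(2) x that by (force simp: subset_iff not_less)
        then show "x \<in> K n" using R[OF x] elim unfolding K_def by (auto simp: dist_norm) (meson less_imp_le order_trans)+
      qed
    qed
  qed
qed

text \<open>\<open>Det_D\<close> selects a limit common to all admissible sequences, so uniqueness
  needs at least one of them. Each member is the mollification of \<open>w\<close> cut off to a
  compact set of an exhaustion.\<close>

lemma smooth_approximation:
  fixes w :: "real^2 \<Rightarrow> real^2"
  assumes U: "open U" and w: "continuous_on U w"
    and slob: "\<And>V i. compactly_inside V U \<Longrightarrow> slobodeckij_sq (1/2) V (\<lambda>x. w x $ i) < \<infinity>"
  obtains W where "\<And>k. smooth_on U (W k)" "tends_H12_loc U W w"
proof -
  obtain K :: "nat \<Rightarrow> (real^2) set" where K: "\<And>n. compact (K n)" "\<And>n. K n \<subseteq> U"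
    "\<And>C. compact C \<Longrightarrow> C \<subseteq> U \<Longrightarrow> \<forall>\<^sub>F n in sequentially. C \<subseteq> K n"
    using compact_exhaustion[OF U] by blast
  define s where "s k = 1 / real (Suc k)" for k
  have s: "s \<longlonglongrightarrow> 0" "\<And>k. s k > 0" using inverse_Suc_tendsto unfolding s_def by auto
  have wc: "continuous_on U (\<lambda>x. w x $ i)" for i using w by (intro continuous_on_component)
  define M where "M k i = moll (s k) (restr (K k) (\<lambda>x. w x $ i))" for k i
  have smM: "Ck_on n UNIV (M k i)" for n k i
    unfolding M_def using L12_restr[OF K(1) continuous_on_subset[OF wc K(2)], of k i]
    by (intro Ck_on_moll s) (auto simp: L12_def)
  define W :: "nat \<Rightarrow> real^2 \<Rightarrow> real^2" where "W k x = (M k 1 x) *\<^sub>R axis 1 1 + (M k 2 x) *\<^sub>R axis 2 1" for k x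
  have Wi: "W k x $ i = M k i x" for k x i
    using exhaust_2[of i] by (auto simp: W_def axis_def)
  show thesis
  proof (rule that[of W])
    fix k
    have "Ck_on n UNIV (W k)" for n
      unfolding W_def[abs_def]
      by (intro Ck_on_add bounded_linear.Ck_on_compose[OF bounded_linear_scaleR_left] smM open_UNIV)
    then show "smooth_on U (W k)" unfolding smooth_on_def using Ck_on_subset by blast
  next
    show "tends_H12_loc U W w"
      unfolding tends_H12_loc_def
    proof (intro allI impI)
      fix V assume V: "compactly_inside V U"
      have Vo: "open V" "compact (closure V)" "closure V \<subseteq> U" "V \<subseteq> closure V" using V closure_subset by (auto simp: compactly_inside_def)
      obtain V1 r where V1: "r > 0" "compactly_inside V1 U" "closure V \<subseteq> V1" "\<And>x. x \<in> closure V \<Longrightarrow> ball x r \<subseteq> V1"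
        using compact_neighbourhood[OF Vo(2) U Vo(3)] by metis
      have V1o: "open V1" "compact (closure V1)" "closure V1 \<subseteq> U" using V1(2) by (auto simp: compactly_inside_def)
      have Vb: "V \<in> sets borel" using Vo by simp
      have fin: "emeasure lborel V < \<infinity>" by (rule compactly_inside_finite[OF V])
      have mV: "set_borel_measurable borel V (\<lambda>x. w x $ i)" for i
        using Vo(3,4) by (intro set_borel_measurable_continuous Vb continuous_on_subset[OF wc]) auto
      have D: "tends_tame V (\<lambda>k x. M k i x - w x $ i) (\<lambda>_. 0)" for i
      proof -
        have 1: "tends_tame V (\<lambda>k. moll (s k) (restr (closure V1) (\<lambda>x. w x $ i))) (\<lambda>x. w x $ i)"
          using V1(4) Vo(4) by (intro tends_tame_moll[OF Vb V1o(1,2) continuous_on_subset[OF wc V1o(3)] V1(1) _ s slob[OF V1(2)]]) blast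
        have "\<forall>\<^sub>F k in sequentially. s k < r" using order_tendstoD(2)[OF s(1) V1(1)] .
        \<comment> \<open>Near \<open>V\<close> the growing cut-off eventually agrees with the fixed
          one to which \<open>tends_tame_moll\<close> applies.\<close>
        with K(3)[OF V1o(2,3)] have "\<forall>\<^sub>F k in sequentially. \<forall>x\<in>V. moll (s k) (restr (closure V1) (\<lambda>x. w x $ i)) x = M k i x"
        proof eventually_elim
          case (elim k)
          show ?case
          proof
            fix x assume "x \<in> V"
            then have "ball x (s k) \<subseteq> V1" using V1(4)[of x] Vo(4) elim(2) by force
            then show "moll (s k) (restr (closure V1) (\<lambda>x. w x $ i)) x = M k i x"
              unfolding M_def using elim(1) closure_subset[of V1] by (intro moll_cong s) (auto simp: restr_def indicator_def subset_iff)
          qed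
        qed
        from tends_tame_cong[OF this refl 1] have 2: "tends_tame V (\<lambda>k. M k i) (\<lambda>x. w x $ i)" .
        have "tame V (\<lambda>_ x. w x $ i)" by (rule tame_const[OF Vb mV slob[OF V]])
        then have 3: "tends_tame V (\<lambda>_ x. w x $ i) (\<lambda>x. w x $ i)"
          using mV 2 by (auto simp: tends_tame_def intro: uniform_limit_const)
        show ?thesis using tends_tame_diff[OF Vb 2 3] by simp
      qed
      note null = tends_tame_null[OF Vb fin D]
      have mD: "\<forall>\<^sub>F k in sequentially. \<forall>i. set_borel_measurable borel V (\<lambda>x. (W k x - w x) $ i)"
      proof (intro always_eventually allI)
        fix k i
        have "continuous_on V (\<lambda>x. (W k x - w x) $ i)"
          using smM[of 0 k i] continuous_on_subset[OF wc, of V i] Vo(3,4)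
          by (auto simp: Wi intro!: continuous_on_diff intro: continuous_on_subset)
        then show "set_borel_measurable borel V (\<lambda>x. (W k x - w x) $ i)" by (rule set_borel_measurable_continuous[OF Vb])
      qed
      show "(\<lambda>k. L2_norm_sq V (\<lambda>x. W k x - w x)) \<longlonglongrightarrow> 0 \<and> (\<lambda>k. slobodeckij_sq (1/2) V (\<lambda>x. W k x - w x)) \<longlonglongrightarrow> 0"
      proof
        have "\<forall>\<^sub>F k in sequentially. L2_norm_sq V (\<lambda>x. W k x - w x) \<le> L2_norm_sq V (\<lambda>x. M k 1 x - w x $ 1) + L2_norm_sq V (\<lambda>x. M k 2 x - w x $ 2)"
          using mD by (rule eventually_mono) (use L2_norm_sq_vec2_le[OF Vb, of "\<lambda>x. W _ x - w x"] in \<open>simp add: Wi\<close>)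
        then show "(\<lambda>k. L2_norm_sq V (\<lambda>x. W k x - w x)) \<longlonglongrightarrow> 0"
          by (rule ennreal_tendsto_0_mono) (rule ennreal_tendsto_0_add[OF null(1) null(1)])
        have "\<forall>\<^sub>F k in sequentially. slobodeckij_sq (1/2) V (\<lambda>x. W k x - w x) \<le> slobodeckij_sq (1/2) V (\<lambda>x. M k 1 x - w x $ 1) + slobodeckij_sq (1/2) V (\<lambda>x. M k 2 x - w x $ 2)"
          using mD by (rule eventually_mono) (use slobodeckij_vec2_le[OF Vb, of "\<lambda>x. W _ x - w x"] in \<open>simp add: Wi\<close>)
        then show "(\<lambda>k. slobodeckij_sq (1/2) V (\<lambda>x. W k x - w x)) \<longlonglongrightarrow> 0"
          by (rule ennreal_tendsto_0_mono) (rule ennreal_tendsto_0_add[OF null(2) null(2)])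
      qed
    qed
  qed
qed

section \<open>Slopes and the graph map along tame sequences\<close>

lemma tends_tame_graph_map:
  fixes P :: "nat \<Rightarrow> 3 \<Rightarrow> real^2 \<Rightarrow> real" and p :: "3 \<Rightarrow> real^2 \<Rightarrow> real"
  assumes V: "V \<in> sets borel" and t: "\<And>i m. tends_tame V (\<lambda>k. pderiv_at i (P k m)) (pderiv_at i (p m))"
  shows "tends_tame V (\<lambda>k. nrm (P k m) (P k n)) (nrm (p m) (p n))"
    "tends_tame V (\<lambda>k. ffundamental i j (P k 1) (P k 2) (P k 3)) (ffundamental i j (p 1) (p 2) (p 3))"
    "c > 0 \<Longrightarrow> (\<And>x. x \<in> V \<Longrightarrow> c \<le> \<bar>nrm (p 1) (p 2) x\<bar>) \<Longrightarrow>
      tends_tame V (\<lambda>k. slope (nrm (P k m) (P k n)) (nrm (P k 1) (P k 2))) (slope (nrm (p m) (p n)) (nrm (p 1) (p 2)))"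
proof -
  show n: "tends_tame V (\<lambda>k. nrm (P k m) (P k n)) (nrm (p m) (p n))" for m n
    unfolding nrm_def[abs_def] by (intro tends_tame_diff tends_tame_mult V t)
  show "tends_tame V (\<lambda>k. ffundamental i j (P k 1) (P k 2) (P k 3)) (ffundamental i j (p 1) (p 2) (p 3))"
    unfolding ffundamental_def[abs_def] by (intro tends_tame_add tends_tame_mult V t)
  assume c: "c > 0" "\<And>x. x \<in> V \<Longrightarrow> c \<le> \<bar>nrm (p 1) (p 2) x\<bar>"
  have "tends_tame V (\<lambda>k x. (-1) * (nrm (P k m) (P k n) x * inverse (nrm (P k 1) (P k 2) x))) (\<lambda>x. (-1) * (nrm (p m) (p n) x * inverse (nrm (p 1) (p 2) x)))"
    by (intro tends_tame_mult tends_tame_const V n tends_tame_inverse[OF V _ c])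
  then show "tends_tame V (\<lambda>k. slope (nrm (P k m) (P k n)) (nrm (P k 1) (P k 2))) (slope (nrm (p m) (p n)) (nrm (p 1) (p 2)))"
    by (simp add: slope_def[abs_def])
qed

lemma tends_tame_F1:
  assumes V: "V \<in> sets borel" and A: "tends_tame V A a" and B: "tends_tame V B b"
  shows "tends_tame V (\<lambda>k x. F1 (A k x) (B k x)) (\<lambda>x. F1 (a x) (b x))"
proof -
  have q: "tends_tame V (\<lambda>k x. 1 + (A k x * A k x + B k x * B k x)) (\<lambda>x. 1 + (a x * a x + b x * b x))"
    by (intro tends_tame_add tends_tame_const tends_tame_mult V A B)
  have r: "tends_tame V (\<lambda>k x. 1 + B k x * B k x) (\<lambda>x. 1 + b x * b x)"
    by (intro tends_tame_add tends_tame_const tends_tame_mult V B)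
  have sq: "tends_tame V (\<lambda>k x. sqrt (1 + (A k x * A k x + B k x * B k x))) (\<lambda>x. sqrt (1 + (a x * a x + b x * b x)))"
    by (rule tends_tame_sqrt[OF V q]) auto
  have "tends_tame V (\<lambda>k x. inverse (sqrt (1 + (A k x * A k x + B k x * B k x)))) (\<lambda>x. inverse (sqrt (1 + (a x * a x + b x * b x))))"
    by (rule tends_tame_inverse[OF V sq, where c=1]) (auto intro: order_trans[OF _ abs_ge_self])
  moreover have "tends_tame V (\<lambda>k x. inverse (1 + B k x * B k x)) (\<lambda>x. inverse (1 + b x * b x))"
    by (rule tends_tame_inverse[OF V r, where c=1]) (auto intro: order_trans[OF _ abs_ge_self])
  ultimately show ?thesis unfolding F1_def by (intro tends_tame_mult V A)
qed

lemma Ck_on_1_F1: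
  assumes "open S" "Ck_on 1 S a" "Ck_on 1 S b"
  shows "Ck_on 1 S (\<lambda>x. F1 (a x) (b x))"
proof -
  have p: "1 + (a x * a x + b x * b x) > 0" "1 + b x * b x > 0" for x by (auto intro: add_pos_nonneg)
  have q: "Ck_on 1 S (\<lambda>x. 1 + (a x * a x + b x * b x))" "Ck_on 1 S (\<lambda>x. 1 + b x * b x)"
    by (intro Ck_on_add Ck_on_mult Ck_on_const assms)+
  have "Ck_on 1 S (\<lambda>x. inverse (sqrt (1 + (a x * a x + b x * b x))))" "Ck_on 1 S (\<lambda>x. inverse (1 + b x * b x))"
    using p by (auto intro!: Ck_on_1_inverse Ck_on_1_sqrt assms(1) q simp del: Ck_on.simps One_nat_def simp: less_imp_neq[symmetric])
  then show ?thesis unfolding F1_def using assms by (intro Ck_on_mult)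
qed

lemma Ck_on_1_slope:
  assumes "open S" "Ck_on 1 S n" "Ck_on 1 S m" "\<And>x. x \<in> S \<Longrightarrow> m x \<noteq> 0"
  shows "Ck_on 1 S (slope n m)"
proof -
  have "Ck_on 1 S (\<lambda>x. (-1) * (n x * inverse (m x)))"
    using assms by (intro Ck_on_mult Ck_on_const Ck_on_1_inverse; assumption?)
  then show ?thesis by (simp add: slope_def[abs_def] del: Ck_on.simps One_nat_def)
qed

lemma Ck_on_1_nrm:
  assumes "open S" "Ck_on 2 S a" "Ck_on 2 S b" shows "Ck_on 1 S (nrm a b)"
  unfolding nrm_def[abs_def] by (intro Ck_on_diff Ck_on_mult assms(1) Ck_on_2_D(2)[OF assms(2)] Ck_on_2_D(2)[OF assms(3)])

section \<open>The graph of an isometric embedding\<close>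

locale graph_isometry =
  fixes U U' :: "(real^2) set"
    and g :: "real^2 \<Rightarrow> real^2^2"
    and u :: "real^2 \<Rightarrow> real^3"
    and \<Psi> \<Phi> :: "real^2 \<Rightarrow> real^2"
    and v f :: "real^2 \<Rightarrow> real"
    and w :: "real^2 \<Rightarrow> real^2"
  assumes connected_U: "connected U" "U \<noteq> {}"
    and metric: "smooth_riemannian_metric U g"
    and regularity: "Ck_on 1 U u" "H32_loc U u"
    and isometric: "\<And>x i j. x \<in> U \<Longrightarrow> pderiv_at i u x \<bullet> pderiv_at j u x = g x $ i $ j"
    and components: "\<And>x. x \<in> U \<Longrightarrow> u x = vector [\<Psi> x $ 1, \<Psi> x $ 2, v x]"
    and diffeo: "C1_diffeomorphism U U' \<Psi> \<Phi>"
    and f_eq: "\<And>y. y \<in> U' \<Longrightarrow> f y = v (\<Phi> y)"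
    and w_eq: "\<And>y. y \<in> U' \<Longrightarrow> w y = F_map (grad f y)"
begin

definition p :: "3 \<Rightarrow> real^2 \<Rightarrow> real" where "p m x = u x $ m"

abbreviation N3 where "N3 \<equiv> nrm (p 1) (p 2)"
abbreviation s1 where "s1 \<equiv> slope (nrm (p 2) (p 3)) N3"
abbreviation s2 where "s2 \<equiv> slope (nrm (p 3) (p 1)) N3"

lemmas D = diffeo_facts[OF diffeo]

lemma p_Ck: "Ck_on 1 U (p m)"
  unfolding p_def[abs_def] by (rule Ck_on_vec_nth[OF D(1) regularity(1)])

lemma p_cont: "continuous_on U (pderiv_at i (p m))"
  by (rule Ck_on_1_D(3)[OF p_Ck])

lemma p_pderiv: "x \<in> U \<Longrightarrow> pderiv_at i (p m) x = pderiv_at i u x $ m"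
  unfolding p_def[abs_def] by (intro pderiv_at_component Ck_on_1_D(2)[OF regularity(1)])

lemma p_values: "x \<in> U \<Longrightarrow> p 1 x = \<Psi> x $ 1" "x \<in> U \<Longrightarrow> p 2 x = \<Psi> x $ 2" "x \<in> U \<Longrightarrow> p 3 x = v x"
  unfolding p_def by (simp_all add: components)

lemma N3_jacobian: "x \<in> U \<Longrightarrow> N3 x = jacobian_det \<Psi> x"
proof -
  assume x: "x \<in> U"
  have "pderiv_at i (p 1) x = pderiv_at i (\<lambda>x. \<Psi> x $ 1) x" "pderiv_at i (p 2) x = pderiv_at i (\<lambda>x. \<Psi> x $ 2) x" for i
    by (rule pderiv_at_cong[OF D(1) x], simp add: p_values)+
  then show ?thesis
    using jacobian_det_eq_jac[OF Ck_on_1_D(2)[OF D(3) x]] by (simp add: nrm_def jac_def)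
qed

text \<open>Chain rule for the composition of \<open>\<Psi>\<close> with \<open>\<Phi>\<close>,
  which is the identity on U'; \<open>N3\<close> is the Jacobian of \<open>\<Psi>\<close>.\<close>

lemma jacobian_inverse: "y \<in> U' \<Longrightarrow> N3 (\<Phi> y) * jacobian_det \<Phi> y = 1"
proof -
  assume y: "y \<in> U'"
  have x: "\<Phi> y \<in> U" using y D(6) by blast
  have \<Psi>d: "\<Psi> differentiable (at (\<Phi> y))" by (rule Ck_on_1_D(2)[OF D(3) x])
  have d: "(\<lambda>x. \<Psi> x $ i) differentiable (at (\<Phi> y))" for i
    by (rule Ck_on_1_D(2)[OF Ck_on_vec_nth[OF D(1,3)] x])
  have "jac (\<lambda>y. \<Psi> (\<Phi> y) $ 1) (\<lambda>y. \<Psi> (\<Phi> y) $ 2) y = N3 (\<Phi> y) * jacobian_det \<Phi> y"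
    using jac_chain[OF Ck_on_1_D(2)[OF D(4) y] d d] jacobian_det_eq_jac[OF \<Psi>d] N3_jacobian[OF x] by simp
  moreover have "pderiv_at i (\<lambda>y. \<Psi> (\<Phi> y) $ j) y = axis i 1 $ j" for i j
  proof -
    have "pderiv_at i (\<lambda>y. \<Psi> (\<Phi> y) $ j) y = pderiv_at i (\<lambda>y. y $ j) y"
      by (rule pderiv_at_cong[OF D(2) y]) (simp add: D(8))
    also have "\<dots> = axis i 1 $ j"
      by (rule pderiv_at_eqI) (intro bounded_linear_imp_has_derivative bounded_linear_vec_nth)
    finally show ?thesis .
  qed
  ultimately show ?thesis by (simp add: jac_def axis_def)
qed

lemma N3_nonzero: "x \<in> U \<Longrightarrow> N3 x \<noteq> 0"
  using jacobian_inverse[of "\<Psi> x"] D(5,7) by force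

lemma N3_cont: "continuous_on U N3"
  unfolding nrm_def[abs_def] by (intro continuous_intros p_cont)

text \<open>A continuous function without zeros has constant sign on the connected set
  \<open>U\<close>. The sign enters twice, as the orientation of the projected surface and in the
  change of variables, and cancels.\<close>

lemma N3_sign: obtains \<sigma> where "\<sigma> * \<sigma> = 1" "\<And>x. x \<in> U \<Longrightarrow> sgn (N3 x) = \<sigma>" "\<And>y. y \<in> U' \<Longrightarrow> sgn (jacobian_det \<Phi> y) = \<sigma>"
proof -
  obtain x0 where x0: "x0 \<in> U" using connected_U(2) by blast
  have c: "connected (N3 ` U)" by (rule connected_continuous_image[OF N3_cont connected_U(1)])
  have s: "sgn (N3 x) = sgn (N3 x0)" if x: "x \<in> U" for x
  proof (rule ccontr)
    assume ne: "sgn (N3 x) \<noteq> sgn (N3 x0)"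
    have "0 \<in> N3 ` U"
    proof (cases "N3 x < 0")
      case True
      then have "N3 x0 > 0" using ne N3_nonzero[OF x0] by (auto simp: sgn_if split: if_splits)
      then show ?thesis using connectedD_interval[OF c imageI[OF x] imageI[OF x0], of 0] True by simp
    next
      case False
      then have "N3 x > 0" "N3 x0 < 0" using ne N3_nonzero[OF x0] N3_nonzero[OF x] by (auto simp: sgn_if split: if_splits)
      then show ?thesis using connectedD_interval[OF c imageI[OF x0] imageI[OF x], of 0] by simp
    qed
    then show False using N3_nonzero by auto
  qed
  show thesis
  proof (rule that[of "sgn (N3 x0)"])
    show "sgn (N3 x0) * sgn (N3 x0) = 1" using N3_nonzero[OF x0] by (auto simp: sgn_if)
    fix y assume y: "y \<in> U'"
    then have "\<Phi> y \<in> U" using D(6) by blast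
    then have "sgn (N3 x0) * sgn (jacobian_det \<Phi> y) = 1"
      using arg_cong[OF jacobian_inverse[OF y], of sgn] s[of "\<Phi> y"] by (simp add: sgn_mult)
    then show "sgn (jacobian_det \<Phi> y) = sgn (N3 x0)" by (auto simp: sgn_if split: if_splits)
  qed (rule s)
qed

lemma f_Ck: "Ck_on 1 U' f"
proof -
  have "Ck_on 1 U' (\<lambda>y. p 3 (\<Phi> y))"
    using D(6) by (intro Ck_on_1_chain[OF D(2,4) p_Ck]) blast
  moreover have "p 3 (\<Phi> y) = f y" if "y \<in> U'" for y
    using that D(6) f_eq p_values(3)[of "\<Phi> y"] by auto
  ultimately show ?thesis using Ck_on_cong[OF D(2), of "\<lambda>y. p 3 (\<Phi> y)" f 1] by blast
qed

text \<open>Differentiating the third coordinate as \<open>f\<close> composed with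
  \<open>\<Psi>\<close> gives two linear equations for the gradient of \<open>f\<close>; Cramer's
  rule solves them by quotients of the normal components.\<close>

lemma f_pderiv:
  assumes y: "y \<in> U'"
  shows "pderiv_at 1 f y = s1 (\<Phi> y)" "pderiv_at 2 f y = s2 (\<Phi> y)"
proof -
  let ?x = "\<Phi> y"
  have x: "?x \<in> U" "\<Psi> ?x = y" using y D(6,8) by auto
  have "pderiv_at i (p 3) ?x = pderiv_at i (p 1) ?x * pderiv_at 1 f y + pderiv_at i (p 2) ?x * pderiv_at 2 f y" for i
  proof -
    have "pderiv_at i (p 3) ?x = pderiv_at i (\<lambda>x. f (\<Psi> x)) ?x"
    proof (rule pderiv_at_cong[OF D(1) x(1)])
      fix x assume "x \<in> U"
      then show "p 3 x = f (\<Psi> x)" using D(5,7) f_eq[of "\<Psi> x"] p_values(3) by auto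
    qed
    also have "\<dots> = pderiv_at i (\<lambda>x. \<Psi> x $ 1) ?x * pderiv_at 1 f (\<Psi> ?x) + pderiv_at i (\<lambda>x. \<Psi> x $ 2) ?x * pderiv_at 2 f (\<Psi> ?x)"
      using Ck_on_1_D(2)[OF f_Ck y] x(2) by (intro pderiv_at_chain(2) Ck_on_1_D(2)[OF D(3) x(1)]) simp
    also have "pderiv_at i (\<lambda>x. \<Psi> x $ 1) ?x = pderiv_at i (p 1) ?x"
      by (rule pderiv_at_cong[OF D(1) x(1)]) (simp add: p_values)
    also have "pderiv_at i (\<lambda>x. \<Psi> x $ 2) ?x = pderiv_at i (p 2) ?x"
      by (rule pderiv_at_cong[OF D(1) x(1)]) (simp add: p_values)
    finally show ?thesis by (simp add: x(2))
  qed
  note e = this[of 1] this[of 2]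
  have "pderiv_at 1 f y * N3 ?x = - nrm (p 2) (p 3) ?x" "pderiv_at 2 f y * N3 ?x = - nrm (p 3) (p 1) ?x"
    unfolding nrm_def e by (simp_all add: algebra_simps)
  then show "pderiv_at 1 f y = s1 ?x" "pderiv_at 2 f y = s2 ?x"
    unfolding slope_def using N3_nonzero[OF x(1)] by (simp_all add: field_simps)
qed

lemma w_components:
  assumes y: "y \<in> U'"
  shows "w y $ 1 = F1 (s1 (\<Phi> y)) (s2 (\<Phi> y))" "w y $ 2 = s2 (\<Phi> y)"
proof -
  have g: "grad f y $ 1 = s1 (\<Phi> y)" "grad f y $ 2 = s2 (\<Phi> y)" using f_pderiv[OF y] by (simp_all add: grad_def)
  show "w y $ 1 = F1 (s1 (\<Phi> y)) (s2 (\<Phi> y))" "w y $ 2 = s2 (\<Phi> y)"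
    unfolding w_eq[OF y] F_map_def norm_vec2_sq g
    by (simp_all add: F1_def g power2_eq_square field_simps)
qed

lemma slob_p: "compactly_inside V U \<Longrightarrow> slobodeckij_sq (1/2) V (pderiv_at i (p m)) < \<infinity>"
proof -
  assume V: "compactly_inside V U"
  obtain d where d: "weak_pderiv U i u d" "H12_loc U d" using regularity(2) by (auto simp: H32_loc_def)
  have "slobodeckij_sq (1/2) V (\<lambda>x. pderiv_at i u x $ m) < \<infinity>"
    by (rule weak_pderiv_slobodeckij[OF D(1) regularity(1) d V])
  moreover have "slobodeckij_sq (1/2) V (\<lambda>x. pderiv_at i u x $ m) = slobodeckij_sq (1/2) V (pderiv_at i (p m))"
    unfolding slobodeckij_eq using V closure_subset[of V]
    by (intro nn_integral_cong) (auto simp: compactly_inside_def indicator_def p_pderiv subset_iff)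
  ultimately show ?thesis by simp
qed

lemma tends_p_const:
  assumes V: "compactly_inside V U"
  shows "tends_tame V (\<lambda>_. pderiv_at i (p m)) (pderiv_at i (p m))"
proof -
  have Vo: "open V" "compact (closure V)" "closure V \<subseteq> U" "V \<subseteq> closure V" using V closure_subset by (auto simp: compactly_inside_def)
  have Vb: "V \<in> sets borel" using Vo by simp
  have m: "set_borel_measurable borel V (pderiv_at i (p m))"
    using Vo by (intro set_borel_measurable_continuous Vb continuous_on_subset[OF p_cont]) auto
  have "bounded (pderiv_at i (p m) ` closure V)"
    by (intro compact_imp_bounded compact_continuous_image continuous_on_subset[OF p_cont] Vo)
  then have "bounded (pderiv_at i (p m) ` V)" using Vo(4) by (meson bounded_subset image_mono)
  then show ?thesis unfolding tends_tame_def using m tame_const[OF Vb m slob_p[OF V]] by (auto intro: uniform_limit_const)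
qed

lemma N3_lower:
  assumes V: "compactly_inside V U"
  obtains c where "c > 0" "\<And>x. x \<in> V \<Longrightarrow> c \<le> \<bar>N3 x\<bar>"
proof -
  have Vo: "compact (closure V)" "closure V \<subseteq> U" "V \<subseteq> closure V" using V closure_subset by (auto simp: compactly_inside_def)
  have "continuous_on (closure V) (\<lambda>x. inverse (N3 x))"
    using N3_nonzero Vo(2) by (intro continuous_on_inverse continuous_on_subset[OF N3_cont]) auto
  then obtain B where B: "B > 0" "\<And>x. x \<in> closure V \<Longrightarrow> norm (inverse (N3 x)) \<le> B"
    using compact_continuous_bound[OF Vo(1)] by blast
  show thesis
  proof (rule that[of "inverse B"])
    fix x assume "x \<in> V"
    then have "inverse \<bar>N3 x\<bar> \<le> B" "N3 x \<noteq> 0" using B(2)[of x] Vo N3_nonzero by (auto simp: abs_inverse)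
    then show "inverse B \<le> \<bar>N3 x\<bar>" using B(1) by (simp add: field_simps)
  qed (use B in simp)
qed

text \<open>The calculus of tame sequences is applied to constant sequences, and finite energy of
  the slopes and of \<open>w\<close> is read off by \<open>slobodeckij_finite\<close>.\<close>

lemma tends_U':
  assumes V: "compactly_inside V U'"
  shows "tends_tame V (\<lambda>_ y. s1 (\<Phi> y)) (\<lambda>y. s1 (\<Phi> y))" "tends_tame V (\<lambda>_ y. s2 (\<Phi> y)) (\<lambda>y. s2 (\<Phi> y))"
    "tends_tame V (\<lambda>_ y. F1 (s1 (\<Phi> y)) (s2 (\<Phi> y))) (\<lambda>y. F1 (s1 (\<Phi> y)) (s2 (\<Phi> y)))"
proof -
  note V1 = diffeo_compactly_inside(1)[OF diffeo V]
  have Vb: "\<Phi> ` V \<in> sets borel" "V \<in> sets borel" using V1 V by (auto simp: compactly_inside_def)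
  obtain c where c: "c > 0" "\<And>x. x \<in> \<Phi> ` V \<Longrightarrow> c \<le> \<bar>N3 x\<bar>" using N3_lower[OF V1] by blast
  have s: "tends_tame (\<Phi> ` V) (\<lambda>_. slope (nrm (p m) (p n)) N3) (slope (nrm (p m) (p n)) N3)" for m n
    by (rule tends_tame_graph_map(3)[OF Vb(1) tends_p_const[OF V1] c])
  show 1: "tends_tame V (\<lambda>_ y. s1 (\<Phi> y)) (\<lambda>y. s1 (\<Phi> y))" "tends_tame V (\<lambda>_ y. s2 (\<Phi> y)) (\<lambda>y. s2 (\<Phi> y))"
    by (rule tends_tame_comp[OF diffeo V s])+
  show "tends_tame V (\<lambda>_ y. F1 (s1 (\<Phi> y)) (s2 (\<Phi> y))) (\<lambda>y. F1 (s1 (\<Phi> y)) (s2 (\<Phi> y)))"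
    by (rule tends_tame_F1[OF Vb(2) 1])
qed

lemma slobodeckij_cong: "(\<And>x. x \<in> V \<Longrightarrow> h x = h' x) \<Longrightarrow> slobodeckij_sq s V h = slobodeckij_sq s V h'"
  unfolding slobodeckij_sq_def by (intro nn_integral_cong) (auto simp: indicator_def intro!: nn_integral_cong)

lemma slob_f:
  assumes V: "compactly_inside V U'"
  shows "slobodeckij_sq (1/2) V (pderiv_at i f) < \<infinity>" "slobodeckij_sq (1/2) V (\<lambda>y. w y $ i) < \<infinity>"
proof -
  have VU: "V \<subseteq> U'" "V \<in> sets borel" using V closure_subset[of V] by (auto simp: compactly_inside_def)
  note fin = slobodeckij_finite[OF VU(2) compactly_inside_finite[OF V]]
  have 1: "slobodeckij_sq (1/2) V (pderiv_at 1 f) = slobodeckij_sq (1/2) V (\<lambda>y. s1 (\<Phi> y))"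
    "slobodeckij_sq (1/2) V (pderiv_at 2 f) = slobodeckij_sq (1/2) V (\<lambda>y. s2 (\<Phi> y))"
    "slobodeckij_sq (1/2) V (\<lambda>y. w y $ 1) = slobodeckij_sq (1/2) V (\<lambda>y. F1 (s1 (\<Phi> y)) (s2 (\<Phi> y)))"
    "slobodeckij_sq (1/2) V (\<lambda>y. w y $ 2) = slobodeckij_sq (1/2) V (\<lambda>y. s2 (\<Phi> y))"
    using VU(1) f_pderiv w_components by (auto intro!: slobodeckij_cong)
  show "slobodeckij_sq (1/2) V (pderiv_at i f) < \<infinity>" "slobodeckij_sq (1/2) V (\<lambda>y. w y $ i) < \<infinity>"
    using exhaust_2[of i] 1 fin[OF tends_U'(1)[OF V]] fin[OF tends_U'(2)[OF V]] fin[OF tends_U'(3)[OF V]] by auto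
qed

lemma f_H32: "H32_loc U' f"
proof -
  have fc: "continuous_on U' f" "continuous_on U' (pderiv_at i f)" for i
    using Ck_on_1_D(1,3)[OF f_Ck] by auto
  have w: "weak_pderiv U' i f (pderiv_at i f)" for i
    unfolding weak_pderiv_def
  proof (intro conjI ballI)
    show "L2_loc U' f" "L2_loc U' (pderiv_at i f)" unfolding L2_loc_def using L2_on_continuous fc by blast+
    fix \<psi> assume "\<psi> \<in> test_functions U'"
    moreover define C where "C = closure {x. \<psi> x \<noteq> 0}"
    ultimately have \<psi>: "Ck_on 1 UNIV \<psi>" "compact C" "C \<subseteq> U'"
      by (auto simp: test_functions_def smooth_on_def simp del: Ck_on.simps)
    have z: "\<psi> x = 0" if "x \<notin> C" for x using that closure_subset[of "{x. \<psi> x \<noteq> 0}"] unfolding C_def by blast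
    have C: "closed C" unfolding C_def by simp
    have z': "pderiv_at i \<psi> x = 0" if "x \<notin> C" for x by (rule pderiv_at_zero_outside[OF C z that])
    have e: "indicator U' x *\<^sub>R (pderiv_at i \<psi> x *\<^sub>R f x) = pderiv_at i \<psi> x * f x"
      "indicator U' x *\<^sub>R (\<psi> x *\<^sub>R pderiv_at i f x) = \<psi> x * pderiv_at i f x" for x
      using z[of x] z'[of x] \<psi>(3) by (cases "x \<in> C"; force simp: indicator_def)+
    show "(LINT x:U'|lborel. pderiv_at i \<psi> x *\<^sub>R f x) = - (LINT x:U'|lborel. \<psi> x *\<^sub>R pderiv_at i f x)"
      unfolding set_lebesgue_integral_def e by (rule integration_by_parts(3)[OF \<psi>(1,2) z D(2) \<psi>(3) f_Ck])
  qed
  have "H12_loc U' (pderiv_at i f)" for i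
    unfolding H12_loc_def Hs_on_def using L2_on_continuous fc slob_f(1) by blast
  then show ?thesis unfolding H32_loc_def H1_loc_def using w by blast
qed

lemma s_cont: "continuous_on U (slope (nrm (p m) (p n)) N3)"
  unfolding slope_def[abs_def] nrm_def[abs_def] using N3_nonzero
  by (intro continuous_intros p_cont) (auto simp: nrm_def)

lemma w_cont: "continuous_on U' (\<lambda>y. w y $ i)" "continuous_on U' w"
proof -
  have s: "continuous_on U' (\<lambda>y. slope (nrm (p m) (p n)) N3 (\<Phi> y))" for m n
    using D(6) by (intro continuous_on_compose2[OF s_cont D(10)]) auto
  have pos: "1 + (a * a + b * b) \<noteq> 0" "1 + b * b \<noteq> 0" for a b :: real
    by (metis add_pos_nonneg less_irrefl zero_less_one zero_le_square add_nonneg_nonneg)+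
  have "continuous_on U' (\<lambda>y. F1 (s1 (\<Phi> y)) (s2 (\<Phi> y)))"
    unfolding F1_def by (intro continuous_intros s) (auto simp: pos)
  then show c: "continuous_on U' (\<lambda>y. w y $ i)" for i
    using s exhaust_2[of i] w_components by (auto cong: continuous_on_cong)
  have "continuous_on U' (\<lambda>y. \<chi> i. w y $ i)" by (intro continuous_on_vec_lambda c)
  then show "continuous_on U' w" by simp
qed

lemma w_H12: "H12_loc U' w"
  unfolding H12_loc_def Hs_on_def
proof (intro allI impI conjI)
  fix V assume V: "compactly_inside V U'"
  show "L2_on V w" by (rule L2_on_continuous[OF V w_cont(2)])
  have VU: "V \<subseteq> U'" "V \<in> sets borel" using V closure_subset[of V] by (auto simp: compactly_inside_def)
  have "set_borel_measurable borel V (\<lambda>y. w y $ i)" for i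
    by (rule set_borel_measurable_continuous[OF VU(2) continuous_on_subset[OF w_cont(1) VU(1)]])
  from slobodeckij_vec2_le[OF VU(2) this] show "slobodeckij_sq (1/2) V w < \<infinity>"
    using slob_f(2)[OF V] by (auto intro: le_less_trans)
qed

lemma g_ffundamental: "x \<in> U \<Longrightarrow> ffundamental i j (p 1) (p 2) (p 3) x = g x $ i $ j"
  using isometric[of x i j] by (simp add: ffundamental_def p_pderiv inner_vec_def sum_3)

end

text \<open>Lagrange's identity: the Gram determinant of two vectors in space is the squared length
  of their cross product.\<close>

lemma metric_det_ffundamental:
  "metric_det (ffundamental 1 1 p q r) (ffundamental 1 2 p q r) (ffundamental 2 2 p q r) x
    = nrm q r x * nrm q r x + nrm r p x * nrm r p x + nrm p q x * nrm p q x"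
  unfolding metric_det_def ffundamental_def nrm_def by algebra

lemma ffundamental_positive:
  assumes "nrm p q x \<noteq> 0"
  shows "ffundamental 1 1 p q r x > 0"
    "metric_det (ffundamental 1 1 p q r) (ffundamental 1 2 p q r) (ffundamental 2 2 p q r) x > 0"
proof -
  have "pderiv_at 1 p x \<noteq> 0 \<or> pderiv_at 1 q x \<noteq> 0" using assms by (auto simp: nrm_def)
  then show "ffundamental 1 1 p q r x > 0"
    unfolding ffundamental_def by (metis add_nonneg_pos add_pos_nonneg not_real_square_gt_zero zero_le_square)
  show "metric_det (ffundamental 1 1 p q r) (ffundamental 1 2 p q r) (ffundamental 2 2 p q r) x > 0"
    unfolding metric_det_ffundamental using assms
    by (metis add_nonneg_pos add_nonneg_nonneg not_real_square_gt_zero zero_le_square)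
qed

text \<open>Integration by parts moves the curl to the test function, so the integral sees first
  derivatives of the metric only. The indicator of \<open>C\<close> brings the terms into the form
  of \<open>conn_limit\<close>.\<close>

lemma curl_integral:
  assumes \<psi>: "cutoff_on C \<psi>" and S: "open S" "C \<subseteq> S" and ck: "Ck_on 2 S E" "Ck_on 2 S F" "Ck_on 2 S G"
    and pos: "\<And>x. x \<in> S \<Longrightarrow> E x > 0" "\<And>x. x \<in> S \<Longrightarrow> metric_det E F G x > 0"
  defines "\<kappa> \<equiv> \<lambda>x. \<psi> x * (metric_brioschi E F G x / (metric_det E F G x * sqrt (metric_det E F G x)))"
  shows "integrable lborel \<kappa>"
    "(LINT x|lborel. \<kappa> x) = (LINT x|lborel. indicator C x * (pderiv_at 2 \<psi> x * conn1 E F G x))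
       - (LINT x|lborel. indicator C x * (pderiv_at 1 \<psi> x * conn2 E F G x))"
proof -
  have p: "Ck_on 1 UNIV \<psi>" "compact C" "\<And>x. x \<notin> C \<Longrightarrow> \<psi> x = 0" using \<psi> by (auto simp: cutoff_on_def)
  note c = Ck_on_conn[OF S(1) ck pos]
  note i1 = integration_by_parts[OF p S c(1)] and i2 = integration_by_parts[OF p S c(2)]
  have e: "\<kappa> x = \<psi> x * pderiv_at 1 (conn2 E F G) x - \<psi> x * pderiv_at 2 (conn1 E F G) x" for x
  proof (cases "x \<in> C")
    case True
    then have x: "x \<in> S" using S by blast
    show ?thesis unfolding \<kappa>_def curl_conn[OF S(1) x ck pos[OF x], symmetric] by (simp add: right_diff_distrib)
  qed (simp add: \<kappa>_def p(3))
  show "integrable lborel \<kappa>" unfolding e[abs_def] by (intro Bochner_Integration.integrable_diff i1(2) i2(2))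
  have z: "indicator C x * (pderiv_at i \<psi> x * h x) = pderiv_at i \<psi> x * h x" for i x and h :: "real^2 \<Rightarrow> real"
    by (cases "x \<in> C") (auto simp: pderiv_at_zero_outside[OF compact_imp_closed[OF p(2)] p(3)])
  have "(LINT x|lborel. \<kappa> x) = (LINT x|lborel. \<psi> x * pderiv_at 1 (conn2 E F G) x) - (LINT x|lborel. \<psi> x * pderiv_at 2 (conn1 E F G) x)"
    unfolding e by (rule Bochner_Integration.integral_diff[OF i2(2) i1(2)])
  then show "(LINT x|lborel. \<kappa> x) = (LINT x|lborel. indicator C x * (pderiv_at 2 \<psi> x * conn1 E F G x))
       - (LINT x|lborel. indicator C x * (pderiv_at 1 \<psi> x * conn2 E F G x))"
    using i1(3)[of 2] i2(3)[of 1] by (simp add: z)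
qed

lemma (in graph_isometry) g_Ck: "Ck_on n U (\<lambda>x. g x $ i $ j)"
  using metric by (simp add: smooth_riemannian_metric_def smooth_on_def del: Ck_on.simps)

section \<open>Mollified embeddings\<close>

text \<open>The mollified surfaces are studied over \<open>A\<close>; \<open>V\<close> supplies the
  values to be mollified, with room \<open>r\<close> around every point of \<open>A\<close>.\<close>

locale mollified_graph = graph_isometry +
  fixes A V :: "(real^2) set" and r :: real and s :: "nat \<Rightarrow> real"
  assumes A: "compactly_inside A U" and V: "compactly_inside V U"
    and r: "r > 0" "\<And>x. x \<in> A \<Longrightarrow> ball x r \<subseteq> V"
    and s: "s \<longlonglongrightarrow> 0" "\<And>k. s k > 0"
begin

definition P :: "nat \<Rightarrow> 3 \<Rightarrow> real^2 \<Rightarrow> real" where "P k m = moll (s k) (restr (closure V) (p m))"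

abbreviation N where "N k \<equiv> nrm (P k 1) (P k 2)"
abbreviation S1 where "S1 k \<equiv> slope (nrm (P k 2) (P k 3)) (N k)"
abbreviation S2 where "S2 k \<equiv> slope (nrm (P k 3) (P k 1)) (N k)"
abbreviation gk where "gk k i j \<equiv> ffundamental i j (P k 1) (P k 2) (P k 3)"

lemma Vo: "open V" "compact (closure V)" "closure V \<subseteq> U" "V \<subseteq> closure V"
  using V closure_subset by (auto simp: compactly_inside_def)

lemma Ao: "open A" "A \<in> sets borel" "A \<subseteq> U" using A closure_subset[of A] by (auto simp: compactly_inside_def)

lemma P_Ck: "Ck_on n B (P k m)"
proof -
  have "continuous_on (closure V) (p m)" using Ck_on_1_D(1)[OF p_Ck] Vo(3) continuous_on_subset by blast
  from L12_restr[OF Vo(2) this] have "Ck_on n UNIV (P k m)"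
    unfolding P_def by (intro Ck_on_moll s) (auto simp: L12_def)
  then show ?thesis by (rule Ck_on_subset) simp
qed

lemma tends_P:
  assumes B: "B \<in> sets borel" "B \<subseteq> A"
  shows "tends_tame B (\<lambda>k. pderiv_at i (P k m)) (pderiv_at i (p m))"
proof -
  have r': "ball x r \<subseteq> V" if "x \<in> B" for x using r(2) B(2) that by blast
  have t: "tends_tame B (\<lambda>k. moll (s k) (restr (closure V) (pderiv_at i (p m)))) (pderiv_at i (p m))"
    by (rule tends_tame_moll[OF B(1) Vo(1,2) continuous_on_subset[OF p_cont Vo(3)] r(1) r' s slob_p[OF V]])
  have "\<forall>\<^sub>F k in sequentially. s k < r" using order_tendstoD(2)[OF s(1) r(1)] .
  then have "\<forall>\<^sub>F k in sequentially. \<forall>x\<in>B. moll (s k) (restr (closure V) (pderiv_at i (p m))) x = pderiv_at i (P k m) x"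
  proof eventually_elim
    case (elim k)
    show ?case
    proof
      fix x assume "x \<in> B"
      then have "cball x (s k) \<subseteq> closure V" using r'[of x] elim Vo(4) by force
      from pderiv_moll_restr[OF D(1) Vo(3,2) p_Ck s(2) this]
      show "moll (s k) (restr (closure V) (pderiv_at i (p m))) x = pderiv_at i (P k m) x" by (simp add: P_def)
    qed
  qed
  from tends_tame_cong[OF this refl t] show ?thesis .
qed

text \<open>Convergence of the normals is uniform and |N3| is bounded below on \<open>A\<close>, so
  the mollified surfaces eventually project locally diffeomorphically and with the same
  orientation.\<close>

lemma N_eventually: "\<forall>\<^sub>F k in sequentially. \<forall>x\<in>A. N k x \<noteq> 0 \<and> sgn (N k x) = sgn (N3 x)"
proof -
  obtain c where c: "c > 0" "\<And>x. x \<in> A \<Longrightarrow> c \<le> \<bar>N3 x\<bar>" using N3_lower[OF A] by blast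
  have "uniform_limit A N N3 sequentially"
    using tends_tame_graph_map(1)[where P=P and p=p and m=1 and n=2, OF Ao(2) tends_P[OF Ao(2) subset_refl]] by (simp add: tends_tame_def)
  from uniform_limitD[OF this c(1)] show ?thesis
  proof eventually_elim
    case (elim k)
    show ?case
    proof
      fix x assume x: "x \<in> A"
      have "\<bar>N k x - N3 x\<bar> < c" using elim x by (simp add: dist_real_def)
      with c(2)[OF x] show "N k x \<noteq> 0 \<and> sgn (N k x) = sgn (N3 x)" by (auto simp: sgn_if abs_if split: if_splits)
    qed
  qed
qed

lemma Ck_on_slopes:
  assumes "\<forall>x\<in>A. N k x \<noteq> 0"
  shows "Ck_on 1 A (\<lambda>x. F1 (S1 k x) (S2 k x))" "Ck_on 1 A (S2 k)"
proof -
  have s: "Ck_on 1 A (slope (nrm (P k m) (P k n)) (N k))" for m n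
    using assms by (intro Ck_on_1_slope Ck_on_1_nrm Ao(1) P_Ck) auto
  then show "Ck_on 1 A (\<lambda>x. F1 (S1 k x) (S2 k x))" "Ck_on 1 A (S2 k)"
    by (intro Ck_on_1_F1 Ao(1) s)+
qed

text \<open>No pointwise convergence of the curvatures is claimed. Both sides become integrals of
  connection forms by \<open>curl_integral\<close>, eventually on the left, where positivity of the
  metrics of the mollified surfaces comes from their nonzero normals.\<close>

lemma curvature_limit:
  assumes \<psi>: "cutoff_on C \<psi>" and CA: "C \<subseteq> A"
  shows "(\<lambda>k. LINT x|lborel. \<psi> x * (metric_brioschi (gk k 1 1) (gk k 1 2) (gk k 2 2) x /
      (metric_det (gk k 1 1) (gk k 1 2) (gk k 2 2) x * sqrt (metric_det (gk k 1 1) (gk k 1 2) (gk k 2 2) x))))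
    \<longlonglongrightarrow> (LINT x|lborel. \<psi> x * (gauss_curvature g x * sqrt (metric_det (\<lambda>x. g x $ 1 $ 1) (\<lambda>x. g x $ 1 $ 2) (\<lambda>x. g x $ 2 $ 2) x)))"
    (is "?L \<longlonglongrightarrow> ?R")
    "integrable lborel (\<lambda>x. \<psi> x * (gauss_curvature g x * sqrt (metric_det (\<lambda>x. g x $ 1 $ 1) (\<lambda>x. g x $ 1 $ 2) (\<lambda>x. g x $ 2 $ 2) x)))"
proof -
  let ?E = "\<lambda>x. g x $ 1 $ 1" and ?F = "\<lambda>x. g x $ 1 $ 2" and ?G = "\<lambda>x. g x $ 2 $ 2"
  have C: "compact C" "\<And>x. x \<notin> C \<Longrightarrow> \<psi> x = 0" "Ck_on 1 UNIV \<psi>" using \<psi> by (auto simp: cutoff_on_def)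
  have CU: "C \<subseteq> U" using CA Ao(3) by blast
  have pos: "?E x > 0" "metric_det ?E ?F ?G x > 0" if "x \<in> U" for x
    using metric_positive[OF metric that] by (simp_all add: metric_det_def)
  have eqR: "\<psi> x * (gauss_curvature g x * sqrt (metric_det ?E ?F ?G x))
      = \<psi> x * (metric_brioschi ?E ?F ?G x / (metric_det ?E ?F ?G x * sqrt (metric_det ?E ?F ?G x)))" for x
  proof (cases "x \<in> C")
    case True
    then have "x \<in> U" using CU by blast
    from gauss_curvature_brioschi[OF D(1) this metric] show ?thesis by simp
  qed (simp add: C(2))
  note curl = curl_integral[OF \<psi> D(1) CU g_Ck g_Ck g_Ck pos]
  show "integrable lborel (\<lambda>x. \<psi> x * (gauss_curvature g x * sqrt (metric_det ?E ?F ?G x)))"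
    unfolding eqR by (rule curl(1))
  have gkCk: "Ck_on n B (gk k i j)" for n B k i j
  proof -
    have "Ck_on n UNIV (gk k i j)" by (intro Ck_on_ffundamental P_Ck) simp
    then show ?thesis by (rule Ck_on_subset) simp
  qed
  have ul: "uniform_limit C (\<lambda>k. gk k i j) (\<lambda>x. g x $ i $ j) sequentially" for i j
  proof -
    have "uniform_limit A (\<lambda>k. gk k i j) (ffundamental i j (p 1) (p 2) (p 3)) sequentially"
      using tends_tame_graph_map(2)[where P=P and p=p and i=i and j=j, OF Ao(2) tends_P[OF Ao(2) subset_refl]] by (simp add: tends_tame_def)
    then have "uniform_limit C (\<lambda>k. gk k i j) (ffundamental i j (p 1) (p 2) (p 3)) sequentially"
      by (rule uniform_limit_on_subset[OF _ CA])
    then show ?thesis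
      unfolding uniform_limit_sequentially_iff using g_ffundamental[of _ i j] CU by (metis subsetD)
  qed
  have posN: "\<forall>\<^sub>F k in sequentially. \<forall>x\<in>A. gk k 1 1 x > 0 \<and> metric_det (gk k 1 1) (gk k 1 2) (gk k 2 2) x > 0"
    using N_eventually by eventually_elim (auto intro!: ffundamental_positive)
  have posk: "\<forall>\<^sub>F k in sequentially. \<forall>x\<in>C. gk k 1 1 x > 0 \<and> metric_det (gk k 1 1) (gk k 1 2) (gk k 2 2) x > 0"
    using posN by eventually_elim (use CA in blast)
  have fC: "Ck_on 1 U (ffundamental i j (p 1) (p 2) (p 3))" for i j
    using Ck_on_cong[OF D(1), of "ffundamental i j (p 1) (p 2) (p 3)" "\<lambda>x. g x $ i $ j" 1] g_ffundamental g_Ck by blast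
  have L1: "(\<lambda>k. \<integral>\<^sup>+x\<in>C. ennreal \<bar>pderiv_at l (gk k i j) x - pderiv_at l (\<lambda>x. g x $ i $ j) x\<bar> \<partial>lborel) \<longlonglongrightarrow> 0" for l i j
  proof -
    have e: "pderiv_at l (ffundamental i j (p 1) (p 2) (p 3)) x = pderiv_at l (\<lambda>x. g x $ i $ j) x" if "x \<in> U" for x
      by (rule pderiv_at_cong[OF D(1) that g_ffundamental])
    have e': "(\<integral>\<^sup>+x\<in>C. ennreal \<bar>pderiv_at l (gk k i j) x - pderiv_at l (ffundamental i j (p 1) (p 2) (p 3)) x\<bar> \<partial>lborel)
      = (\<integral>\<^sup>+x\<in>C. ennreal \<bar>pderiv_at l (gk k i j) x - pderiv_at l (\<lambda>x. g x $ i $ j) x\<bar> \<partial>lborel)" for k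
      by (rule nn_integral_cong) (use e CU in \<open>auto simp: indicator_def\<close>)
    have "(\<lambda>k. \<integral>\<^sup>+x\<in>C. ennreal \<bar>pderiv_at l (gk k i j) x - pderiv_at l (ffundamental i j (p 1) (p 2) (p 3)) x\<bar> \<partial>lborel) \<longlonglongrightarrow> 0"
      unfolding P_def by (rule induced_metric_L1[OF D(1) p_Ck fC V C(1) Ao(1) CA r slob_p[OF V] s])
    then show ?thesis unfolding e' .
  qed
  have zc: "continuous_on C (pderiv_at i \<psi>)" for i
    using Ck_on_1_D(3)[OF C(3)] continuous_on_subset by blast
  have R: "?R = (LINT x|lborel. indicator C x * (pderiv_at 2 \<psi> x * conn1 ?E ?F ?G x)) - (LINT x|lborel. indicator C x * (pderiv_at 1 \<psi> x * conn2 ?E ?F ?G x))"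
    unfolding eqR by (rule curl(2))
  have lim: "(\<lambda>k. (LINT x|lborel. indicator C x * (pderiv_at 2 \<psi> x * conn1 (gk k 1 1) (gk k 1 2) (gk k 2 2) x))
       - (LINT x|lborel. indicator C x * (pderiv_at 1 \<psi> x * conn2 (gk k 1 1) (gk k 1 2) (gk k 2 2) x))) \<longlonglongrightarrow> ?R"
    unfolding R
    by (intro tendsto_diff conn_limit[OF C(1) D(1) CU gkCk gkCk gkCk g_Ck g_Ck g_Ck ul ul ul pos posk L1 L1 L1 zc])
  have "\<forall>\<^sub>F k in sequentially. (LINT x|lborel. indicator C x * (pderiv_at 2 \<psi> x * conn1 (gk k 1 1) (gk k 1 2) (gk k 2 2) x))
       - (LINT x|lborel. indicator C x * (pderiv_at 1 \<psi> x * conn2 (gk k 1 1) (gk k 1 2) (gk k 2 2) x)) = ?L k"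
    using posN
  proof eventually_elim
    case (elim k)
    have pk: "gk k 1 1 x > 0" "metric_det (gk k 1 1) (gk k 1 2) (gk k 2 2) x > 0" if "x \<in> A" for x using elim that by auto
    show ?case by (rule curl_integral(2)[OF \<psi> Ao(1) CA gkCk gkCk gkCk pk, symmetric])
  qed
  from Lim_transform_eventually[OF lim this] show "?L \<longlonglongrightarrow> ?R" .
qed

end

section \<open>The distributional Jacobian of the graph\<close>

lemma L2_tame_of_tends_tame:
  assumes V: "V \<in> sets borel" "emeasure lborel V < \<infinity>" and t: "tends_tame V A a" "tends_tame V (\<lambda>_. a) a"
  shows "L2_tame V A a"
proof -
  have "tends_tame V (\<lambda>k x. A k x - a x) (\<lambda>_. 0)" using tends_tame_diff[OF V(1) t] by simp
  from tends_tame_null(1)[OF V this] show ?thesis using t(1) by (simp add: L2_tame_def tends_tame_def)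
qed

text \<open>\<open>W k\<close> is split into W k - w, whose whole seminorm tends to 0, and the
  single function \<open>w\<close> of finite seminorm; both parts are tame, and tameness passes to
  the sum.\<close>

lemma L2_tame_of_tends_H12:
  fixes W :: "nat \<Rightarrow> real^2 \<Rightarrow> real^2"
  assumes V: "V \<in> sets borel" and W: "\<And>k i. set_borel_measurable borel V (\<lambda>x. W k x $ i)"
    and w: "set_borel_measurable borel V (\<lambda>x. w x $ i)" "slobodeckij_sq (1/2) V (\<lambda>x. w x $ i) < \<infinity>"
    and lim: "(\<lambda>k. L2_norm_sq V (\<lambda>x. W k x - w x)) \<longlonglongrightarrow> 0" "(\<lambda>k. slobodeckij_sq (1/2) V (\<lambda>x. W k x - w x)) \<longlonglongrightarrow> 0"
  shows "L2_tame V (\<lambda>k x. W k x $ i) (\<lambda>x. w x $ i)"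
  unfolding L2_tame_def
proof
  have "L2_norm_sq V (\<lambda>x. W k x $ i - w x $ i) \<le> L2_norm_sq V (\<lambda>x. W k x - w x)" for k
    using L2_norm_sq_component[of V "\<lambda>x. W k x - w x" i] by simp
  then show "(\<lambda>k. L2_norm_sq V (\<lambda>x. W k x $ i - w x $ i)) \<longlonglongrightarrow> 0"
    by (intro ennreal_tendsto_0_mono[OF always_eventually lim(1)]) simp
  have sl: "slobodeckij_sq (1/2) V (\<lambda>x. W k x $ i - w x $ i) \<le> slobodeckij_sq (1/2) V (\<lambda>x. W k x - w x)" for k
    using slobodeckij_component[of "1/2" V "\<lambda>x. W k x - w x" i] by simp
  have D: "tame V (\<lambda>k x. W k x $ i - w x $ i)"
    unfolding tame_def
  proof (intro allI impI exI conjI)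
    fix e :: real assume "e > 0"
    from ennreal_tendsto_0D[OF lim(2) this]
    \<comment> \<open>Every \<delta> serves here, because the truncated energy is at most the full
      seminorm; the witness is 1.\<close>
    show "\<forall>\<^sub>F k in sequentially. near_energy V 1 (\<lambda>x. W k x $ i - w x $ i) \<le> ennreal e"
      by eventually_elim (rule order_trans[OF near_energy_le_slobodeckij order_trans[OF sl]])
  qed simp
  show "tame V (\<lambda>k x. W k x $ i)"
  proof (rule tame_comparison[OF V D tame_const[OF V w], where c=2])
    show "\<forall>\<^sub>F k in sequentially. set_borel_measurable borel V (\<lambda>x. W k x $ i - w x $ i)"
      using W[of _ i] w(1) by (simp add: set_borel_measurable_def right_diff_distrib)
    show "\<forall>\<^sub>F k in sequentially. \<forall>x\<in>V. \<forall>y\<in>V. (W k x $ i - W k y $ i)\<^sup>2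
        \<le> 2 * ((W k x $ i - w x $ i - (W k y $ i - w y $ i))\<^sup>2 + (w x $ i - w y $ i)\<^sup>2)"
    proof (intro always_eventually allI ballI)
      fix k x y
      have "(a + b)\<^sup>2 \<le> 2 * (a\<^sup>2 + b\<^sup>2)" for a b :: real using zero_le_power2[of "a - b"] by (simp add: power2_eq_square algebra_simps)
      from this[of "W k x $ i - w x $ i - (W k y $ i - w y $ i)" "w x $ i - w y $ i"]
      show "(W k x $ i - W k y $ i)\<^sup>2 \<le> 2 * ((W k x $ i - w x $ i - (W k y $ i - w y $ i))\<^sup>2 + (w x $ i - w y $ i)\<^sup>2)"
        by simp
    qed
  qed (use w in simp)
qed

context graph_isometry
begin

abbreviation area where "area \<equiv> \<lambda>x. sqrt (metric_det (\<lambda>x. g x $ 1 $ 1) (\<lambda>x. g x $ 1 $ 2) (\<lambda>x. g x $ 2 $ 2) x)"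

text \<open>The Jacobian of \<open>\<Phi>\<close> is the reciprocal of the third normal component,
  so scaling the normal by it gives (-grad f, 1), while the area density is the length of the
  normal.\<close>

lemma area_graph:
  assumes y: "y \<in> U'"
  shows "\<bar>jacobian_det \<Phi> y\<bar> * area (\<Phi> y) = sqrt (1 + (norm (grad f y))\<^sup>2)"
proof -
  have x: "\<Phi> y \<in> U" using y D(6) by blast
  let ?J = "jacobian_det \<Phi> y" and ?n1 = "nrm (p 2) (p 3) (\<Phi> y)" and ?n2 = "nrm (p 3) (p 1) (\<Phi> y)" and ?n3 = "N3 (\<Phi> y)"
  have J: "inverse ?n3 = ?J" using jacobian_inverse[OF y] by (metis inverse_unique)
  have "metric_det (\<lambda>x. g x $ 1 $ 1) (\<lambda>x. g x $ 1 $ 2) (\<lambda>x. g x $ 2 $ 2) (\<Phi> y) = ?n1 * ?n1 + ?n2 * ?n2 + ?n3 * ?n3"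
    unfolding metric_det_ffundamental[symmetric] by (simp add: metric_det_def g_ffundamental[OF x])
  then have "\<bar>?J\<bar> * area (\<Phi> y) = sqrt (?J * ?J * (?n1 * ?n1 + ?n2 * ?n2 + ?n3 * ?n3))"
    by (simp add: real_sqrt_mult)
  also have "?J * ?J * (?n1 * ?n1 + ?n2 * ?n2 + ?n3 * ?n3) = (?n1 * ?J) * (?n1 * ?J) + (?n2 * ?J) * (?n2 * ?J) + (?n3 * ?J) * (?n3 * ?J)"
    by (simp add: algebra_simps)
  also have "\<dots> = 1 + (norm (grad f y))\<^sup>2"
    using f_pderiv[OF y] by (simp add: norm_vec2_sq grad_def slope_def J jacobian_inverse[OF y]) (simp add: power2_eq_square)
  finally show ?thesis .
qed

text \<open>The extension by zero is glued from \<open>U\<close> and the complement of the compact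
  image of \<open>C\<close>, two open sets that cover the plane.\<close>

lemma pulled_back_cutoff:
  assumes \<psi>: "cutoff_on C \<psi>" and C: "C \<subseteq> U'"
  shows "cutoff_on (\<Phi> ` C) (\<lambda>x. if x \<in> U then \<psi> (\<Psi> x) else 0)"
  unfolding cutoff_on_def
proof (intro conjI allI impI)
  let ?\<psi> = "\<lambda>x. if x \<in> U then \<psi> (\<Psi> x) else 0"
  have C': "compact C" "Ck_on 1 UNIV \<psi>" "\<And>x. x \<notin> C \<Longrightarrow> \<psi> x = 0" using \<psi> by (auto simp: cutoff_on_def)
  show cpt: "compact (\<Phi> ` C)" by (rule compact_continuous_image[OF continuous_on_subset[OF D(10) C] C'(1)])
  show z: "?\<psi> x = 0" if "x \<notin> \<Phi> ` C" for x
  proof -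
    have "\<Psi> x \<notin> C" if "x \<in> U" using \<open>x \<notin> \<Phi> ` C\<close> D(7)[OF that] by force
    then show ?thesis using C'(3) by simp
  qed
  have CU: "\<Phi> ` C \<subseteq> U" using C D(6) by blast
  have "Ck_on 1 U (\<lambda>x. \<psi> (\<Psi> x))" by (rule Ck_on_1_chain[OF D(1,3) C'(2)]) simp
  then have "Ck_on 1 U ?\<psi>" using Ck_on_cong[OF D(1), of ?\<psi> "\<lambda>x. \<psi> (\<Psi> x)" 1] by simp
  moreover have "Ck_on 1 (- \<Phi> ` C) ?\<psi>"
    using Ck_on_cong[of "- \<Phi> ` C" ?\<psi> "\<lambda>_. 0" 1] z Ck_on_const[of "- \<Phi> ` C" 1 0] compact_imp_closed[OF cpt] by blast
  ultimately have "Ck_on 1 (U \<union> - \<Phi> ` C) ?\<psi>"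
    using compact_imp_closed[OF cpt] by (intro Ck_on_Un D(1)) auto
  moreover have "U \<union> - \<Phi> ` C = UNIV" using CU by blast
  ultimately show "Ck_on 1 UNIV ?\<psi>" by simp
qed

text \<open>The chain rule produces the signed determinant of D\<Phi>, the change of variables its
  absolute value; the quotient is the constant sign \<open>\<sigma>\<close>.\<close>

lemma jacobian_form_pull_back:
  assumes \<psi>: "cutoff_on C \<psi>" and B: "open B" "B \<subseteq> U'" "C \<subseteq> B"
    and ab: "Ck_on 1 (\<Phi> ` B) a" "Ck_on 1 (\<Phi> ` B) b"
    and \<sigma>: "\<sigma> * \<sigma> = 1" "\<And>y. y \<in> U' \<Longrightarrow> sgn (jacobian_det \<Phi> y) = \<sigma>"
  shows "jacobian_form \<psi> (\<lambda>y. a (\<Phi> y)) (\<lambda>y. b (\<Phi> y)) = (LINT x|lborel. (if x \<in> U then \<psi> (\<Psi> x) else 0) * (\<sigma> * jac a b x))"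
proof -
  let ?\<psi> = "\<lambda>x. if x \<in> U then \<psi> (\<Psi> x) else 0"
  note o = diffeo_image_open[OF diffeo B(1,2)]
  have "C \<subseteq> U'" using B by blast
  note c = pulled_back_cutoff[OF \<psi> this]
  have "integrable lborel (\<lambda>x. ?\<psi> x * jac a b x)" using B by (intro integrable_jac[OF c o _ ab]) blast
  then have i: "integrable lborel (\<lambda>x. ?\<psi> x * (\<sigma> * jac a b x))"
    using integrable_mult_right[of \<sigma> lborel] by (simp add: mult.left_commute)
  have e: "\<psi> y * jac (\<lambda>y. a (\<Phi> y)) (\<lambda>y. b (\<Phi> y)) y
      = indicator U' y * (\<bar>jacobian_det \<Phi> y\<bar> * (?\<psi> (\<Phi> y) * (\<sigma> * jac a b (\<Phi> y))))" for y
  proof (cases "y \<in> C")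
    case True
    then have y: "y \<in> B" "y \<in> U'" "\<Phi> y \<in> \<Phi> ` B" "\<Phi> y \<in> U" using B D(6) by blast+
    have "jac (\<lambda>y. a (\<Phi> y)) (\<lambda>y. b (\<Phi> y)) y = jac a b (\<Phi> y) * jacobian_det \<Phi> y"
      by (rule jac_chain[OF Ck_on_1_D(2)[OF D(4) y(2)] Ck_on_1_D(2)[OF ab(1) y(3)] Ck_on_1_D(2)[OF ab(2) y(3)]])
    moreover have "\<bar>jacobian_det \<Phi> y\<bar> * \<sigma> = jacobian_det \<Phi> y"
      using sgn_mult_abs[of "jacobian_det \<Phi> y"] \<sigma>(2)[OF y(2)] by (simp add: mult.commute)
    ultimately show ?thesis using y D(8)[OF y(2)] by (simp add: mult_ac)
  next
    case False
    then have "\<psi> y = 0" using \<psi> by (auto simp: cutoff_on_def)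
    then show ?thesis using D(8)[of y] by (cases "y \<in> U'") auto
  qed
  show ?thesis unfolding jacobian_form_def e by (rule diffeo_change_of_variables[OF diffeo i]) simp
qed

lemma curvature_integral:
  assumes i: "integrable lborel (\<lambda>x. (if x \<in> U then \<psi> (\<Psi> x) else 0) * (gauss_curvature g x * area x))"
  shows "(LINT x|lborel. (if x \<in> U then \<psi> (\<Psi> x) else 0) * (gauss_curvature g x * area x))
    = (LINT y:U'|lborel. gauss_curvature g (\<Phi> y) * sqrt (1 + (norm (grad f y))\<^sup>2) * \<psi> y)"
  unfolding set_lebesgue_integral_def
proof (subst diffeo_change_of_variables[OF diffeo i, symmetric])
  show "(LINT y|lborel. indicator U' y * (\<bar>jacobian_det \<Phi> y\<bar> * ((if \<Phi> y \<in> U then \<psi> (\<Psi> (\<Phi> y)) else 0) * (gauss_curvature g (\<Phi> y) * area (\<Phi> y)))))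
    = (LINT y|lborel. indicator U' y *\<^sub>R (gauss_curvature g (\<Phi> y) * sqrt (1 + (norm (grad f y))\<^sup>2) * \<psi> y))"
  proof (rule Bochner_Integration.integral_cong[OF refl])
    fix y
    show "indicator U' y * (\<bar>jacobian_det \<Phi> y\<bar> * ((if \<Phi> y \<in> U then \<psi> (\<Psi> (\<Phi> y)) else 0) * (gauss_curvature g (\<Phi> y) * area (\<Phi> y))))
      = indicator U' y *\<^sub>R (gauss_curvature g (\<Phi> y) * sqrt (1 + (norm (grad f y))\<^sup>2) * \<psi> y)"
    proof (cases "y \<in> U'")
      case True
      then have "\<Phi> y \<in> U" using D(6) by blast
      then show ?thesis unfolding area_graph[OF True, symmetric] using D(8)[OF True] by (simp add: mult_ac)
    qed simp
  qed
qed simp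

text \<open>The slopes of the mollified surfaces, transported by \<open>\<Phi>\<close>, form one
  sequence whose Jacobians have a known limit, although it is only C^1. Any admissible smooth
  sequence shares its L^2 limit and its tameness, hence the limit of its Jacobians.\<close>

lemma jacobian_limit:
  assumes \<psi>: "\<psi> \<in> test_functions U'" and W: "\<And>k. smooth_on U' (W k)" "tends_H12_loc U' W w"
  shows "(\<lambda>k. LINT y:U'|lborel. \<psi> y * jacobian_det (W k) y)
    \<longlonglongrightarrow> (LINT y:U'|lborel. gauss_curvature g (\<Phi> y) * sqrt (1 + (norm (grad f y))\<^sup>2) * \<psi> y)"
proof -
  define C where "C = closure {x. \<psi> x \<noteq> 0}"
  have C: "compact C" "C \<subseteq> U'" "Ck_on 1 UNIV \<psi>" using \<psi> by (simp_all add: C_def test_functions_def smooth_on_def del: Ck_on.simps)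
  have z: "\<psi> x = 0" if "x \<notin> C" for x using that closure_subset[of "{x. \<psi> x \<noteq> 0}"] unfolding C_def by blast
  have cut: "cutoff_on C \<psi>" using C z by (auto simp: cutoff_on_def simp del: Ck_on.simps)
  obtain V t where V: "t > 0" "compactly_inside V U'" "C \<subseteq> V" "\<And>x. x \<in> C \<Longrightarrow> ball x t \<subseteq> V"
    using compact_neighbourhood[OF C(1) D(2) C(2)] by metis
  have Vo: "open V" "compact (closure V)" "closure V \<subseteq> U'" "V \<subseteq> closure V" using V(2) closure_subset by (auto simp: compactly_inside_def)
  \<comment> \<open>\<open>V\<close> carries the energies. The comparison asks for C^1 regularity
    around its closure, which \<open>B\<close> provides; the image of \<open>B\<close> under
    \<open>\<Phi>\<close> is the region of the mollified surfaces.\<close>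
  obtain B where B: "compactly_inside B U'" "closure V \<subseteq> B"
    using compact_neighbourhood[OF Vo(2) D(2) Vo(3)] by metis
  have Bo: "open B" "B \<subseteq> U'" "C \<subseteq> B" "V \<subseteq> B" using B closure_subset[of B] Vo(4) V(3) by (auto simp: compactly_inside_def)
  have Vb: "V \<in> sets borel" "emeasure lborel V < \<infinity>" using Vo(1) compactly_inside_finite[OF V(2)] by auto
  have A: "compactly_inside (\<Phi> ` B) U" by (rule diffeo_compactly_inside(1)[OF diffeo B(1)])
  obtain V1 r where V1: "r > 0" "compactly_inside V1 U" "\<And>x. x \<in> closure (\<Phi> ` B) \<Longrightarrow> ball x r \<subseteq> V1"
    using compact_neighbourhood[of "closure (\<Phi> ` B)" U] A D(1) unfolding compactly_inside_def by metis
  have r: "ball x r \<subseteq> V1" if "x \<in> \<Phi> ` B" for x using V1(3) that closure_subset by blast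
  define s where "s k = 1 / real (Suc k)" for k
  have s: "s \<longlonglongrightarrow> 0" "\<And>k. s k > 0" using inverse_Suc_tendsto unfolding s_def by auto
  interpret M: mollified_graph U U' g u \<Psi> \<Phi> v f w "\<Phi> ` B" V1 r s
    by unfold_locales (rule A V1 r s; assumption?)+
  obtain \<sigma> where \<sigma>: "\<sigma> * \<sigma> = 1" "\<And>x. x \<in> U \<Longrightarrow> sgn (N3 x) = \<sigma>" "\<And>y. y \<in> U' \<Longrightarrow> sgn (jacobian_det \<Phi> y) = \<sigma>"
    using N3_sign by blast
  let ?X = "\<lambda>k x. F1 (M.S1 k x) (M.S2 k x)"
  let ?\<psi> = "\<lambda>x. if x \<in> U then \<psi> (\<Psi> x) else 0"
  let ?R = "LINT y:U'|lborel. gauss_curvature g (\<Phi> y) * sqrt (1 + (norm (grad f y))\<^sup>2) * \<psi> y"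
  note cutU = pulled_back_cutoff[OF cut C(2)]
  have CB: "\<Phi> ` C \<subseteq> \<Phi> ` B" using Bo by blast
  note K = M.curvature_limit[OF cutU CB]
  have "\<forall>\<^sub>F k in sequentially. (LINT x|lborel. ?\<psi> x * (metric_brioschi (M.gk k 1 1) (M.gk k 1 2) (M.gk k 2 2) x /
      (metric_det (M.gk k 1 1) (M.gk k 1 2) (M.gk k 2 2) x * sqrt (metric_det (M.gk k 1 1) (M.gk k 1 2) (M.gk k 2 2) x))))
      = jacobian_form \<psi> (\<lambda>y. ?X k (\<Phi> y)) (\<lambda>y. M.S2 k (\<Phi> y))"
    using M.N_eventually
  proof eventually_elim
    case (elim k)
    then have n: "\<forall>x\<in>\<Phi> ` B. M.N k x \<noteq> 0" by blast
    have "?\<psi> x * (metric_brioschi (M.gk k 1 1) (M.gk k 1 2) (M.gk k 2 2) x /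
      (metric_det (M.gk k 1 1) (M.gk k 1 2) (M.gk k 2 2) x * sqrt (metric_det (M.gk k 1 1) (M.gk k 1 2) (M.gk k 2 2) x)))
      = ?\<psi> x * (\<sigma> * jac (?X k) (M.S2 k) x)" for x
    proof (cases "x \<in> \<Phi> ` C")
      case True
      then have x: "x \<in> \<Phi> ` B" "x \<in> U" using CB M.Ao(3) by blast+
      \<comment> \<open>The sign from \<open>jac_graph_map\<close> meets the sign from
        \<open>jacobian_form_pull_back\<close>, and their product is 1.\<close>
      have sg: "sgn (M.N k x) = \<sigma>" and nx: "M.N k x \<noteq> 0" using elim x \<sigma>(2) by auto
      show ?thesis
        unfolding jac_graph_map[OF M.Ao(1) x(1) M.P_Ck M.P_Ck M.P_Ck nx] sg
        by (simp add: mult.assoc[symmetric] \<sigma>(1))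
    next
      case False
      then have "?\<psi> x = 0" using cutU unfolding cutoff_on_def by blast
      then show ?thesis by (simp only: mult_zero_left)
    qed
    then show ?case
      by (simp only: jacobian_form_pull_back[OF cut Bo(1,2,3) M.Ck_on_slopes(1)[OF n] M.Ck_on_slopes(2)[OF n] \<sigma>(1,3)])
  qed
  from Lim_transform_eventually[OF K(1) this]
  have lim: "(\<lambda>k. jacobian_form \<psi> (\<lambda>y. ?X k (\<Phi> y)) (\<lambda>y. M.S2 k (\<Phi> y))) \<longlonglongrightarrow> ?R"
    unfolding curvature_integral[OF K(2)] .
  have wc: "w y $ 1 = F1 (s1 (\<Phi> y)) (s2 (\<Phi> y))" "w y $ 2 = s2 (\<Phi> y)" if "y \<in> V" for y
    using w_components that Vo by blast+
  have VA: "\<Phi> ` V \<subseteq> \<Phi> ` B" "\<Phi> ` V \<in> sets borel"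
    using Bo diffeo_image_open[OF diffeo Vo(1)] Vo by auto
  obtain c where c: "c > 0" "\<And>x. x \<in> \<Phi> ` V \<Longrightarrow> c \<le> \<bar>N3 x\<bar>"
    using N3_lower[OF diffeo_compactly_inside(1)[OF diffeo V(2)]] by blast
  have tS: "tends_tame V (\<lambda>k y. slope (nrm (M.P k m) (M.P k n)) (M.N k) (\<Phi> y)) (\<lambda>y. slope (nrm (p m) (p n)) N3 (\<Phi> y))" for m n
    by (rule tends_tame_comp[OF diffeo V(2) tends_tame_graph_map(3)[OF VA(2) M.tends_P[OF VA(2,1)] c]])
  have t1: "tends_tame V (\<lambda>k y. ?X k (\<Phi> y)) (\<lambda>y. F1 (s1 (\<Phi> y)) (s2 (\<Phi> y)))"
    by (rule tends_tame_F1[OF Vb(1) tS tS])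
  have "L2_tame V (\<lambda>k y. ?X k (\<Phi> y)) (\<lambda>y. F1 (s1 (\<Phi> y)) (s2 (\<Phi> y)))"
    by (rule L2_tame_of_tends_tame[OF Vb t1 tends_U'(3)[OF V(2)]])
  moreover have "L2_tame V (\<lambda>k y. M.S2 k (\<Phi> y)) (\<lambda>y. s2 (\<Phi> y))"
    by (rule L2_tame_of_tends_tame[OF Vb tS tends_U'(2)[OF V(2)]])
  moreover have "L2_norm_sq V (\<lambda>x. H x - F1 (s1 (\<Phi> x)) (s2 (\<Phi> x))) = L2_norm_sq V (\<lambda>x. H x - w x $ 1)"
    "L2_norm_sq V (\<lambda>x. H x - s2 (\<Phi> x)) = L2_norm_sq V (\<lambda>x. H x - w x $ 2)" for H
    unfolding L2_norm_sq_def by (rule nn_integral_cong, simp add: indicator_def wc)+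
  ultimately have tZ: "L2_tame V (\<lambda>k y. ?X k (\<Phi> y)) (\<lambda>y. w y $ 1)" "L2_tame V (\<lambda>k y. M.S2 k (\<Phi> y)) (\<lambda>y. w y $ 2)"
    by (simp_all add: L2_tame_def)
  have WC: "Ck_on 1 U' (\<lambda>x. W k x $ i)" for k i
    using W(1) by (intro Ck_on_vec_nth D(2)) (simp add: smooth_on_def del: Ck_on.simps)
  have mV: "set_borel_measurable borel V (\<lambda>x. W k x $ i)" "set_borel_measurable borel V (\<lambda>x. w x $ i)" for k i
    using Vo(3,4) set_borel_measurable_continuous[OF Vb(1) continuous_on_subset[OF Ck_on_1_D(1)[OF WC]]]
      set_borel_measurable_continuous[OF Vb(1) continuous_on_subset[OF w_cont(1)]] by blast+
  have tW: "L2_tame V (\<lambda>k x. W k x $ i) (\<lambda>x. w x $ i)" for i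
    using W(2) V(2) by (intro L2_tame_of_tends_H12 Vb mV slob_f(2)[OF V(2)]) (auto simp: tends_H12_loc_def)
  have ck: "\<forall>\<^sub>F k in sequentially. Ck_on 1 B (\<lambda>x. W k x $ 1) \<and> Ck_on 1 B (\<lambda>x. W k x $ 2) \<and>
      Ck_on 1 B (\<lambda>y. ?X k (\<Phi> y)) \<and> Ck_on 1 B (\<lambda>y. M.S2 k (\<Phi> y))"
    using M.N_eventually
  proof eventually_elim
    case (elim k)
    then have n: "\<forall>x\<in>\<Phi> ` B. M.N k x \<noteq> 0" by blast
    note ch = Ck_on_1_chain[OF Bo(1) Ck_on_subset[OF D(4) Bo(2)] _ subset_refl]
    show ?case
      using Ck_on_subset[OF WC Bo(2)] ch[OF M.Ck_on_slopes(1)[OF n]] ch[OF M.Ck_on_slopes(2)[OF n]] by blast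
  qed
  have "(\<lambda>k. jacobian_form \<psi> (\<lambda>x. W k x $ 1) (\<lambda>x. W k x $ 2) - jacobian_form \<psi> (\<lambda>y. ?X k (\<Phi> y)) (\<lambda>y. M.S2 k (\<Phi> y))) \<longlonglongrightarrow> 0"
    by (rule jacobian_form_compare[OF cut Bo(1) B(2) Vo(1,2) V(1,4) ck continuous_on_subset[OF w_cont(1) Vo(3)]
        continuous_on_subset[OF w_cont(1) Vo(3)] tW tW tZ])
  from tendsto_add[OF this lim] have "(\<lambda>k. jacobian_form \<psi> (\<lambda>x. W k x $ 1) (\<lambda>x. W k x $ 2)) \<longlonglongrightarrow> ?R" by simp
  moreover have e: "indicator U' y *\<^sub>R (\<psi> y * jacobian_det (W k) y) = \<psi> y * jac (\<lambda>x. W k x $ 1) (\<lambda>x. W k x $ 2) y" for k y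
  proof (cases "y \<in> U'")
    case True
    have "Ck_on 1 U' (W k)" using W(1) by (simp add: smooth_on_def del: Ck_on.simps)
    from jacobian_det_eq_jac[OF Ck_on_1_D(2)[OF this True]] True show ?thesis by simp
  next
    case False
    then have "\<psi> y = 0" using z C(2) by blast
    then show ?thesis by simp
  qed
  ultimately show ?thesis unfolding set_lebesgue_integral_def jacobian_form_def e by simp
qed

lemma Det_D_graph:
  assumes \<psi>: "\<psi> \<in> test_functions U'"
  shows "Det_D U' w \<psi> = (LINT y:U'|lborel. gauss_curvature g (\<Phi> y) * sqrt (1 + (norm (grad f y))\<^sup>2) * \<psi> y)"
  unfolding Det_D_def
proof (rule the_equality)
  show "\<forall>W. (\<forall>k. smooth_on U' (W k)) \<and> tends_H12_loc U' W w \<longrightarrow>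
     (\<lambda>k. LINT x:U'|lborel. \<psi> x * jacobian_det (W k) x)
       \<longlonglongrightarrow> (LINT y:U'|lborel. gauss_curvature g (\<Phi> y) * sqrt (1 + (norm (grad f y))\<^sup>2) * \<psi> y)"
    using jacobian_limit[OF \<psi>] by blast
next
  fix L
  assume L: "\<forall>W. (\<forall>k. smooth_on U' (W k)) \<and> tends_H12_loc U' W w \<longrightarrow>
     (\<lambda>k. LINT x:U'|lborel. \<psi> x * jacobian_det (W k) x) \<longlonglongrightarrow> L"
  \<comment> \<open>Without an admissible sequence every \<open>L\<close> would satisfy the defining
    condition.\<close>
  obtain W where W: "\<And>k. smooth_on U' (W k)" "tends_H12_loc U' W w"
    using smooth_approximation[OF D(2) w_cont(2) slob_f(2)] by blast
  show "L = (LINT y:U'|lborel. gauss_curvature g (\<Phi> y) * sqrt (1 + (norm (grad f y))\<^sup>2) * \<psi> y)"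
    using LIMSEQ_unique[OF _ jacobian_limit[OF \<psi> W]] L W by blast
qed

end

theorem corollary1p2:
  fixes U U' :: "(real^2) set"
    and g :: "real^2 \<Rightarrow> real^2^2"
    and u :: "real^2 \<Rightarrow> real^3"
    and \<Psi> \<Phi> :: "real^2 \<Rightarrow> real^2"
    and v f :: "real^2 \<Rightarrow> real"
    and w :: "real^2 \<Rightarrow> real^2"
  assumes domain: "open U" "connected U" "U \<noteq> {}"
    and metric: "smooth_riemannian_metric U g"
    and regularity: "Ck_on 1 U u" "H32_loc U u"
    and isometric: "isometric_embedding U g u"
    and components: "\<And>x. x \<in> U \<Longrightarrow> u x = vector [\<Psi> x $ 1, \<Psi> x $ 2, v x]"
    and diffeo: "C1_diffeomorphism U U' \<Psi> \<Phi>"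
    and f_eq: "\<And>y. y \<in> U' \<Longrightarrow> f y = v (\<Phi> y)"
    and w_eq: "\<And>y. y \<in> U' \<Longrightarrow> w y = F_map (grad f y)"
  shows "Ck_on 1 U' f \<and> H32_loc U' f \<and> H12_loc U' w \<and>
    (\<forall>\<psi>\<in>test_functions U'.
       Det_D U' w \<psi> =
         (LINT y:U'|lborel. gauss_curvature g (\<Phi> y) * sqrt (1 + (norm (grad f y))\<^sup>2) * \<psi> y))"
proof -
  interpret graph_isometry U U' g u \<Psi> \<Phi> v f w
    using assms by unfold_locales (auto simp: isometric_embedding_def simp del: Ck_on.simps)
  show ?thesis using f_Ck f_H32 w_H12 Det_D_graph by blast
qed

end
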